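(* Let $A_\pm\in C(B_1)$ with $\mu\le A_\pm\le\frac1\mu$ in $B_1$ and $f_\pm\in L^N(B_1)$. Let $u\in W^{1,p}(B_1)\cap L^\infty(B_1)$ be a weak solution of $-\operatorname{div}(A(x,u)|\nabla u|^{p-2}\nabla u)=f(x,u)$ in $B_1$. Then $u\in C^{0,\alpha}_{loc}(B_1)$ for every $\alpha\in(0,1)$, and for every $r\in(0,1)$, $$\|u\|_{C^{0,\alpha}(B_r)}\le\frac{C}{(1-r)^\alpha}\Big(\|u\|_{L^\infty(B_1)}+\|f_+\|_{L^N(B_1)}^{\frac1{p-1}}+\|f_-\|_{L^N(B_1)}^{\frac1{p-1}}\Big),$$ where $C$ depends only on $N,p,\mu,\alpha$ and on $\omega_{A_\pm,B_{r^*}}$, the maximum of the moduli of continuity of $A_+$ and $A_-$ on $B_{r^*}$, with $r^*=\frac{1+r}{2}$.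
   Context: Let $N\ge 2$, $1<p<\infty$, $0<\mu<1$. For functions $A_\pm$, $f_\pm$ on a domain $\Omega\subset\mathbb R^N$, set $A(x,s)=A_+(x)\chi_{\{s>0\}}+A_-(x)\chi_{\{s\le 0\}}$ and $f(x,s)=f_+(x)\chi_{\{s>0\}}+f_-(x)\chi_{\{s\le 0\}}$. A function $u\in W^{1,p}(\Omega)$ is a weak solution of $-\operatorname{div}(A(x,u)|\nabla u|^{p-2}\nabla u)=f(x,u)$ in $\Omega$ if $\int_\Omega A(x,u)|\nabla u|^{p-2}\nabla u\cdot\nabla\varphi\,dx=\int_\Omega f(x,u)\varphi\,dx$ for all $\varphi\in W^{1,p}_0(\Omega)$. $B_\rho(x_0)$ is the open ball, $B_\rho=B_\rho(0)$. $\|u\|_{C^{0,\alpha}(D)}=\sup_D|u|+\sup_{x\ne y\in D}|u(x)-u(y)|/|x-y|^\alpha$. The modulus of continuity of $A$ on $E$ is $\omega_{A,E}(t)=\sup\{|A(x)-A(y)|:x,y\in E,|x-y|<t\}$. *)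

theory Defs
  imports "HOL-Analysis.Analysis" "HOL-Probability.Essential_Supremum"
begin

definition partial_deriv :: "'n::finite \<Rightarrow> (real^'n \<Rightarrow> real) \<Rightarrow> real^'n \<Rightarrow> real" where
  "partial_deriv i f x = frechet_derivative f (at x) (axis i 1)"

definition grad :: "(real^'n::finite \<Rightarrow> real) \<Rightarrow> real^'n \<Rightarrow> real^'n" where
  "grad f x = (\<chi> i. partial_deriv i f x)"

coinductive smooth_fun :: "(real^'n::finite \<Rightarrow> real) \<Rightarrow> bool" where
  "(\<forall>x. f differentiable (at x)) \<Longrightarrow> (\<forall>i. smooth_fun (partial_deriv i f)) \<Longrightarrow> smooth_fun f"

definition test_fun :: "(real^'n::finite) set \<Rightarrow> (real^'n \<Rightarrow> real) \<Rightarrow> bool" where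
  "test_fun \<Omega> \<phi> \<longleftrightarrow> smooth_fun \<phi> \<and> compact (closure {x. \<phi> x \<noteq> 0})
      \<and> closure {x. \<phi> x \<noteq> 0} \<subseteq> \<Omega>"

definition in_Lp :: "real \<Rightarrow> (real^'n::finite) set \<Rightarrow> (real^'n \<Rightarrow> real) \<Rightarrow> bool" where
  "in_Lp q \<Omega> f \<longleftrightarrow> set_borel_measurable lebesgue \<Omega> f
      \<and> set_integrable lebesgue \<Omega> (\<lambda>x. \<bar>f x\<bar> powr q)"

definition Lp_norm :: "real \<Rightarrow> (real^'n::finite) set \<Rightarrow> (real^'n \<Rightarrow> real) \<Rightarrow> real" where
  "Lp_norm q \<Omega> f = (LINT x:\<Omega>|lebesgue. \<bar>f x\<bar> powr q) powr (1 / q)"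

definition in_Linf :: "(real^'n::finite) set \<Rightarrow> (real^'n \<Rightarrow> real) \<Rightarrow> bool" where
  "in_Linf \<Omega> f \<longleftrightarrow> set_borel_measurable lebesgue \<Omega> f
      \<and> esssup (restrict_space lebesgue \<Omega>) (\<lambda>x. ereal \<bar>f x\<bar>) < \<infinity>"

definition Linf_norm :: "(real^'n::finite) set \<Rightarrow> (real^'n \<Rightarrow> real) \<Rightarrow> real" where
  "Linf_norm \<Omega> f = real_of_ereal (esssup (restrict_space lebesgue \<Omega>) (\<lambda>x. ereal \<bar>f x\<bar>))"

definition weak_grad :: "(real^'n::finite) set \<Rightarrow> (real^'n \<Rightarrow> real) \<Rightarrow> (real^'n \<Rightarrow> real^'n) \<Rightarrow> bool" where
  "weak_grad \<Omega> u Du \<longleftrightarrow> set_borel_measurable lebesgue \<Omega> Du \<and>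
     (\<forall>\<phi>. test_fun \<Omega> \<phi> \<longrightarrow> (\<forall>i.
        (LINT x:\<Omega>|lebesgue. u x * partial_deriv i \<phi> x) = - (LINT x:\<Omega>|lebesgue. Du x $ i * \<phi> x)))"

definition W1p :: "real \<Rightarrow> (real^'n::finite) set \<Rightarrow> (real^'n \<Rightarrow> real) \<Rightarrow> (real^'n \<Rightarrow> real^'n) \<Rightarrow> bool" where
  "W1p p \<Omega> u Du \<longleftrightarrow> in_Lp p \<Omega> u \<and> weak_grad \<Omega> u Du \<and> in_Lp p \<Omega> (\<lambda>x. norm (Du x))"

definition W1p0 :: "real \<Rightarrow> (real^'n::finite) set \<Rightarrow> (real^'n \<Rightarrow> real) \<Rightarrow> (real^'n \<Rightarrow> real^'n) \<Rightarrow> bool" where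
  "W1p0 p \<Omega> u Du \<longleftrightarrow> W1p p \<Omega> u Du \<and>
     (\<exists>\<psi>. (\<forall>k. test_fun \<Omega> (\<psi> k)) \<and>
        (\<lambda>k. LINT x:\<Omega>|lebesgue. \<bar>\<psi> k x - u x\<bar> powr p) \<longlonglongrightarrow> 0 \<and>
        (\<lambda>k. LINT x:\<Omega>|lebesgue. norm (grad (\<psi> k) x - Du x) powr p) \<longlonglongrightarrow> 0)"

definition phase :: "('x \<Rightarrow> real) \<Rightarrow> ('x \<Rightarrow> real) \<Rightarrow> 'x \<Rightarrow> real \<Rightarrow> real" where
  "phase Fp Fm x s = (if s > 0 then Fp x else Fm x)"

definition weak_solution ::
  "real \<Rightarrow> (real^'n::finite) set \<Rightarrow> (real^'n \<Rightarrow> real) \<Rightarrow> (real^'n \<Rightarrow> real)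
   \<Rightarrow> (real^'n \<Rightarrow> real) \<Rightarrow> (real^'n \<Rightarrow> real) \<Rightarrow> (real^'n \<Rightarrow> real) \<Rightarrow> bool" where
  "weak_solution p \<Omega> Ap Am fp fm u \<longleftrightarrow> (\<exists>Du. W1p p \<Omega> u Du \<and>
     (\<forall>\<phi> D\<phi>. W1p0 p \<Omega> \<phi> D\<phi> \<longrightarrow>
        (LINT x:\<Omega>|lebesgue. phase Ap Am x (u x) * norm (Du x) powr (p - 2) * (Du x \<bullet> D\<phi> x))
        = (LINT x:\<Omega>|lebesgue. phase fp fm x (u x) * \<phi> x)))"

definition holder_norm :: "real \<Rightarrow> ('a::metric_space) set \<Rightarrow> ('a \<Rightarrow> real) \<Rightarrow> ereal" where
  "holder_norm \<alpha> D v = (SUP x\<in>D. ereal \<bar>v x\<bar>)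
     + (SUP xy\<in>{(x,y). x \<in> D \<and> y \<in> D \<and> x \<noteq> y}.
          ereal (\<bar>v (fst xy) - v (snd xy)\<bar> / dist (fst xy) (snd xy) powr \<alpha>))"

definition modulus :: "('a::metric_space \<Rightarrow> real) \<Rightarrow> 'a set \<Rightarrow> real \<Rightarrow> ereal" where
  "modulus A E t = (SUP xy\<in>{(x,y). x \<in> E \<and> y \<in> E \<and> dist x y < t}.
                       ereal \<bar>A (fst xy) - A (snd xy)\<bar>)"

end

(* Scale u so that the bound in brackets is 1. In a small ball where A_+ and A_- are almost constants a_+
   and a_-, the function v = T(u) with T(s) = a_+^(1/(p-1)) max(s,0) - a_-^(1/(p-1)) max(-s,0) solves
   -div(b |Dv|^(p-2) Dv) = f with b close to 1: the jump of the coefficient across {u = 0} is absorbed by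
   the kink of T. Hence v is close in energy to a p-harmonic function, obtained by minimizing the p-energy.
   Gradients of p-harmonic functions are locally in every L^q: testing the equation for a difference
   d = w(x+h) - w(x) with truncated powers of d controls second differences of w, and dyadic
   averages turn this into a gain of integrability of Dw. So the energy on a smaller ball decays with any
   exponent below N; iterating the comparison gives the energy decay r^(N-p(1-alpha)) of v, hence of u,
   and Poincare's inequality on dyadic balls (Morrey-Campanato) yields a Hoelder continuous
   representative. The size of the small ball depends on A only through its modulus of continuity. *)
theory Submission
 imports Defs "HOL-Probability.Probability_Measure"
begin

text \<open>\<open>C\<close> is fixed before the functions. Accordingly every estimate on the way is
  an existence statement whose constant precedes the functions, obtained by direct computation. For
  p < 2 the monotonicity of z -> |z|^(p-2) z controls |a - b|^p only together with the size of the
  gradients. A parameter l, later set to |h|, balances the two contributions and leaves a gain |h|^k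
  with k = min(1, p/2), for every p > 1. This k multiplies the integrability exponent of a
  p-harmonic gradient by 1 + k/(2N), a factor independent of the current exponent, so finitely many
  rounds reach any q. With q >= 2N/(1 - alpha) the p-harmonic function decays faster than required,
  and the surplus pays for the constants. The source lies in L^N because this norm is invariant
  under the dilations that occur, up to a factor at most 1; one smallness condition therefore
  survives all scales. All functional analysis is carried out for Borel functions, with derivatives
  defined as limits of C1 gradients.\<close>

abbreviation meas :: "('a::topological_space => 'b::topological_space) => bool" where
 "meas f == f \<in> borel_measurable borel"

abbreviation lborel_nn_integral :: "('a::euclidean_space => ennreal) => ennreal" (binder "NN " 60) where
 "lborel_nn_integral f == nn_integral lborel f"

notation LIMSEQ ("(_/ ---> _)" [60, 60] 60)
notation scaleR (infixr "*R" 75)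

abbreviation enn :: "real => ennreal" where "enn == ennreal"

notation infinity ("oo")


section \<open>The monotone map z -> |z|^(p-2) z\<close>

definition plap :: "real => 'a::real_inner => 'a" where
 "plap p z = norm z powr (p - 2) *R z"

lemma norm_plap: "p > 1 ==> norm (plap p z) = norm z powr (p - 1)"
proof (cases "z = 0")
 case False
 then have "norm z powr (p - 2) * norm z powr 1 = norm z powr (p - 1)" by (subst powr_add[symmetric]) simp
 then show ?thesis using False by (simp add: plap_def)
qed (simp add: plap_def)

lemma plap_inner_self: "p > 1 ==> plap p z \<bullet> z = norm z powr p"
proof (cases "z = 0")
 case False
 then have "norm z powr (p - 2) * norm z powr 2 = norm z powr p" by (subst powr_add[symmetric]) simp
 then show ?thesis using False by (simp add: plap_def power2_norm_eq_inner[symmetric])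
qed (simp add: plap_def)

lemma weighted_am_gm:
 fixes x y te :: real
 assumes "0 <= te" "te <= 1" "0 <= x" "0 <= y"
 shows "x powr te * y powr (1 - te) <= x + y"
proof -
 have "x powr te * y powr (1 - te) <= te * x + (1 - te) * y" using assms Youngs_inequality_0[of te "1 - te" x y] by (cases "x = 0 \<or> y = 0") auto
 also have "... <= 1 * x + 1 * y" using assms by (intro add_mono mult_right_mono) auto
 finally show ?thesis by simp
qed

lemma bernoulli_powr:
 fixes t r :: real
 assumes "0 <= t" "0 < r" "r <= 1"
 shows "t powr r <= 1 + r * (t - 1)" using assms Youngs_inequality_0[of r "1 - r" t 1] by (cases "t = 0") (auto simp: algebra_simps)

text \<open>Homogeneity reduces it to 1 - t^(p-1) >= min(1, p-1) (1 - t) for t = y/x in [0,1]: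
  Bernoulli's inequality for p <= 2, and t^(p-1) <= t for p > 2.\<close>

lemma powr_diff_lower:
 fixes x y p :: real
 assumes "p > 1" "0 <= y" "y <= x"
 shows "min 1 (p - 1) * x powr (p - 2) * (x - y) <= x powr (p - 1) - y powr (p - 1)"
proof (cases "x = 0")
 case True then show ?thesis using assms by simp
next
 case False
 then have x: "x > 0" using assms by simp
 define t where "t = y / x"
 have t: "0 <= t" "t <= 1" "y = x * t" using assms x by (auto simp: t_def)
 have *: "t powr (p - 1) <= 1 - min 1 (p - 1) * (1 - t)"
 proof (cases "p <= 2")
  case True
  then show ?thesis using bernoulli_powr[of t "p - 1"] t assms by (auto simp: min_def algebra_simps)
 next
  case False
  then have "t powr (p - 1) <= t powr 1" using t by (intro powr_mono') auto
  then show ?thesis using False t by (simp add: min_def)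
 qed
 have "x powr (p - 1) = x powr (p - 2) * x" using x by (simp add: powr_diff power2_eq_square)
 moreover have "y powr (p - 1) = x powr (p - 1) * t powr (p - 1)" using t x by (simp add: powr_mult)
 ultimately have "x powr (p - 1) - y powr (p - 1) = x powr (p - 2) * x * (1 - t powr (p - 1))" by (simp add: algebra_simps)
 also have "... >= x powr (p - 2) * x * (min 1 (p - 1) * (1 - t))" using * x by (intro mult_left_mono) auto
 also have "x powr (p - 2) * x * (min 1 (p - 1) * (1 - t)) = min 1 (p - 1) * x powr (p - 2) * (x - y)" using t by (simp add: algebra_simps)
 finally show ?thesis by simp
qed

text \<open>The right-hand side depends only on |a|, |b| and |a - b|. Polarization
  (\<open>id\<close>) splits it into a transversal part, weighted by the mean of the two powers, and
  a radial part. The transversal part keeps half of the weight at a, whence the constant 1/2; the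
  radial part is \<open>powr_diff_lower\<close>.\<close>

lemma plap_monotone_aux:
 fixes a b :: "'a::real_inner"
 assumes p: "p > 1" and ab: "norm b <= norm a"
 shows "min (1/2) (p - 1) * norm a powr (p - 2) * (norm (a - b))\<^sup>2 <= (plap p a - plap p b) \<bullet> (a - b)"
proof -
 define x y D where "x = norm a" "y = norm b" "D = norm (a - b)"
 define c where "c = min (1/2) (p - 1)"
 have xy: "0 <= y" "y <= x" using ab by (auto simp: x_y_D_def)
 have D: "(x - y)\<^sup>2 <= D\<^sup>2" using norm_triangle_ineq3[of a b] by (auto simp: x_y_D_def intro: abs_le_square_iff[THEN iffD1])
 have ip: "a \<bullet> b = (x\<^sup>2 + y\<^sup>2 - D\<^sup>2) / 2" by (simp add: x_y_D_def power2_norm_eq_inner inner_diff inner_commute algebra_simps)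
 have ex: "x powr (p - 2) * x\<^sup>2 = x powr (p - 1) * x" if "x >= 0" for x :: real using that by (cases "x = 0") (auto simp: power2_eq_square powr_diff)
 have ex2: "x powr (p - 2) * x = x powr (p - 1)" if "x >= 0" for x :: real using that by (cases "x = 0") (auto simp: powr_diff power2_eq_square)
 have id: "(plap p a - plap p b) \<bullet> (a - b)
   = (x powr (p-2) + y powr (p-2)) / 2 * (D\<^sup>2 - (x - y)\<^sup>2) + (x powr (p-1) - y powr (p-1)) * (x - y)"
 proof -
  have "(plap p a - plap p b) \<bullet> (a - b)
   = x powr (p-2) * x\<^sup>2 + y powr (p-2) * y\<^sup>2 - (x powr (p-2) + y powr (p-2)) * (a \<bullet> b)"
   by (simp add: plap_def x_y_D_def power2_norm_eq_inner inner_diff inner_commute algebra_simps)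
  also have "... = (x powr (p-2) + y powr (p-2)) / 2 * (D\<^sup>2 - (x - y)\<^sup>2) + (x powr (p-2) * x - y powr (p-2) * y) * (x - y)"
   unfolding ip by (simp add: field_simps power2_eq_square)
  finally show ?thesis using xy by (simp add: ex2)
 qed
 have c: "0 < c" "c <= 1/2" "c <= min 1 (p - 1)" using p by (auto simp: c_def min_def)
 have 1: "c * x powr (p - 2) * (D\<^sup>2 - (x - y)\<^sup>2) <= (x powr (p-2) + y powr (p-2)) / 2 * (D\<^sup>2 - (x - y)\<^sup>2)"
 proof -
  have "c * x powr (p - 2) <= 1/2 * x powr (p - 2)" using c by (intro mult_right_mono) auto
  also have "... <= (x powr (p-2) + y powr (p-2)) / 2" by simp
  finally show ?thesis using D by (intro mult_right_mono) auto
 qed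
 have 2: "c * x powr (p - 2) * (x - y)\<^sup>2 <= (x powr (p-1) - y powr (p-1)) * (x - y)"
 proof -
  have "c * (x powr (p - 2) * (x - y)) <= min 1 (p - 1) * (x powr (p - 2) * (x - y))" using c xy by (intro mult_right_mono) auto
  also have "... <= x powr (p-1) - y powr (p-1)" using powr_diff_lower[OF p xy] by (simp add: mult.assoc)
  finally have "c * (x powr (p - 2) * (x - y)) * (x - y) <= (x powr (p-1) - y powr (p-1)) * (x - y)" using xy by (intro mult_right_mono) auto
  then show ?thesis by (simp add: power2_eq_square mult.assoc)
 qed
 have "c * x powr (p - 2) * D\<^sup>2 = c * x powr (p - 2) * (D\<^sup>2 - (x - y)\<^sup>2) + c * x powr (p - 2) * (x - y)\<^sup>2"
  by (simp add: right_diff_distrib)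
 also have "... <= (plap p a - plap p b) \<bullet> (a - b)" unfolding id by (rule add_mono[OF 1 2])
 finally have "c * x powr (p - 2) * D\<^sup>2 <= (plap p a - plap p b) \<bullet> (a - b)" .
 then show ?thesis by (simp add: c_def x_y_D_def)
qed

lemma plap_monotone:
 fixes a b :: "'a::real_inner"
 assumes p: "p > 1"
 shows "min (1/2) (p - 1) * max (norm a) (norm b) powr (p - 2) * (norm (a - b))\<^sup>2
  <= (plap p a - plap p b) \<bullet> (a - b)"
proof (cases "norm b <= norm a")
 case True then show ?thesis using plap_monotone_aux[OF p True] by (simp add: max_absorb1)
next
 case False
 then have "norm a <= norm b" by simp
 from plap_monotone_aux[OF p this] show ?thesis using False by (simp add: max_absorb2 norm_minus_commute inner_diff algebra_simps)
qed

lemma plap_monotone_nonneg: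
 fixes a b :: "'a::real_inner"
 assumes "p > 1" shows "0 <= (plap p a - plap p b) \<bullet> (a - b)"
proof (rule order_trans[OF _ plap_monotone[OF assms]])
 have "0 <= min (1/2) (p - 1)" using assms by simp
 then show "0 <= min (1/2) (p - 1) * max (norm a) (norm b) powr (p - 2) * (norm (a - b))\<^sup>2" by (intro mult_nonneg_nonneg) auto
qed

text \<open>The parameter \<open>l\<close> trades the missing coercivity for \<open>p < 2\<close> against the size of the gradients.\<close>

lemma plap_coercive:
 assumes p: "p > 1"
 obtains C where "C > 0"
  "!!l (a::'a::real_inner) b. 0 < l ==> l <= 1 ==>
   norm (a - b) powr p <= C * l powr (min 1 (p/2)) *
   ((plap p a - plap p b) \<bullet> (a - b) / l + max (norm a) (norm b) powr p)"
proof -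
 define c where "c = min (1/2) (p - 1)"
 have c: "0 < c" "c <= 1" using p by (auto simp: c_def)
 define C where "C = 2 powr p / c"
 have "norm (a - b) powr p <= C * l powr (min 1 (p/2)) *
   ((plap p a - plap p b) \<bullet> (a - b) / l + max (norm a) (norm b) powr p)"
  if l: "0 < l" "l <= 1" for l and a b :: 'a
 proof -
  define M D E where "M = max (norm a) (norm b)" "D = norm (a - b)" "E = (plap p a - plap p b) \<bullet> (a - b)"
  have "norm a <= M" "norm b <= M" "D <= norm a + norm b" using norm_triangle_ineq4[of a b] unfolding M_D_E_def by auto
  then have M: "0 <= M" "0 <= D" "D <= 2 * M" using norm_ge_zero[of a] norm_ge_zero[of "a - b"] unfolding M_D_E_def(2) by linarith+
  have E0: "0 <= E" using plap_monotone_nonneg[OF p] by (simp add: M_D_E_def)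
  have E: "c * (M powr (p - 2) * D\<^sup>2) <= E" using plap_monotone[OF p, of a b] by (simp add: c_def M_D_E_def mult.assoc)
  have Ec: "M powr (p - 2) * D\<^sup>2 <= E / c" using E c by (simp add: field_simps)
  have "D powr p <= C * l powr (min 1 (p/2)) * (E / l + M powr p)"
  proof (cases "p >= 2")
   case True
   have "D powr p = D powr (p - 2) * D\<^sup>2" using M by (cases "D = 0") (auto simp: powr_diff power2_eq_square)
   also have "... <= (2 * M) powr (p - 2) * D\<^sup>2" using M True by (intro mult_right_mono powr_mono2) auto
   also have "... = 2 powr (p - 2) * (M powr (p - 2) * D\<^sup>2)" using M by (simp add: powr_mult)
   also have "... <= 2 powr p * (E / c)" using Ec E0 c by (intro mult_mono) (auto simp: powr_mono)
   also have "... = C * E" by (simp add: C_def)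
   also have "... <= C * (E + l * M powr p)" using l c by (intro mult_left_mono) (auto simp: C_def)
   also have "... = C * l powr (min 1 (p/2)) * (E / l + M powr p)" using l True by (simp add: field_simps)
   finally show ?thesis .
  next
   case False
   show ?thesis
   proof (cases "D = 0")
   case True
   then show ?thesis using M E0 c l by (simp add: C_def)
   next
   case False2: False
   then have Dp: "D > 0" "M > 0" using M by auto
   define X where "X = M powr (p - 2) * D\<^sup>2"
   \<comment> \<open>For p < 2 the power of D is a geometric mean of the controlled quantity X and
     of M^p. Taking l^(p/2) out before the weighted mean inequality produces the factor that
     vanishes with l.\<close>
   have "D powr p = X powr (p/2) * (M powr p) powr (1 - p/2)"
   proof -
   have "X powr (p/2) = M powr ((p - 2) * (p/2)) * D powr p"
   proof -
   have "D\<^sup>2 = D powr 2" using Dp by simp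
   then show ?thesis unfolding X_def using Dp by (simp only: powr_mult powr_powr) simp
   qed
   moreover have "(M powr p) powr (1 - p/2) = M powr (p * (1 - p/2))" by (rule powr_powr)
   moreover have "M powr ((p - 2) * (p/2)) * M powr (p * (1 - p/2)) = 1" using Dp by (subst powr_add[symmetric]) (simp add: field_simps)
   ultimately show ?thesis by (simp add: mult.assoc mult.left_commute mult.commute)
   qed
   also have "... = l powr (p/2) * ((X / l) powr (p/2) * (M powr p) powr (1 - p/2))" using l by (simp add: powr_divide X_def)
   also have "... <= l powr (p/2) * (X / l + M powr p)" using False p l by (intro mult_left_mono weighted_am_gm) (auto simp: X_def)
   also have "... <= l powr (p/2) * (1/c * (E / l + M powr p))"
   proof (intro mult_left_mono)
   have "X / l <= E / c / l" using Ec l by (intro divide_right_mono) (auto simp: X_def)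
   moreover have "M powr p <= M powr p / c" using c mult_right_mono[of c 1 "M powr p"] by (simp add: field_simps)
   ultimately show "X / l + M powr p <= 1/c * (E / l + M powr p)" by (simp add: add_divide_distrib mult.commute)
   qed auto
   also have "... <= l powr (p/2) * (C * (E / l + M powr p))"
   using c E0 l p by (intro mult_left_mono mult_right_mono) (auto simp: C_def divide_right_mono ge_one_powr_ge_zero)
   finally show ?thesis using False by (simp add: min_def mult_ac)
   qed
  qed
  then show ?thesis by (simp add: M_D_E_def)
 qed
 moreover have "C > 0" using c by (simp add: C_def)
 ultimately show ?thesis using that by blast
qed

lemma powr_add_le:
 fixes x y q :: real
 assumes "0 <= x" "0 <= y" "0 <= q"
 shows "(x + y) powr q <= 2 powr q * (x powr q + y powr q)"
proof -
 have "(x + y) powr q <= (2 * max x y) powr q" using assms by (intro powr_mono2) auto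
 also have "... = 2 powr q * max x y powr q" using assms by (simp add: powr_mult)
 also have "... <= 2 powr q * (x powr q + y powr q)" using assms by (intro mult_left_mono) (auto simp: max_def)
 finally show ?thesis .
qed

lemma norm_add_powr_le:
 fixes a b :: "'a::real_normed_vector"
 assumes "0 <= q"
 shows "norm (a + b) powr q <= 2 powr q * (norm a powr q + norm b powr q)"
  and "norm (a - b) powr q <= 2 powr q * (norm a powr q + norm b powr q)"
proof -
 have "norm (a + b) powr q <= (norm a + norm b) powr q" "norm (a - b) powr q <= (norm a + norm b) powr q"
  using assms by (auto intro!: powr_mono2 norm_triangle_ineq norm_triangle_ineq4)
 then show "norm (a + b) powr q <= 2 powr q * (norm a powr q + norm b powr q)"
  "norm (a - b) powr q <= 2 powr q * (norm a powr q + norm b powr q)" using powr_add_le[of "norm a" "norm b" q] assms by auto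
qed

text \<open>For small l the maximum in \<open>plap_coercive\<close> is replaced by |a - b|^p and
  |b|^p with a small factor, and |a - b|^p is absorbed on the left. Only the energy of one of the
  two fields remains on the right.\<close>

lemma plap_coercive_absorb:
 assumes p: "p > 1" and d: "d > 0"
 obtains C where "C > 0"
  "!!(a::'a::real_inner) b. norm (a - b) powr p <= d * norm b powr p + C * ((plap p a - plap p b) \<bullet> (a - b))"
proof -
 obtain C0 where C0: "C0 > 0" and ineq:
  "!!l (a::'a) b. 0 < l ==> l <= 1 ==>
   norm (a - b) powr p <= C0 * l powr (min 1 (p/2)) *
   ((plap p a - plap p b) \<bullet> (a - b) / l + max (norm a) (norm b) powr p)" using plap_coercive[OF p] by metis
 define k where "k = min 1 (p/2)"
 have k: "k > 0" using p by (simp add: k_def)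
 \<comment> \<open>The factor 2^p + 1 comes from bounding the maximum by |a - b| and |b|. The first
   entry of the minimum lets half of the left-hand side be absorbed, the second keeps the share of
   |b|^p at d/2 before doubling.\<close>
 define e where "e = min (1/2) (d/2) / (2 powr p + 1)"
 have e: "e > 0" "e * (2 powr p + 1) <= 1/2" "e * (2 powr p + 1) <= d / 2" using d by (auto simp: e_def add_pos_pos intro!: divide_pos_pos)
 define l where "l = min 1 ((e / C0) powr (1/k))"
 have l: "0 < l" "l <= 1" using e C0 by (auto simp: l_def)
 have "l powr k <= ((e / C0) powr (1/k)) powr k" using l k by (intro powr_mono2) (auto simp: l_def)
 then have lk: "C0 * l powr k <= e" using C0 k e by (simp add: powr_powr field_simps)
 define C where "C = 2 * C0 * l powr k / l"
 have "norm (a - b) powr p <= d * norm b powr p + C * ((plap p a - plap p b) \<bullet> (a - b))" for a b :: 'a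
 proof -
  define D B E where "D = norm (a - b) powr p" "B = norm b powr p" "E = (plap p a - plap p b) \<bullet> (a - b)"
  have E0: "0 <= E" using plap_monotone_nonneg[OF p] by (simp add: D_B_E_def)
  have na: "norm a powr p <= 2 powr p * (D + B)" using norm_add_powr_le(1)[of p "a - b" b] p by (simp add: D_B_E_def)
  have M: "max (norm a) (norm b) powr p <= (2 powr p + 1) * (D + B)" using na by (auto simp: max_def D_B_E_def algebra_simps intro: add_increasing order_trans)
  have "D <= C0 * l powr k * (E / l + max (norm a) (norm b) powr p)" using ineq[OF l, of a b] by (simp add: D_B_E_def k_def)
  also have "... <= C0 * l powr k * E / l + C0 * l powr k * ((2 powr p + 1) * (D + B))"
   using mult_left_mono[OF M, of "C0 * l powr k"] C0 by (simp add: distrib_left)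
  also have "... <= C0 * l powr k * E / l + e * ((2 powr p + 1) * (D + B))" using lk by (intro add_left_mono mult_right_mono) (auto simp: D_B_E_def)
  also have "e * ((2 powr p + 1) * (D + B)) = e * (2 powr p + 1) * D + e * (2 powr p + 1) * B" by (simp add: algebra_simps)
  also have "... <= 1/2 * D + d/2 * B" using e by (intro add_mono mult_right_mono) (auto simp: D_B_E_def)
  finally have "D <= d * B + C * E" by (simp add: C_def)
  then show ?thesis by (simp add: D_B_E_def)
 qed
 moreover have "C > 0" using C0 l by (simp add: C_def)
 ultimately show ?thesis using that by blast
qed

text \<open>The tangent plane of |.|^p at c; it reduces to Young's inequality for |c|^(p-1) |a|.
  Jensen's inequality, uniform convexity and the Euler-Lagrange equation are all drawn from
  it.\<close>

lemma plap_convex: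
 fixes a c :: "'a::real_inner"
 assumes p: "p > 1"
 shows "norm c powr p + p * (plap p c \<bullet> (a - c)) <= norm a powr p"
proof -
 define q where "q = p / (p - 1)"
 have q: "q > 1" "1/p + 1/q = 1" using p by (auto simp: q_def field_simps)
 have "plap p c \<bullet> a <= norm c powr (p - 1) * norm a" using norm_cauchy_schwarz[of "plap p c" a] norm_plap[OF p, of c] by simp
 also have "... <= norm a powr p / p + (norm c powr (p - 1)) powr q / q"
  using Youngs_inequality[of p q "norm a" "norm c powr (p - 1)"] p q by (simp add: mult.commute)
 also have "(norm c powr (p - 1)) powr q = norm c powr p" using p by (simp add: powr_powr q_def)
 finally have "p * (plap p c \<bullet> a) <= norm a powr p + norm c powr p * (p / q)" using p by (simp add: field_simps)
 moreover have "p / q = p - 1" using p by (simp add: q_def)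
 ultimately show ?thesis using plap_inner_self[OF p, of c] by (simp add: inner_diff_right algebra_simps)
qed

text \<open>\<open>c1\<close> and \<open>c2\<close> are the quarter points of the segment from a to
  b. Adding the tangent inequalities for a at c1, for b at c2, and for c1 and c2 at the midpoint m
  bounds the monotonicity term between c1 and c2 by the convexity defect;
  \<open>plap_coercive_absorb\<close> turns it into a power of |a - b|. It makes minimizing
  sequences Cauchy.\<close>

lemma uniform_convexity_powr:
 assumes p: "p > 1" and d: "d > 0"
 obtains C where "C > 0"
  "!!(a::'a::real_inner) b. norm (a - b) powr p <= d * (norm a powr p + norm b powr p)
   + C * (norm a powr p + norm b powr p - 2 * norm ((1/2) *R (a + b)) powr p)"
proof -
 define d' where "d' = d / (4 powr p)"
 have d': "d' > 0" using d by (simp add: d'_def)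
 obtain C where C: "C > 0"
  "!!(a::'a) b. norm (a - b) powr p <= d' * norm b powr p + C * ((plap p a - plap p b) \<bullet> (a - b))"
  using plap_coercive_absorb[OF p d', where 'a='a] by metis
 define K where "K = 2 powr p * C * (2 / p)"
 have "norm (a - b) powr p <= d * (norm a powr p + norm b powr p)
   + K * (norm a powr p + norm b powr p - 2 * norm ((1/2) *R (a + b)) powr p)" for a b :: 'a
 proof -
  define m e where "m = (1/2) *R (a + b)" "e = (1/2) *R (a - b)"
  define c1 c2 where "c1 = m + (1/2) *R e" "c2 = m - (1/2) *R e"
  have a: "a = m + e" and b: "b = m - e" by (auto simp: m_e_def algebra_simps simp flip: scaleR_left_distrib)
  have ac1: "a - c1 = (1/2) *R e" and bc2: "b - c2 = - ((1/2) *R e)" and c12: "c1 - c2 = e"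
   by (auto simp: a b c1_c2_def algebra_simps simp flip: scaleR_left_distrib)
  have c1m: "c1 - m = (1/2) *R e" and c2m: "c2 - m = - ((1/2) *R e)" by (auto simp: c1_c2_def)
  define Q where "Q = norm a powr p + norm b powr p - 2 * norm m powr p"
  define E where "E = (plap p c1 - plap p c2) \<bullet> (c1 - c2)"
  have "p / 2 * E <= Q" using plap_convex[OF p, of c1 a] plap_convex[OF p, of c2 b] plap_convex[OF p, of m c1] plap_convex[OF p, of m c2]
   unfolding ac1 bc2 c1m c2m by (simp add: E_def c12 Q_def inner_diff_left algebra_simps)
  then have EQ: "E <= 2 / p * Q" using p by (simp add: field_simps)
  have "norm c2 <= norm a + norm b"
  proof -
   have "c2 = (1/4) *R a + (3/4) *R b"  by (simp add: c1_c2_def m_e_def algebra_simps flip: scaleR_left_distrib)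
   then have "norm c2 <= norm ((1/4) *R a) + norm ((3/4) *R b)" by (metis norm_triangle_ineq)
   then have "norm c2 <= norm a / 4 + 3 * norm b / 4" by simp
   then show ?thesis using norm_ge_zero[of a] norm_ge_zero[of b] by linarith
  qed
  then have "norm c2 powr p <= (norm a + norm b) powr p" using p by (intro powr_mono2) auto
  also have "... <= 2 powr p * (norm a powr p + norm b powr p)" using p by (intro powr_add_le) auto
  finally have c2: "norm c2 powr p <= 2 powr p * (norm a powr p + norm b powr p)" .
  have "norm (a - b) powr p = 2 powr p * norm (c1 - c2) powr p" unfolding c12 by (simp add: m_e_def powr_divide)
  also have "... <= 2 powr p * (d' * norm c2 powr p + C * E)" using C(2)[of c1 c2] by (simp add: E_def)
  also have "... <= 2 powr p * (d' * (2 powr p * (norm a powr p + norm b powr p)) + C * (2 / p * Q))" using c2 EQ d' C by (intro mult_left_mono add_mono) auto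
  also have "... = (2 powr p * 2 powr p) * d' * (norm a powr p + norm b powr p) + K * Q" by (simp add: K_def algebra_simps)
  also have "(2 powr p * 2 powr p) * d' = d" by (simp add: d'_def flip: powr_mult)
  finally show ?thesis by (simp add: Q_def m_e_def)
 qed
 moreover have "K > 0" using p C by (simp add: K_def)
 ultimately show ?thesis using that by blast
qed

section \<open>Energies as extended integrals\<close>

text \<open>The p-th power of the norm without the root, in \<open>ennreal\<close>: Fubini, Fatou
  and sums need no integrability conditions, and the missing triangle inequality costs only factors
  \<open>2 powr p\<close>.\<close>

definition en :: "real => 'a::euclidean_space set => ('a => 'b::real_normed_vector) => ennreal" where
 "en p S f = (NN x. enn (norm (f x) powr p) * indicator S x)"

lemma en_real: "en p S f = (NN x. enn (norm (f x) powr p * indicator S x))"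
 unfolding en_def by (simp add: ennreal_mult' ennreal_indicator)

lemma nn_integral_le_lincomb:
 fixes f g h :: "'a::euclidean_space => real"
 assumes [measurable]: "meas g" "meas h"
  and "0 <= a" "0 <= b" "!!x. 0 <= g x" "!!x. 0 <= h x" "!!x. f x <= a * g x + b * h x"
 shows "(NN x. enn (f x)) <= enn a * (NN x. enn (g x)) + enn b * (NN x. enn (h x))"
proof -
 have "(NN x. enn (f x)) <= (NN x. enn a * enn (g x) + enn b * enn (h x))"
  using assms(3-) by (intro nn_integral_mono) (simp add: ennreal_mult[symmetric] ennreal_plus[symmetric] ennreal_leI del: ennreal_plus)
 then show ?thesis by (simp add: nn_integral_add nn_integral_cmult)
qed

lemma en_le_combination:
 fixes g :: "'a::euclidean_space => 'b::euclidean_space" and h :: "'a => 'c::euclidean_space"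
 assumes [measurable]: "meas g" "meas h" "S \<in> sets borel"
  and "0 <= a" "0 <= b" "!!x. x \<in> S ==> norm (f x) powr p <= a * norm (g x) powr q + b * norm (h x) powr r"
 shows "en p S f <= enn a * en q S g + enn b * en r S h" unfolding en_real using assms(4-) by (intro nn_integral_le_lincomb) (auto simp: indicator_def)

lemma en_le_sum:
 fixes g :: "'i => 'a::euclidean_space => 'b::euclidean_space"
 assumes [measurable]: "!!i. meas (g i)" "S \<in> sets borel"
  and c: "!!i. 0 <= c i" and le: "!!x. norm (f x) powr p <= (\<Sum>i\<in>I. c i * norm (g i x) powr p)"
 shows "en p S f <= (\<Sum>i\<in>I. enn (c i) * en p S (g i))"
proof -
 have "en p S f <= (NN x. (\<Sum>i\<in>I. enn (c i) * (enn (norm (g i x) powr p) * indicator S x)))" unfolding en_def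
 proof (intro nn_integral_mono, goal_cases)
  case (1 x)
  have "enn (norm (f x) powr p) <= (\<Sum>i\<in>I. enn (c i) * enn (norm (g i x) powr p))"
   using ennreal_leI[OF le[of x]] c by (simp add: sum_ennreal[symmetric] ennreal_mult)
  then show ?case by (auto simp: indicator_def)
 qed
 also have "... = (\<Sum>i\<in>I. enn (c i) * en p S (g i))" unfolding en_def by (simp add: nn_integral_sum nn_integral_cmult)
 finally show ?thesis .
qed

abbreviation Lp_tendsto :: "real => 'a::euclidean_space set => (nat => 'a => 'b::real_normed_vector) => ('a => 'b) => bool" where
 "Lp_tendsto p S f g \<equiv> (%k. en p S (%x. f k x - g x)) ---> 0"

lemma en_mono_set: "S \<subseteq> T ==> en p S f <= en p T f"
 unfolding en_def by (intro nn_integral_mono) (auto simp: indicator_def)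

lemma en_mono:
 assumes "0 <= p" "!!x. x \<in> S ==> norm (f x) <= norm (g x)"
 shows "en p S f <= en p S g" unfolding en_def using assms by (intro nn_integral_mono) (auto simp: indicator_def intro!: ennreal_leI powr_mono2)

lemma en_cong: "(!!x. x \<in> S ==> norm (f x) = norm (g x)) ==> en p S f = en p S g"
 unfolding en_def by (intro nn_integral_cong) (auto simp: indicator_def)

lemma en_cong_AE:
 "AE x in lborel. x \<in> S --> norm (f x) = norm (g x) ==> en p S f = en p S g"
 unfolding en_def by (intro nn_integral_cong_AE) (auto simp: indicator_def elim!: eventually_mono)

lemma en_minus: "en p S (%x. - f x) = en p S f"
 by (intro en_cong) simp

lemma en_diff_commute: "en p S (%x. f x - g x) = en p S (%x. g x - f x)"
 by (intro en_cong) (simp add: norm_minus_commute)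

lemma en_scaleR: 
 fixes f :: "'a::euclidean_space => 'b::euclidean_space"
 assumes [measurable]: "meas f" "S \<in> sets borel"
 shows "en p S (%x. c *R f x) = enn (abs c powr p) * en p S f" unfolding en_def
 by (subst nn_integral_cmult[symmetric]) (auto simp: powr_mult ennreal_mult' mult.assoc)

lemma en_add:
 fixes f g :: "'a::euclidean_space => 'b::euclidean_space"
 assumes [measurable]: "meas f" "meas g" "S \<in> sets borel" and p: "0 <= p"
 shows "en p S (%x. f x + g x) <= enn (2 powr p) * (en p S f + en p S g)"
 unfolding distrib_left by (rule en_le_combination) (use norm_add_powr_le(1)[OF p] in \<open>auto simp: distrib_left\<close>)

lemma en_diff:
 fixes f g :: "'a::euclidean_space => 'b::euclidean_space"
 assumes "meas f" "meas g" "S \<in> sets borel" "0 <= p"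
 shows "en p S (%x. f x - g x) <= enn (2 powr p) * (en p S f + en p S g)"
 using en_add[OF assms(1) _ assms(3,4), of "%x. - g x"] assms(2) by (simp add: en_minus)

lemma nn_integral_translate:
 fixes f :: "'a::euclidean_space => ennreal"
 assumes [measurable]: "meas f"
 shows "(NN x. f (x + h)) = (NN x. f x)"
proof -
 have "(NN x. f x) = (\<integral>\<^sup>+x. f x \<partial>distr lborel borel (%x. x + h))" using lborel_distr_plus[of h] by (simp add: add.commute[of _ h])
 also have "... = (NN x. f (x + h))" by (subst nn_integral_distr) auto
 finally show ?thesis ..
qed

lemma en_translate:
 fixes f :: "'a::euclidean_space => 'b::euclidean_space"
 assumes [measurable]: "meas f" "S \<in> sets borel"
 shows "en p S (%x. f (x + h)) = en p {x. x - h \<in> S} f"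
proof -
 have "en p {x. x - h \<in> S} f = (NN x. enn (norm (f x) powr p) * indicator S (x - h))"
  unfolding en_def by (intro nn_integral_cong) (auto simp: indicator_def)
 also have "... = (NN x. enn (norm (f (x + h)) powr p) * indicator S ((x + h) - h))" by (subst nn_integral_translate) auto
 finally show ?thesis by (simp add: en_def)
qed

lemma nn_integral_affine:
 fixes f :: "'a::euclidean_space => ennreal"
 assumes [measurable]: "meas f" and c: "c > 0"
 shows "(NN x. f x) = enn (c ^ DIM('a)) * (NN x. f (t + c *R x))"
proof -
 have "(NN x. f x) = (\<integral>\<^sup>+x. f x \<partial>density (distr lborel borel (%x. t + c *R x)) (%_. (enn (abs c^DIM('a)))))"
  using lborel_affine[of c t] c by simp
 also have "... = enn (c ^ DIM('a)) * (NN x. f (t + c *R x))" using c by (simp add: nn_integral_density nn_integral_distr nn_integral_cmult)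
 finally show ?thesis .
qed

lemma en_affine:
 fixes f :: "'a::euclidean_space => 'b::euclidean_space"
 assumes [measurable]: "meas f" and c: "c > 0"
 shows "en p (ball t (c * r)) f = enn (c ^ DIM('a)) * en p (ball 0 r) (%x. f (t + c *R x))" unfolding en_def using c
 by (subst nn_integral_affine[OF _ c, of _ t]) (auto simp: indicator_def dist_norm intro!: arg_cong2[where f="(*)"] nn_integral_cong)

text \<open>Integrating the tangent inequality \<open>plap_convex\<close> at the mean value gives Jensen's inequality.\<close>

lemma jensen_powr:
 fixes f :: "'c => 'b::euclidean_space"
 assumes M: "prob_space M" and [measurable]: "f \<in> borel_measurable M" and q: "q > 1"
 shows "enn (norm (\<integral>x. f x \<partial>M) powr q) <= (\<integral>\<^sup>+x. enn (norm (f x) powr q) \<partial>M)"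
  and "(\<integral>\<^sup>+x. enn (norm (f x) powr q) \<partial>M) < oo ==> integrable M f"
proof -
 interpret prob_space M by fact
 have int: "integrable M f & integrable M (%x. norm (f x) powr q)"
  if fin: "(\<integral>\<^sup>+x. enn (norm (f x) powr q) \<partial>M) < oo"
 proof -
  have 1: "integrable M (%x. norm (f x) powr q)" using fin by (intro integrableI_nonneg) auto
  moreover have "integrable M f"
  proof (rule Bochner_Integration.integrable_bound[of M "%x. 1 + norm (f x) powr q"])
   show "AE x in M. norm (f x) <= norm (1 + norm (f x) powr q)"
   proof (intro AE_I2)
   fix x
   have "norm (f x) <= 1 + norm (f x) powr q"
   proof (cases "norm (f x) <= 1")
   case False
   then have "norm (f x) powr 1 <= norm (f x) powr q" using q by (intro powr_mono) auto
   then show ?thesis using False by simp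
   qed (simp add: add_increasing2)
   then show "norm (f x) <= norm (1 + norm (f x) powr q)" by simp
   qed
  qed (use 1 in auto)
  ultimately show ?thesis by simp
 qed
 show "(\<integral>\<^sup>+x. enn (norm (f x) powr q) \<partial>M) < oo ==> integrable M f" using int by blast
 show "enn (norm (\<integral>x. f x \<partial>M) powr q) <= (\<integral>\<^sup>+x. enn (norm (f x) powr q) \<partial>M)"
 proof (cases "(\<integral>\<^sup>+x. enn (norm (f x) powr q) \<partial>M) < oo")
  case True
  with int have I: "integrable M f" "integrable M (%x. norm (f x) powr q)" by auto
  define c where "c = (\<integral>x. f x \<partial>M)"
  have "(\<integral>x. norm c powr q + q * (plap q c \<bullet> (f x - c)) \<partial>M) <= (\<integral>x. norm (f x) powr q \<partial>M)"
   using I plap_convex[OF q] by (intro integral_mono) auto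
  also have "(\<integral>x. norm c powr q + q * (plap q c \<bullet> (f x - c)) \<partial>M) = norm c powr q" using I by (simp add: prob_space c_def)
  finally have "enn (norm c powr q) <= enn (\<integral>x. norm (f x) powr q \<partial>M)" by (rule ennreal_leI)
  also have "... = (\<integral>\<^sup>+x. enn (norm (f x) powr q) \<partial>M)" using I by (subst nn_integral_eq_integral) auto
  finally show ?thesis by (simp add: c_def)
 qed (auto simp: not_less top_unique)
qed

lemma ennreal_subseq:
 fixes a :: "nat => ennreal" and e :: "nat => ennreal"
 assumes "a ---> 0" "!!k. e k > 0"
 obtains r where "strict_mono r" "!!k. a (r k) <= e k"
proof -
 have *: "EX m>n. a m <= e k" for n k
 proof -
  have "eventually (%m. a m < e k) sequentially" using assms by (auto intro: order_tendstoD)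
  then have "eventually (%m. a m < e k & m > n) sequentially" using eventually_gt_at_top[of n] by eventually_elim auto
  then show ?thesis using eventually_happens[of _ sequentially] by (force intro: less_imp_le)
 qed
 define r where "r = rec_nat (SOME m. a m <= e 0) (%k rk. SOME m. m > rk & a m <= e (Suc k))"
 have r0: "a (r 0) <= e 0" unfolding r_def using *[of 0 0] by (auto intro: someI2_ex)
 have rS: "r (Suc k) > r k & a (r (Suc k)) <= e (Suc k)" for k unfolding r_def by simp (rule someI_ex, use * in blast)
 have "strict_mono r" using rS by (simp add: strict_mono_Suc_iff)
 moreover have "a (r k) <= e k" for k using r0 rS by (cases k) auto
 ultimately show ?thesis using that by blast
qed

lemma ennreal_tendsto_0I:
 fixes a :: "nat => ennreal"
 assumes "!!e. e > 0 ==> eventually (%n. a n <= enn e) sequentially"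
 shows "a ---> 0"
proof (rule order_tendstoI)
 fix y :: ennreal assume "0 < y"
 then obtain e where e: "e > 0" "enn e < y"
  using ennreal_rat_dense[of 0 y] dense[of 0 y] by (metis ennreal_cases ennreal_less_zero_iff less_top top.extremum_strict)
 show "eventually (%n. a n < y) sequentially" using assms[OF e(1)] by eventually_elim (use e in auto)
qed simp

lemma ennreal_half_sum: "(\<Sum>k. enn ((1/2)^k)) < oo"
 by (subst suminf_ennreal2) (auto intro: summable_geometric)

lemma AE_tendsto_of_summable:
 fixes f :: "nat => 'c => real"
 assumes [measurable]: "!!k. f k \<in> borel_measurable M" and nn: "!!k x. f k x >= 0"
  and le: "!!k. (\<integral>\<^sup>+x. enn (f k x) \<partial>M) <= enn ((1/2)^k)"
 shows "AE x in M. (%k. f k x) ---> 0"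
proof -
 have "(\<integral>\<^sup>+x. (\<Sum>k. enn (f k x)) \<partial>M) = (\<Sum>k. \<integral>\<^sup>+x. enn (f k x) \<partial>M)"
  by (rule nn_integral_suminf) auto
 also have "... <= (\<Sum>k. enn ((1/2)^k))" using le by (intro suminf_le) auto
 also have "... < oo" by (rule ennreal_half_sum)
 finally have "AE x in M. (\<Sum>k. enn (f k x)) ~= oo" by (intro nn_integral_PInf_AE) auto
 then show ?thesis
 proof eventually_elim
  case (elim x)
  then have "summable (%k. f k x)" using nn by (intro summable_suminf_not_top) auto
  then show ?case by (rule summable_LIMSEQ_zero)
 qed
qed

lemma powr_tendsto_0D:
 fixes f :: "nat => real"
 assumes "(%k. f k powr p) ---> 0" "p > 0" "!!k. f k >= 0"
 shows "f ---> 0"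
proof -
 have "(%k. (f k powr p) powr (1/p)) ---> 0 powr (1/p)" using assms by (intro tendsto_powr2 tendsto_const) auto
 then show ?thesis using assms by (simp add: powr_powr)
qed

lemma en_AE_subseq:
 fixes F :: "nat => 'a::euclidean_space => 'b::euclidean_space"
 assumes [measurable]: "!!n. meas (F n)" "meas f" "S \<in> sets borel"
  and p: "p > 0" and lim: "Lp_tendsto p S F f"
 obtains r where "strict_mono r" "AE x in lborel. x \<in> S --> (%n. F (r n) x) ---> f x"
proof -
 obtain r where r: "strict_mono r" "!!k. en p S (%x. F (r k) x - f x) <= enn ((1/2)^k)" using ennreal_subseq[OF lim, of "%k. enn ((1/2)^k)"] by auto
 have "AE x in lborel. (%k. norm (F (r k) x - f x) powr p * indicator S x) ---> 0"
 proof (rule AE_tendsto_of_summable)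
  fix k show "(NN x. enn (norm (F (r k) x - f x) powr p * indicator S x)) <= enn ((1/2)^k)"
   using r(2)[of k] unfolding en_def by (simp add: ennreal_mult' ennreal_indicator)
 qed (auto simp: measurable_compose_rev)
 then have "AE x in lborel. x \<in> S --> (%n. F (r n) x) ---> f x"
 proof eventually_elim
  case (elim x)
  show ?case
  proof
   assume "x \<in> S"
   with elim have "(%k. norm (F (r k) x - f x) powr p) ---> 0" by simp
   then have "(%k. norm (F (r k) x - f x)) ---> 0" using p by (rule powr_tendsto_0D) auto
   then show "(%n. F (r n) x) ---> f x" by (simp add: LIM_zero_cancel tendsto_norm_zero_iff)
  qed
 qed
 with r show ?thesis using that by blast
qed

lemma en_fatou:
 fixes F :: "nat => 'a::euclidean_space => 'b::euclidean_space"
 assumes [measurable]: "!!n. meas (F n)" "S \<in> sets borel"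
  and p: "p > 0" and lim: "AE x in lborel. x \<in> S --> (%n. F n x) ---> f x"
  and bd: "!!n. en p S (F n) <= B"
 shows "en p S f <= B"
proof -
 have "en p S f <= (NN x. liminf (%n. enn (norm (F n x) powr p) * indicator S x))" unfolding en_def
 proof (rule nn_integral_mono_AE, use lim in eventually_elim)
  case (elim x)
  show ?case
  proof (cases "x \<in> S")
   case True
   with elim have "(%n. enn (norm (F n x) powr p)) ---> enn (norm (f x) powr p)"
   using p by (intro tendsto_ennrealI tendsto_powr2 tendsto_norm tendsto_const) auto
   from lim_imp_Liminf[OF _ this] show ?thesis using True by simp
  qed simp
 qed
 also have "... <= liminf (%n. en p S (F n))" unfolding en_def by (rule nn_integral_liminf) auto
 also have "... <= B" using bd by (intro Liminf_le) auto
 finally show ?thesis .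
qed

text \<open>Riesz-Fischer. A fast subsequence converges a.e. by a summable pointwise bound on its
  increments; Fatou's lemma then gives convergence of the whole sequence, the index of the
  subsequence running to infinity while n stays fixed.\<close>

lemma en_complete:
 fixes F :: "nat => 'a::euclidean_space => 'b::euclidean_space"
 assumes [measurable]: "!!n. meas (F n)" "S \<in> sets borel"
  and p: "p > 0"
  and cauchy: "!!e. e > 0 ==> EX n0. ALL m>=n0. ALL n>=n0. en p S (%x. F m x - F n x) <= enn e"
 obtains f where "meas f" "Lp_tendsto p S F f"
proof -
 \<comment> \<open>Dividing by the weight 2^(kp) leaves (1/2)^k for the weighted increments. Their
   convergence to 0 then means that the increments themselves are eventually below 2^(-k).\<close>
 define e where "e k = (1/2)^k / (2 powr (real k * p))" for k :: nat
 have e: "e k > 0" for k by (simp add: e_def)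
 obtain n0 where n0: "!!k m n. m >= n0 k ==> n >= n0 k ==> en p S (%x. F m x - F n x) <= enn (e k)" using cauchy[OF e] by metis
 \<comment> \<open>The maximum makes \<open>r k\<close> and \<open>r (Suc k)\<close> both admissible
   for \<open>e k\<close>; the summand k forces \<open>r\<close> to infinity.\<close>
 define r where "r k = Max (n0 ` {..k}) + k" for k
 have r: "r k >= n0 k" "r (Suc k) >= n0 k" "k <= l ==> r l >= n0 k" for k l
 proof -
  have "n0 k <= Max (n0 ` {..l})" if "k <= l" for k l using that by (intro Max_ge) auto
  then show "r k >= n0 k" "r (Suc k) >= n0 k" "k <= l ==> r l >= n0 k" unfolding r_def by (meson le_Suc_eq order_refl trans_le_add1)+
 qed
 have r_ge: "r k >= k" for k by (simp add: r_def)
 define d where "d k x = norm (F (r (Suc k)) x - F (r k) x)" for k x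
 have "AE x in lborel. (%k. 2 powr (real k * p) * d k x powr p * indicator S x) ---> 0"
 proof (rule AE_tendsto_of_summable)
  fix k
  show "(%x. 2 powr (real k * p) * d k x powr p * indicator S x) \<in> borel_measurable lborel" unfolding d_def by measurable
  have "(NN x. enn (2 powr (real k * p) * d k x powr p * indicator S x))
   = (NN x. enn (2 powr (real k * p)) * (enn (d k x powr p) * indicator S x))"
   by (intro nn_integral_cong) (auto simp: ennreal_mult' ennreal_indicator mult.assoc)
  also have "... = enn (2 powr (real k * p)) * en p S (%x. F (r (Suc k)) x - F (r k) x)" unfolding en_def d_def by (subst nn_integral_cmult) auto
  also have "... <= enn (2 powr (real k * p)) * enn (e k)" by (intro mult_left_mono n0 r) auto
  also have "... = enn ((1/2)^k)" by (simp add: ennreal_mult'[symmetric] e_def)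
  finally show "(NN x. enn (2 powr (real k * p) * d k x powr p * indicator S x)) <= enn ((1/2)^k)" .
 qed auto
 then have AEc: "AE x in lborel. x \<in> S --> convergent (%k. F (r k) x)"
 proof eventually_elim
  case (elim x)
  show ?case
  proof
   assume "x \<in> S"
   with elim have l0: "(%k. 2 powr (real k * p) * d k x powr p) ---> 0" by simp
   have "(%k. (2 powr real k * d k x) powr p) ---> 0" using l0 by (simp add: powr_mult powr_powr d_def)
   then have "(%k. 2 powr real k * d k x) ---> 0" using p by (rule powr_tendsto_0D) (auto simp: d_def)
   then have ev: "eventually (%k. 2 powr real k * d k x < 1) sequentially" by (intro order_tendstoD(2)[of _ 0]) auto
   have "summable (%k. d k x)"
   proof (rule summable_comparison_test_ev)
   show "eventually (%k. norm (d k x) <= (1/2)^k) sequentially" using ev by eventually_elim (auto simp: d_def powr_realpow field_simps power_divide)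
   qed (auto intro: summable_geometric)
   then have "summable (%k. F (r (Suc k)) x - F (r k) x)" unfolding d_def by (rule summable_norm_cancel)
   then have "convergent (%n. \<Sum>k<n. F (r (Suc k)) x - F (r k) x)" by (simp add: summable_iff_convergent)
   then have "convergent (%n. F (r n) x - F (r 0) x)" by (simp add: sum_lessThan_telescope[of "%k. F (r k) x"])
   then have "convergent (%n. (F (r n) x - F (r 0) x) + F (r 0) x)" by (intro convergent_add convergent_const)
   then show "convergent (%k. F (r k) x)" by simp
  qed
 qed
 \<comment> \<open>On the null set where the subsequence diverges, and outside S, the value is
   whatever \<open>lim\<close> returns; the function is Borel all the same.\<close>
 define f where "f x = lim (%k. F (r k) x)" for x
 have fm[measurable]: "meas f" unfolding f_def by (rule borel_measurable_lim_metric) auto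
 have AEf: "AE x in lborel. x \<in> S --> (%k. F (r k) x) ---> f x" using AEc by eventually_elim (auto simp: f_def convergent_LIMSEQ_iff)
 have "Lp_tendsto p S F f"
 proof (rule ennreal_tendsto_0I)
  fix e :: real assume "e > 0"
  from cauchy[OF this] obtain n1 where n1: "!!m n. m >= n1 ==> n >= n1 ==> en p S (%x. F m x - F n x) <= enn e" by blast
  have "en p S (%x. F n x - f x) <= enn e" if n: "n >= n1" for n
  proof (rule en_fatou[where F="%k x. F n x - F (r (k + n1)) x"])
   show "AE x in lborel. x \<in> S --> (%k. F n x - F (r (k + n1)) x) ---> F n x - f x" using AEf
   proof eventually_elim
   case (elim x)
   then show ?case by (intro impI tendsto_diff tendsto_const) (simp add: LIMSEQ_ignore_initial_segment[of "%k. F (r k) x" _ n1])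
   qed
   show "en p S (%x. F n x - F (r (k + n1)) x) <= enn e" for k
   proof (rule n1[OF n])
   have "r j >= j" for j using r_ge .
   then show "r (k + n1) >= n1" by (meson le_add2 order_trans)
   qed
  qed (use p in auto)
  then show "eventually (%n. en p S (%x. F n x - f x) <= enn e) sequentially" by (auto simp: eventually_sequentially)
 qed
 then show ?thesis by (rule that[OF fm])
qed

lemma en_tendsto_squeeze:
 fixes a b :: "nat => ennreal"
 assumes "!!n. a n <= enn C * b n" "b ---> 0"
 shows "a ---> 0"
proof (rule tendsto_sandwich[OF _ _ tendsto_const])
 have "(%n. enn C * b n) ---> enn C * 0" using assms(2) by (intro ennreal_tendsto_cmult) auto
 then show "(%n. enn C * b n) ---> 0" by simp
qed (use assms in auto)

lemma en_add_tendsto: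
 fixes F G :: "nat => 'a::euclidean_space => 'b::euclidean_space"
 assumes "!!n. meas (F n)" "!!n. meas (G n)" "S \<in> sets borel" "0 <= p"
  and "(%n. en p S (F n)) ---> 0" "(%n. en p S (G n)) ---> 0"
 shows "(%n. en p S (%x. F n x + G n x)) ---> 0"
proof (rule en_tendsto_squeeze)
 show "en p S (%x. F n x + G n x) <= enn (2 powr p) * (en p S (F n) + en p S (G n))" for n using assms by (intro en_add) auto
 show "(%n. en p S (F n) + en p S (G n)) ---> 0" using tendsto_add[OF assms(5,6)] by simp
qed

section \<open>Continuity of translations\<close>

text \<open>Stated along sequences because dominated convergence is; \<open>tcont_delta\<close>
  recovers the uniform version.\<close>

definition tcont :: "real => ('a::euclidean_space => 'b::euclidean_space) => bool" where
 "tcont p f \<longleftrightarrow> (ALL h::nat => 'a. h ---> 0 --> (%n. en p UNIV (%x. f (x + h n) - f x)) ---> 0)"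

lemma tcont_add:
 fixes f g :: "'a::euclidean_space => 'b::euclidean_space"
 assumes [measurable]: "meas f" "meas g" and "0 <= p" "tcont p f" "tcont p g"
 shows "tcont p (%x. f x + g x)" unfolding tcont_def
proof (intro allI impI)
 fix h :: "nat => 'a" assume h: "h ---> 0"
 have "(%n. en p UNIV (%x. (f (x + h n) - f x) + (g (x + h n) - g x))) ---> 0" using assms h by (intro en_add_tendsto) (auto simp: tcont_def)
 then show "(%n. en p UNIV (%x. (f (x + h n) + g (x + h n)) - (f x + g x))) ---> 0" by (simp add: algebra_simps)
qed

text \<open>The usual three-term argument: the two approximation errors are equal by translation
  invariance, and the middle term tends to 0 by hypothesis on the approximant.\<close>

lemma tcont_limit:
 fixes f :: "'a::euclidean_space => 'b::euclidean_space"
 assumes [measurable]: "meas f" and p: "0 <= p"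
  and ap: "!!e. e > 0 ==> EX g:borel_measurable borel. tcont p g & en p UNIV (%x. f x - g x) <= enn e"
 shows "tcont p f" unfolding tcont_def
proof (intro allI impI ennreal_tendsto_0I)
 fix h :: "nat => 'a" and e :: real assume h: "h ---> 0" and e: "e > 0"
 define C where "C = 2 powr p"
 have C: "C >= 1" using p by (simp add: C_def ge_one_powr_ge_zero)
 \<comment> \<open>Three terms, each of which passes through at most two applications of
   \<open>en_add\<close> with constant C.\<close>
 define e1 where "e1 = e / (3 * C\<^sup>2)"
 have e1: "e1 > 0" using e C by (simp add: e1_def)
 obtain g where [measurable]: "meas g" and g: "tcont p g" "en p UNIV (%x. f x - g x) <= enn e1" using ap[OF e1] by blast
 have "(%n. en p UNIV (%x. g (x + h n) - g x)) ---> 0" using g h by (auto simp: tcont_def)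
 then have "eventually (%n. en p UNIV (%x. g (x + h n) - g x) < enn e1) sequentially" using e1 by (intro order_tendstoD) auto
 then show "eventually (%n. en p UNIV (%x. f (x + h n) - f x) <= enn e) sequentially"
 proof eventually_elim
  case (elim n)
  have t: "en p UNIV (%x. f (x + h n) - g (x + h n)) = en p UNIV (%x. f x - g x)" using en_translate[of "%x. f x - g x" UNIV p "h n"] by simp
  have "en p UNIV (%x. f (x + h n) - f x)
   = en p UNIV (%x. (f (x + h n) - g (x + h n)) + ((g (x + h n) - g x) + (g x - f x)))" by (intro en_cong) simp
  also have "... <= enn C * (en p UNIV (%x. f (x + h n) - g (x + h n)) +
   en p UNIV (%x. (g (x + h n) - g x) + (g x - f x)))" unfolding C_def by (intro en_add) (use p in auto)
  also have "... <= enn C * (en p UNIV (%x. f x - g x) +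
   enn C * (en p UNIV (%x. g (x + h n) - g x) + en p UNIV (%x. g x - f x)))"
   unfolding t C_def by (intro mult_left_mono add_left_mono en_add) (use p in simp_all)
  also have "... <= enn C * (enn e1 + enn C * (enn e1 + enn e1))"
   using g elim en_diff_commute[of p UNIV f g] by (intro mult_left_mono add_mono) auto
  also have "... = enn (C * (e1 + C * (e1 + e1)))"
   using e1 by (simp only: ennreal_mult ennreal_plus add_nonneg_nonneg mult_nonneg_nonneg order_trans[OF zero_le_one C] less_imp_le)
  also have "... <= enn e"
  proof (rule ennreal_leI)
   have "C * e1 <= C * (C * e1)" using C e1 by (intro mult_left_mono) (auto simp: mult_le_cancel_right1)
   then have "C * (e1 + C * (e1 + e1)) <= 3 * C\<^sup>2 * e1" by (simp add: algebra_simps power2_eq_square)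
   also have "... = e" using C by (simp add: e1_def)
   finally show "C * (e1 + C * (e1 + e1)) <= e" .
  qed
  finally show ?case .
 qed
qed

text \<open>Every point of an open set stays in it under small shifts, so the indicators tend to 0
  pointwise; the finite measure of U supplies the dominating function.\<close>

lemma emeasure_open_translate:
 fixes U :: "'a::euclidean_space set"
 assumes U: "open U" "emeasure lborel U < oo" and h: "h ---> (0::'a)"
 shows "(%n. emeasure lborel {x\<in>U. x + h n \<notin> U}) ---> 0"
proof -
 have [measurable]: "U \<in> sets borel" using U by auto
 have "(%n. NN x. indicator {x\<in>U. x + h n \<notin> U} x) ---> (\<integral>\<^sup>+x. 0 \<partial>(lborel::'a measure))"
 proof (rule nn_integral_dominated_convergence[where w="indicator U"])
  show "AE x in lborel. (%n. indicator {x\<in>U. x + h n \<notin> U} x :: ennreal) ---> 0"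
  proof (intro AE_I2)
   fix x
   show "(%n. indicator {x\<in>U. x + h n \<notin> U} x :: ennreal) ---> 0"
   proof (cases "x \<in> U")
   case True
   have "(%n. x + h n) ---> x + 0" by (intro tendsto_add tendsto_const h)
   then have "eventually (%n. x + h n \<in> U) sequentially" using topological_tendstoD[OF _ U(1)] True by auto
   then show ?thesis by (intro tendsto_eventually) (auto elim!: eventually_mono)
   qed simp
  qed
 next
  show "(NN  x. indicator U x) < oo" using U by simp
 next
  show "AE x in lborel. indicator {x \<in> U. x + h j \<notin> U} x <= (indicator U x :: ennreal)" for j by (auto simp: indicator_def)
 qed auto
 then show ?thesis by (subst (asm) nn_integral_indicator) auto
qed

lemma tcont_open:
 fixes U :: "'a::euclidean_space set" and v :: "'b::euclidean_space"
 assumes U: "open U" "emeasure lborel U < oo" and p: "p > 0"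
 shows "tcont p (%x. indicator U x *R v)" unfolding tcont_def
proof (intro allI impI)
 fix h :: "nat => 'a" assume h: "h ---> 0"
 have [measurable]: "U \<in> sets borel" using U by auto
 \<comment> \<open>The two halves of the symmetric difference of U and its translate.
   \<open>B n\<close> is evaluated at x + h n: there x + h n lies in U and x does not.\<close>
 define A where "A n = {x\<in>U. x + h n \<notin> U}" for n
 define B where "B n = {x\<in>U. x + (- h n) \<notin> U}" for n
 have [measurable]: "A n \<in> sets borel" "B n \<in> sets borel" for n unfolding A_def B_def by measurable
 show "(%n. en p UNIV (%x. indicator U (x + h n) *R v - indicator U x *R v)) ---> 0"
 proof (rule en_tendsto_squeeze)
  fix n
  have "en p UNIV (%x. indicator U (x + h n) *R v - indicator U x *R v)
   <= (NN x. enn (norm v powr p) * (indicator (A n) x + indicator (B n) (x + h n)))"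
   unfolding en_def by (intro nn_integral_mono) (auto simp: indicator_def A_def B_def)
  also have "... = enn (norm v powr p) * (emeasure lborel (A n) + (NN x. indicator (B n) (x + h n)))"
   by (subst nn_integral_cmult, simp, subst nn_integral_add) auto
  also have "(NN x. indicator (B n) (x + h n)) = emeasure lborel (B n)" by (subst nn_integral_translate) auto
  finally show "en p UNIV (%x. indicator U (x + h n) *R v - indicator U x *R v)
   <= enn (norm v powr p) * (emeasure lborel (A n) + emeasure lborel (B n))" .
 next
  have "(%n. - h n) ---> 0" using tendsto_minus[OF h] by simp
  then show "(%n. emeasure lborel (A n) + emeasure lborel (B n)) ---> 0"
   using tendsto_add[OF emeasure_open_translate[OF U h] emeasure_open_translate[OF U, of "%n. - h n"]] by (simp add: A_def B_def)
 qed
qed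

lemma tcont_indicator:
 fixes E :: "'a::euclidean_space set" and v :: "'b::euclidean_space"
 assumes E[measurable]: "E \<in> sets borel" and fin: "emeasure lborel E < oo" and p: "p > 0"
 shows "tcont p (%x. indicator E x *R v)"
proof (rule tcont_limit)
 fix e :: real assume e: "e > 0"
 define e' where "e' = e / (norm v powr p + 1)"
 have e': "e' > 0" using e by (simp add: e'_def add_nonneg_pos)
 obtain U where U: "open U" "E \<subseteq> U" "emeasure lborel (U - E) < e'" using outer_regular_lborel[OF E e'] .
 have [measurable]: "U \<in> sets borel" using U by auto
 have "emeasure lborel U <= emeasure lborel E + emeasure lborel (U - E)" using emeasure_subadditive[of E lborel "U - E"] U by (simp add: Un_absorb1)
 also have "... < oo" using fin U by (auto simp: less_top[symmetric])
 finally have Uf: "emeasure lborel U < oo" .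
 have "en p UNIV (%x. indicator E x *R v - indicator U x *R v) <= (NN x. enn (norm v powr p) * indicator (U - E) x)"
  unfolding en_def using U by (intro nn_integral_mono) (auto simp: indicator_def)
 also have "... = enn (norm v powr p) * emeasure lborel (U - E)" by (subst nn_integral_cmult) auto
 also have "... <= enn (norm v powr p) * enn e'" using U by (intro mult_left_mono) auto
 also have "... = enn (norm v powr p * e')" using e' by (simp add: ennreal_mult)
 also have "... <= enn e"
 proof (rule ennreal_leI)
  have "norm v powr p * e' <= (norm v powr p + 1) * e'" using e' by (intro mult_right_mono) auto
  also have "... = e" by (simp add: e'_def add_nonneg_pos less_imp_neq[symmetric])
  finally show "norm v powr p * e' <= e" .
 qed
 finally show "EX g:borel_measurable borel. tcont p g & en p UNIV (%x. indicator E x *R v - g x) <= enn e"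
  using tcont_open[OF U(1) Uf p, of v] by (intro bexI[of _ "%x. indicator U x *R v"]) auto
qed (use p in auto)

lemma tcont_sum:
 fixes f :: "'i => 'a::euclidean_space => 'b::euclidean_space"
 assumes "finite I" "!!i. i \<in> I ==> meas (f i)" "!!i. i \<in> I ==> tcont p (f i)" "0 <= p"
 shows "tcont p (%x. \<Sum>i\<in>I. f i x)" using assms
proof (induction I rule: finite_induct)
 case empty
 then show ?case by (simp add: tcont_def en_def)
next
 case (insert i I)
 then show ?case by (simp add: tcont_add borel_measurable_sum)
qed

text \<open>Translations act continuously on \<open>L\<^sup>p\<close>: outer regularity reduces the claim to indicators of open sets,
 which are lower semicontinuous.\<close>

lemma en_translation_continuous:
 fixes f :: "'a::euclidean_space => 'b::euclidean_space"
 assumes f[measurable]: "meas f" and fin: "en p UNIV f < oo" and p: "p > 0"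
 shows "tcont p f"
proof -
 obtain F where F: "!!i. simple_function borel (F i)" "!!x. (%i. F i x) ---> f x"
  "!!i x. norm (F i x) <= 2 * norm (f x)" using borel_measurable_implies_sequence_metric[OF f, of 0] by (auto simp: dist_norm)
 have Fm[measurable]: "meas (F i)" for i using F(1) by (rule borel_measurable_simple_function)
 have lim: "(%i. en p UNIV (%x. f x - F i x)) ---> (\<integral>\<^sup>+x. 0 \<partial>(lborel::'a measure))" unfolding en_def
 proof (rule nn_integral_dominated_convergence[where w="%x. enn (3 powr p) * enn (norm (f x) powr p)"])
  fix i
  show "AE x in lborel. enn (norm (f x - F i x) powr p) * indicator UNIV x <= enn (3 powr p) * enn (norm (f x) powr p)"
  proof (intro AE_I2, goal_cases)
   case (1 x)
   have "norm (f x - F i x) <= 3 * norm (f x)" using F(3)[of i x] norm_triangle_ineq4[of "f x" "F i x"] by linarith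
   then have "norm (f x - F i x) powr p <= (3 * norm (f x)) powr p" using p by (intro powr_mono2) auto
   then show ?case by (simp add: powr_mult ennreal_mult'[symmetric] ennreal_leI)
  qed
 next
  show "(NN  x. enn (3 powr p) * enn (norm (f x) powr p)) < oo"
   using fin by (subst nn_integral_cmult) (auto simp: en_def ennreal_mult_less_top)
 next
  show "AE x in lborel. (%i. enn (norm (f x - F i x) powr p) * indicator UNIV x) ---> 0"
  proof (intro AE_I2, goal_cases)
   case (1 x)
   have "(%i. norm (f x - F i x)) ---> norm (f x - f x)" by (intro tendsto_norm tendsto_diff tendsto_const F)
   then have "(%i. norm (f x - F i x) powr p) ---> 0 powr p" using p by (intro tendsto_powr2 tendsto_const) auto
   then have "(%i. enn (norm (f x - F i x) powr p)) ---> enn (0 powr p)" by (rule tendsto_ennrealI)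
   then show ?case by simp
  qed
 qed auto
 have tcF: "tcont p (F i)" for i
 proof -
  have fr: "finite (range (F i))" using F(1)[of i] by (simp add: simple_function_def)
  have "F i = (%x. \<Sum>y\<in>range (F i). indicator (F i -` {y}) x *R y)"
  proof
   fix x
   have "(\<Sum>y\<in>range (F i). indicator (F i -` {y}) x *R y) = (\<Sum>y\<in>{F i x}. indicator (F i -` {y}) x *R y)"
   by (rule sum.mono_neutral_right) (use fr in auto)
   then show "F i x = (\<Sum>y\<in>range (F i). indicator (F i -` {y}) x *R y)" by simp
  qed
  moreover have "tcont p (%x. \<Sum>y\<in>range (F i). indicator (F i -` {y}) x *R y)"
  proof (intro tcont_sum fr)
   fix y
   have [measurable]: "F i -` {y} \<in> sets borel" using measurable_sets[OF Fm[of i], of "{y}"] by simp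
   show "meas (%x. indicator (F i -` {y}) x *R y)" by measurable
   show "tcont p (%x. indicator (F i -` {y}) x *R y)"
   \<comment> \<open>The level set of the value 0 may have infinite measure, but its summand
     vanishes. For y nonzero the level set has finite measure because |y| <= 2 |f| on it.\<close>
   proof (cases "y = 0")
   case True then show ?thesis by (simp add: tcont_def en_def)
   next
   case False
   have "enn (norm y powr p) * emeasure lborel (F i -` {y}) = (NN x. enn (norm y powr p) * indicator (F i -` {y}) x)" by (subst nn_integral_cmult) auto
   also have "... <= (NN x. enn (2 powr p) * enn (norm (f x) powr p))"
   proof (intro nn_integral_mono, goal_cases)
   case (1 x)
   have "norm (F i x) powr p <= (2 * norm (f x)) powr p" using F(3) p by (intro powr_mono2) auto
   then show ?case by (auto simp: indicator_def powr_mult ennreal_mult'[symmetric] ennreal_leI)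
   qed
   also have "... < oo" using fin by (subst nn_integral_cmult) (auto simp: en_def ennreal_mult_less_top)
   finally have "emeasure lborel (F i -` {y}) < oo" using False by (auto simp: ennreal_mult_less_top)
   then show ?thesis using p by (intro tcont_indicator) auto
   qed
  qed (use p in auto)
  ultimately show ?thesis by simp
 qed
 show ?thesis
 proof (rule tcont_limit)
  fix e :: real assume "e > 0"
  then have "eventually (%i. en p UNIV (%x. f x - F i x) < enn e) sequentially" using lim by (intro order_tendstoD(2)) auto
  then obtain i where "en p UNIV (%x. f x - F i x) < enn e" by (auto simp: eventually_sequentially)
  then show "EX g:borel_measurable borel. tcont p g & en p UNIV (%x. f x - g x) <= enn e" using tcF Fm by (intro bexI[of _ "F i"]) auto
 qed (use p in auto)
qed

section \<open>C1 functions and compact support\<close>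

definition c1 :: "('a::euclidean_space => real) => ('a => 'a) => bool" where
 "c1 psi psi' \<longleftrightarrow> (ALL x. (psi has_derivative (%h. psi' x \<bullet> h)) (at x)) & continuous_on UNIV psi'"

text \<open>The support lies in a strictly smaller ball. The gap leaves room for mollifying such a
  function inside the ball of radius R.\<close>

definition c1c :: "real => ('a::euclidean_space => real) => ('a => 'a) => bool" where
 "c1c R psi psi' \<longleftrightarrow> c1 psi psi' & (EX r>0. r < R & (ALL x. r <= norm x --> psi x = 0 & psi' x = 0))"

lemma c1_D: "c1 psi psi' ==> (psi has_derivative (%h. psi' x \<bullet> h)) (at x within S)"
 by (auto simp: c1_def intro: has_derivative_at_withinI)

lemma c1_continuous: "c1 psi psi' ==> continuous_on S psi" "c1 psi psi' ==> continuous_on S psi'"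
proof -
 assume c: "c1 psi psi'"
 show "continuous_on S psi" using c1_D[OF c] by (rule has_derivative_continuous_on)
 show "continuous_on S psi'" using c by (auto simp: c1_def intro: continuous_on_subset)
qed

lemma c1_borel: "c1 psi psi' ==> meas psi" "c1 psi psi' ==> meas psi'"
 by (auto intro: borel_measurable_continuous_onI c1_continuous)

lemma c1_const: "c1 (%x. c) (%x. 0)"
 by (simp add: c1_def)

lemma c1_add: "c1 f f' ==> c1 g g' ==> c1 (%x. f x + g x) (%x. f' x + g' x)"
 by (auto simp: c1_def inner_add_left intro!: has_derivative_add continuous_intros)

lemma c1_mult: "c1 f f' ==> c1 g g' ==> c1 (%x. f x * g x) (%x. f x *R g' x + g x *R f' x)"
proof -
 assume f: "c1 f f'" and g: "c1 g g'"
 have "((%x. f x * g x) has_derivative (%h. (f x *R g' x + g x *R f' x) \<bullet> h)) (at x)" for x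
  using has_derivative_mult[OF c1_D[OF f] c1_D[OF g], of x UNIV] by (simp add: inner_add_left mult.commute)
 moreover have "continuous_on UNIV (%x. f x *R g' x + g x *R f' x)" by (intro continuous_intros c1_continuous[OF f] c1_continuous[OF g])
 ultimately show ?thesis by (simp add: c1_def)
qed

lemma c1_cmult: "c1 f f' ==> c1 (%x. c * f x) (%x. c *R f' x)"
 using c1_mult[OF c1_const, of f f' c] by simp

lemma c1_affine: "c1 f f' ==> c1 (%x. f (a + c *R x)) (%x. c *R f' (a + c *R x))"
proof -
 assume c: "c1 f f'"
 have "((%x. f (a + c *R x)) has_derivative (%h. (c *R f' (a + c *R x)) \<bullet> h)) (at x)" for x
 proof -
  have "((%x. a + c *R x) has_derivative (%h. c *R h)) (at x)" by (auto intro!: derivative_eq_intros)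
  from diff_chain_at[OF this c1_D[OF c]] show ?thesis by (simp add: o_def)
 qed
 moreover have "continuous_on UNIV (%x. c *R f' (a + c *R x))" by (intro continuous_intros continuous_on_compose2[OF c1_continuous(2)[OF c, of UNIV]]) auto
 ultimately show ?thesis by (simp add: c1_def)
qed

lemma c1_translate: "c1 f f' ==> c1 (%x. f (x + h)) (%x. f' (x + h))"
 using c1_affine[of f f' h 1] by (simp add: add.commute)

lemma c1_compose:
 assumes g: "!!t. (g has_real_derivative g' t) (at t)" "continuous_on UNIV g'" and f: "c1 f f'"
 shows "c1 (%x. g (f x)) (%x. g' (f x) *R f' x)"
proof -
 have "((%x. g (f x)) has_derivative (%h. (g' (f x) *R f' x) \<bullet> h)) (at x)" for x
 proof -
  have "(g has_derivative (%h. g' (f x) * h)) (at (f x))" using g(1) by (simp add: has_field_derivative_def)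
  from diff_chain_at[OF c1_D[OF f] this] show ?thesis by (simp add: o_def)
 qed
 moreover have "continuous_on UNIV (%x. g' (f x) *R f' x)" by (intro continuous_intros continuous_on_compose2[OF g(2)] c1_continuous[OF f]) auto
 ultimately show ?thesis by (simp add: c1_def)
qed

lemma c1c_c1: "c1c R f f' ==> c1 f f'" by (simp add: c1c_def)

lemma c1c_zero: "R > 0 ==> c1c R (%x. 0) (%x. 0)"
 using dense[of 0 R] by (auto simp: c1c_def c1_const)

lemma c1c_mono: "c1c R f f' ==> R <= R' ==> c1c R' f f'"
 by (auto simp: c1c_def intro: less_le_trans)

lemma c1c_add:
 assumes "c1c R f f'" "c1c R g g'" shows "c1c R (%x. f x + g x) (%x. f' x + g' x)"
proof -
 obtain r s where "r > 0" "r < R" "ALL x. r <= norm x --> f x = 0 & f' x = 0"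
  "s > 0" "s < R" "ALL x. s <= norm x --> g x = 0 & g' x = 0" using assms by (auto simp: c1c_def)
 then show ?thesis using assms by (auto simp: c1c_def c1_add intro!: exI[of _ "max r s"])
qed

lemma c1c_mult:
 assumes "c1c R f f'" "c1 g g'" shows "c1c R (%x. f x * g x) (%x. f x *R g' x + g x *R f' x)" using assms by (auto simp: c1c_def c1_mult)

lemma c1c_cmult: "c1c R f f' ==> c1c R (%x. c * f x) (%x. c *R f' x)"
 by (auto simp: c1c_def c1_cmult)

lemma c1c_diff: "c1c R f f' ==> c1c R g g' ==> c1c R (%x. f x - g x) (%x. f' x - g' x)"
 using c1c_add[OF _ c1c_cmult[of R g g' "-1"], of f f'] by simp

lemma c1c_outside: "c1c R f f' ==> R <= norm x ==> f x = 0 & f' x = 0"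
 unfolding c1c_def by force

lemma compact_support_bounded:
 fixes f :: "'a::euclidean_space => 'b::real_normed_vector"
 assumes "continuous_on UNIV f" "!!x. r <= norm x ==> f x = 0"
 obtains B where "B > 0" "!!x. norm (f x) <= B"
proof -
 have "compact (f ` cball 0 r)" by (intro compact_continuous_image continuous_on_subset[OF assms(1)]) auto
 then obtain B where "B > 0" and B: "ALL y:f ` cball 0 r. norm y <= B" using compact_imp_bounded bounded_pos by metis
 moreover have "norm (f x) <= B" for x using B assms(2)[of x] \<open>B > 0\<close> by (cases "norm x <= r") auto
 ultimately show ?thesis using that by blast
qed

lemma c1c_bounded:
 assumes "c1c R f f'"
 obtains B where "B > 0" "!!x. norm (f x) <= B" "!!x. norm (f' x) <= B"
proof -
 obtain B1 where B1: "B1 > 0" "!!x. norm (f x) <= B1" using compact_support_bounded[of f R] c1_continuous[OF c1c_c1[OF assms]] c1c_outside[OF assms] by metis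
 obtain B2 where B2: "B2 > 0" "!!x. norm (f' x) <= B2" using compact_support_bounded[of f' R] c1_continuous[OF c1c_c1[OF assms]] c1c_outside[OF assms] by metis
 show ?thesis by (rule that[of "max B1 B2"]) (use B1 B2 in \<open>auto intro: le_max_iff_disj[THEN iffD2]\<close>)
qed

lemma compact_support_uniformly_continuous:
 fixes f :: "'a::euclidean_space => 'b::real_normed_vector"
 assumes c: "continuous_on UNIV f" and z: "!!x. r <= norm x ==> f x = 0"
 shows "uniformly_continuous_on UNIV f" unfolding uniformly_continuous_on_def
proof (intro allI impI)
 fix e :: real assume e: "e > 0"
 have "uniformly_continuous_on (cball 0 (r + 1)) f" by (intro compact_uniformly_continuous continuous_on_subset[OF c]) auto
 then obtain d where d: "d > 0" "!!x y. x \<in> cball 0 (r+1) ==> y \<in> cball 0 (r+1) ==> dist y x < d ==> dist (f y) (f x) < e"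
  using e unfolding uniformly_continuous_on_def by blast
 have "dist (f y) (f x) < e" if xy: "dist y x < min d 1" for x y
 proof (cases "norm x <= r \<or> norm y <= r")
  case True
  have "norm x <= norm y + norm (y - x)" "norm y <= norm x + norm (y - x)"
   using norm_triangle_sub[of x y] norm_triangle_sub[of y x] by (auto simp: norm_minus_commute)
  then show ?thesis using True xy by (intro d(2)) (auto simp: dist_norm)
 next
  case False
  then show ?thesis using z e by auto
 qed
 then show "EX d>0. ALL x:UNIV. ALL x':UNIV. dist x' x < d --> dist (f x') (f x) < e" using d(1) by (intro exI[of _ "min d 1"]) auto
qed

lemma c1_linearize:
 assumes c: "c1 f f'" and B: "!!t. t \<in> {0..1} ==> norm (f' (x + t *R h) - f' x) <= e"
 shows "abs (f (x + h) - f x - f' x \<bullet> h) <= e * norm h"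
proof -
 have "norm (f (x + h) - f x - (%k. f' x \<bullet> k) ((x + h) - x)) <= norm ((x + h) - x) * e"
 proof (rule differentiable_bound_linearization[where S="closed_segment x (x + h)" and f'="%y k. f' y \<bullet> k"])
  fix y assume "y \<in> closed_segment x (x + h)"
  then obtain t where t: "t \<in> {0..1}" "y = x + t *R h" by (auto simp: closed_segment_def algebra_simps)
  have "(%k. f' y \<bullet> k) - (%k. f' x \<bullet> k) = (%k. (f' y - f' x) \<bullet> k)" by (auto simp: inner_diff_left)
  moreover have "onorm (%k. (f' y - f' x) \<bullet> k) <= norm (f' y - f' x)" by (intro onorm_le) (simp add: Cauchy_Schwarz_ineq2)
  ultimately show "onorm ((%k. f' y \<bullet> k) - (%k. f' x \<bullet> k)) <= e" using B[OF t(1)] t by simp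
 next
  fix t :: real assume "t \<in> {0..1}"
  then show "x + t *R ((x + h) - x) \<in> closed_segment x (x + h)" by (auto simp: closed_segment_def algebra_simps intro!: exI[of _ t])
 qed (auto intro: c1_D[OF c])
 then show ?thesis by (simp add: mult.commute)
qed

section \<open>Convolution and mollification\<close>

text \<open>The second argument may be vector-valued and is the one that receives the derivative in
  \<open>c1_conv\<close>; the gradient of a convolution is thus again a \<open>conv\<close>.\<close>

definition conv :: "('a::euclidean_space => real) => ('a => 'b::euclidean_space) => 'a => 'b" where
 "conv f k x = (LBINT y. f y *R k (x - y))"

lemma conv_integrable:
 fixes f :: "'a::euclidean_space => real" and k :: "'a => 'b::euclidean_space"
 assumes f: "integrable lborel f" and k: "meas k" "!!x. norm (k x) <= B"
 shows "integrable lborel (%y. f y *R k (x - y))"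
proof (rule Bochner_Integration.integrable_bound[where f="%y. B * f y"])
 show "integrable lborel (%y. B * f y)" using f by simp
 have [measurable]: "meas k" "meas f" using k f by auto
 show "(%y. f y *R k (x - y)) \<in> borel_measurable lborel" by measurable
 have "0 <= B" using k(2)[of 0] norm_ge_zero order_trans by blast
 then have "abs (f y) * norm (k (x - y)) <= B * abs (f y)" for y using k(2)[of "x - y"] mult_left_mono[of "norm (k (x - y))" B "abs (f y)"] by (simp add: mult.commute)
 then show "AE y in lborel. norm (f y *R k (x - y)) <= norm (B * f y)" using \<open>0 <= B\<close> by (simp add: abs_mult)
qed

lemma conv_uniformly_continuous:
 fixes f :: "'a::euclidean_space => real" and k :: "'a => 'b::euclidean_space"
 assumes f: "integrable lborel f" and k: "uniformly_continuous_on UNIV k" "!!x. norm (k x) <= B"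
 shows "continuous_on UNIV (conv f k)" unfolding continuous_on_iff
proof (intro ballI allI impI)
 fix x :: 'a and e :: real assume e: "e > 0"
 have km[measurable]: "meas k" using uniformly_continuous_imp_continuous[OF k(1)] by (rule borel_measurable_continuous_onI)
 define I where "I = (LBINT y. abs (f y))"
 have I: "0 <= I" by (simp add: I_def)
 define e' where "e' = e / (I + 1)"
 have e': "e' > 0" using e I by (simp add: e'_def)
 obtain d where d: "d > 0" "!!u v. dist u v < d ==> dist (k u) (k v) < e'" using k(1) e' unfolding uniformly_continuous_on_def by (metis UNIV_I)
 have "dist (conv f k z) (conv f k x) < e" if z: "dist z x < d" for z
 proof -
  have "conv f k z - conv f k x = (LBINT y. f y *R k (z - y) - f y *R k (x - y))"
   unfolding conv_def by (intro Bochner_Integration.integral_diff[symmetric] conv_integrable[OF f km k(2)])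
  also have "norm ... <= (LBINT y. e' * abs (f y))"
  proof (rule order_trans[OF integral_norm_bound] , rule integral_mono)
   show "integrable lborel (%y. norm (f y *R k (z - y) - f y *R k (x - y)))"
   by (intro integrable_norm Bochner_Integration.integrable_diff conv_integrable[OF f km k(2)])
   show "integrable lborel (%y. e' * abs (f y))" using f by simp
   fix y
   have "norm (k (z - y) - k (x - y)) <= e'" using d(2)[of "z - y" "x - y"] z by (simp add: dist_norm less_imp_le)
   then show "norm (f y *R k (z - y) - f y *R k (x - y)) <= e' * abs (f y)"
   unfolding scaleR_diff_right[symmetric] norm_scaleR mult.commute[of e'] by (intro mult_left_mono) auto
  qed
  also have "... = e' * I" by (simp add: I_def)
  also have "... < e' * (I + 1)" using e' by simp
  also have "... = e" using I by (simp add: e'_def)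
  finally show ?thesis by (simp add: dist_norm)
 qed
 then show "EX d>0. ALL x':UNIV. dist x' x < d --> dist (conv f k x') (conv f k x) < e" using d(1) by blast
qed

text \<open>The gradient of k is uniformly continuous, so the linearization error of k is at most e'
  |h| uniformly in the base point; integrating it against |f| gives the derivative of the
  convolution.\<close>

lemma c1_conv:
 fixes f :: "'a::euclidean_space => real"
 assumes f: "integrable lborel f" and k: "c1c R k k'"
 shows "c1 (conv f k) (conv f k')"
proof -
 obtain B where B: "B > 0" "!!x. norm (k x) <= B" "!!x. norm (k' x) <= B" using c1c_bounded[OF k] by blast
 have kc: "c1 k k'" using k by (rule c1c_c1)
 have [measurable]: "meas k" "meas k'" using c1_borel[OF kc] by auto
 have uc: "uniformly_continuous_on UNIV k'" using compact_support_uniformly_continuous[of k' R] c1_continuous[OF kc] c1c_outside[OF k] by metis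
 define I where "I = (LBINT y. abs (f y))"
 have I: "0 <= I" by (simp add: I_def)
 have "(conv f k has_derivative (%h. conv f k' x \<bullet> h)) (at x)" for x unfolding has_derivative_at_alt
 proof (intro conjI allI impI)
  show "bounded_linear (%h. conv f k' x \<bullet> h)" by (rule bounded_linear_inner_right)
  fix e :: real assume e: "e > 0"
  define e' where "e' = e / (I + 1)"
  have e': "e' > 0" using e I by (simp add: e'_def)
  obtain d where d: "d > 0" "!!u v. dist u v < d ==> dist (k' u) (k' v) < e'" using uc e' unfolding uniformly_continuous_on_def by (metis UNIV_I)
  have "norm (conv f k z - conv f k x - conv f k' x \<bullet> (z - x)) <= e * norm (z - x)" if z: "norm (z - x) < d" for z
  proof -
   define h where "h = z - x"
   have i1: "integrable lborel (%y. f y *R k (w - y))" for w using f B by (intro conv_integrable) auto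
   have i2: "integrable lborel (%y. f y *R k' (x - y))" using f B by (intro conv_integrable) auto
   have i3: "integrable lborel (%y. f y *R k (z - y) - f y *R k (x - y) - (f y *R k' (x - y)) \<bullet> h)"
   by (intro Bochner_Integration.integrable_diff i1 integrable_inner_left i2)
   have i4: "integrable lborel (%y. (f y *R k' (x - y)) \<bullet> h)" using i2 by (rule integrable_inner_left)
   have i5: "(LBINT y. (f y *R k' (x - y)) \<bullet> h) = (LBINT y. f y *R k' (x - y)) \<bullet> h" using i2 by (rule integral_inner_left)
   have "conv f k z - conv f k x - conv f k' x \<bullet> h
   = (LBINT y. f y *R k (z - y) - f y *R k (x - y) - (f y *R k' (x - y)) \<bullet> h)"
   using Bochner_Integration.integral_diff[OF Bochner_Integration.integrable_diff[OF i1[of z] i1[of x]] i4]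
   Bochner_Integration.integral_diff[OF i1[of z] i1[of x]] i5 unfolding conv_def by linarith
   also have "norm ... <= (LBINT y. e' * norm h * abs (f y))"
   proof (rule order_trans[OF integral_norm_bound], rule integral_mono)
   show "integrable lborel (%y. norm (f y *R k (z - y) - f y *R k (x - y) - (f y *R k' (x - y)) \<bullet> h))" using i3 by (rule integrable_norm)
   show "integrable lborel (%y. e' * norm h * abs (f y))" using f by simp
   fix y
   have "abs (k ((x - y) + h) - k (x - y) - k' (x - y) \<bullet> h) <= e' * norm h"
   proof (rule c1_linearize[OF kc])
   fix t :: real assume t: "t \<in> {0..1}"
   have "norm (t *R h) <= 1 * norm h" unfolding norm_scaleR using t by (intro mult_right_mono) auto
   then have "dist (x - y + t *R h) (x - y) < d" using z by (simp add: dist_norm h_def)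
   then show "norm (k' (x - y + t *R h) - k' (x - y)) <= e'" using d(2) by (simp add: dist_norm less_imp_le)
   qed
   moreover have "f y *R k (z - y) - f y *R k (x - y) - (f y *R k' (x - y)) \<bullet> h
   = f y * (k ((x - y) + h) - k (x - y) - k' (x - y) \<bullet> h)" by (simp add: h_def algebra_simps)
   ultimately show "norm (f y *R k (z - y) - f y *R k (x - y) - (f y *R k' (x - y)) \<bullet> h) <= e' * norm h * abs (f y)"
   unfolding mult.commute[of "e' * norm h"] by (simp only: real_norm_def abs_mult) (intro mult_left_mono, auto)
   qed
   also have "... = e' * I * norm h" by (simp add: I_def)
   also have "... <= e' * (I + 1) * norm h" using e' by (intro mult_right_mono) auto
   also have "e' * (I + 1) = e" using I by (simp add: e'_def)
   finally show ?thesis by (simp add: h_def)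
  qed
  then show "EX d>0. ALL y. norm (y - x) < d --> norm (conv f k y - conv f k x - conv f k' x \<bullet> (y - x)) <= e * norm (y - x)" using d(1) by blast
 qed
 moreover have "continuous_on UNIV (conv f k')" using f uc B(3) by (rule conv_uniformly_continuous)
 ultimately show ?thesis by (simp add: c1_def)
qed

text \<open>The dilation sits in the argument of f and the weight stays fixed, so that Jensen's
  inequality applies to one probability measure for all n. \<open>moll_conv\<close> gives the form
  as a convolution with \<open>kern\<close>.\<close>

definition moll :: "('a::euclidean_space => real) => nat => ('a => 'b::euclidean_space) => 'a => 'b" where
 "moll rho n f x = (LBINT z. rho z *R f (x - (1 / real (Suc n)) *R z))"

lemma moll_measurable:
 assumes [measurable]: "meas rho" "meas f"
 shows "meas (moll rho n f)" unfolding moll_def[abs_def] by measurable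

lemma prob_space_density_lborel:
 fixes rho :: "'a::euclidean_space => real"
 assumes [measurable]: "meas rho" and "(NN x. enn (rho x)) = 1"
 shows "prob_space (density lborel (%x. enn (rho x)))" by (rule prob_spaceI) (use assms in \<open>simp add: emeasure_density\<close>)

lemma moll_minus_le:
 fixes f :: "'a::euclidean_space => 'b::euclidean_space"
 assumes rho[measurable]: "meas rho" and nn: "!!x. rho x >= 0" and one: "(NN x. enn (rho x)) = 1"
  and [measurable]: "meas f" and p: "p > 1"
 shows "enn (norm (moll rho n f x - f x) powr p)
  <= (NN z. enn (rho z) * enn (norm (f (x - (1 / real (Suc n)) *R z) - f x) powr p))"
proof -
 define P where "P = density lborel (%x. enn (rho x))"
 interpret P: prob_space P unfolding P_def using rho one by (rule prob_space_density_lborel)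
 define g where "g z = f (x - (1 / real (Suc n)) *R z)" for z
 have [measurable]: "meas g" unfolding g_def by measurable
 have sP[measurable_cong]: "sets P = sets borel" by (simp add: P_def)
 have rhs: "(NN z. enn (rho z) * enn (norm (g z - f x) powr p)) = (\<integral>\<^sup>+z. enn (norm (g z - f x) powr p) \<partial>P)"
  unfolding P_def by (subst nn_integral_density) auto
 show ?thesis
 proof (cases "(\<integral>\<^sup>+z. enn (norm (g z - f x) powr p) \<partial>P) < oo")
  case True
  have int: "integrable P (%z. g z - f x)" using jensen_powr(2)[OF P.prob_space_axioms _ p True] by simp
  then have "integrable P (%z. (g z - f x) + f x)" by (intro Bochner_Integration.integrable_add) auto
  then have intg: "integrable P g" by simp
  have "moll rho n f x = (\<integral>z. g z \<partial>P)" unfolding P_def moll_def g_def[symmetric] using nn by (subst integral_density) auto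
  then have "moll rho n f x - f x = (\<integral>z. g z - f x \<partial>P)" using intg by (simp add: P.prob_space)
  then show ?thesis using jensen_powr(1)[OF P.prob_space_axioms, of "%z. g z - f x" p] p rhs by (simp add: g_def)
 next
  \<comment> \<open>The right-hand side is infinite here, so the value that \<open>moll\<close>
    takes for a non-integrable integrand does not matter.\<close>
  case False
  then have "(\<integral>\<^sup>+z. enn (norm (g z - f x) powr p) \<partial>P) = oo" by (simp add: not_less top_unique)
  then show ?thesis unfolding g_def[symmetric] rhs by simp
 qed
qed

text \<open>Jensen and Fubini bound the error by the mean over z of the translation errors
  \<open>D n z\<close>. Each tends to 0 by continuity of translations, and all are dominated by a
  multiple of the energy of f.\<close>

lemma en_moll_tendsto:
 fixes f :: "'a::euclidean_space => 'b::euclidean_space"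
 assumes rho[measurable]: "meas rho" and nn: "!!x. rho x >= 0" and one: "(NN x. enn (rho x)) = 1"
  and f[measurable]: "meas f" and p: "p > 1" and fin: "en p UNIV f < oo"
 shows "(%n. en p UNIV (%x. moll rho n f x - f x)) ---> 0"
proof -
 define D where "D n z = en p UNIV (%x. f (x + - ((1 / real (Suc n)) *R z)) - f x)" for n z
 have Dm[measurable]: "meas (D n)" for n unfolding D_def en_def by measurable
 have le: "en p UNIV (%x. moll rho n f x - f x) <= (NN z. enn (rho z) * D n z)" for n
 proof -
  have "en p UNIV (%x. moll rho n f x - f x) <= (NN x. NN z. enn (rho z) * enn (norm (f (x - (1 / real (Suc n)) *R z) - f x) powr p))"
   unfolding en_def using moll_minus_le[OF rho nn one f p, of n] by (intro nn_integral_mono) simp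
  also have "... = (NN z. NN x. enn (rho z) * enn (norm (f (x - (1 / real (Suc n)) *R z) - f x) powr p))" by (rule lborel_pair.Fubini') measurable
  also have "... = (NN z. enn (rho z) * D n z)" unfolding D_def en_def by (intro nn_integral_cong) (subst nn_integral_cmult, auto)
  finally show ?thesis .
 qed
 have "(%n. NN z. enn (rho z) * D n z) ---> (\<integral>\<^sup>+z. 0 \<partial>(lborel::'a measure))"
 proof (rule nn_integral_dominated_convergence[where w="%z. enn (rho z) * (enn (2 powr p) * (en p UNIV f + en p UNIV f))"])
  fix n
  have "D n z <= enn (2 powr p) * (en p UNIV f + en p UNIV f)" for z
  proof -
   have "D n z <= enn (2 powr p) * (en p UNIV (%x. f (x + - ((1 / real (Suc n)) *R z))) + en p UNIV f)" unfolding D_def using p by (intro en_diff) auto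
   also have "en p UNIV (%x. f (x + - ((1 / real (Suc n)) *R z))) = en p UNIV f" by (subst en_translate) auto
   finally show ?thesis .
  qed
  then show "AE z in lborel. enn (rho z) * D n z <= enn (rho z) * (enn (2 powr p) * (en p UNIV f + en p UNIV f))"
   by (intro AE_I2 mult_left_mono) auto
 next
  show "(NN  z. enn (rho z) * (enn (2 powr p) * (en p UNIV f + en p UNIV f))) < oo"
   using fin by (subst nn_integral_multc) (auto simp: one ennreal_mult_less_top)
 next
  have tc: "tcont p f" using f fin p by (intro en_translation_continuous) auto
  show "AE z in lborel. (%n. enn (rho z) * D n z) ---> 0"
  proof (intro AE_I2, goal_cases)
   case (1 z)
   have "(%n. 1 / real (Suc n)) ---> 0" using LIMSEQ_inverse_real_of_nat by (simp add: inverse_eq_divide)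
   from tendsto_minus[OF tendsto_scaleR[OF this tendsto_const[of z]]]
   have "(%n. - ((1 / real (Suc n)) *R z)) ---> 0" by simp
   then have "(%n. D n z) ---> 0" using tc unfolding tcont_def D_def by blast
   then show ?case by (rule en_tendsto_squeeze[OF order_refl])
  qed
 qed auto
 then have "(%n. NN z. enn (rho z) * D n z) ---> 0" by simp
 then show ?thesis by (rule en_tendsto_squeeze[where C=1, rotated]) (use le in simp)
qed

section \<open>Smooth functions and a bump function\<close>

lemma frechet_derivative_eq: "(f has_derivative f') (at x) ==> frechet_derivative f (at x) = f'"
 by (metis frechet_derivative_at)

lemma partial_deriv_eq:
 fixes f :: "real^'n::finite => real"
 assumes "(f has_derivative (%h. D \<bullet> h)) (at x)"
 shows "partial_deriv i f x = D $ i" using frechet_derivative_eq[OF assms] by (simp add: partial_deriv_def inner_axis)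

lemma grad_eq:
 fixes f :: "real^'n::finite => real"
 assumes "(f has_derivative (%h. D \<bullet> h)) (at x)"
 shows "grad f x = D" using partial_deriv_eq[OF assms] by (simp add: grad_def vec_eq_iff)

lemma has_derivative_grad:
 fixes f :: "real^'n::finite => real"
 assumes "f differentiable (at x)"
 shows "(f has_derivative (%h. grad f x \<bullet> h)) (at x)"
proof -
 obtain f' where f': "(f has_derivative f') (at x)" using assms by (auto simp: differentiable_def)
 interpret bounded_linear f' using f' by (rule has_derivative_bounded_linear)
 have "f' h = grad f x \<bullet> h" for h
 proof -
  have "f' h = f' (\<Sum>i\<in>UNIV. h $ i *R axis i 1)" using basis_expansion[of h] by (simp add: scalar_mult_eq_scaleR)
  also have "... = (\<Sum>i\<in>UNIV. h $ i * f' (axis i 1))" by (simp add: sum scaleR)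
  also have "... = grad f x \<bullet> h" using frechet_derivative_eq[OF f'] by (simp add: grad_def partial_deriv_def inner_vec_def mult.commute)
  finally show ?thesis .
 qed
 then show ?thesis using f' by (metis ext)
qed

lemma smooth_fun_differentiable: "smooth_fun f ==> f differentiable (at x)"
 by (erule smooth_fun.cases) auto

lemma smooth_fun_partial: "smooth_fun f ==> smooth_fun (partial_deriv i f)"
 by (erule smooth_fun.cases) auto

lemma smooth_fun_c1: "smooth_fun f ==> c1 f (grad f)"
proof -
 assume f: "smooth_fun f"
 have "continuous_on UNIV (partial_deriv i f)" for i using smooth_fun_differentiable[OF smooth_fun_partial[OF f]]
  by (intro differentiable_imp_continuous_on differentiable_at_imp_differentiable_on) auto
 then have "continuous_on UNIV (grad f)" unfolding grad_def[abs_def] by (intro continuous_on_vec_lambda) 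
 then show ?thesis using has_derivative_grad[OF smooth_fun_differentiable[OF f]] by (simp add: c1_def)
qed

lemma c1_partial: "c1 f f' ==> partial_deriv i f = (%x. f' x $ i)"
 by (auto simp: c1_def intro!: ext partial_deriv_eq)

lemma c1_grad: "c1 f f' ==> grad f = f'"
 by (auto simp: c1_def intro!: ext grad_eq)

text \<open>Coinduction in usable form: a class of C1 functions that contains the partial
  derivatives of its members consists of smooth functions.\<close>

lemma smooth_funI:
 assumes "X f" "!!f. X f ==> EX f'. c1 f f' & (ALL i. X (%x. f' x $ i))"
 shows "smooth_fun f" using assms(1)
proof (coinduction arbitrary: f rule: smooth_fun.coinduct)
 case (smooth_fun f)
 from assms(2)[OF this] obtain f' where f': "c1 f f'" "ALL i. X (%x. f' x $ i)" by blast
 have "f differentiable (at x)" for x using c1_D[OF f'(1), of x UNIV] by (auto simp: differentiable_def)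
 then show ?case using c1_partial[OF f'(1)] f'(2) by auto
qed

lemma smooth_fun_affine:
 fixes f :: "real^'n::finite => real"
 assumes "smooth_fun f"
 shows "smooth_fun (%x. d * f (a + c *R x))"
proof (rule smooth_funI[where X="%g. EX f d. smooth_fun f & g = (%x. d * f (a + c *R x))"])
 fix g :: "real^'n => real" assume "EX f d. smooth_fun f & g = (%x. d * f (a + c *R x))"
 then obtain f d where f: "smooth_fun f" and g: "g = (%x. d * f (a + c *R x))" by blast
 have "c1 g (%x. d *R c *R grad f (a + c *R x))" unfolding g by (intro c1_cmult c1_affine smooth_fun_c1 f)
 moreover have "EX f' d'. smooth_fun f' & (%x. (d *R c *R grad f (a + c *R x)) $ i) = (%x. d' * f' (a + c *R x))" for i
  using smooth_fun_partial[OF f, of i] by (intro exI[of _ "partial_deriv i f"] exI[of _ "d * c"]) (simp add: grad_def mult.assoc)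
 ultimately show "EX f'. c1 g f' & (ALL i. EX f d. smooth_fun f & (%x. f' x $ i) = (%x. d * f (a + c *R x)))" by blast
qed (use assms in blast)

lemma conv_component:
 fixes k :: "real^'n::finite => real^'n"
 assumes f: "integrable lborel f" and k: "meas k" "!!x. norm (k x) <= B"
 shows "conv f k x $ i = conv f (%x. k x $ i) x"
proof -
 have "conv f k x $ i = (LBINT y. f y *R k (x - y)) \<bullet> axis i 1" by (simp add: conv_def inner_axis)
 also have "... = (LBINT y. (f y *R k (x - y)) \<bullet> axis i 1)" by (rule integral_inner_left[symmetric]) (rule conv_integrable[OF f k])
 finally show ?thesis by (simp add: conv_def inner_axis)
qed

text \<open>In the open exterior the function is locally constant, so its gradient vanishes there;
  continuity of the gradient adds the sphere.\<close>

lemma c1_zero_outside: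
 fixes k :: "'a::euclidean_space => real"
 assumes k: "c1 k k'" and r: "r > 0" and z: "!!x. r <= norm x ==> k x = 0" and x: "r <= norm x"
 shows "k' x = 0"
proof -
 have "x \<in> closure (- cball 0 r)" using x by (simp add: closure_complement mem_ball_0 not_less)
 moreover have "closed {x. k' x = 0}" using continuous_closed_preimage_constant[OF c1_continuous(2)[OF k] closed_UNIV, of 0] by simp
 moreover have "- cball 0 r \<subseteq> {x. k' x = 0}"
 proof
  fix y :: 'a assume y: "y \<in> - cball 0 r"
  have "(k has_derivative (%h. 0 \<bullet> h)) (at y)"
  proof (rule has_derivative_transform_within_open[where f="%_. 0" and s="- cball 0 r"])
   show "((%_. 0) has_derivative (\<bullet>) 0) (at y)" using c1_D[OF c1_const[of 0]] by blast
  qed (use y z in \<open>auto simp: mem_ball_0\<close>)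
  from has_derivative_unique[OF this c1_D[OF k]] have "0 \<bullet> k' y = k' y \<bullet> k' y" by meson
  then show "y \<in> {x. k' x = 0}" by simp
 qed
 ultimately show ?thesis using closure_minimal by blast
qed

text \<open>The convolutions of a fixed f with smooth kernels supported in the ball of radius r form
  a class closed under partial derivatives.\<close>

lemma smooth_fun_conv:
 fixes f k :: "real^'n::finite => real"
 assumes f: "integrable lborel f" and k: "smooth_fun k" "r > 0" "!!x. r <= norm x ==> k x = 0"
 shows "smooth_fun (conv f k)"
proof (rule smooth_funI[where X="%g. EX k. smooth_fun k & (ALL x. r <= norm x --> k x = 0) & g = conv f k"])
 fix g assume "EX k. smooth_fun k & (ALL x. r <= norm x --> k x = 0) & g = conv f k"
 then obtain k where k: "smooth_fun k" "!!x. r <= norm x ==> k x = 0" and g: "g = conv f k" by blast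
 have kc: "c1 k (grad k)" using k(1) by (rule smooth_fun_c1)
 have z: "grad k x = 0" if "r <= norm x" for x using c1_zero_outside[OF kc \<open>r > 0\<close> k(2) that] .
 have kcc: "c1c (r + 1) k (grad k)" using kc k z \<open>r > 0\<close> by (auto simp: c1c_def intro!: exI[of _ r])
 obtain B where B: "!!x. norm (grad k x) <= B" using c1c_bounded[OF kcc] by metis
 have "c1 g (conv f (grad k))" unfolding g using f kcc by (rule c1_conv)
 moreover have "EX k'. smooth_fun k' & (ALL x. r <= norm x --> k' x = 0) & (%x. conv f (grad k) x $ i) = conv f k'" for i
 proof (intro exI conjI ext)
  show "smooth_fun (partial_deriv i k)" using k(1) by (rule smooth_fun_partial)
  show "ALL x. r <= norm x --> partial_deriv i k x = 0" using z by (simp add: grad_def vec_eq_iff)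
  show "conv f (grad k) x $ i = conv f (partial_deriv i k) x" for x using conv_component[OF f c1_borel(2)[OF kc] B] by (simp add: grad_def[abs_def])
 qed
 ultimately show "EX f'. c1 g f' & (ALL i. EX k. smooth_fun k & (ALL x. r <= norm x --> k x = 0) & (%x. f' x $ i) = conv f k)" by blast
qed (use k in blast)

text \<open>The functions exp(-1/t) t^(-k), continued by 0. The whole family is taken because a
  derivative raises k by 1 and 2 and so stays in its span.\<close>

definition flat :: "nat => real => real" where
 "flat k t = (if t > 0 then exp (- (1/t)) / t ^ k else 0)"

text \<open>A quadratic bound is what the derivative 0 at the origin requires. It comes from the
  single term of order k + 2 of the exponential series at 1/t.\<close>

lemma flat_bound: "abs (flat k t) <= fact (k + 2) * t\<^sup>2"
proof (cases "t > 0")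
 case True
 have "(1/t) ^ (k + 2) / fact (k + 2) <= exp (1/t)"
 proof -
  have "(\<Sum>n\<in>{k+2}. (1/t) ^ n /\<^sub>R fact n) <= (\<Sum>n. (1/t) ^ n /\<^sub>R fact n)" using True by (intro sum_le_suminf summable_exp_generic) auto
  also have "... = exp (1/t)" by (simp only: exp_def)
  finally show ?thesis by (simp add: divide_inverse mult.commute)
 qed
 then have "exp (- (1/t)) <= fact (k + 2) * t ^ (k + 2)"
 proof -
  define c E T :: real where "c = fact (k + 2)" "E = exp (1/t)" "T = t ^ (k + 2)"
  have pos: "c > 0" "E > 0" "T > 0" using True by (simp_all only: c_E_T_def fact_gt_zero exp_gt_zero zero_less_power)
  have "1 / T / c <= E" using \<open>(1/t) ^ (k + 2) / fact (k + 2) <= exp (1/t)\<close> by (simp only: c_E_T_def power_one_over[symmetric])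
  then have "1 / E <= c * T" using pos by (simp add: field_simps)
  then show ?thesis by (simp only: c_E_T_def exp_minus inverse_eq_divide)
 qed
 then have "exp (- (1/t)) / t ^ k <= fact (k + 2) * t ^ (k + 2) / t ^ k" using True by (intro divide_right_mono) auto
 also have "... = fact (k + 2) * t\<^sup>2" using True by (simp add: power_add power2_eq_square)
 finally show ?thesis using True by (simp add: flat_def)
qed (simp add: flat_def)

lemma flat_deriv: "(flat k has_real_derivative (flat (k + 2) t - real k * flat (k + 1) t)) (at t)"
proof -
 consider "t > 0" | "t < 0" | "t = 0" by linarith
 then show ?thesis
 proof cases
  case 1
  have "((%t. exp (- (1/t)) / t ^ k) has_real_derivative (flat (k + 2) t - real k * flat (k + 1) t)) (at t)"
   using 1 by (auto intro!: derivative_eq_intros simp: flat_def field_simps power2_eq_square) 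
   (cases k; simp add: field_simps)
  then show ?thesis by (rule has_field_derivative_transform_within_open[where S="{0<..}"]) (use 1 in \<open>auto simp: flat_def\<close>)
 next
  case 2
  have "((%t. 0) has_real_derivative (flat (k + 2) t - real k * flat (k + 1) t)) (at t)" using 2 by (simp add: flat_def)
  then show ?thesis by (rule has_field_derivative_transform_within_open[where S="{..<0}"]) (use 2 in \<open>auto simp: flat_def\<close>)
 next
  case 3
  have "((%h. flat k h / h) \<longlongrightarrow> 0) (at 0)"
  proof (rule Lim_null_comparison)
   show "eventually (%h. norm (flat k h / h) <= fact (k + 2) * abs h) (at 0)"
   proof (rule always_eventually, rule allI)
   fix h :: real
   show "norm (flat k h / h) <= fact (k + 2) * abs h"
   proof (cases "h = 0")
   case False
   have "abs (flat k h) <= fact (k + 2) * abs h * abs h" using flat_bound[of k h] by (simp only: power2_eq_square abs_mult_self_eq mult.assoc)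
   then show ?thesis using False by (simp only: abs_divide real_norm_def) (simp add: pos_divide_le_eq del: fact_Suc)
   qed simp
   qed
   have "((%h::real. fact (k + 2) * abs h) \<longlongrightarrow> fact (k + 2) * abs 0) (at 0)" by (intro tendsto_intros)
   then show "((%h::real. fact (k + 2) * abs h) \<longlongrightarrow> 0) (at 0)" by simp
  qed
  then show ?thesis using 3 by (simp add: DERIV_def flat_def)
 qed
qed

text \<open>The algebra generated by constants, coordinates and the functions \<open>flat k\<close>
  of 1 - |x|^2. It is closed under partial derivatives and serves as the class X in
  \<open>smooth_funI\<close>.\<close>

inductive bumpy :: "(real^'n::finite => real) => bool" where
 "bumpy (%x. c)"
| "bumpy (%x. x $ i)"
| "bumpy (%x. flat k (1 - x \<bullet> x))"
| "bumpy f ==> bumpy g ==> bumpy (%x. f x + g x)"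
| "bumpy f ==> bumpy g ==> bumpy (%x. f x * g x)"

lemma bumpy_c1:
 fixes f :: "real^'n::finite => real"
 shows "bumpy f ==> EX f'. c1 f f' & (ALL i. bumpy (%x. f' x $ i))"
proof (induction rule: bumpy.induct)
 case (1 c)
 show ?case by (rule exI[of _ "%x. 0"]) (simp add: c1_const bumpy.intros)
next
 case (2 j)
 have "((%x::real^'n. x $ j) has_derivative (%h. axis j 1 \<bullet> h)) (at x)" for x
  unfolding inner_axis' by (simp, rule bounded_linear.has_derivative[OF bounded_linear_vec_nth has_derivative_ident])
 then show ?case by (intro exI[of _ "%x. axis j 1"]) (auto simp: c1_def bumpy.intros)
next
 case (3 k)
 have sq: "c1 (%x::real^'n. 1 - x \<bullet> x) (%x. (- 2) *R x)" by (auto simp: c1_def inner_commute intro!: derivative_eq_intros continuous_intros)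
 have fc: "continuous_on UNIV (flat j)" for j using flat_deriv by (intro continuous_at_imp_continuous_on ballI) (rule DERIV_isCont)
 have "c1 (%x::real^'n. flat k (1 - x \<bullet> x)) (%x. (flat (k + 2) (1 - x \<bullet> x) - real k * flat (k + 1) (1 - x \<bullet> x)) *R ((-2) *R x))"
  by (rule c1_compose[OF flat_deriv _ sq]) (intro continuous_intros continuous_on_compose2[OF fc]; simp)
 moreover have "bumpy (%x::real^'n. ((flat (k + 2) (1 - x \<bullet> x) - real k * flat (k + 1) (1 - x \<bullet> x)) *R ((-2) *R x)) $ i)" for i
 proof -
  have "bumpy (%x::real^'n. (flat (k + 2) (1 - x \<bullet> x) + (- real k) * flat (k + 1) (1 - x \<bullet> x)) * ((-2) * x $ i))" by (intro bumpy.intros)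
  then show ?thesis by (simp add: algebra_simps)
 qed
 ultimately show ?case by blast
next
 case (4 f g)
 then obtain f' g' where "c1 f f'" "ALL i. bumpy (%x. f' x $ i)" "c1 g g'" "ALL i. bumpy (%x. g' x $ i)" by blast
 then show ?case by (intro exI[of _ "%x. f' x + g' x"]) (auto intro!: c1_add bumpy.intros)
next
 case (5 f g)
 then obtain f' g' where "c1 f f'" "ALL i. bumpy (%x. f' x $ i)" "c1 g g'" "ALL i. bumpy (%x. g' x $ i)" by blast
 then show ?case using 5 by (intro exI[of _ "%x. f x *R g' x + g x *R f' x"]) (auto intro!: c1_mult bumpy.intros)
qed

lemma bump_exists:
 obtains rho :: "real^'n::finite => real" where "smooth_fun rho" "!!x. rho x >= 0" "!!x. 1 <= norm x ==> rho x = 0"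
  "(NN x. enn (rho x)) = 1"
proof -
 define b where "b x = flat 0 (1 - x \<bullet> x)" for x :: "real^'n"
 have bs: "smooth_fun b" unfolding b_def[abs_def] by (rule smooth_funI[where X=bumpy]) (auto intro: bumpy.intros bumpy_c1)
 have bc: "continuous_on UNIV b" using smooth_fun_c1[OF bs] by (rule c1_continuous)
 have b0: "b x >= 0" for x by (simp add: b_def flat_def)
 have b1: "b x = 0" if "1 <= norm x" for x
 proof -
  have "1 <= (norm x)\<^sup>2" using that by (simp add: one_le_power)
  then show ?thesis by (simp add: b_def flat_def power2_norm_eq_inner)
 qed
 have ble: "b x <= 1" for x by (simp add: b_def flat_def)
 have [measurable]: "meas b" using bc by (rule borel_measurable_continuous_onI)
 define I where "I = (NN x. enn (b x))"
 have "I <= (\<integral>\<^sup>+x. indicator (cball 0 1) x \<partial>(lborel::(real^'n) measure))"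
  unfolding I_def using b1 ble by (intro nn_integral_mono) (auto simp: indicator_def)
 also have "... < oo" using emeasure_lborel_cball_finite by simp
 finally have Ifin: "I < oo" .
 \<comment> \<open>On the ball of radius 1/2 one has 1 - |x|^2 >= 3/4, hence b >= exp(-4/3) there;
   this makes the mass positive, so that it can be normalized to 1.\<close>
 have "enn (exp (-4/3)) * emeasure lborel (ball (0::real^'n) (1/2)) = (\<integral>\<^sup>+x. enn (exp (-4/3)) * indicator (ball 0 (1/2)) x \<partial>(lborel::(real^'n) measure))"
  by (rule nn_integral_cmult_indicator[symmetric]) simp
 also have "... <= I" unfolding I_def
 proof (intro nn_integral_mono)
  fix x :: "real^'n"
  show "enn (exp (-4/3)) * indicator (ball 0 (1 / 2)) x <= enn (b x)"
  proof (cases "x \<in> ball 0 (1/2)")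
   case True
   then have "(norm x)\<^sup>2 <= (1/2)\<^sup>2" by (intro power_mono) auto
   then have *: "3/4 <= 1 - x \<bullet> x" unfolding power2_norm_eq_inner by (simp add: power2_eq_square)
   then have "1 / (1 - x \<bullet> x) <= 4/3" by (simp add: field_simps)
   then show ?thesis using * True by (auto simp: b_def flat_def intro!: ennreal_leI)
  qed simp
 qed
 finally have "I > 0" using content_ball_pos[of "1/2" "0::real^'n"] emeasure_lborel_ball_finite[of "0::real^'n" "1/2"]
  by (auto simp: emeasure_eq_ennreal_measure zero_less_iff_neq_zero) 
 define c where "c = enn2real I"
 have c: "c > 0" "I = enn c" using \<open>I > 0\<close> Ifin by (auto simp: c_def enn2real_positive_iff less_top)
 define rho where "rho x = (1/c) * b x" for x
 show ?thesis
 proof (rule that)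
  show "smooth_fun rho" using smooth_fun_affine[OF bs, of "1/c" 0 1] by (simp add: rho_def[abs_def])
  show "rho x >= 0" for x using b0 c by (simp add: rho_def)
  show "rho x = 0" if "1 <= norm x" for x using b1[OF that] by (simp add: rho_def)
  have "(NN x. enn (rho x)) = (NN x. enn (1/c) * enn (b x))" using b0 c by (simp add: rho_def ennreal_mult'[symmetric])
  also have "... = enn (1/c) * I" unfolding I_def by (rule nn_integral_cmult) simp
  also have "... = 1" using c by (simp add: ennreal_mult'[symmetric])
  finally show "(NN x. enn (rho x)) = 1" .
 qed
qed

section \<open>Sobolev pairs from weak derivatives\<close>

lemma ball_borel [measurable, simp]: "ball (x::'a::euclidean_space) r \<in> sets borel" "cball x r \<in> sets borel"
 by (auto intro: borel_open borel_closed)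

lemma c1c_bounded_ex:
 assumes "c1c R f f'" shows "EX B>0. (ALL x. norm (f x) <= B) & (ALL x. norm (f' x) <= B)"
proof (rule c1c_bounded[OF assms])
 fix B assume "0 < B" "!!x. norm (f x) <= B" "!!x. norm (f' x) <= B"
 then show ?thesis by (intro exI[of _ B] conjI allI)
qed

text \<open>Derivatives in the strong sense: the pair (u, D) is a limit in L^p(S) of C1 functions
  and their gradients, so every rule of calculus is proved by passage to the limit. The approximants
  are C1 on the whole space, and a weak gradient on the unit ball yields such pairs on each smaller
  ball.\<close>

definition sob :: "real => 'a::euclidean_space set => ('a => real) => ('a => 'a) => bool" where
 "sob p S u D \<longleftrightarrow> meas u & meas D & en p S u < oo & en p S D < oo &
  (EX psi psi'. (ALL k. c1 (psi k) (psi' k)) & Lp_tendsto p S psi u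
   & Lp_tendsto p S psi' D)"

lemma integral_affine:
 fixes f :: "'a::euclidean_space => 'b::euclidean_space"
 assumes [measurable]: "meas f" and c: "c ~= 0"
 shows "(LBINT x. f x) = abs c ^ DIM('a) *R (LBINT x. f (t + c *R x))"
proof -
 have "(LBINT x. f x) = (\<integral>x. f x \<partial>density (distr lborel borel (%x. t + c *R x)) (%_. enn (abs c^DIM('a))))"
  using lborel_affine[of c t] c by simp
 also have "... = abs c ^ DIM('a) *R (LBINT x. f (t + c *R x))" using c by (subst integral_density) (auto simp: integral_distr)
 finally show ?thesis .
qed

lemma conv_commute:
 assumes [measurable]: "meas f" "meas g"
 shows "conv f (g :: 'a::euclidean_space => real) x = conv g f x"
proof -
 have "conv f g x = (LBINT y. f (x + (-1) *R y) *R g (x - (x + (-1) *R y)))" unfolding conv_def by (subst integral_affine[where c="-1" and t=x]) auto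
 then show ?thesis by (simp add: conv_def mult.commute)
qed

definition kern :: "('a::euclidean_space => real) => nat => 'a => real" where
 "kern rho n y = real (Suc n) ^ DIM('a) * rho (real (Suc n) *R y)"

lemma moll_conv:
 fixes f :: "'a::euclidean_space => 'b::euclidean_space"
 assumes [measurable]: "meas rho" "meas f"
 shows "moll rho n f = conv (kern rho n) f"
proof
 fix x
 define c where "c = 1 / real (Suc n)"
 have c: "c ~= 0" "c >= 0" "real (Suc n) = 1 / c" by (auto simp: c_def)
 have [measurable]: "meas (kern rho n)" unfolding kern_def by measurable
 have "conv (kern rho n) f x = abs c ^ DIM('a) *R (LBINT z. kern rho n (0 + c *R z) *R f (x - (0 + c *R z)))"
  unfolding conv_def by (subst integral_affine[where c=c and t=0]) (use c in auto)
 also have "... = (LBINT z. abs c ^ DIM('a) *R (kern rho n (0 + c *R z) *R f (x - (0 + c *R z))))"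
  by (rule Bochner_Integration.integral_scaleR_right[symmetric])
 also have "... = moll rho n f x"
 proof -
  have "abs c ^ DIM('a) * kern rho n (0 + c *R z) = rho z" for z :: 'a
  proof -
   have "abs c ^ DIM('a) * (1 / c) ^ DIM('a) = 1" using c by (simp add: power_mult_distrib[symmetric])
   then show ?thesis unfolding kern_def c(3) mult.assoc[symmetric] using c by simp
  qed
  then show ?thesis unfolding moll_def c_def[symmetric] scaleR_scaleR by simp
 qed
 finally show "moll rho n f x = conv (kern rho n) f x" ..
qed

lemma en_finite_integrable:
 fixes f :: "'a::euclidean_space => 'b::euclidean_space"
 assumes [measurable]: "meas f" and fin: "en p (ball 0 R) f < oo" and p: "p >= 1"
  and z: "!!x. x \<notin> ball 0 R ==> f x = 0"
 shows "integrable lborel f"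
proof (rule integrableI_bounded)
 have "(NN x. enn (norm (f x))) <= (NN x. (indicator (ball 0 R) x + enn (norm (f x) powr p) * indicator (ball 0 R) x))"
 proof (intro nn_integral_mono)
  fix x
  have "norm (f x) <= 1 + norm (f x) powr p"
  proof (cases "norm (f x) <= 1")
   case False
   then have "norm (f x) powr 1 <= norm (f x) powr p" using p by (intro powr_mono) auto
   then show ?thesis using False by simp
  qed (simp add: add_increasing2)
  then have "enn (norm (f x)) <= 1 + enn (norm (f x) powr p)" by (metis ennreal_leI ennreal_plus ennreal_1 zero_le_one powr_ge_zero)
  then show "enn (norm (f x)) <= indicator (ball 0 R) x + enn (norm (f x) powr p) * indicator (ball 0 R) x" using z[of x] by (auto simp: indicator_def)
 qed
 also have "... = emeasure lborel (ball (0::'a) R) + en p (ball 0 R) f" unfolding en_def by (subst nn_integral_add) auto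
 also have "... < oo" using fin emeasure_lborel_ball_finite[of "0::'a" R] by simp
 finally show "(NN x. enn (norm (f x))) < oo" .
qed simp

lemma bounded_support_integrable:
 fixes f :: "'a::euclidean_space => 'b::euclidean_space"
 assumes [measurable]: "meas f" and B: "!!x. norm (f x) <= B"
  and z: "!!x. x \<notin> ball 0 R ==> f x = 0"
 shows "integrable lborel f"
proof (rule integrableI_bounded_set[where A="ball 0 R" and B=B])
 show "emeasure lborel (ball 0 R) < oo" by (rule emeasure_lborel_ball_finite)
qed (use B z in auto)

lemma c1c_integrable:
 assumes "c1c R f f'" shows "integrable lborel f" "integrable lborel f'"
proof -
 obtain B where "B > 0" "!!x. norm (f x) <= B" "!!x. norm (f' x) <= B" using c1c_bounded_ex[OF assms] by auto
 moreover have "f x = 0" "f' x = 0" if "x \<notin> ball 0 R" for x using c1c_outside[OF assms, of x] that by auto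
 ultimately show "integrable lborel f" "integrable lborel f'"
  by (rule_tac bounded_support_integrable[where R=R and B=B]; use c1_borel[OF c1c_c1[OF assms]] in blast)+
qed

text \<open>The integral of F(x + t e) - F(x) vanishes by translation invariance, while it equals t
  times the e-component of the integrated gradient up to an error that is o(t), uniformly on a fixed
  ball.\<close>

lemma c1c_integral_gradient:
 fixes F :: "'a::euclidean_space => real"
 assumes F: "c1c R F F'" shows "(LBINT x. F' x) = 0"
proof -
 have Fc: "c1 F F'" using F by (rule c1c_c1)
 have [measurable]: "meas F" "meas F'" using c1_borel[OF Fc] by auto
 have uc: "uniformly_continuous_on UNIV F'" using compact_support_uniformly_continuous[of F' R] c1_continuous[OF Fc] c1c_outside[OF F] by metis
 have "(LBINT x. F' x) \<bullet> e = 0" if e: "e \<in> Basis" for e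
 proof (rule ccontr)
  define V where "V = measure lborel (ball (0::'a) (R + 1))"
  assume n: "(LBINT x. F' x) \<bullet> e ~= 0"
  \<comment> \<open>Chosen so that eps V stays strictly below the absolute value that is assumed
    nonzero; the summand 1 rules out a division by zero.\<close>
  define eps where "eps = abs ((LBINT x. F' x) \<bullet> e) / (V + 1)"
  have eps: "eps > 0" using n by (simp add: eps_def V_def add_nonneg_pos)
  obtain d where d: "d > 0" "!!u v. dist u v < d ==> dist (F' u) (F' v) < eps" using uc eps unfolding uniformly_continuous_on_def by (metis UNIV_I)
  define t where "t = min (1/2) (d/2)"
  have t: "0 < t" "t < d" "t < 1" using d by (auto simp: t_def)
  have i1: "integrable lborel (%x. F (x + t *R e))"
  proof (rule bounded_support_integrable[where R="R+1"])
   show "norm (F (x + t *R e)) <= (SOME B. ALL x. norm (F x) <= B)" for x using someI_ex[of "%B. ALL x. norm (F x) <= B"] c1c_bounded_ex[OF F] by blast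
   fix x :: 'a assume "x \<notin> ball 0 (R+1)"
   then have "R <= norm (x + t *R e)" using norm_triangle_ineq2[of x "- (t *R e)"] e t by simp
   then show "F (x + t *R e) = 0" using c1c_outside[OF F] by blast
  qed simp
  have i2: "integrable lborel F" "integrable lborel F'" using c1c_integrable[OF F] by auto
  have "(LBINT x. F (x + t *R e)) = (LBINT x. F x)" using integral_affine[of F 1 "t *R e"] by (simp add: add.commute)
  then have "t * ((LBINT x. F' x) \<bullet> e) = - (LBINT x. F (x + t *R e) - F x - F' x \<bullet> (t *R e))" using i1 i2 by (simp add: integral_inner_left)
  also have "abs (...) <= (\<integral>x. eps * t * indicator (ball 0 (R+1)) x \<partial>(lborel::'a measure))"
  proof -
   have "norm (LBINT x. F (x + t *R e) - F x - F' x \<bullet> (t *R e)) <= (LBINT x. norm (F (x + t *R e) - F x - F' x \<bullet> (t *R e)))"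
   by (rule integral_norm_bound)
   also have "... <= (\<integral>x. eps * t * indicator (ball 0 (R+1)) x \<partial>(lborel::'a measure))"
   proof (rule integral_mono)
   show "integrable lborel (%x. norm (F (x + t *R e) - F x - F' x \<bullet> (t *R e)))" using i1 i2 by auto
   show "integrable lborel (%x. eps * t * indicator (ball (0::'a) (R+1)) x)"
   using emeasure_lborel_ball_finite[of "0::'a" "R+1"] by (simp add: integrable_indicator_iff)
   fix x
   show "norm (F (x + t *R e) - F x - F' x \<bullet> (t *R e)) <= eps * t * indicator (ball 0 (R+1)) x"
   proof (cases "x \<in> ball 0 (R+1)")
   case True
   have "abs (F (x + t *R e) - F x - F' x \<bullet> (t *R e)) <= eps * norm (t *R e)"
   proof (rule c1_linearize[OF Fc])
   fix s :: real assume s: "s \<in> {0..1}"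
   have "s * t <= 1 * t" using s t by (intro mult_right_mono) auto
   then have "s * t < d" using t by linarith
   then have "dist (x + s *R t *R e) x < d" using s t e by (simp add: dist_norm)
   then show "norm (F' (x + s *R t *R e) - F' x) <= eps" using d(2) by (simp add: dist_norm less_imp_le)
   qed
   then show ?thesis using True e t by simp
   next
   case False
   then have "R <= norm (x + t *R e)" "R <= norm x" using norm_triangle_ineq2[of x "- (t *R e)"] e t by auto
   then have "F (x + t *R e) = 0" "F x = 0" "F' x = 0" using c1c_outside[OF F] by blast+
   then show ?thesis using False by simp
   qed
   qed
   finally show ?thesis by simp
  qed
  also have "... = eps * t * V" by (simp add: V_def)
  finally have "abs (t * ((LBINT x. F' x) \<bullet> e)) <= eps * t * V" .
  then have "abs ((LBINT x. F' x) \<bullet> e) <= eps * V" using t by (simp add: abs_mult)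
  also have "... < eps * (V + 1)" using eps by simp
  also have "... = abs ((LBINT x. F' x) \<bullet> e)" by (simp add: eps_def V_def add_nonneg_pos less_imp_neq[symmetric])
  finally show False by simp
 qed
 then show ?thesis by (subst euclidean_eq_iff) simp
qed

lemma c1c_integrate_by_parts:
 fixes F :: "'a::euclidean_space => real"
 assumes F: "c1c R F F'" and G: "c1c R G G'"
 shows "(LBINT x. F x *R G' x) = - (LBINT x. G x *R F' x)"
proof -
 have P: "c1c R (%x. F x * G x) (%x. F x *R G' x + G x *R F' x)" using F c1c_c1[OF G] by (rule c1c_mult)
 have [measurable]: "meas F" "meas F'" "meas G" "meas G'" using c1_borel[OF c1c_c1[OF F]] c1_borel[OF c1c_c1[OF G]] by auto
 obtain B where B: "B > 0" "!!x. norm (F x) <= B" "!!x. norm (F' x) <= B" using c1c_bounded_ex[OF F] by auto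
 obtain C where C: "C > 0" "!!x. norm (G x) <= C" "!!x. norm (G' x) <= C" using c1c_bounded_ex[OF G] by auto
 have z: "F x = 0" "G x = 0" if "x \<notin> ball 0 R" for x using c1c_outside[OF F, of x] c1c_outside[OF G, of x] that by auto
 have "integrable lborel (%x. F x *R G' x)"
 proof (rule bounded_support_integrable[where R=R and B="B*C"])
  show "norm (F x *R G' x) <= B * C" for x unfolding norm_scaleR using B(2)[of x] C(3)[of x] B(1) by (intro mult_mono) auto
 qed (use z in auto)
 moreover have "integrable lborel (%x. G x *R F' x)"
 proof (rule bounded_support_integrable[where R=R and B="C*B"])
  show "norm (G x *R F' x) <= C * B" for x unfolding norm_scaleR using B(3)[of x] C(2)[of x] C(1) by (intro mult_mono) auto
 qed (use z in auto)
 ultimately show ?thesis using c1c_integral_gradient[OF P] by (simp add: add_eq_0_iff2)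
qed

lemma test_funI:
 fixes phi :: "real^'n::finite => real"
 assumes "smooth_fun phi" "compact K" "K \<subseteq> \<Omega>" "!!x. x \<notin> K ==> phi x = 0"
 shows "test_fun \<Omega> phi"
proof -
 have "closure {x. phi x ~= 0} \<subseteq> K" using assms by (intro closure_minimal) (auto intro: compact_imp_closed)
 moreover from this have "compact (closure {x. phi x ~= 0})"
  using compact_Int_closed[OF assms(2) closed_closure, of "{x. phi x ~= 0}"] by (simp only: inf.absorb2)
 ultimately show ?thesis using assms by (auto simp: test_fun_def)
qed

lemma test_fun_c1c:
 fixes phi :: "real^'n::finite => real"
 assumes "test_fun (ball 0 1) phi"
 shows "c1c 1 phi (grad phi)"
proof -
 define K where "K = closure {x. phi x ~= 0}"
 have K: "compact K" "K \<subseteq> ball 0 1" and s: "smooth_fun phi" using assms by (auto simp: test_fun_def K_def)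
 have "EX r>0. r < 1 & (ALL x:K. norm x < r)"
 proof (cases "K = {}")
  case True then show ?thesis by (intro exI[of _ "1/2"]) auto
 next
  case False
  then obtain x0 where x0: "x0 \<in> K" "!!x. x \<in> K ==> norm x <= norm x0"
   using continuous_attains_sup[OF K(1), of norm] by (auto intro: continuous_on_norm_id)
  then have "norm x0 < 1" using K by auto
  then obtain r where "norm x0 < r" "r < 1" using dense by blast
  then show ?thesis using x0 by (intro exI[of _ r]) (auto intro: le_less_trans norm_ge_zero)
 qed
 then obtain r where r: "r > 0" "r < 1" "!!x. x \<in> K ==> norm x < r" by blast
 have z: "phi x = 0" if "r <= norm x" for x using r(3)[of x] that closure_subset[of "{x. phi x ~= 0}"] by (auto simp: K_def)
 show ?thesis using smooth_fun_c1[OF s] c1_zero_outside[OF smooth_fun_c1[OF s] r(1) z] r z by (auto simp: c1c_def)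
qed

lemma integrable_affine:
 fixes f :: "'a::euclidean_space => 'b::euclidean_space"
 assumes f: "integrable lborel f" and c: "c ~= 0"
 shows "integrable lborel (%x. f (t + c *R x))"
proof -
 have [measurable]: "meas f" using f by auto
 have "integrable (density (distr lborel borel (%x. t + c *R x)) (%_. enn (abs c^DIM('a)))) f" using lborel_affine[OF c, of t] f by simp
 then have "integrable (distr lborel borel (%x. t + c *R x)) (%x. abs c^DIM('a) *R f x)" by (subst (asm) integrable_density) auto
 then have "integrable (distr lborel borel (%x. t + c *R x)) (%x. (1 / abs c^DIM('a)) *R (abs c^DIM('a) *R f x))" by (rule integrable_scaleR_right)
 then have "integrable (distr lborel borel (%x. t + c *R x)) f" using c by simp
 then show ?thesis by (subst (asm) integrable_distr_eq) auto
qed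

lemma kern_c1c:
 fixes rho :: "real^'n::finite => real"
 assumes s: "smooth_fun rho" and z: "!!x. 1 <= norm x ==> rho x = 0"
 shows "smooth_fun (kern rho n)" "1 / real (Suc n) <= norm y ==> kern rho n y = 0" "c1c 2 (kern rho n) (grad (kern rho n))"
proof -
 show ks: "smooth_fun (kern rho n)" using smooth_fun_affine[OF s, of "real (Suc n) ^ CARD('n)" 0 "real (Suc n)"] by (simp add: kern_def[abs_def])
 show k0: "kern rho n y = 0" if "1 / real (Suc n) <= norm y" for y
 proof -
  have "1 <= real (Suc n) * norm y" using that by (simp add: field_simps del: of_nat_Suc)
  then have "1 <= norm (real (Suc n) *R y)" by (simp only: norm_scaleR abs_of_nat)
  then show ?thesis by (simp add: kern_def z)
 qed
 have k1: "kern rho n y = 0" if "1 <= norm y" for y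
 proof (rule k0)
  have "1 / real (Suc n) <= 1" by simp
  then show "1 / real (Suc n) <= norm y" using that by linarith
 qed
 show "c1c 2 (kern rho n) (grad (kern rho n))" using smooth_fun_c1[OF ks] k1 c1_zero_outside[OF smooth_fun_c1[OF ks] _ k1, of 1]
  unfolding c1c_def by (intro conjI exI[of _ 1]) auto
qed

lemma test_fun_kern:
 fixes rho :: "real^'n::finite => real"
 assumes s: "smooth_fun rho" and z: "!!x. 1 <= norm x ==> rho x = 0" and x: "norm x + 1 / real (Suc n) < 1"
 shows "test_fun (ball 0 1) (%y. kern rho n (x - y))"
proof (rule test_funI)
 show "smooth_fun (%y. kern rho n (x - y))" using smooth_fun_affine[OF kern_c1c(1)[OF s z], of 1 n x "-1"] by simp
 show "compact (cball x (1 / real (Suc n)))" by simp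
 show "cball x (1 / real (Suc n)) \<subseteq> ball 0 1"
 proof
  fix y assume "y \<in> cball x (1 / real (Suc n))"
  then show "y \<in> ball 0 1" using x norm_triangle_sub[of y x] by (simp add: dist_norm norm_minus_commute)
 qed
 show "kern rho n (x - y) = 0" if "y \<notin> cball x (1 / real (Suc n))" for y using that by (intro kern_c1c(2)[OF s z]) (auto simp: dist_norm)
qed

text \<open>At a point whose distance to the sphere exceeds the radius of the kernel, y -> k(x - y)
  is an admissible test function, so the gradient of the mollified u is there the mollification of
  D. Both mollifications converge on the whole space by \<open>en_moll_tendsto\<close>.\<close>

lemma sob_of_weak_grad:
 fixes u :: "real^'n::finite => real"
 assumes um[measurable]: "meas u" and Dm[measurable]: "meas D"
  and z: "!!x. x \<notin> ball 0 1 ==> u x = 0" "!!x. x \<notin> ball 0 1 ==> D x = 0"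
  and p: "p > 1" and fin: "en p UNIV u < oo" "en p UNIV D < oo"
  and w: "!!phi i. test_fun (ball 0 1) phi ==> (LBINT x. u x * partial_deriv i phi x) = - (LBINT x. D x $ i * phi x)"
  and r: "r < 1"
 shows "sob p (ball 0 r) u D"
proof -
 obtain rho :: "real^'n => real" where rho: "smooth_fun rho" "!!x. rho x >= 0" "!!x. 1 <= norm x ==> rho x = 0"
  "(NN x. enn (rho x)) = 1" using bump_exists by metis
 have rhom[measurable]: "meas rho" using c1_borel[OF smooth_fun_c1[OF rho(1)]] by simp
 define k where "k n = kern rho n" for n
 have kc: "c1c 2 (k n) (grad (k n))" for n unfolding k_def by (rule kern_c1c(3)[OF rho(1,3)])
 have km[measurable]: "meas (k n)" "meas (grad (k n))" for n using c1_borel[OF c1c_c1[OF kc[of n]]] by auto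
 have fin': "en p (ball 0 1) u < oo" "en p (ball 0 1) D < oo"
  using fin en_mono_set[of "ball 0 1" UNIV p u] en_mono_set[of "ball 0 1" UNIV p D] by (auto intro: le_less_trans)
 have ui: "integrable lborel u" by (rule en_finite_integrable[OF um fin'(1)]) (use p z in auto)
 have Di: "integrable lborel D" by (rule en_finite_integrable[OF Dm fin'(2)]) (use p z in auto)
 \<comment> \<open>Starting the sequence at n0 keeps all kernel radii below 1 - r, so that the
   identity of gradients holds on the whole ball of radius r.\<close>
 obtain n0 where n0: "1 / real (Suc n0) < 1 - r" using nat_approx_posE[of "1 - r"] r by auto
 define psi where "psi n = conv u (k (n + n0))" for n
 define psi' where "psi' n = conv u (grad (k (n + n0)))" for n
 have c: "c1 (psi n) (psi' n)" for n unfolding psi_def psi'_def by (rule c1_conv[OF ui kc])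
 have psieq: "psi n = moll rho (n + n0) u" for n unfolding psi_def moll_conv[OF rhom um] k_def[symmetric] by (intro ext conv_commute) auto
 have psi'eq: "psi' n x = moll rho (n + n0) D x" if x: "x \<in> ball 0 r" for n x
 proof -
  define m where "m = n + n0"
  have "1 / real (Suc m) <= 1 / real (Suc n0)" by (simp add: m_def frac_le)
  then have xm: "norm x + 1 / real (Suc m) < 1" using x n0 by simp
  define phi where "phi y = k m (x - y)" for y
  have tf: "test_fun (ball 0 1) phi" unfolding phi_def k_def by (rule test_fun_kern[OF rho(1,3) xm])
  have c1phi: "c1 phi (%y. - grad (k m) (x - y))" using c1_affine[OF c1c_c1[OF kc[of m]], of x "-1"] by (simp add: phi_def[abs_def])
  obtain B where B: "!!x. norm (k m x) <= B" "!!x. norm (grad (k m) x) <= B" using c1c_bounded_ex[OF kc] by blast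
  have "psi' n x $ i = moll rho (n + n0) D x $ i" for i
  proof -
   have "meas (%y. D y \<bullet> axis i 1)" by measurable
   then have [measurable]: "meas (%y. D y $ i)" by (simp add: inner_axis)
   have "psi' n x $ i = conv u (%x. grad (k m) x $ i) x" unfolding psi'_def m_def[symmetric] by (rule conv_component[OF ui km(2) B(2)])
   also have "... = - (LBINT y. u y * partial_deriv i phi y)" unfolding c1_partial[OF c1phi] conv_def by simp
   also have "... = (LBINT y. D y $ i * phi y)" using w[OF tf] by simp
   also have "... = (LBINT y. k m y * D (x - y) $ i)" by (subst integral_affine[where c="-1" and t=x]) (auto simp: phi_def mult.commute)
   also have "... = (LBINT y. (k m y *R D (x - y)) \<bullet> axis i 1)" by (simp add: inner_axis)
   also have "... = (LBINT y. k m y *R D (x - y)) \<bullet> axis i 1"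
   proof (rule integral_inner_left)
   have "integrable lborel (%y. D (x - y) )" using integrable_affine[OF Di, of "-1" x] by simp
   show "integrable lborel (%y. k m y *R D (x - y))"
   proof (rule Bochner_Integration.integrable_bound[where f="%y. B *R D (x - y)"])
   show "integrable lborel (%y. B *R D (x - y))" using \<open>integrable lborel (%y. D (x - y))\<close> by simp
   have "B >= 0" using B(1)[of 0] norm_ge_zero order_trans by blast
   then show "AE y in lborel. norm (k m y *R D (x - y)) <= norm (B *R D (x - y))" using B(1) by (auto intro!: mult_right_mono)
   qed simp
   qed
   also have "... = moll rho m D x $ i" unfolding moll_conv[OF rhom Dm] k_def conv_def by (simp add: inner_axis)
   finally show ?thesis by (simp add: m_def)
  qed
  then show ?thesis by (simp add: vec_eq_iff)
 qed
 have 1: "Lp_tendsto p (ball 0 r) psi u"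
 proof (rule en_tendsto_squeeze[where C=1])
  show "en p (ball 0 r) (%x. psi n x - u x) <= enn 1 * en p UNIV (%x. moll rho (n + n0) u x - u x)" for n unfolding psieq by (simp add: en_mono_set)
  show "(%n. en p UNIV (%x. moll rho (n + n0) u x - u x)) ---> 0" using LIMSEQ_ignore_initial_segment[OF en_moll_tendsto[OF rhom rho(2,4) um p fin(1)], of n0] .
 qed
 have 2: "Lp_tendsto p (ball 0 r) psi' D"
 proof (rule en_tendsto_squeeze[where C=1])
  fix n
  have "en p (ball 0 r) (%x. psi' n x - D x) = en p (ball 0 r) (%x. moll rho (n + n0) D x - D x)" by (rule en_cong) (simp only: psi'eq)
  then show "en p (ball 0 r) (%x. psi' n x - D x) <= enn 1 * en p UNIV (%x. moll rho (n + n0) D x - D x)" by (simp add: en_mono_set)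
  show "(%n. en p UNIV (%x. moll rho (n + n0) D x - D x)) ---> 0" using LIMSEQ_ignore_initial_segment[OF en_moll_tendsto[OF rhom rho(2,4) Dm p fin(2)], of n0] .
 qed
 have "en p (ball 0 r) u < oo" "en p (ball 0 r) D < oo"
  using fin en_mono_set[of "ball 0 r" UNIV p u] en_mono_set[of "ball 0 r" UNIV p D] by (auto intro: le_less_trans)
 then show ?thesis unfolding sob_def using c 1 2 um Dm by blast
qed

section \<open>Borel representatives of weak solutions\<close>

lemma set_borel_representative:
 fixes f :: "real^'n::finite => real"
 assumes "set_borel_measurable lebesgue B f" and [measurable]: "B \<in> sets borel"
 obtains g where "meas g" "!!x. x \<notin> B ==> g x = 0" "AE x in lborel. x \<in> B --> g x = f x"
proof -
 obtain h where [measurable]: "h \<in> borel_measurable lborel" and h: "AE x in lborel. indicator B x *R f x = h x"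
  using completion_ex_borel_measurable_real[of "%x. indicator B x *R f x" lborel] assms(1) by (auto simp: set_borel_measurable_def)
 show ?thesis
 proof (rule that[of "%x. indicator B x * h x"])
  show "AE x in lborel. x \<in> B --> indicator B x * h x = f x" using h by eventually_elim auto
 qed auto
qed

lemma set_borel_representative_vec:
 fixes f :: "real^'n::finite => real^'n"
 assumes f: "set_borel_measurable lebesgue B f" and B[measurable]: "B \<in> sets borel"
 obtains g where "meas g" "!!x. x \<notin> B ==> g x = 0" "AE x in lborel. x \<in> B --> g x = f x"
proof -
 have "EX g. meas g & (ALL x. x \<notin> B --> g x = 0) & (AE x in lborel. x \<in> B --> g x = f x $ i)" for i
 proof -
  have "(%x. (indicator B x *R f x) \<bullet> axis i 1) \<in> borel_measurable lebesgue"
   using f by (intro borel_measurable_inner) (auto simp: set_borel_measurable_def)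
  then have "set_borel_measurable lebesgue B (%x. f x $ i)" by (simp add: set_borel_measurable_def inner_axis)
  then show ?thesis by (rule set_borel_representative[OF _ B]) blast
 qed
 then have "EX g. ALL i. meas (g i) & (ALL x. x \<notin> B --> g i x = 0) & (AE x in lborel. x \<in> B --> g i x = f x $ i)" by (intro choice allI)
 then obtain g where gg: "ALL i. meas (g i) & (ALL x. x \<notin> B --> g i x = 0) & (AE x in lborel. x \<in> B --> g i x = f x $ i)" by (rule exE)
 have g: "!!i. meas (g i)" "!!i x. x \<notin> B ==> g i x = 0"
  "!!i. AE x in lborel. x \<in> B --> g i x = f x $ i" using gg by simp_all
 note g(1)[measurable]
 have "AE x in lborel. ALL i:UNIV. x \<in> B --> g i x = f x $ i" using g(3) by (intro AE_finite_allI) auto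
 then have ae: "AE x in lborel. x \<in> B --> (\<Sum>i\<in>UNIV. g i x *R axis i 1) = f x"
 proof eventually_elim
  case (elim x)
  then show ?case using basis_expansion[of "f x"] by (auto simp: scalar_mult_eq_scaleR)
 qed
 show ?thesis by (rule that[OF _ _ ae]) (use g(2) in auto)
qed

text \<open>The notions of the theorem integrate over \<open>lebesgue\<close>. A Borel function that
  vanishes off B and agrees with f a.e. on B carries the integral over to \<open>lborel\<close>,
  where translations, dilations and Fubini are at hand.\<close>

lemma set_lebesgue_integral_borel:
 fixes f :: "real^'n::finite => real"
 assumes h: "meas h" "!!x. x \<notin> B ==> h x = 0" and ae: "AE x in lborel. x \<in> B --> h x = f x"
 shows "(LINT x:B|lebesgue. f x) = (LBINT x. h x)"
  and "set_integrable lebesgue B f \<longleftrightarrow> integrable lborel h"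
proof -
 have ae': "AE x in lebesgue. h x = indicator B x *R f x" using AE_completion[OF ae] by eventually_elim (use h(2) in \<open>auto simp: indicator_def\<close>)
 have hm: "h \<in> borel_measurable lebesgue" using h(1) by (intro measurable_completion) simp
 have fm: "(%x. indicator B x *R f x) \<in> borel_measurable lebesgue" by (rule borel_measurable_AE[OF hm ae'])
 have "(LINT x:B|lebesgue. f x) = (\<integral>x. h x \<partial>lebesgue)"
  unfolding set_lebesgue_integral_def using ae' by (intro integral_cong_AE[OF fm hm]) (auto elim: eventually_mono)
 also have "... = (LBINT x. h x)" using h(1) by (intro integral_completion) simp
 finally show "(LINT x:B|lebesgue. f x) = (LBINT x. h x)" .
 have "set_integrable lebesgue B f \<longleftrightarrow> integrable lebesgue h"
  unfolding set_integrable_def using ae' by (intro integrable_cong_AE[OF fm hm]) (auto elim: eventually_mono)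
 also have "... \<longleftrightarrow> integrable lborel h" using h(1) by (intro integrable_completion) simp
 finally show "set_integrable lebesgue B f \<longleftrightarrow> integrable lborel h" .
qed

lemma in_Lp_representative:
 fixes f :: "real^'n::finite => real" and g :: "real^'n => 'b::euclidean_space"
 assumes f: "in_Lp q B f" and g: "meas g" "!!x. x \<notin> B ==> g x = 0" "AE x in lborel. x \<in> B --> norm (g x) = abs (f x)"
  and q: "q > 0"
 shows "en q UNIV g = enn (Lp_norm q B f powr q)"
proof -
 note g(1)[measurable]
 have hm: "meas (%x. norm (g x) powr q)" by measurable
 have hz: "norm (g x) powr q = 0" if "x \<notin> B" for x using g(2)[OF that] by simp
 have hae: "AE x in lborel. x \<in> B --> norm (g x) powr q = abs (f x) powr q" using g(3) by eventually_elim auto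
 have *: "(LINT x:B|lebesgue. abs (f x) powr q) = (LBINT x. norm (g x) powr q)"
  "set_integrable lebesgue B (%x. abs (f x) powr q) \<longleftrightarrow> integrable lborel (%x. norm (g x) powr q)"
  by (rule set_lebesgue_integral_borel[OF hm hz hae], assumption)+
 have i: "integrable lborel (%x. norm (g x) powr q)" using * f by (simp add: in_Lp_def)
 have "en q UNIV g = enn (LBINT x. norm (g x) powr q)" unfolding en_def using i by (simp add: nn_integral_eq_integral)
 moreover have "Lp_norm q B f powr q = (LBINT x. norm (g x) powr q)"
 proof -
  have "Lp_norm q B f = (LBINT x. norm (g x) powr q) powr (1 / q)" unfolding Lp_norm_def by (simp only: *(1))
  then show ?thesis using q by (simp add: powr_powr Bochner_Integration.integral_nonneg)
 qed
 ultimately show ?thesis by simp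
qed

lemma c1c_en_finite:
 fixes f :: "'a::euclidean_space => real"
 assumes c: "c1c R f f'" and p: "p > 0" shows "en p S f < oo" "en p S f' < oo"
proof -
 obtain B where B: "B > 0" "!!x. norm (f x) <= B" "!!x. norm (f' x) <= B" using c1c_bounded_ex[OF c] by auto
 have fin: "en p S g < oo" if "!!x. norm (g x) <= B" "!!x. R <= norm x ==> g x = 0" for g :: "'a => 'c::euclidean_space"
 proof -
  have "en p S g <= (\<integral>\<^sup>+x. enn (B powr p) * indicator (ball 0 R) x \<partial>(lborel :: 'a measure))" unfolding en_def
  proof (intro nn_integral_mono, goal_cases)
   case (1 x)
   have "norm (g x) powr p <= B powr p" using that(1)[of x] p by (intro powr_mono2) auto
   then show ?case using that(2)[of x] by (auto simp: indicator_def intro: ennreal_leI)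
  qed
  also have "... = enn (B powr p) * emeasure lborel (ball (0::'a) R)" by (rule nn_integral_cmult_indicator) simp
  also have "... < oo" using emeasure_lborel_ball_finite[of "0::'a" R] by (simp add: ennreal_mult_less_top)
  finally show ?thesis .
 qed
 show "en p S f < oo" "en p S f' < oo" by (rule fin; use B c1c_outside[OF c] in blast)+
qed

text \<open>Makes C1 functions of compact support admissible in the weak equation. They are
  mollified within the room that \<open>c1c\<close> leaves before the unit sphere, which yields
  smooth functions of compact support converging together with their gradients.\<close>

lemma c1c_W1p0:
 fixes psi :: "real^'n::finite => real"
 assumes c: "c1c 1 psi psi'" and p: "p > 1"
 shows "W1p0 p (ball 0 1) psi psi'"
proof -
 let ?B = "ball 0 1 :: (real^'n) set"
 note c1_borel[OF c1c_c1[OF c], measurable]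
 have p0: "p > 0" using p by simp
 obtain B where B: "B > 0" "!!x. norm (psi x) <= B" "!!x. norm (psi' x) <= B" using c1c_bounded_ex[OF c] by blast
 have z: "psi x = 0" "psi' x = 0" if "x \<notin> ?B" for x using c1c_outside[OF c, of x] that by auto
 have sm: "set_borel_measurable lebesgue ?B f" if "meas f" for f :: "real^'n => 'b::euclidean_space"
  unfolding set_borel_measurable_def using that by (intro measurable_completion) measurable
 have Lp: "in_Lp p ?B f" if [measurable]: "meas f" and f: "!!x. abs (f x) <= B" "!!x. x \<notin> ?B ==> f x = 0" for f :: "real^'n => real"
 proof -
  have "integrable lborel (%x. abs (f x) powr p)" using f p by (intro bounded_support_integrable[where R=1 and B="B powr p"]) (auto intro!: powr_mono2)
  then have "set_integrable lebesgue ?B (%x. abs (f x) powr p)" using f by (subst set_lebesgue_integral_borel(2)[where h="%x. abs (f x) powr p"]) auto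
  then show ?thesis using sm[of f] by (simp add: in_Lp_def)
 qed
 have comp: "(LBINT x. (f x *R G x) $ i) = (LBINT x. f x *R G x) $ i" "meas (%x. G x $ i)"
  if f: "c1c 1 f f'" and G: "c1c 1 g G" for f g :: "real^'n => real" and f' G i
 proof -
  note c1_borel[OF c1c_c1[OF f], measurable] c1_borel[OF c1c_c1[OF G], measurable]
  have "meas (%x. G x \<bullet> axis i 1)" by measurable
  then show "meas (%x. G x $ i)" by (simp add: inner_axis)
  obtain b1 where b1: "b1 > 0" "!!x. norm (f x) <= b1" using c1c_bounded_ex[OF f] by blast
  obtain b2 where b2: "!!x. norm (G x) <= b2" using c1c_bounded_ex[OF G] by blast
  have "integrable lborel (%x. f x *R G x)"
  proof (rule bounded_support_integrable[where R=1 and B="b1*b2"])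
   show "norm (f x *R G x) <= b1 * b2" for x unfolding norm_scaleR using b1(1) b1(2)[of x] b2[of x] by (intro mult_mono) auto
  qed (use c1c_outside[OF f] in auto)
  then have "(LBINT x. (f x *R G x) \<bullet> axis i 1) = (LBINT x. f x *R G x) \<bullet> axis i 1" by (intro integral_inner_left)
  then show "(LBINT x. (f x *R G x) $ i) = (LBINT x. f x *R G x) $ i" by (simp add: inner_axis)
 qed
 have wg: "weak_grad ?B psi psi'" unfolding weak_grad_def
 proof (intro conjI allI impI sm)
  fix phi :: "real^'n => real" and i :: 'n assume "test_fun ?B phi"
  then have d: "c1c 1 phi (grad phi)" by (rule test_fun_c1c)
  note c1_borel[OF c1c_c1[OF d], measurable] comp(2)[OF c d, measurable] comp(2)[OF d c, measurable]
  have pd: "partial_deriv i phi x = grad phi x $ i" for x by (simp add: grad_def)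
  have "(LINT x:?B|lebesgue. psi x * partial_deriv i phi x) = (LBINT x. (psi x *R grad phi x) $ i)"
   by (rule set_lebesgue_integral_borel(1)) (use z in \<open>auto simp: pd\<close>)
  also have "... = - (LBINT x. (phi x *R psi' x) $ i)" unfolding comp(1)[OF c d] comp(1)[OF d c] using c1c_integrate_by_parts[OF c d] by simp
  also have "(LBINT x. (phi x *R psi' x) $ i) = (LINT x:?B|lebesgue. psi' x $ i * phi x)"
   by (rule set_lebesgue_integral_borel(1)[symmetric]) (use z in \<open>auto simp: mult.commute\<close>)
  finally show "(LINT x:?B|lebesgue. psi x * partial_deriv i phi x) = - (LINT x:?B|lebesgue. psi' x $ i * phi x)" .
 qed simp
 obtain rho :: "real^'n => real" where rho: "smooth_fun rho" "!!x. rho x >= 0" "!!x. 1 <= norm x ==> rho x = 0"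
  "(NN x. enn (rho x)) = 1" using bump_exists by metis
 have rhom[measurable]: "meas rho" using c1_borel[OF smooth_fun_c1[OF rho(1)]] by simp
 obtain r where r: "r > 0" "r < 1" "!!x. r <= norm x ==> psi x = 0" using c by (auto simp: c1c_def)
 \<comment> \<open>The support of psi lies in the ball of radius r; kernels of radius below 1 - r
   keep the mollified functions supported in the open unit ball.\<close>
 obtain n0 where n0: "1 / real (Suc n0) < 1 - r" using nat_approx_posE[of "1 - r"] r by auto
 define k where "k n = kern rho (n + n0)" for n
 have kc: "c1c 2 (k n) (grad (k n))" "smooth_fun (k n)" for n unfolding k_def using kern_c1c[OF rho(1,3)] by auto
 have k0: "k n y = 0" if "1 / real (Suc n0) <= norm y" for n y
 proof -
  have "1 / real (Suc (n + n0)) <= 1 / real (Suc n0)" by (simp add: frac_le)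
  then show ?thesis unfolding k_def using that by (intro kern_c1c(2)[OF rho(1,3)]) auto
 qed
 note c1_borel[OF c1c_c1[OF kc(1)], measurable]
 define phi where "phi n = conv (k n) psi" for n
 have gphi: "grad (phi n) = conv (k n) psi'" for n unfolding phi_def by (rule c1_grad[OF c1_conv[OF c1c_integrable(1)[OF kc(1)] c]])
 have tf: "test_fun ?B (phi n)" for n
 proof (rule test_funI)
  have "phi n = conv psi (k n)" unfolding phi_def by (intro ext conv_commute) auto
  then show "smooth_fun (phi n)" using smooth_fun_conv[OF c1c_integrable(1)[OF c] kc(2), of 2 n] c1c_outside[OF kc(1)[of n]] by auto
  show "compact (cball 0 (r + 1 / real (Suc n0)) :: (real^'n) set)" by simp
  show "cball 0 (r + 1 / real (Suc n0)) \<subseteq> ?B" using n0 by auto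
  fix x :: "real^'n" assume x: "x \<notin> cball 0 (r + 1 / real (Suc n0))"
  have *: "k n y *R psi (x - y) = 0" for y
  proof (cases "1 / real (Suc n0) <= norm y")
   case False
   then have "r <= norm (x - y)" using x norm_triangle_ineq2[of x y] by simp
   then show ?thesis by (simp add: r)
  qed (simp add: k0)
  show "phi n x = 0" by (simp only: phi_def conv_def *) simp
 qed
 have lim: "(%n. LINT x:?B|lebesgue. norm (conv (k n) f x - f x) powr p) ---> 0"
  if [measurable]: "meas f" and fin: "en p UNIV f < oo" and m[measurable]: "!!n. meas (conv (k n) f)"
   and z: "!!x. x \<notin> ?B ==> f x = 0" "!!x n. x \<notin> ?B ==> conv (k n) f x = 0" for f :: "real^'n => 'b::euclidean_space"
 proof -
  have "(%n. en p UNIV (%x. conv (k n) f x - f x)) ---> 0" unfolding k_def moll_conv[OF rhom that(1), symmetric]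
   by (rule LIMSEQ_ignore_initial_segment[OF en_moll_tendsto[OF rhom rho(2,4) that(1) p fin]])
  then have "(%n. enn2real (en p UNIV (%x. conv (k n) f x - f x))) ---> 0" by (intro tendsto_enn2real) simp_all
  moreover have "(LINT x:?B|lebesgue. norm (conv (k n) f x - f x) powr p) = enn2real (en p UNIV (%x. conv (k n) f x - f x))" for n
   by (subst set_lebesgue_integral_borel(1)[where h="%x. norm (conv (k n) f x - f x) powr p"])
   (use z in \<open>auto simp: en_def integral_eq_nn_integral\<close>)
  ultimately show ?thesis by simp
 qed
 have out: "phi n x = 0" "conv (k n) psi' x = 0" if "x \<notin> ?B" for n x using c1c_outside[OF test_fun_c1c[OF tf[of n]], of x] that by (auto simp: gphi)
 have phim: "meas (phi n)" "meas (conv (k n) psi')" for n using c1_borel[OF c1c_c1[OF test_fun_c1c[OF tf[of n]]]] by (auto simp: gphi)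
 have "W1p p ?B psi psi'" unfolding W1p_def using wg B z by (auto intro!: Lp)
 moreover have "(%n. LINT x:?B|lebesgue. abs (phi n x - psi x) powr p) ---> 0"
  using lim[of psi] c1c_en_finite(1)[OF c p0] phim(1) z(1) out(1) by (simp add: phi_def)
 moreover have "(%n. LINT x:?B|lebesgue. norm (grad (phi n) x - psi' x) powr p) ---> 0"
  unfolding gphi by (rule lim) (use c1c_en_finite(2)[OF c p0] phim(2) z(2) out(2) in auto)
 ultimately show ?thesis unfolding W1p0_def using tf by blast
qed

lemma Linf_norm_AE:
 fixes u :: "real^'n::finite => real"
 assumes u: "in_Linf (ball 0 1) u"
 shows "AE x in lborel. x \<in> ball 0 1 --> abs (u x) <= Linf_norm (ball 0 1) u" "0 <= Linf_norm (ball 0 1) u"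
proof -
 define M where "M = restrict_space lebesgue (ball 0 1 :: (real^'n) set)"
 define s where "s = esssup M (%x. ereal (abs (u x)))"
 have bl: "ball 0 1 \<in> sets (lebesgue :: (real^'n) measure)" by (intro sets_completionI_sets) simp
 have s: "s < oo" using u by (simp add: in_Linf_def s_def M_def)
 have ae: "AE x in M. ereal (abs (u x)) <= s" unfolding s_def by (rule esssup_AE)
 \<comment> \<open>A negative essential supremum would make the ball a null set. This has to be
   excluded because \<open>real_of_ereal\<close> sends minus infinity to 0.\<close>
 have "0 <= s"
 proof (rule ccontr)
  assume "\<not> 0 <= s"
  have "AE x in M. False" using ae
  proof eventually_elim
   case (elim x)
   have "0 <= ereal (abs (u x))" by simp
   from order_trans[OF this elim] \<open>\<not> 0 <= s\<close> show False by simp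
  qed
  then have "emeasure M (space M) = 0" by (simp add: AE_iff_null null_setsD1)
  moreover have "emeasure M (space M) = emeasure lborel (ball 0 1 :: (real^'n) set)"
   unfolding M_def using bl by (simp add: emeasure_restrict_space space_restrict_space)
  moreover have "emeasure lborel (ball 0 1 :: (real^'n) set) ~= 0" using content_ball_pos[of 1 "0::real^'n"] emeasure_lborel_ball_finite[of "0::real^'n" 1]
   by (auto simp: emeasure_eq_ennreal_measure)
  ultimately show False by simp
 qed
 with s have sr: "s = ereal (Linf_norm (ball 0 1) u)" "0 <= Linf_norm (ball 0 1) u"
  unfolding Linf_norm_def M_def[symmetric] s_def[symmetric] by (cases s; auto)+
 have "AE x in lebesgue. x \<in> ball 0 1 --> abs (u x) <= Linf_norm (ball 0 1) u"
  using ae unfolding M_def sr(1) using bl by (subst (asm) AE_restrict_space_iff) auto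
 then show "AE x in lborel. x \<in> ball 0 1 --> abs (u x) <= Linf_norm (ball 0 1) u" by (simp only: AE_completion_iff)
 show "0 <= Linf_norm (ball 0 1) u" by (rule sr(2))
qed

lemma powr_minus_one_le: 
 fixes t :: real assumes "1 <= p" "0 <= t" shows "t powr (p - 1) <= 1 + t powr p"
proof (cases "t <= 1")
 case True
 then have "t powr (p - 1) <= 1 powr (p - 1)" using assms by (intro powr_mono2) auto
 then show ?thesis by (simp add: add_increasing2)
next
 case False
 then have "t powr (p - 1) <= t powr p" using assms by (intro powr_mono) auto
 then show ?thesis by simp
qed

lemma plap_measurable[measurable]:
 "plap p \<in> borel_measurable (borel :: 'a::euclidean_space measure)" unfolding plap_def[abs_def] by measurable

lemma vec_nth_measurable[measurable]:
 fixes D :: "'c => real^'n::finite"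
 assumes "D \<in> borel_measurable M" shows "(%x. D x $ i) \<in> borel_measurable M"
proof -
 have "(%x. D x \<bullet> axis i 1) \<in> borel_measurable M" using assms by measurable
 then show ?thesis by (simp add: inner_axis)
qed

text \<open>The interface between the notions of the theorem and the Borel setting. At each point g
  equals one of the two sources, so its N-th power integral is at most the sum of theirs; both a and
  g select the phase by the representative \<open>u0\<close>.\<close>

lemma weak_solution_borel:
 fixes u fp fm Ap Am :: "real^'n::finite => real"
 assumes p: "p > 1" and cA: "continuous_on (ball 0 1) Ap" "continuous_on (ball 0 1) Am"
  and Lf: "in_Lp (real CARD('n)) (ball 0 1) fp" "in_Lp (real CARD('n)) (ball 0 1) fm"
  and ws: "weak_solution p (ball 0 1) Ap Am fp fm u"
 shows "EX u0 D a g. meas u0 & meas D & meas a & meas g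
  & (AE x in lborel. x \<in> ball 0 1 --> u0 x = u x)
  & (ALL x:ball 0 1. a x = (if u0 x > 0 then Ap x else Am x))
  & en (real CARD('n)) UNIV g <= enn (Lp_norm (real CARD('n)) (ball 0 1) fp powr (real CARD('n)) + Lp_norm (real CARD('n)) (ball 0 1) fm powr (real CARD('n)))
  & en p (ball 0 1) D < oo & (ALL r<1. sob p (ball 0 r) u0 D)
  & (ALL psi psi'. c1c 1 psi psi' --> (LBINT x. a x * (plap p (D x) \<bullet> psi' x)) = (LBINT x. g x * psi x))"
proof -
 let ?B = "ball 0 1 :: (real^'n) set"
 let ?N = "real CARD('n)"
 obtain Du where W: "W1p p ?B u Du" and eq: "!!phi Dphi. W1p0 p ?B phi Dphi ==>
   (LINT x:?B|lebesgue. phase Ap Am x (u x) * norm (Du x) powr (p - 2) * (Du x \<bullet> Dphi x))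
   = (LINT x:?B|lebesgue. phase fp fm x (u x) * phi x)" using ws unfolding weak_solution_def by blast
 have Lu: "in_Lp p ?B u" "in_Lp p ?B (%x. norm (Du x))" and wg: "weak_grad ?B u Du" using W by (auto simp: W1p_def)
 have rep: "EX g. meas g & (ALL x. x \<notin> ?B --> g x = 0) & (AE x in lborel. x \<in> ?B --> g x = f x)"
  if "set_borel_measurable lebesgue ?B f" for f :: "real^'n => real" using that by (rule set_borel_representative) auto
 obtain u0 where u0[measurable]: "meas u0" and u0z: "!!x. x \<notin> ?B ==> u0 x = 0" and u0e: "AE x in lborel. x \<in> ?B --> u0 x = u x"
  using rep[of u] Lu(1) by (auto simp: in_Lp_def)
 obtain P where P[measurable]: "meas P" and Pz: "!!x. x \<notin> ?B ==> P x = 0" and Pe: "AE x in lborel. x \<in> ?B --> P x = fp x"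
  using rep[of fp] Lf(1) by (auto simp: in_Lp_def)
 obtain M where M[measurable]: "meas M" and Mz: "!!x. x \<notin> ?B ==> M x = 0" and Me: "AE x in lborel. x \<in> ?B --> M x = fm x"
  using rep[of fm] Lf(2) by (auto simp: in_Lp_def)
 have "EX D. meas D & (ALL x. x \<notin> ?B --> D x = 0) & (AE x in lborel. x \<in> ?B --> D x = Du x)"
 proof -
  have "set_borel_measurable lebesgue ?B Du" using wg by (simp add: weak_grad_def)
  then show ?thesis by (rule set_borel_representative_vec) auto
 qed
 then obtain D where D[measurable]: "meas D" and Dz: "!!x. x \<notin> ?B ==> D x = 0" and De: "AE x in lborel. x \<in> ?B --> D x = Du x" by auto
 have ae: "AE x in lborel. x \<in> ?B --> norm (u0 x) = abs (u x)" "AE x in lborel. x \<in> ?B --> norm (D x) = abs (norm (Du x))"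
  "AE x in lborel. x \<in> ?B --> norm (P x) = abs (fp x)" "AE x in lborel. x \<in> ?B --> norm (M x) = abs (fm x)"
  using u0e De Pe Me by (eventually_elim, simp)+
 have pN: "p > 0" "?N > 0" using p by auto
 have enu: "en p UNIV u0 < oo" using in_Lp_representative[OF Lu(1) u0 u0z ae(1) pN(1)] by simp
 have enD: "en p UNIV D < oo" using in_Lp_representative[OF Lu(2) D Dz ae(2) pN(1)] by simp
 have enP: "en ?N UNIV P = enn (Lp_norm ?N ?B fp powr ?N)" by (rule in_Lp_representative[OF Lf(1) P Pz ae(3) pN(2)])
 have enM: "en ?N UNIV M = enn (Lp_norm ?N ?B fm powr ?N)" by (rule in_Lp_representative[OF Lf(2) M Mz ae(4) pN(2)])
 \<comment> \<open>Continuity of \<open>Ap\<close> and \<open>Am\<close> is known on the ball only.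
   Cutting off outside makes \<open>a\<close> a Borel function on the whole space.\<close>
 define a where "a x = indicator ?B x * (if u0 x > 0 then Ap x else Am x)" for x
 define g where "g x = (if u0 x > 0 then P x else M x)" for x
 have [measurable]: "meas (%x. indicator ?B x *R Ap x)" "meas (%x. indicator ?B x *R Am x)" by (rule borel_measurable_continuous_on_indicator; simp add: cA)+
 have "a = (%x. if u0 x > 0 then indicator ?B x *R Ap x else indicator ?B x *R Am x)" by (auto simp: a_def)
 then have a[measurable]: "meas a" by simp
 have g[measurable]: "meas g" unfolding g_def[abs_def] by measurable
 have gz: "g x = 0" if "x \<notin> ?B" for x using Pz[OF that] Mz[OF that] by (simp add: g_def)
 have "en ?N UNIV g <= (NN x. enn (norm (P x) powr ?N) * indicator UNIV x + enn (norm (M x) powr ?N) * indicator UNIV x)"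
  unfolding en_def by (intro nn_integral_mono) (auto simp: g_def)
 also have "... = en ?N UNIV P + en ?N UNIV M" unfolding en_def by (subst nn_integral_add) auto
 finally have eng: "en ?N UNIV g <= enn (Lp_norm ?N ?B fp powr ?N + Lp_norm ?N ?B fm powr ?N)" by (simp add: enP enM)
 have sob: "sob p (ball 0 r) u0 D" if r: "r < 1" for r
 proof (rule sob_of_weak_grad[OF u0 D u0z Dz p enu enD _ r])
  fix phi :: "real^'n => real" and i assume t: "test_fun ?B phi"
  have c: "c1c 1 phi (grad phi)" using t by (rule test_fun_c1c)
  note c1_borel[OF c1c_c1[OF c], measurable]
  have [measurable]: "meas (partial_deriv i phi)" unfolding c1_partial[OF c1c_c1[OF c]] by measurable
  have "(LBINT x. u0 x * partial_deriv i phi x) = (LINT x:?B|lebesgue. u x * partial_deriv i phi x)"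
  proof (rule set_lebesgue_integral_borel(1)[symmetric])
   show "AE x in lborel. x \<in> ?B --> u0 x * partial_deriv i phi x = u x * partial_deriv i phi x" using u0e by eventually_elim simp
  qed (use u0z in auto)
  also have "... = - (LINT x:?B|lebesgue. Du x $ i * phi x)" using wg t by (auto simp: weak_grad_def)
  also have "(LINT x:?B|lebesgue. Du x $ i * phi x) = (LBINT x. D x $ i * phi x)"
  proof (rule set_lebesgue_integral_borel(1))
   show "AE x in lborel. x \<in> ?B --> D x $ i * phi x = Du x $ i * phi x" using De by eventually_elim simp
  qed (use Dz in auto)
  finally show "(LBINT x. u0 x * partial_deriv i phi x) = - (LBINT x. D x $ i * phi x)" .
 qed
 have enDB: "en p ?B D < oo" using enD en_mono_set[of ?B UNIV p D] by (auto intro: le_less_trans)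
 have eqc: "(LBINT x. a x * (plap p (D x) \<bullet> psi' x)) = (LBINT x. g x * psi x)" if psi: "c1c 1 psi psi'" for psi psi'
 proof -
  note c1_borel[OF c1c_c1[OF psi], measurable]
  have "(LBINT x. a x * (plap p (D x) \<bullet> psi' x)) = (LINT x:?B|lebesgue. phase Ap Am x (u x) * norm (Du x) powr (p - 2) * (Du x \<bullet> psi' x))"
  proof (rule set_lebesgue_integral_borel(1)[symmetric])
   show "AE x in lborel. x \<in> ?B --> a x * (plap p (D x) \<bullet> psi' x) = phase Ap Am x (u x) * norm (Du x) powr (p - 2) * (Du x \<bullet> psi' x)"
   using De u0e by eventually_elim (auto simp: a_def phase_def plap_def)
   show "meas (%x. a x * (plap p (D x) \<bullet> psi' x))" by measurable
  qed (simp add: a_def)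
  also have "... = (LINT x:?B|lebesgue. phase fp fm x (u x) * psi x)" by (rule eq[OF c1c_W1p0[OF psi p]])
  also have "... = (LBINT x. g x * psi x)"
  proof (rule set_lebesgue_integral_borel(1))
   show "AE x in lborel. x \<in> ?B --> g x * psi x = phase fp fm x (u x) * psi x" using Pe Me u0e by eventually_elim (auto simp: g_def phase_def)
  qed (use gz in auto)
  finally show ?thesis .
 qed
 show ?thesis by (rule exI[of _ u0], rule exI[of _ D], rule exI[of _ a], rule exI[of _ g]) (use u0e eng enDB sob eqc in \<open>auto simp: a_def\<close>)
qed

section \<open>Calculus of Sobolev pairs\<close>

lemma sobE:
 assumes "sob p S u D"
 obtains psi psi' where "!!k. c1 (psi k) (psi' k)" "Lp_tendsto p S psi u"
  "Lp_tendsto p S psi' D" using assms unfolding sob_def by blast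

lemma sob_borel: "sob p S u D ==> meas u" "sob p S u D ==> meas D"
 by (auto simp: sob_def)

lemma sob_finite: "sob p S u D ==> en p S u < oo" "sob p S u D ==> en p S D < oo"
 by (auto simp: sob_def)

lemma sob_mono:
 assumes s: "sob p T u D" and ST: "S \<subseteq> T" shows "sob p S u D"
proof (rule sobE[OF s])
 fix psi psi' assume c: "!!k. c1 (psi k) (psi' k)" and l: "Lp_tendsto p T psi u"
  "Lp_tendsto p T psi' D"
 have "Lp_tendsto p S psi u" "Lp_tendsto p S psi' D" by (rule en_tendsto_squeeze[where C=1, OF _ l(1)], simp add: en_mono_set[OF ST])
   (rule en_tendsto_squeeze[where C=1, OF _ l(2)], simp add: en_mono_set[OF ST])
 moreover have "en p S u < oo" "en p S D < oo" by (rule le_less_trans[OF en_mono_set[OF ST]], rule sob_finite[OF s])+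
 ultimately show ?thesis unfolding sob_def using c sob_borel[OF s] by blast
qed

text \<open>Closedness: the gradients need not be related to the functions beyond the approximation.\<close>

lemma sob_limit:
 fixes u :: "'a::euclidean_space => real"
 assumes [measurable]: "meas u" "meas D" "S \<in> sets borel" and p: "p > 0"
  and s: "!!k. sob p S (U k) (E k)" and l: "Lp_tendsto p S U u" "Lp_tendsto p S E D"
 shows "sob p S u D"
proof -
 have [measurable]: "meas (U k)" "meas (E k)" for k using sob_borel[OF s] by auto
 \<comment> \<open>Diagonal choice: for each k a single C1 function within 1/(k+1) of the k-th pair,
   in value and in gradient.\<close>
 have "EX psi psi'. c1 psi psi' & en p S (%x. psi x - U k x) < enn (1 / real (Suc k)) & en p S (%x. psi' x - E k x) < enn (1 / real (Suc k))" for k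
 proof (rule sobE[OF s[of k]])
  fix psi psi' assume c: "!!j. c1 (psi j) (psi' j)" and l: "(%j. en p S (%x. psi j x - U k x)) ---> 0"
  "(%j. en p S (%x. psi' j x - E k x)) ---> 0"
  have "eventually (%j. en p S (%x. psi j x - U k x) < enn (1 / real (Suc k)) & en p S (%x. psi' j x - E k x) < enn (1 / real (Suc k))) sequentially"
   using l by (intro eventually_conj order_tendstoD(2)) auto
  then show ?thesis using c unfolding eventually_sequentially by blast
 qed
 then have "EX psi. ALL k. EX psi'. c1 (psi k) psi' & en p S (%x. psi k x - U k x) < enn (1 / real (Suc k)) & en p S (%x. psi' x - E k x) < enn (1 / real (Suc k))"
  by (intro choice allI)
 then obtain psi where "ALL k. EX psi'. c1 (psi k) psi' & en p S (%x. psi k x - U k x) < enn (1 / real (Suc k)) & en p S (%x. psi' x - E k x) < enn (1 / real (Suc k))"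
  by (rule exE)
 then have "EX psi'. ALL k. c1 (psi k) (psi' k) & en p S (%x. psi k x - U k x) < enn (1 / real (Suc k)) & en p S (%x. psi' k x - E k x) < enn (1 / real (Suc k))"
  by (rule choice)
 then obtain psi' where ps: "ALL k. c1 (psi k) (psi' k) & en p S (%x. psi k x - U k x) < enn (1 / real (Suc k)) & en p S (%x. psi' k x - E k x) < enn (1 / real (Suc k))"
  by (rule exE)
 have c: "c1 (psi k) (psi' k)" for k using ps by blast
 note c1_borel[OF c, measurable]
 have inv0: "(%k. enn (1 / real (Suc k))) ---> 0"
  using LIMSEQ_inverse_real_of_nat tendsto_ennrealI[of "%k. 1 / real (Suc k)" 0 sequentially] by (simp add: inverse_eq_divide)
 have a: "(%k. en p S (%x. psi k x - U k x)) ---> 0" "(%k. en p S (%x. psi' k x - E k x)) ---> 0"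
  by (rule en_tendsto_squeeze[where C=1, OF _ inv0], use ps in \<open>simp add: less_imp_le\<close>)+
 have "(%k. en p S (%x. (psi k x - U k x) + (U k x - u x))) ---> 0" "(%k. en p S (%x. (psi' k x - E k x) + (E k x - D x))) ---> 0"
  by (rule en_add_tendsto, simp, simp, simp, use p in simp, rule a, rule l)+
 then have b: "Lp_tendsto p S psi u" "Lp_tendsto p S psi' D" by simp_all
 have "en p S u < oo"
 proof -
  have "eventually (%k. en p S (%x. U k x - u x) < 1) sequentially" using l(1) by (rule order_tendstoD(2)) simp
  then obtain k where k: "en p S (%x. U k x - u x) < 1" by (auto simp: eventually_sequentially)
  have "en p S u = en p S (%x. U k x - (U k x - u x))" by simp
  also have "... <= enn (2 powr p) * (en p S (U k) + en p S (%x. U k x - u x))" using p by (intro en_diff) auto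
  also have "... < oo" using k sob_finite(1)[OF s[of k]] by (auto simp: ennreal_mult_less_top intro: less_trans)
  finally show ?thesis .
 qed
 moreover have "en p S D < oo"
 proof -
  have "eventually (%k. en p S (%x. E k x - D x) < 1) sequentially" using l(2) by (rule order_tendstoD(2)) simp
  then obtain k where k: "en p S (%x. E k x - D x) < 1" by (auto simp: eventually_sequentially)
  have "en p S D = en p S (%x. E k x - (E k x - D x))" by simp
  also have "... <= enn (2 powr p) * (en p S (E k) + en p S (%x. E k x - D x))" using p by (intro en_diff) auto
  also have "... < oo" using k sob_finite(2)[OF s[of k]] by (auto simp: ennreal_mult_less_top intro: less_trans)
  finally show ?thesis .
 qed
 ultimately show ?thesis unfolding sob_def using b c by auto
qed

lemma sob_add:
 fixes u v :: "'a::euclidean_space => real"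
 assumes s: "sob p S u D" and t: "sob p S v E" and [measurable]: "S \<in> sets borel" and p: "p > 0"
 shows "sob p S (%x. u x + v x) (%x. D x + E x)"
proof (rule sobE[OF s], rule sobE[OF t])
 note sob_borel[OF s, measurable] sob_borel[OF t, measurable]
 fix psi psi' phi phi' assume c: "!!k. c1 (psi k) (psi' k)" and l: "Lp_tendsto p S psi u"
  "Lp_tendsto p S psi' D"
 and d: "!!k. c1 (phi k) (phi' k)" and m: "Lp_tendsto p S phi v"
  "Lp_tendsto p S phi' E"
 note c1_borel[OF c, measurable] c1_borel[OF d, measurable]
 have "(%k. en p S (%x. (psi k x - u x) + (phi k x - v x))) ---> 0" "(%k. en p S (%x. (psi' k x - D x) + (phi' k x - E x))) ---> 0"
  by (rule en_add_tendsto, simp, simp, simp, use p in simp, rule l, rule m)+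
 then have "(%k. en p S (%x. (psi k x + phi k x) - (u x + v x))) ---> 0" "(%k. en p S (%x. (psi' k x + phi' k x) - (D x + E x))) ---> 0"
  by (simp_all add: algebra_simps)
 moreover have "en p S (%x. u x + v x) < oo"
  by (rule le_less_trans[OF en_add]) (use sob_finite[OF s] sob_finite[OF t] p in \<open>auto simp: ennreal_mult_less_top\<close>)
 moreover have "en p S (%x. D x + E x) < oo"
  by (rule le_less_trans[OF en_add]) (use sob_finite[OF s] sob_finite[OF t] p in \<open>auto simp: ennreal_mult_less_top\<close>)
 ultimately show ?thesis unfolding sob_def using c1_add[OF c d] by (intro conjI exI[of _ "%k x. psi k x + phi k x"] exI[of _ "%k x. psi' k x + phi' k x"]) auto
qed

lemma sob_affine:
 fixes u :: "'a::euclidean_space => real"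
 assumes s: "sob p (ball t (c * r)) u D" and c: "c > 0"
 shows "sob p (ball 0 r) (%x. d * u (t + c *R x)) (%x. (d * c) *R D (t + c *R x))"
proof (rule sobE[OF s])
 note sob_borel[OF s, measurable]
 fix psi psi' assume k: "!!k. c1 (psi k) (psi' k)" and l: "(%k. en p (ball t (c * r)) (%x. psi k x - u x)) ---> 0"
  "(%k. en p (ball t (c * r)) (%x. psi' k x - D x)) ---> 0"
 note c1_borel[OF k, measurable]
 define K where "K = 1 / c ^ DIM('a)"
 have K: "enn K * enn (c ^ DIM('a)) = 1" using c by (simp add: K_def ennreal_mult'[symmetric])
 have e: "en p (ball 0 r) (%x. a *R f (t + c *R x)) = enn (abs a powr p * K) * en p (ball t (c * r)) f"
  if [measurable]: "meas f" for a and f :: "'a => 'b::euclidean_space"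
 proof -
  have "en p (ball 0 r) (%x. a *R f (t + c *R x)) = enn (abs a powr p) * en p (ball 0 r) (%x. f (t + c *R x))" by (rule en_scaleR) auto
  also have "... = enn (abs a powr p) * ((enn K * enn (c ^ DIM('a))) * en p (ball 0 r) (%x. f (t + c *R x)))" by (simp add: K)
  also have "... = enn (abs a powr p) * (enn K * en p (ball t (c * r)) f)" by (subst en_affine[OF _ c]) (auto simp: mult.assoc)
  also have "... = enn (abs a powr p * K) * en p (ball t (c * r)) f" using c by (subst ennreal_mult) (auto simp: K_def mult.assoc)
  finally show ?thesis .
 qed
 have "en p (ball 0 r) (%x. d * psi k (t + c *R x) - d * u (t + c *R x)) = enn (abs d powr p * K) * en p (ball t (c * r)) (%x. psi k x - u x)" for k
  using e[of "%x. psi k x - u x" d] by (simp add: right_diff_distrib)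
 then have 1: "(%k. en p (ball 0 r) (%x. d * psi k (t + c *R x) - d * u (t + c *R x))) ---> 0" using en_tendsto_squeeze[OF order_refl l(1)] by simp
 have "en p (ball 0 r) (%x. d *R c *R psi' k (t + c *R x) - (d * c) *R D (t + c *R x)) = enn (abs (d * c) powr p * K) * en p (ball t (c * r)) (%x. psi' k x - D x)" for k
  using e[of "%x. psi' k x - D x" "d * c"] by (simp add: scaleR_right_diff_distrib)
 then have 2: "(%k. en p (ball 0 r) (%x. d *R c *R psi' k (t + c *R x) - (d * c) *R D (t + c *R x))) ---> 0"
  using en_tendsto_squeeze[OF order_refl l(2)] by simp
 have 3: "en p (ball 0 r) (%x. d * u (t + c *R x)) < oo" "en p (ball 0 r) (%x. (d * c) *R D (t + c *R x)) < oo"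
  using e[of u d] e[of D "d * c"] sob_finite[OF s] by (auto simp: ennreal_mult_less_top)
 have "c1 (%x. d * psi k (t + c *R x)) (%x. d *R c *R psi' k (t + c *R x))" for k by (intro c1_cmult c1_affine k)
 then show ?thesis unfolding sob_def using 1 2 3 by (intro conjI exI[of _ "%k x. d * psi k (t + c *R x)"] exI[of _ "%k x. d *R c *R psi' k (t + c *R x)"]) auto
qed

lemma sob_translate:
 fixes u :: "'a::euclidean_space => real"
 assumes s: "sob p (ball 0 R) u D" and h: "norm h + r <= R"
 shows "sob p (ball 0 r) (%x. u (x + h)) (%x. D (x + h))"
proof -
 have "ball h (1 * r) \<subseteq> ball 0 R"
 proof
  fix x assume "x \<in> ball h (1 * r)"
  then show "x \<in> ball 0 R" using h norm_triangle_sub[of x h] by (simp add: dist_norm norm_minus_commute)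
 qed
 from sob_affine[OF sob_mono[OF s this], of 1] show ?thesis by (simp add: add.commute)
qed

lemma sob_cmult:
 fixes u :: "'a::euclidean_space => real"
 assumes s: "sob p (ball 0 R) u D" shows "sob p (ball 0 R) (%x. d * u x) (%x. d *R D x)" using sob_affine[of p 0 1 R u D d] s by simp

lemma sob_diff_translate:
 fixes u :: "'a::euclidean_space => real"
 assumes s: "sob p (ball 0 R) u D" and h: "norm h + r <= R" and p: "p > 0"
 shows "sob p (ball 0 r) (%x. u (x + h) - u x) (%x. D (x + h) - D x)"
proof -
 have "r <= R" using h norm_ge_zero[of h] by linarith
 then have "sob p (ball 0 r) u D" by (intro sob_mono[OF s] subset_ball)
 from sob_add[OF sob_translate[OF s h] sob_cmult[OF this, of "-1"] _ p] show ?thesis by simp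
qed

lemma en_scaleR_tendsto:
 fixes D :: "'a::euclidean_space => 'b::euclidean_space"
 assumes [measurable]: "!!k. meas (c k)" "meas D" "S \<in> sets borel"
  and p: "p > 0" and fin: "en p S D < oo" and bd: "!!k x. abs (c k x) <= M"
  and lim: "AE x in lborel. x \<in> S --> (%k. c k x) ---> 0"
 shows "(%k. en p S (%x. c k x *R D x)) ---> 0"
proof -
 have M: "0 <= M" using bd[of undefined undefined] by linarith
 have "(%k. en p S (%x. c k x *R D x)) ---> (\<integral>\<^sup>+x. 0 \<partial>(lborel :: 'a measure))" unfolding en_real
 proof (rule nn_integral_dominated_convergence[where w="%x. enn (M powr p) * enn (norm (D x) powr p * indicator S x)"])
  show "AE x in lborel. enn (norm (c k x *R D x) powr p * indicator S x) <= enn (M powr p) * enn (norm (D x) powr p * indicator S x)" for k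
   using bd p M by (intro AE_I2) (auto simp: powr_mult ennreal_mult[symmetric] indicator_def intro!: ennreal_leI mult_right_mono powr_mono2)
  show "(NN x. enn (M powr p) * enn (norm (D x) powr p * indicator S x)) < oo"
   using fin by (subst nn_integral_cmult) (auto simp: en_real ennreal_mult_less_top)
  show "AE x in lborel. (%k. enn (norm (c k x *R D x) powr p * indicator S x)) ---> 0" using lim
  proof eventually_elim
   case (elim x)
   have "(%k. enn (norm (c k x *R D x) powr p)) ---> enn (norm (0 *R D x) powr p)" if "x \<in> S"
   using elim that p by (intro tendsto_ennrealI tendsto_powr' tendsto_intros) auto
   then show ?case using p by (cases "x \<in> S") auto
  qed
 qed auto
 then show ?thesis by simp
qed

text \<open>The error of the gradients splits into g'(psi) (psi' - D), controlled by the bound L,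
  and (g'(psi) - g'(u)) D. Since g' is merely continuous, the second part is handled by dominated
  convergence along a subsequence with psi -> u a.e.\<close>

lemma sob_chain:
 fixes u :: "'a::euclidean_space => real"
 assumes s: "sob p S u D" and [measurable]: "S \<in> sets borel" and fin: "emeasure lborel S < oo" and p: "p > 0"
  and g: "!!t. (g has_real_derivative g' t) (at t)" "continuous_on UNIV g'" and L: "!!t. abs (g' t) <= L"
 shows "sob p S (%x. g (u x)) (%x. g' (u x) *R D x)"
proof (rule sobE[OF s])
 note sob_borel[OF s, measurable]
 fix psi psi' assume c: "!!k. c1 (psi k) (psi' k)" and l: "Lp_tendsto p S psi u"
  "Lp_tendsto p S psi' D"
 note c1_borel[OF c, measurable]
 have L0: "0 <= L" using L[of 0] by simp
 have gc: "continuous_on UNIV g" using g(1) by (intro continuous_at_imp_continuous_on ballI) (rule DERIV_isCont)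
 have [measurable]: "meas g" "meas g'" using gc g(2) by (auto intro: borel_measurable_continuous_onI)
 have lip: "abs (g a - g b) <= L * abs (a - b)" for a b using field_differentiable_bound[of UNIV g g' L a b] g(1) L by auto
 have 1: "(%k. en p S (%x. g (psi k x) - g (u x))) ---> 0"
 proof (rule en_tendsto_squeeze[OF _ l(1)])
  fix k
  have "en p S (%x. g (psi k x) - g (u x)) <= en p S (%x. L *R (psi k x - u x))" using lip L0 p by (intro en_mono) (auto simp: abs_mult)
  then show "en p S (%x. g (psi k x) - g (u x)) <= enn (L powr p) * en p S (%x. psi k x - u x)" using L0 by (subst (asm) en_scaleR) auto
 qed
 obtain r where r: "strict_mono r" "AE x in lborel. x \<in> S --> (%n. psi (r n) x) ---> u x" by (rule en_AE_subseq[OF _ _ _ p l(1)]) auto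
 have a: "(%k. en p S (%x. g' (psi (r k) x) *R (psi' (r k) x - D x))) ---> 0"
 proof (rule en_tendsto_squeeze[OF _ LIMSEQ_subseq_LIMSEQ[OF l(2) r(1), unfolded o_def]])
  fix k
  have "en p S (%x. g' (psi (r k) x) *R (psi' (r k) x - D x)) <= en p S (%x. L *R (psi' (r k) x - D x))"
   using L L0 p by (intro en_mono) (auto intro: mult_right_mono)
  then show "en p S (%x. g' (psi (r k) x) *R (psi' (r k) x - D x)) <= enn (L powr p) * en p S (%x. psi' (r k) x - D x)"
   using L0 by (subst (asm) en_scaleR) auto
 qed
 have b: "(%k. en p S (%x. (g' (psi (r k) x) - g' (u x)) *R D x)) ---> 0"
 proof (rule en_scaleR_tendsto[OF _ _ _ p sob_finite(2)[OF s]])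
  show "abs (g' (psi (r k) x) - g' (u x)) <= 2 * L" for k x using L[of "psi (r k) x"] L[of "u x"] by linarith
  show "AE x in lborel. x \<in> S --> (%k. g' (psi (r k) x) - g' (u x)) ---> 0"
   using r(2) by eventually_elim (auto intro!: LIM_zero continuous_on_tendsto_compose[OF g(2)])
 qed auto
 have "(%k. en p S (%x. g' (psi (r k) x) *R (psi' (r k) x - D x) + (g' (psi (r k) x) - g' (u x)) *R D x)) ---> 0"
  by (rule en_add_tendsto, simp, simp, simp, use p in simp, rule a, rule b)
 then have 2: "(%k. en p S (%x. g' (psi (r k) x) *R psi' (r k) x - g' (u x) *R D x)) ---> 0" by (simp add: algebra_simps)
 have f1: "en p S (%x. g (u x)) < oo"
 proof -
  have "en p S (%x. g (u x)) <= en p S (%x. abs (g 0) + L * abs (u x))"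
  proof (intro en_mono)
   fix x show "norm (g (u x)) <= norm (abs (g 0) + L * abs (u x))" using lip[of "u x" 0] L0 by simp
  qed (use p in simp)
  also have "... <= enn (2 powr p) * (en p S (%x. abs (g 0)) + en p S (%x. L *R (abs (u x))))"
   using p en_add[of "%x. abs (g 0)" "%x. L * abs (u x)" S p] by simp
  also have "en p S (%x. L *R (abs (u x))) = enn (abs L powr p) * en p S (%x. abs (u x))" by (rule en_scaleR) auto
  also have "en p S (%x. abs (u x)) = en p S u" by (rule en_cong) simp
  also have "en p S (%x. abs (g 0)) = enn (abs (g 0) powr p) * emeasure lborel S" unfolding en_def by (subst nn_integral_cmult_indicator) auto
  finally show ?thesis by (rule le_less_trans) (use fin sob_finite(1)[OF s] in \<open>auto simp: ennreal_mult_less_top\<close>)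
 qed
 have f2: "en p S (%x. g' (u x) *R D x) < oo"
 proof -
  have "en p S (%x. g' (u x) *R D x) <= en p S (%x. L *R D x)" using L L0 p by (intro en_mono) (auto intro: mult_right_mono)
  also have "... = enn (abs L powr p) * en p S D" by (rule en_scaleR) auto
  finally show ?thesis by (rule le_less_trans) (use sob_finite(2)[OF s] in \<open>auto simp: ennreal_mult_less_top\<close>)
 qed
 have "c1 (%x. g (psi (r k) x)) (%x. g' (psi (r k) x) *R psi' (r k) x)" for k by (rule c1_compose[OF g c])
 then show ?thesis unfolding sob_def using f1 f2 2 LIMSEQ_subseq_LIMSEQ[OF 1 r(1), unfolded o_def]
  by (intro conjI exI[of _ "%k x. g (psi (r k) x)"] exI[of _ "%k x. g' (psi (r k) x) *R psi' (r k) x"]) auto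
qed

section \<open>Duality pairings and extended test functions\<close>

lemma young_eps:
 assumes p: "p > 1" and d: "d > 0"
 shows "EX C>0. ALL x y::real. 0 <= x --> 0 <= y --> x * y <= d * x powr (p / (p - 1)) + C * y powr p"
proof -
 define q where "q = p / (p - 1)"
 have q: "q > 1" "1/q + 1/p = 1" using p by (auto simp: q_def field_simps)
 define s where "s = d powr (1 / q)"
 have s: "s > 0" "s powr q = d" using d q by (auto simp: s_def powr_powr)
 have "x * y <= d * x powr q + (1/s) powr p * y powr p" if x: "0 <= x" and y: "0 <= y" for x y :: real
 proof -
  have "x * y = (s * x) * (y / s)" using s by simp
  also have "... <= (s * x) powr q / q + (y / s) powr p / p" using s x y p q by (intro Youngs_inequality) auto
  also have "... <= (s * x) powr q / 1 + (y / s) powr p / 1" using p q by (intro add_mono divide_left_mono) auto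
  also have "... = d * x powr q + (1/s) powr p * y powr p" using s x y by (simp add: powr_mult powr_divide)
  finally show ?thesis .
 qed
 then show ?thesis unfolding q_def by (intro exI[of _ "(1/s) powr p"]) (use s in auto)
qed

lemma pairing_le:
 fixes H X :: "'a::euclidean_space => 'b::euclidean_space"
 assumes [measurable]: "meas H" "meas X" "S \<in> sets borel"
  and z: "!!x. x \<notin> S ==> X x = 0" and d: "0 <= d" "0 <= C"
  and Y: "!!x y::real. 0 <= x ==> 0 <= y ==> x * y <= d * x powr q + C * y powr p"
 shows "(NN x. enn (abs (H x \<bullet> X x))) <= enn d * en q S H + enn C * en p S X"
proof -
 have "abs (H x \<bullet> X x) <= d * norm (H x) powr q + C * norm (X x) powr p" for x by (rule order_trans[OF Cauchy_Schwarz_ineq2 Y]) auto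
 then show ?thesis unfolding en_real using z d by (intro nn_integral_le_lincomb) (auto simp: indicator_def)
qed

lemma pairing_integrable:
 fixes H X :: "'a::euclidean_space => 'b::euclidean_space"
 assumes [measurable]: "meas H" "meas X" "S \<in> sets borel"
  and z: "!!x. x \<notin> S ==> X x = 0" and p: "p > 1"
  and fin: "en (p / (p - 1)) S H < oo" "en p S X < oo"
 shows "integrable lborel (%x. H x \<bullet> X x)"
proof (rule integrableI_bounded)
 obtain C where C: "C > 0" "ALL x y::real. 0 <= x --> 0 <= y --> x * y <= 1 * x powr (p / (p - 1)) + C * y powr p" using young_eps[OF p, of 1] by auto
 have "(NN x. enn (abs (H x \<bullet> X x))) <= enn 1 * en (p / (p - 1)) S H + enn C * en p S X" by (rule pairing_le) (use C z in auto)
 also have "... < oo" using fin by (auto simp: ennreal_mult_less_top)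
 finally show "(NN x. enn (norm (H x \<bullet> X x))) < oo" by simp
qed simp

text \<open>Young's inequality with a small weight d on H takes the place of Hoelder's: d times the
  energy of H stays below e/2, and the other term is a constant times an energy that tends to
  0.\<close>

lemma pairing_tendsto:
 fixes H X :: "'a::euclidean_space => 'b::euclidean_space"
 assumes [measurable]: "meas H" "meas X" "!!k. meas (Y k)" "S \<in> sets borel"
  and z: "!!x. x \<notin> S ==> X x = 0" "!!k x. x \<notin> S ==> Y k x = 0" and p: "p > 1"
  and fin: "en (p / (p - 1)) S H < oo" "en p S X < oo" "!!k. en p S (Y k) < oo"
  and lim: "Lp_tendsto p S Y X"
 shows "(%k. LBINT x. H x \<bullet> Y k x) ---> (LBINT x. H x \<bullet> X x)"
proof (rule LIMSEQ_I)
 fix e :: real assume e: "e > 0"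
 define h where "h = enn2real (en (p / (p - 1)) S H)"
 have h: "en (p / (p - 1)) S H = enn h" "0 <= h" using fin(1) by (auto simp: h_def)
 define d where "d = e / (2 * (h + 1))"
 have d: "d > 0" using e h by (simp add: d_def)
 obtain C where C: "C > 0" "ALL x y::real. 0 <= x --> 0 <= y --> x * y <= d * x powr (p / (p - 1)) + C * y powr p" using young_eps[OF p d] by auto
 have "eventually (%k. en p S (%x. Y k x - X x) < enn (e / (2 * C))) sequentially" using lim e C by (intro order_tendstoD(2)) auto
 then obtain n0 where n0: "!!k. k >= n0 ==> en p S (%x. Y k x - X x) < enn (e / (2 * C))" by (auto simp: eventually_sequentially)
 have "norm ((LBINT x. H x \<bullet> Y k x) - (LBINT x. H x \<bullet> X x)) < e" if k: "k >= n0" for k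
 proof -
  have i: "integrable lborel (%x. H x \<bullet> Y k x)" "integrable lborel (%x. H x \<bullet> X x)"
   using pairing_integrable[of H "Y k" S p] pairing_integrable[of H X S p] z p fin by auto
  have "(LBINT x. H x \<bullet> Y k x) - (LBINT x. H x \<bullet> X x) = (LBINT x. H x \<bullet> (Y k x - X x))" using i by (simp add: inner_diff_right)
  moreover have "enn (norm (LBINT x. H x \<bullet> (Y k x - X x))) < enn e"
  proof -
   have "enn (norm (LBINT x. H x \<bullet> (Y k x - X x))) <= (NN x. enn (norm (H x \<bullet> (Y k x - X x))))"
   by (rule integral_norm_bound_ennreal) (use i in \<open>simp add: inner_diff_right\<close>)
   also have "... = (NN x. enn (abs (H x \<bullet> (Y k x - X x))))" by simp
   also have "... <= enn d * en (p / (p - 1)) S H + enn C * en p S (%x. Y k x - X x)" by (rule pairing_le) (use C d z in auto)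
   also have "... <= enn d * enn h + enn C * enn (e / (2 * C))" using n0[OF k] h by (intro add_mono mult_left_mono) auto
   also have "... = enn (d * h + C * (e / (2 * C)))"
   proof -
   have "enn (d * h) = enn d * enn h" "enn (C * (e / (2 * C))) = enn C * enn (e / (2 * C))" by (rule ennreal_mult; use d h C e in simp)+
   moreover have "enn (d * h + C * (e / (2 * C))) = enn (d * h) + enn (C * (e / (2 * C)))" by (rule ennreal_plus) (use d h C e in auto)
   ultimately show ?thesis by (simp only:)
   qed
   also have "... < enn e"
   proof (rule ennreal_lessI)
   have "d * h < d * (h + 1)" using d by simp
   also have "... = e / 2" using h(2) unfolding d_def by (simp add: divide_eq_eq)
   finally show "d * h + C * (e / (2 * C)) < e" using C by simp
   qed (use e in simp)
   finally show ?thesis .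
  qed
  ultimately show ?thesis using e by (simp add: ennreal_less_iff)
 qed
 then show "EX no. ALL n>=no. norm ((LBINT x. H x \<bullet> Y n x) - (LBINT x. H x \<bullet> X x)) < e" by blast
qed

text \<open>Products of the cutoff with the C1 approximants of u are themselves admissible test
  functions, and their gradients converge to the formal gradient of eta u.\<close>

lemma sob_mult_approx:
 fixes u :: "'a::euclidean_space => real"
 assumes s: "sob p (ball 0 R) u D" and eta: "c1c R eta eta'" and p: "p > 0"
 shows "EX psi psi'. (ALL k. c1c R (psi k) (psi' k)) & (%k. en p (ball 0 R) (%x. psi' k x - (eta x *R D x + u x *R eta' x))) ---> 0"
proof (rule sobE[OF s])
 note sob_borel[OF s, measurable] c1_borel[OF c1c_c1[OF eta], measurable]
 fix psi psi' assume c: "!!k. c1 (psi k) (psi' k)" and l: "Lp_tendsto p (ball 0 R) psi u"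
  "Lp_tendsto p (ball 0 R) psi' D"
 note c1_borel[OF c, measurable]
 obtain B where B: "B > 0" "!!x. norm (eta x) <= B" "!!x. norm (eta' x) <= B" using c1c_bounded_ex[OF eta] by auto
 have 1: "(%k. en p (ball 0 R) (%x. eta x *R (psi' k x - D x))) ---> 0"
 proof (rule en_tendsto_squeeze[OF _ l(2)])
  fix k
  have "en p (ball 0 R) (%x. eta x *R (psi' k x - D x)) <= en p (ball 0 R) (%x. B *R (psi' k x - D x))"
   using B p by (intro en_mono) (auto intro: mult_right_mono)
  then show "en p (ball 0 R) (%x. eta x *R (psi' k x - D x)) <= enn (B powr p) * en p (ball 0 R) (%x. psi' k x - D x)"
   using B by (subst (asm) en_scaleR) auto
 qed
 have 2: "(%k. en p (ball 0 R) (%x. (psi k x - u x) *R eta' x)) ---> 0"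
 proof (rule en_tendsto_squeeze[OF _ l(1)])
  fix k
  have "en p (ball 0 R) (%x. (psi k x - u x) *R eta' x) <= en p (ball 0 R) (%x. B *R (psi k x - u x))"
  proof (intro en_mono)
   fix x show "norm ((psi k x - u x) *R eta' x) <= norm (B *R (psi k x - u x))"
   using B mult_left_mono[OF B(3)[of x], of "abs (psi k x - u x)"] by (simp add: abs_mult mult.commute)
  qed (use p in simp)
  then show "en p (ball 0 R) (%x. (psi k x - u x) *R eta' x) <= enn (B powr p) * en p (ball 0 R) (%x. psi k x - u x)"
   using B by (subst (asm) en_scaleR) auto
 qed
 have "(%k. en p (ball 0 R) (%x. eta x *R (psi' k x - D x) + (psi k x - u x) *R eta' x)) ---> 0"
  by (rule en_add_tendsto, simp, simp, simp, use p in simp, rule 1, rule 2)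
 then have "(%k. en p (ball 0 R) (%x. (eta x *R psi' k x + psi k x *R eta' x) - (eta x *R D x + u x *R eta' x))) ---> 0" by (simp add: algebra_simps)
 then show ?thesis using c1c_mult[OF eta c] by (intro exI[of _ "%k x. eta x * psi k x"] exI[of _ "%k x. eta x *R psi' k x + psi k x *R eta' x"]) auto
qed

lemma sob_mult_finite:
 fixes u :: "'a::euclidean_space => real"
 assumes s: "sob p (ball 0 R) u D" and eta: "c1c R eta eta'" and p: "p > 0"
 shows "en p (ball 0 R) (%x. eta x *R D x + u x *R eta' x) < oo"
proof -
 note sob_borel[OF s, measurable] c1_borel[OF c1c_c1[OF eta], measurable]
 obtain B where B: "B > 0" "!!x. norm (eta x) <= B" "!!x. norm (eta' x) <= B" using c1c_bounded_ex[OF eta] by auto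
 have "en p (ball 0 R) (%x. eta x *R D x) <= en p (ball 0 R) (%x. B *R D x)" using B p by (intro en_mono) (auto intro: mult_right_mono)
 also have "... = enn (abs B powr p) * en p (ball 0 R) D" by (rule en_scaleR) auto
 also have "... < oo" using sob_finite[OF s] by (auto simp: ennreal_mult_less_top)
 finally have 1: "en p (ball 0 R) (%x. eta x *R D x) < oo" .
 have "en p (ball 0 R) (%x. u x *R eta' x) <= en p (ball 0 R) (%x. B *R u x)"
 proof (intro en_mono)
  fix x show "norm (u x *R eta' x) <= norm (B *R u x)" using B mult_left_mono[OF B(3)[of x], of "abs (u x)"] by (simp add: abs_mult mult.commute)
 qed (use p in simp)
 also have "... = enn (abs B powr p) * en p (ball 0 R) u" by (rule en_scaleR) auto
 also have "... < oo" using sob_finite[OF s] by (auto simp: ennreal_mult_less_top)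
 finally have 2: "en p (ball 0 R) (%x. u x *R eta' x) < oo" .
 show ?thesis by (rule le_less_trans[OF en_add]) (use 1 2 p in \<open>auto simp: ennreal_mult_less_top\<close>)
qed

text \<open>Extends an equation tested with compactly supported C1 functions to the test function
  eta u. The integrability of H is the one dual to p, so the pairing passes to the limit.\<close>

lemma sob_test:
 fixes u :: "'a::euclidean_space => real"
 assumes s: "sob p (ball 0 R) u D" and eta: "c1c R eta eta'" and p: "p > 1"
  and H[measurable]: "meas H" and fin: "en (p / (p - 1)) (ball 0 R) H < oo"
  and eq: "!!psi psi'. c1c R psi psi' ==> (LBINT x. H x \<bullet> psi' x) = 0"
 shows "(LBINT x. H x \<bullet> (eta x *R D x + u x *R eta' x)) = 0"
proof -
 note sob_borel[OF s, measurable] c1_borel[OF c1c_c1[OF eta], measurable]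
 have p0: "p > 0" using p by simp
 obtain psi psi' where c: "!!k. c1c R (psi k) (psi' k)" and l: "(%k. en p (ball 0 R) (%x. psi' k x - (eta x *R D x + u x *R eta' x))) ---> 0"
  using sob_mult_approx[OF s eta p0] by auto
 note c1_borel[OF c1c_c1[OF c], measurable]
 have "(%k. LBINT x. H x \<bullet> psi' k x) ---> (LBINT x. H x \<bullet> (eta x *R D x + u x *R eta' x))"
 proof (rule pairing_tendsto[where S="ball 0 R" and p=p])
  show "en p (ball 0 R) (%x. eta x *R D x + u x *R eta' x) < oo" by (rule sob_mult_finite[OF s eta p0])
  show "en p (ball 0 R) (psi' k) < oo" for k by (rule c1c_en_finite(2)[OF c p0])
  show "eta x *R D x + u x *R eta' x = 0" if "x \<notin> ball 0 R" for x using c1c_outside[OF eta, of x] that by auto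
  show "psi' k x = 0" if "x \<notin> ball 0 R" for k x using c1c_outside[OF c, of x] that by auto
 qed (use p fin l in auto)
 then have "(%k. 0::real) ---> (LBINT x. H x \<bullet> (eta x *R D x + u x *R eta' x))" using eq[OF c] by simp
 then show ?thesis by (simp add: LIMSEQ_const_iff)
qed

section \<open>Difference quotients\<close>

text \<open>For C1 functions this is the increment from x to x + h (\<open>lavg_c1\<close>). Where
  the line integral does not exist the value is 0 by convention, hence the care in
  \<open>lavg_AE_integrable\<close>.\<close>

definition lavg :: "('a::euclidean_space => 'a) => 'a => 'a => real" where
 "lavg D h x = (LBINT t. indicator {0..1} t * (D (x + t *R h) \<bullet> h))"

lemma lavg_measurable[measurable]:
 assumes [measurable]: "meas D" shows "meas (lavg D h)" unfolding lavg_def[abs_def] by measurable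

lemma segment_average_pointwise:
 fixes D :: "'a::euclidean_space => 'a"
 assumes [measurable]: "meas D" and q: "q > 1"
 shows "enn (norm (LBINT t. indicator {0..1} t * ((D (x + t *R h) - y) \<bullet> h)) powr q) <= (NN t. indicator {0..1} t * enn (abs ((D (x + t *R h) - y) \<bullet> h) powr q))"
  and "(NN t. indicator {0..1} t * enn (abs ((D (x + t *R h) - y) \<bullet> h) powr q)) < oo ==>
   integrable lborel (%t. indicator {0..1} t * ((D (x + t *R h) - y) \<bullet> h))"
proof -
 define P where "P = density lborel (%t. enn (indicator {0..1::real} t))"
 have P: "prob_space P" unfolding P_def by (rule prob_space_density_lborel) (auto simp: ennreal_indicator)
 have sP[measurable_cong]: "sets P = sets borel" by (simp add: P_def)
 define f where "f t = (D (x + t *R h) - y) \<bullet> h" for t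
 have [measurable]: "meas f" unfolding f_def by measurable
 have 1: "(LBINT t. indicator {0..1} t * f t) = (\<integral>t. f t \<partial>P)" unfolding P_def by (subst integral_density) auto
 have 2: "(NN t. indicator {0..1} t * enn (abs (f t) powr q)) = (\<integral>\<^sup>+t. enn (norm (f t) powr q) \<partial>P)"
  unfolding P_def by (subst nn_integral_density) (auto simp: ennreal_indicator)
 have 3: "integrable lborel (%t. indicator {0..1} t * f t) \<longleftrightarrow> integrable P f" unfolding P_def by (subst integrable_density) auto
 show "enn (norm (LBINT t. indicator {0..1} t * ((D (x + t *R h) - y) \<bullet> h)) powr q) <= (NN t. indicator {0..1} t * enn (abs ((D (x + t *R h) - y) \<bullet> h) powr q))"
  unfolding f_def[symmetric] 1 2 by (rule jensen_powr(1)[OF P _ q]) simp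
 show "(NN t. indicator {0..1} t * enn (abs ((D (x + t *R h) - y) \<bullet> h) powr q)) < oo ==>
   integrable lborel (%t. indicator {0..1} t * ((D (x + t *R h) - y) \<bullet> h))" unfolding f_def[symmetric] 2 3 by (rule jensen_powr(2)[OF P _ q]) simp_all
qed

text \<open>The parameter c merges two uses: c = 0 bounds the increments themselves, and c = 1
  bounds their deviation from the directional derivative.\<close>

lemma segment_average_le:
 fixes D :: "'a::euclidean_space => 'a"
 assumes [measurable]: "meas D" "S \<in> sets borel" and q: "q > 1"
  and K: "!!t. 0 <= t ==> t <= 1 ==> en q S (%x. D (x + t *R h) - c *R D x) <= K"
 shows "(NN x. (NN t. indicator {0..1} t * enn (abs ((D (x + t *R h) - c *R D x) \<bullet> h) powr q)) * indicator S x) <= enn (norm h powr q) * K" (is "?I <= _")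
  and "en q S (%x. LBINT t. indicator {0..1} t * ((D (x + t *R h) - c *R D x) \<bullet> h)) <= enn (norm h powr q) * K" (is "?E <= _")
proof -
 have "?I = (NN x. (NN t. indicator {0..1} t * enn (abs ((D (x + t *R h) - c *R D x) \<bullet> h) powr q) * indicator S x))"
  by (intro nn_integral_cong) (subst nn_integral_multc, auto)
 also have "... = (NN t. (NN x. indicator {0..1} t * enn (abs ((D (x + t *R h) - c *R D x) \<bullet> h) powr q) * indicator S x))"
  by (rule lborel_pair.Fubini') measurable
 also have "... <= (\<integral>\<^sup>+t. indicator {0..1} t * (enn (norm h powr q) * K) \<partial>(lborel::real measure))"
 proof (intro nn_integral_mono, goal_cases)
  case (1 t)
  show ?case
  proof (cases "t \<in> {0..1}")
   case True
   have "(NN x. indicator {0..1} t * enn (abs ((D (x + t *R h) - c *R D x) \<bullet> h) powr q) * indicator S x)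
   = en q S (%x. (D (x + t *R h) - c *R D x) \<bullet> h)" unfolding en_def using True by simp
   also have "... <= en q S (%x. norm h *R (D (x + t *R h) - c *R D x))"
   using q by (intro en_mono) (auto simp: mult.commute intro: order_trans[OF Cauchy_Schwarz_ineq2])
   also have "... = enn (norm h powr q) * en q S (%x. D (x + t *R h) - c *R D x)" by (subst en_scaleR) auto
   also have "... <= enn (norm h powr q) * K" using True by (intro mult_left_mono K) auto
   finally show ?thesis using True by simp
  qed simp
 qed
 also have "... = enn (norm h powr q) * K" by (subst nn_integral_multc) auto
 finally show 1: "?I <= enn (norm h powr q) * K" .
 have "?E <= ?I" unfolding en_def by (intro nn_integral_mono mult_right_mono segment_average_pointwise(1) q) auto
 then show "?E <= enn (norm h powr q) * K" using 1 by (rule order_trans)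
qed

lemma en_translate_le:
 fixes D :: "'a::euclidean_space => 'b::euclidean_space"
 assumes [measurable]: "meas D" and h: "norm h + s <= R"
 shows "en q (ball 0 s) (%x. D (x + h)) <= en q (ball 0 R) D"
proof -
 have "{x. x - h \<in> ball 0 s} \<subseteq> ball 0 R"
 proof
  fix x assume "x \<in> {x. x - h \<in> ball 0 s}"
  then show "x \<in> ball 0 R" using h norm_triangle_sub[of x h] by simp
 qed
 then show ?thesis by (subst en_translate) (auto intro: en_mono_set)
qed

lemma lavg_le:
 fixes D :: "'a::euclidean_space => 'a"
 assumes [measurable]: "meas D" and q: "q > 1" and h: "norm h + s <= R"
 shows "en q (ball 0 s) (lavg D h) <= enn (norm h powr q) * en q (ball 0 R) D"
  and "(NN x. (NN t. indicator {0..1} t * enn (abs (D (x + t *R h) \<bullet> h) powr q)) * indicator (ball 0 s) x) <= enn (norm h powr q) * en q (ball 0 R) D"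
proof -
 have K: "en q (ball 0 s) (%x. D (x + t *R h) - 0 *R D x) <= en q (ball 0 R) D" if "0 <= t" "t <= 1" for t :: real
 proof -
  have "norm (t *R h) <= 1 * norm h" unfolding norm_scaleR using that by (intro mult_right_mono) auto
  then show ?thesis using en_translate_le[of D "t *R h" s R q] h by simp
 qed
 show "en q (ball 0 s) (lavg D h) <= enn (norm h powr q) * en q (ball 0 R) D"
  and "(NN x. (NN t. indicator {0..1} t * enn (abs (D (x + t *R h) \<bullet> h) powr q)) * indicator (ball 0 s) x) <= enn (norm h powr q) * en q (ball 0 R) D"
  using segment_average_le[where c=0 and h=h and D=D and S="ball 0 s" and q=q and K="en q (ball 0 R) D"] K q by (simp_all add: lavg_def[abs_def])
qed

lemma lavg_c1:
 assumes c: "c1 psi psi'" shows "psi (x + h) - psi x = lavg psi' h x" "integrable lborel (%t. indicator {0..1} t * (psi' (x + t *R h) \<bullet> h))"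
proof -
 have cont: "continuous_on UNIV (%t::real. psi' (x + t *R h) \<bullet> h)"
  by (intro continuous_intros continuous_on_compose2[OF c1_continuous(2)[OF c, of UNIV]]) auto
 have der: "((%t. psi (x + t *R h)) has_real_derivative (psi' (x + t *R h) \<bullet> h)) (at t)" for t :: real
 proof -
  have "((%t::real. x + t *R h) has_derivative (%s. s *R h)) (at t)" by (auto intro!: derivative_eq_intros)
  from diff_chain_at[OF this c1_D[OF c]]
  show ?thesis by (simp add: o_def has_field_derivative_def mult.commute[of _ "psi' (x + t *R h) \<bullet> h"] fun_eq_iff)
 qed
 have "(LBINT t. (psi' (x + t *R h) \<bullet> h) * indicator {0..1} t) = psi (x + 1 *R h) - psi (x + 0 *R h)"
  using der cont by (intro integral_FTC_Icc_real) (auto simp: continuous_on_eq_continuous_at)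
 then show "psi (x + h) - psi x = lavg psi' h x" by (simp add: lavg_def mult.commute)
 have "integrable lborel (%t. indicator {0..1} t *R (psi' (x + t *R h) \<bullet> h))"
  using borel_integrable_compact[of "{0..1::real}" "%t. psi' (x + t *R h) \<bullet> h"] continuous_on_subset[OF cont] by simp
 then show "integrable lborel (%t. indicator {0..1} t * (psi' (x + t *R h) \<bullet> h))" by simp
qed

lemma lavg_AE_integrable:
 fixes D :: "'a::euclidean_space => 'a"
 assumes [measurable]: "meas D" and q: "q > 1" and h: "norm h + s <= R" and fin: "en q (ball 0 R) D < oo"
 shows "AE x in lborel. x \<in> ball 0 s --> integrable lborel (%t. indicator {0..1} t * (D (x + t *R h) \<bullet> h))"
proof -
 have "(NN x. (NN t. indicator {0..1} t * enn (abs (D (x + t *R h) \<bullet> h) powr q)) * indicator (ball 0 s) x)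
  <= enn (norm h powr q) * en q (ball 0 R) D" by (rule lavg_le(2)[OF _ q h]) simp
 also have "... < oo" using fin by (simp add: ennreal_mult_less_top)
 finally have "AE x in lborel. (NN t. indicator {0..1} t * enn (abs (D (x + t *R h) \<bullet> h) powr q)) * indicator (ball 0 s) x ~= oo"
  by (intro nn_integral_PInf_AE) auto
 then show ?thesis
 proof eventually_elim
  case (elim x)
  show ?case
  proof
   assume "x \<in> ball 0 s"
   then have "(NN t. indicator {0..1} t * enn (abs (D (x + t *R h) \<bullet> h) powr q)) < oo" using elim by (simp add: less_top)
   then show "integrable lborel (%t. indicator {0..1} t * (D (x + t *R h) \<bullet> h))" using segment_average_pointwise(2)[OF _ q, of D x h 0] by simp
  qed
 qed
qed

text \<open>The fundamental theorem of calculus for the approximants: both sides are continuous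
  under the convergence that defines \<open>sob\<close>, so their difference has energy 0.\<close>

lemma sob_lavg:
 fixes u :: "'a::euclidean_space => real"
 assumes s: "sob p (ball 0 R) u D" and p: "p > 1" and h: "norm h + s <= R"
 shows "AE x in lborel. x \<in> ball 0 s --> u (x + h) - u x = lavg D h x"
proof (rule sobE[OF s])
 note sob_borel[OF s, measurable]
 fix psi psi' assume c: "!!k. c1 (psi k) (psi' k)" and l: "Lp_tendsto p (ball 0 R) psi u"
  "Lp_tendsto p (ball 0 R) psi' D"
 note c1_borel[OF c, measurable]
 have p0: "0 <= p" using p by simp
 have sR: "s <= R" using h norm_ge_zero[of h] by linarith
 have 1: "(%k. en p (ball 0 s) (%x. lavg D h x - (psi k (x + h) - psi k x))) ---> 0"
 proof (rule en_tendsto_squeeze[OF _ l(2)])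
  fix k
  have "en p (ball 0 s) (%x. lavg D h x - (psi k (x + h) - psi k x)) = en p (ball 0 s) (lavg (%x. psi' k x - D x) h)"
  proof (rule en_cong_AE, use lavg_AE_integrable[OF sob_borel(2)[OF s] p h sob_finite(2)[OF s]] in eventually_elim)
   fix x assume e: "x \<in> ball 0 s --> integrable lborel (%t. indicator {0..1} t * (D (x + t *R h) \<bullet> h))"
   show "x \<in> ball 0 s --> norm (lavg D h x - (psi k (x + h) - psi k x)) = norm (lavg (%x. psi' k x - D x) h x)"
   proof
   assume "x \<in> ball 0 s"
   with e have i: "integrable lborel (%t. indicator {0..1} t * (D (x + t *R h) \<bullet> h))" by simp
   have "lavg (%x. psi' k x - D x) h x = (LBINT t. indicator {0..1} t * (psi' k (x + t *R h) \<bullet> h) - indicator {0..1} t * (D (x + t *R h) \<bullet> h))"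
   unfolding lavg_def by (intro Bochner_Integration.integral_cong refl) (simp add: inner_diff_left right_diff_distrib)
   also have "... = lavg (psi' k) h x - lavg D h x" unfolding lavg_def by (rule Bochner_Integration.integral_diff[OF lavg_c1(2)[OF c] i])
   finally show "norm (lavg D h x - (psi k (x + h) - psi k x)) = norm (lavg (%x. psi' k x - D x) h x)" by (simp add: lavg_c1(1)[OF c] abs_minus_commute)
   qed
  qed
  also have "... <= enn (norm h powr p) * en p (ball 0 R) (%x. psi' k x - D x)" by (rule lavg_le(1)[OF _ p h]) simp
  finally show "en p (ball 0 s) (%x. lavg D h x - (psi k (x + h) - psi k x)) <= enn (norm h powr p) * en p (ball 0 R) (%x. psi' k x - D x)" .
 qed
 have sub: "{x. x - h \<in> ball 0 s} \<subseteq> ball 0 R"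
 proof
  fix x assume "x \<in> {x. x - h \<in> ball 0 s}"
  then show "x \<in> ball 0 R" using h norm_triangle_sub[of x h] by simp
 qed
 have 2: "(%k. en p (ball 0 s) (%x. u (x + h) - psi k (x + h))) ---> 0"
 proof (rule en_tendsto_squeeze[where C=1, OF _ l(1)])
  fix k
  have "en p (ball 0 s) (%x. u (x + h) - psi k (x + h)) = en p (ball 0 s) (%x. psi k (x + h) - u (x + h))" by (rule en_diff_commute)
  also have "... = en p {x. x - h \<in> ball 0 s} (%x. psi k x - u x)" by (rule en_translate) auto
  also have "... <= en p (ball 0 R) (%x. psi k x - u x)" by (rule en_mono_set[OF sub])
  finally show "en p (ball 0 s) (%x. u (x + h) - psi k (x + h)) <= enn 1 * en p (ball 0 R) (%x. psi k x - u x)" by simp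
 qed
 have 3: "Lp_tendsto p (ball 0 s) psi u" by (rule en_tendsto_squeeze[where C=1, OF _ l(1)]) (simp add: en_mono_set subset_ball[OF sR])
 have 4: "(%k. en p (ball 0 s) (%x. (lavg D h x - (psi k (x + h) - psi k x)) - (u (x + h) - psi k (x + h)))) ---> 0"
  using en_add_tendsto[OF _ _ _ p0 1, of "%k x. - (u (x + h) - psi k (x + h))"] 2 by (simp add: en_minus en_diff_commute)
 have "(%k. en p (ball 0 s) (%x. ((lavg D h x - (psi k (x + h) - psi k x)) - (u (x + h) - psi k (x + h))) + (-(psi k x - u x)))) ---> 0"
  by (rule en_add_tendsto[OF _ _ _ p0 4]) (use 3 in \<open>simp_all only: en_minus\<close>, simp_all)
 then have "(%k::nat. en p (ball 0 s) (%x. lavg D h x - (u (x + h) - u x))) ---> 0" by (simp add: algebra_simps)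
 then have "en p (ball 0 s) (%x. lavg D h x - (u (x + h) - u x)) = 0" by (simp add: LIMSEQ_const_iff)
 then have "AE x in lborel. enn (norm (lavg D h x - (u (x + h) - u x)) powr p) * indicator (ball 0 s) x = 0"
  unfolding en_def by (subst (asm) nn_integral_0_iff_AE) auto
 then show ?thesis
 proof eventually_elim
  case (elim x)
  then show ?case by (auto simp: indicator_def split: if_splits)
 qed
qed

text \<open>The identity \<open>sob_lavg\<close> holds a.e. and may therefore be integrated with an
  exponent q other than the exponent p of the approximation. The gain of integrability relies on
  this freedom.\<close>

lemma sob_diff_le:
 fixes u :: "'a::euclidean_space => real"
 assumes s: "sob p (ball 0 R) u D" and p: "p > 1" and h: "norm h + s <= R" and q: "q > 1"
 shows "en q (ball 0 s) (%x. u (x + h) - u x) <= enn (norm h powr q) * en q (ball 0 R) D"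
proof -
 have "en q (ball 0 s) (%x. u (x + h) - u x) = en q (ball 0 s) (lavg D h)" by (rule en_cong_AE) (use sob_lavg[OF s p h] in \<open>eventually_elim, simp\<close>)
 also have "... <= enn (norm h powr q) * en q (ball 0 R) D" by (rule lavg_le(1)[OF sob_borel(2)[OF s] q h])
 finally show ?thesis .
qed

lemma c1_sob:
 fixes psi :: "'a::euclidean_space => real"
 assumes c: "c1 psi psi'" and p: "p > 0" shows "sob p (ball 0 R) psi psi'"
proof -
 have fin: "en p (ball 0 R) f < oo" if f: "continuous_on UNIV f" for f :: "'a => 'b::euclidean_space"
 proof -
  have "compact (f ` cball 0 R)" by (intro compact_continuous_image continuous_on_subset[OF f]) auto
  then obtain B where B: "ALL y:f ` cball 0 R. norm y <= B" using compact_imp_bounded bounded_pos by metis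
  have "en p (ball 0 R) f <= (\<integral>\<^sup>+x. enn (B powr p) * indicator (ball 0 R) x \<partial>(lborel :: 'a measure))" unfolding en_def
  proof (intro nn_integral_mono)
   fix x
   show "enn (norm (f x) powr p) * indicator (ball 0 R) x <= enn (B powr p) * indicator (ball 0 R) x"
   proof (cases "x \<in> ball 0 R")
   case True
   then have "norm (f x) <= B" using B by auto
   then show ?thesis using True p by (auto intro!: ennreal_leI powr_mono2)
   qed simp
  qed
  also have "... = enn (B powr p) * emeasure lborel (ball (0::'a) R)" by (rule nn_integral_cmult_indicator) simp
  also have "... < oo" using emeasure_lborel_ball_finite[of "0::'a" R] by (simp add: ennreal_mult_less_top)
  finally show ?thesis .
 qed
 show ?thesis unfolding sob_def using c1_borel[OF c] fin[OF c1_continuous(1)[OF c]] fin[OF c1_continuous(2)[OF c]] c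
  by (intro conjI exI[of _ "%k. psi"] exI[of _ "%k. psi'"]) (auto simp: en_def)
qed

lemma tcont_delta:
 fixes f :: "'a::euclidean_space => 'b::euclidean_space"
 assumes f: "tcont p f" and e: "ep > 0"
 shows "EX d>0. ALL z. norm z < d --> en p UNIV (%x. f (x + z) - f x) <= enn ep"
proof (rule ccontr)
 assume "\<not> ?thesis"
 then have "ALL n. EX z. norm z < 1 / real (Suc n) & \<not> en p UNIV (%x. f (x + z) - f x) <= enn ep" by (metis of_nat_0_less_iff zero_less_Suc zero_less_divide_1_iff)
 then obtain h where h: "!!n. norm (h n) < 1 / real (Suc n)" "!!n. \<not> en p UNIV (%x. f (x + h n) - f x) <= enn ep" by metis
 have "(%n. 1 / real (Suc n)) ---> 0" using LIMSEQ_inverse_real_of_nat by (simp add: inverse_eq_divide)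
 then have "h ---> 0" by (rule Lim_null_comparison[OF always_eventually[OF allI[OF less_imp_le[OF h(1)]]]])
 then have "(%n. en p UNIV (%x. f (x + h n) - f x)) ---> 0" using f by (simp add: tcont_def)
 from order_tendstoD(2)[OF this, of "enn ep"] have "EX n. en p UNIV (%x. f (x + h n) - f x) < enn ep" using e by (auto dest: eventually_happens)
 then show False using h(2) by (meson less_imp_le)
qed

text \<open>By \<open>sob_lavg\<close> the error is 1/t times the segment mean of the inner product
  of D(x + r h) - D(x) with h = t e, which is small by continuity of translations.\<close>

lemma sob_diffquot:
 fixes u :: "'a::euclidean_space => real"
 assumes s: "sob p (ball 0 R) u D" and p: "p > 1" and sR: "s < R" and e: "norm e = 1"
  and t: "!!j. 0 < t j" "t ---> 0" "!!j. t j + s <= R"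
 shows "(%j. en p (ball 0 s) (%x. (u (x + t j *R e) - u x) / t j - D x \<bullet> e)) ---> 0"
proof (rule ennreal_tendsto_0I)
 note sob_borel[OF s, measurable]
 fix ep :: real assume eps: "ep > 0"
 have p0: "0 < p" using p by simp
 \<comment> \<open>Extension by zero, so that continuity of translations on the whole space applies.
   For x in the smaller ball and short h both arguments lie in the ball of radius R, where nothing
   changes.\<close>
 define D0 where "D0 x = (if x \<in> ball 0 R then D x else 0)" for x
 have [measurable]: "meas D0" unfolding D0_def by measurable
 have "en p UNIV D0 = en p (ball 0 R) D" unfolding en_def using p0 by (intro nn_integral_cong) (auto simp: D0_def indicator_def)
 then have "tcont p D0" using sob_finite(2)[OF s] p0 by (intro en_translation_continuous) auto
 then obtain d where d: "d > 0" "!!z. norm z < d ==> en p UNIV (%x. D0 (x + z) - D0 x) <= enn ep" using tcont_delta eps by blast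
 have "eventually (%j. t j < d) sequentially" using t(2) d(1) by (rule order_tendstoD(2))
 then show "eventually (%j. en p (ball 0 s) (%x. (u (x + t j *R e) - u x) / t j - D x \<bullet> e) <= enn ep) sequentially"
 proof eventually_elim
  case (elim j)
  define h where "h = t j *R e"
  have nh: "norm h = t j" using t(1)[of j] e by (simp add: h_def)
  have hs: "norm h + s <= R" using t(3)[of j] nh by simp
  define G where "G x = (LBINT r. indicator {0..1} r * ((D (x + r *R h) - 1 *R D x) \<bullet> h))" for x
  have [measurable]: "meas G" unfolding G_def by measurable
  have "en p (ball 0 s) G <= enn (norm h powr p) * enn ep" unfolding G_def
  proof (rule segment_average_le(2)[OF _ _ p])
   fix r :: real assume r: "0 <= r" "r <= 1"
   have rh: "norm (r *R h) <= norm h" using r by (simp add: mult_left_le_one_le)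
   have "en p (ball 0 s) (%x. D (x + r *R h) - 1 *R D x) = en p (ball 0 s) (%x. D0 (x + r *R h) - D0 x)"
   proof (rule en_cong)
   fix x :: 'a assume "x \<in> ball 0 s"
   then have "x \<in> ball 0 R" "x + r *R h \<in> ball 0 R" using sR rh hs norm_triangle_ineq[of x "r *R h"] by auto
   then show "norm (D (x + r *R h) - 1 *R D x) = norm (D0 (x + r *R h) - D0 x)" by (simp add: D0_def)
   qed
   also have "... <= en p UNIV (%x. D0 (x + r *R h) - D0 x)" by (rule en_mono_set) simp
   also have "... <= enn ep" using rh elim nh by (intro d(2)) simp
   finally show "en p (ball 0 s) (%x. D (x + r *R h) - 1 *R D x) <= enn ep" .
  qed auto
  moreover have "en p (ball 0 s) (%x. (u (x + t j *R e) - u x) / t j - D x \<bullet> e) = en p (ball 0 s) (%x. (1 / t j) *R G x)"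
  proof (rule en_cong_AE, use sob_lavg[OF s p hs] lavg_AE_integrable[OF sob_borel(2)[OF s] p hs sob_finite(2)[OF s]] in eventually_elim)
   case (elim x)
   show ?case
   proof
   assume "x \<in> ball 0 s"
   then have "G x = (u (x + h) - u x) - D x \<bullet> h" using elim unfolding G_def by (simp add: lavg_def inner_diff_left right_diff_distrib)
   then have "(1 / t j) *R G x = (u (x + t j *R e) - u x) / t j - D x \<bullet> e" using t(1)[of j] by (simp add: h_def diff_divide_distrib)
   then show "norm ((u (x + t j *R e) - u x) / t j - D x \<bullet> e) = norm ((1 / t j) *R G x)" by simp
   qed
  qed
  moreover have "... = enn ((1 / t j) powr p) * en p (ball 0 s) G" using t(1)[of j] by (subst en_scaleR) auto
  moreover have "enn ((1 / t j) powr p) * (enn (norm h powr p) * enn ep) = enn ep"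
   using t(1)[of j] eps by (simp add: ennreal_mult[symmetric] nh powr_divide)
  ultimately show ?case by (metis mult_left_mono zero_le)
 qed
qed

section \<open>Averages over balls and the Poincare inequality\<close>

definition ball_kernel :: "real => 'a::euclidean_space => real" where
 "ball_kernel t z = indicator (ball 0 t) z / measure lborel (ball (0::'a) t)"

lemma emeasure_ball_eq: "emeasure lborel (ball (x::'a::euclidean_space) t) = enn (measure lborel (ball x t))"
 using emeasure_lborel_ball_finite[of x t] by (intro emeasure_eq_ennreal_measure) auto

lemma measure_ball_eq:
 "t > 0 ==> measure lborel (ball (x::'a::euclidean_space) t) = t ^ DIM('a) * measure lborel (ball (0::'a) 1)" using content_ball_conv_unit_ball[of t x] by simp

lemma ball_kernel_props:
 assumes t: "t > 0"
 shows "ball_kernel t \<in> borel_measurable (borel :: 'a::euclidean_space measure)" "!!z::'a. ball_kernel t z >= 0"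
  "(\<integral>\<^sup>+z. enn (ball_kernel t z) \<partial>(lborel :: 'a measure)) = 1"
proof -
 show "ball_kernel t \<in> borel_measurable (borel :: 'a measure)" unfolding ball_kernel_def[abs_def] by measurable
 show "ball_kernel t z >= 0" for z :: 'a by (simp add: ball_kernel_def)
 have pos: "measure lborel (ball (0::'a) t) > 0" using t by (rule content_ball_pos)
 have "(\<integral>\<^sup>+z. enn (ball_kernel t z) \<partial>(lborel :: 'a measure)) = (\<integral>\<^sup>+z. enn (1 / measure lborel (ball (0::'a) t)) * indicator (ball 0 t) z \<partial>(lborel :: 'a measure))"
  by (intro nn_integral_cong) (simp add: ball_kernel_def indicator_def)
 also have "... = enn (1 / measure lborel (ball (0::'a) t)) * emeasure lborel (ball (0::'a) t)" by (rule nn_integral_cmult_indicator) simp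
 also have "... = 1" using pos by (simp add: emeasure_ball_eq ennreal_mult'[symmetric])
 finally show "(\<integral>\<^sup>+z. enn (ball_kernel t z) \<partial>(lborel :: 'a measure)) = 1" .
qed

text \<open>At index 0 the dilation factor of \<open>moll\<close> is 1, so this is the plain mean
  over the ball of radius t.\<close>

definition bavg :: "real => ('a::euclidean_space => 'b::euclidean_space) => 'a => 'b" where
 "bavg t f = moll (ball_kernel t) 0 f"

lemma bavg_measurable[measurable]:
 assumes "t > 0" "meas f" shows "meas (bavg t f)" unfolding bavg_def using assms by (intro moll_measurable ball_kernel_props)

text \<open>Jensen takes the power inside the mean, and Fubini leaves a mean over shifts z of
  quantities bounded by K.\<close>

lemma bavg_diff_le:
 fixes f :: "'a::euclidean_space => 'b::euclidean_space"
 assumes t: "t > 0" and [measurable]: "meas f" "S \<in> sets borel" and q: "q > 1"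
  and K: "!!z. norm z < t ==> en q S (%x. f (x + z) - f x) <= K"
 shows "en q S (%x. f x - bavg t f x) <= K"
proof -
 note ball_kernel_props(1)[OF t, measurable]
 have "en q S (%x. f x - bavg t f x) = en q S (%x. bavg t f x - f x)" by (rule en_diff_commute)
 also have "... <= (NN x. (NN z. enn (ball_kernel t z) * enn (norm (f (x - z) - f x) powr q)) * indicator S x)" unfolding en_def
 proof (intro nn_integral_mono mult_right_mono)
  fix x
  show "enn (norm (bavg t f x - f x) powr q) <= (NN z. enn (ball_kernel t z) * enn (norm (f (x - z) - f x) powr q))"
   using moll_minus_le[OF ball_kernel_props[OF t] _ q, of f 0 x] by (simp add: bavg_def)
 qed simp
 also have "... = (NN x. (NN z. enn (ball_kernel t z) * enn (norm (f (x - z) - f x) powr q) * indicator S x))"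
  by (intro nn_integral_cong) (subst nn_integral_multc, auto)
 also have "... = (NN z. (NN x. enn (ball_kernel t z) * enn (norm (f (x - z) - f x) powr q) * indicator S x))" by (rule lborel_pair.Fubini') measurable
 also have "... <= (\<integral>\<^sup>+z. enn (ball_kernel t z) * K \<partial>(lborel :: 'a measure))"
 proof (intro nn_integral_mono)
  fix z :: 'a
  have "(NN x. enn (ball_kernel t z) * enn (norm (f (x - z) - f x) powr q) * indicator S x)
   = enn (ball_kernel t z) * en q S (%x. f (x + (- z)) - f x)" unfolding en_def mult.assoc by (subst nn_integral_cmult) auto
  also have "... <= enn (ball_kernel t z) * K"
  proof (cases "norm z < t")
   case True then show ?thesis by (intro mult_left_mono K) auto
  next
   case False then show ?thesis by (simp add: ball_kernel_def)
  qed
  finally show "(NN x. enn (ball_kernel t z) * enn (norm (f (x - z) - f x) powr q) * indicator S x) <= enn (ball_kernel t z) * K" .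
 qed
 also have "... = K" using ball_kernel_props(3)[OF t, where 'a='a] by (subst nn_integral_multc) auto
 finally show ?thesis .
qed

text \<open>Turns an energy into a pointwise bound. The volume of the ball, of order t^N, is what
  links the scale of averaging to the height of level sets later on.\<close>

lemma bavg_bound:
 fixes f :: "'a::euclidean_space => 'b::euclidean_space"
 assumes t: "t > 0" and [measurable]: "meas f" and q: "q > 1"
 shows "enn (norm (bavg t f x) powr q) <= enn (1 / measure lborel (ball (0::'a) t)) * en q (ball x t) f"
proof -
 note ball_kernel_props(1)[OF t, measurable]
 define P where "P = density lborel (%z::'a. enn (ball_kernel t z))"
 have P: "prob_space P" unfolding P_def by (rule prob_space_density_lborel) (use ball_kernel_props[OF t] in auto)
 have sP[measurable_cong]: "sets P = sets borel" by (simp add: P_def)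
 define g where "g z = f (x - z)" for z
 have [measurable]: "meas g" unfolding g_def by measurable
 have "bavg t f x = (\<integral>z. g z \<partial>P)" unfolding P_def bavg_def moll_def by (subst integral_density) (auto simp: ball_kernel_props[OF t] g_def)
 then have "enn (norm (bavg t f x) powr q) <= (\<integral>\<^sup>+z. enn (norm (g z) powr q) \<partial>P)" using jensen_powr(1)[OF P _ q, of g] by simp
 also have "... = (NN z. enn (ball_kernel t z) * enn (norm (f (x - z)) powr q))" unfolding P_def g_def by (subst nn_integral_density) auto
 also have "... = (NN z. enn (1 / measure lborel (ball (0::'a) t)) * (enn (norm (f (x - z)) powr q) * indicator (ball 0 t) z))"
  by (intro nn_integral_cong) (auto simp: ball_kernel_def indicator_def)
 also have "... = enn (1 / measure lborel (ball (0::'a) t)) * (NN z. enn (norm (f (x - z)) powr q) * indicator (ball 0 t) z)"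
  by (rule nn_integral_cmult) simp
 also have "(NN z. enn (norm (f (x - z)) powr q) * indicator (ball 0 t) z) = en q (ball x t) f"
 proof -
  have "en q (ball x t) f = (\<integral>\<^sup>+z. enn (norm (f z) powr q) * indicator (ball x t) z \<partial>density (distr lborel borel (%z. x + (-1) *R z)) (%_. enn (abs (-1)^DIM('a))))"
   unfolding en_def using lborel_affine[of "-1" x] by simp
  also have "... = (NN z. enn (norm (f (x - z)) powr q) * indicator (ball x t) (x - z))" by (subst nn_integral_density) (auto simp: nn_integral_distr)
  also have "... = (NN z. enn (norm (f (x - z)) powr q) * indicator (ball 0 t) z)" by (intro nn_integral_cong) (auto simp: indicator_def dist_norm)
  finally show ?thesis ..
 qed
 finally show ?thesis .
qed

text \<open>\<open>c\<close> is the mean of u over the ball. By Jensen |u(x) - c|^p is at most the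
  mean of |u(x + h) - u(x)|^p over shifts of length below 2 rho, and the segments stay in the triple
  ball. The factor 2^N is the volume ratio between the ball of shifts and the averaging
  ball.\<close>

lemma poincare:
 fixes u :: "'a::euclidean_space => real"
 assumes s: "sob p (ball 0 (3 * rho)) u D" and p: "p > 1" and rho: "rho > 0"
 shows "EX c. en p (ball 0 rho) (%x. u x - c) <= enn (2 ^ DIM('a) * (2 * rho) powr p) * en p (ball 0 (3 * rho)) D"
proof -
 note sob_borel[OF s, measurable] ball_kernel_props(1)[OF rho, measurable]
 define m where "m = measure lborel (ball (0::'a) rho)"
 have m: "m > 0" using rho by (simp add: m_def content_ball_pos)
 let ?I = "%x h. enn (1/m) * indicator (ball 0 (2*rho)) h * (enn (norm (u (x + h) - u x) powr p) * indicator (ball 0 rho) x)"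
 let ?K = "enn ((2*rho) powr p) * en p (ball 0 (3*rho)) D"
 let ?J = "%x h. enn (ball_kernel rho (h + x)) * enn (norm (u (h + x) - u x) powr p)"
 define P where "P = density lborel (%z::'a. enn (ball_kernel rho z))"
 have P: "prob_space P" unfolding P_def by (rule prob_space_density_lborel) (use ball_kernel_props[OF rho] in auto)
 interpret P: prob_space P by (rule P)
 have sP[measurable_cong]: "sets P = sets borel" by (simp add: P_def)
 define c where "c = (\<integral>y. u y \<partial>P)"
 have ke: "(\<integral>\<^sup>+y. enn (norm (u y) powr p) \<partial>P) < oo"
 proof -
  have "(\<integral>\<^sup>+y. enn (norm (u y) powr p) \<partial>P) = (NN y. enn (1/m) * (enn (norm (u y) powr p) * indicator (ball 0 rho) y))"
   unfolding P_def by (subst nn_integral_density) (auto simp: ball_kernel_def indicator_def m_def intro!: nn_integral_cong)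
  also have "... = enn (1/m) * en p (ball 0 rho) u" unfolding en_def by (rule nn_integral_cmult) simp
  also have "... <= enn (1/m) * en p (ball 0 (3 * rho)) u" using rho by (intro mult_left_mono en_mono_set subset_ball) auto
  also have "... < oo" using sob_finite[OF s] by (auto simp: ennreal_mult_less_top)
  finally show ?thesis .
 qed
 have ui: "integrable P u" by (rule jensen_powr(2)[OF P _ p ke]) simp
 have pt: "enn (norm (u x - c) powr p) <= (NN h. ?J x h)" for x
 proof -
  have "c - u x = (\<integral>y. u y - u x \<partial>P)" using ui by (simp add: c_def P.prob_space)
  then have "enn (norm (u x - c) powr p) = enn (norm (\<integral>y. u y - u x \<partial>P) powr p)" by (simp add: abs_minus_commute)
  also have "... <= (\<integral>\<^sup>+y. enn (norm (u y - u x) powr p) \<partial>P)" by (rule jensen_powr(1)[OF P _ p]) simp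
  also have "... = (NN y. enn (ball_kernel rho y) * enn (norm (u y - u x) powr p))" unfolding P_def by (subst nn_integral_density) auto
  also have "... = (NN h. ?J x h)" by (subst nn_integral_translate[where h=x, symmetric]) auto
  finally show ?thesis .
 qed
 have "en p (ball 0 rho) (%x. u x - c) <= (NN x. (NN h. ?I x h))" unfolding en_def
 proof (intro nn_integral_mono)
  fix x
  show "enn (norm (u x - c) powr p) * indicator (ball 0 rho) x
   <= (NN h. ?I x h)"
  proof (cases "x \<in> ball 0 rho")
   case True
   have "enn (norm (u x - c) powr p) <= (NN h. ?J x h)" by (rule pt)
   also have "... <= (NN h. ?I x h)"
   proof (intro nn_integral_mono)
   fix h
   have "h + x \<in> ball 0 rho ==> h \<in> ball 0 (2*rho)" using True norm_triangle_ineq4[of "h + x" x] by simp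
   then show "?J x h
   <= ?I x h" using True by (auto simp: ball_kernel_def indicator_def m_def add.commute)
   qed
   finally show ?thesis using True by simp
  qed simp
 qed
 also have "... = (NN h. (NN x. ?I x h))" by (rule lborel_pair.Fubini') measurable
 also have "... = (NN h. enn (1/m) * indicator (ball 0 (2*rho)) h * en p (ball 0 rho) (%x. u (x + h) - u x))"
  unfolding en_def by (intro nn_integral_cong nn_integral_cmult) auto
 also have "... <= (\<integral>\<^sup>+h. enn (1/m) * (?K) * indicator (ball 0 (2*rho)) h \<partial>(lborel :: 'a measure))"
 proof (intro nn_integral_mono)
  fix h :: 'a
  show "enn (1/m) * indicator (ball 0 (2*rho)) h * en p (ball 0 rho) (%x. u (x + h) - u x) <= enn (1/m) * (?K) * indicator (ball 0 (2*rho)) h"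
  proof (cases "h \<in> ball 0 (2*rho)")
   case True
   have "en p (ball 0 rho) (%x. u (x + h) - u x) <= enn (norm h powr p) * en p (ball 0 (3*rho)) D" using True by (intro sob_diff_le[OF s p _ p]) simp
   also have "... <= ?K" using True p by (intro mult_right_mono ennreal_leI powr_mono2) auto
   finally show ?thesis using True by (simp add: mult_left_mono)
  qed simp
 qed
 also have "... = enn (1/m) * (?K) * emeasure lborel (ball (0::'a) (2*rho))" by (rule nn_integral_cmult_indicator) simp
 also have "emeasure lborel (ball (0::'a) (2*rho)) = enn (2 ^ DIM('a) * m)"
  using rho measure_ball_eq[of "2*rho" "0::'a"] measure_ball_eq[of rho "0::'a"] by (simp add: emeasure_ball_eq m_def power_mult_distrib)
 also have "enn (1/m) * (?K) * enn (2 ^ DIM('a) * m)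
  = (enn (1/m) * enn (2 ^ DIM('a) * m)) * enn ((2*rho) powr p) * en p (ball 0 (3*rho)) D" by (simp add: mult_ac)
 also have "enn (1/m) * enn (2 ^ DIM('a) * m) = enn (2 ^ DIM('a))" using m by (simp add: ennreal_mult'[symmetric])
 also have "enn (2 ^ DIM('a)) * enn ((2*rho) powr p) = enn (2 ^ DIM('a) * (2*rho) powr p)" by (rule ennreal_mult[symmetric]) auto
 finally show ?thesis by blast
qed

section \<open>Interpolation over levels, a Sobolev inequality and the source term\<close>

lemma two_pow_powr: "(2 ^ k) powr a = (2 powr a) ^ k" for a :: real
 by (simp add: powr_realpow[symmetric] powr_powr mult.commute)

text \<open>A real interpolation argument with one decomposition per dyadic level replaces the
 Sobolev and Besov embeddings.\<close>

lemma en_by_levels: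
 fixes g :: "'a::euclidean_space => 'c::euclidean_space" and b :: "nat => 'a => 'b::euclidean_space"
 assumes [measurable]: "meas g" "S \<in> sets borel" "!!k. meas (b k)"
  and p: "p > 0" and Q: "Q > 0" and L: "L > 0" and C: "C >= 0" and si: "Q - p < si"
  and lev: "!!k x. x \<in> S ==> L * 2 ^ k < norm (g x) ==> norm (g x) <= L * 2 ^ Suc k ==> norm (g x) <= 2 * norm (b k x)"
  and bk: "!!k. en p S (b k) <= enn (C * (2 powr (- si)) ^ k)"
 shows "en Q S g <= enn (L powr Q) * emeasure lborel S + enn (C * (L powr (Q - p) * 2 powr (Q + p) / (1 - 2 powr (Q - p - si))))"
proof -
 define c where "c k = L powr (Q - p) * 2 powr (Q + p) * (2 powr (Q - p)) ^ k" for k :: nat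
 have c0: "c k >= 0" for k by (simp add: c_def)
 have pt: "enn (norm (g x) powr Q) * indicator S x <= enn (L powr Q) * indicator S x + (\<Sum>k. enn (c k) * (enn (norm (b k x) powr p) * indicator S x))" for x
 proof (cases "x \<in> S & norm (g x) > L")
  case True
  define n where "n = (LEAST n. norm (g x) <= L * 2 ^ n)"
  obtain n0 where n0: "norm (g x) / L < 2 ^ n0" using real_arch_pow[of 2 "norm (g x) / L"] by auto
  have "norm (g x) <= L * 2 ^ n0" using n0 L by (simp add: field_simps)
  then have n: "norm (g x) <= L * 2 ^ n" unfolding n_def by (rule LeastI)
  have "n ~= 0" using n True L by (cases n) auto
  then obtain k where k: "n = Suc k" by (cases n) auto
  have "\<not> norm (g x) <= L * 2 ^ k" using not_less_Least[of k "%n. norm (g x) <= L * 2 ^ n"] k by (simp add: n_def)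
  then have gk: "L * 2 ^ k < norm (g x)" by simp
  have gb: "norm (g x) <= 2 * norm (b k x)" using lev[of x k] True gk n k by auto
  define lk where "lk = L * 2 ^ k"
  have lk: "lk > 0" using L by (simp add: lk_def)
  \<comment> \<open>On the level k both |g| and |b_k| are comparable with or above
    \<open>lk\<close>; inserting a factor that is at least 1 trades the power Q of g for the power p
    of b_k at the price \<open>lk\<close> to the Q - p.\<close>
  have "norm (g x) powr Q <= (2 * lk) powr Q * 1" using n k Q by (auto simp: lk_def intro!: powr_mono2)
  also have "... <= (2 * lk) powr Q * (2 * norm (b k x) / lk) powr p"
  proof (intro mult_left_mono)
   have "1 <= 2 * norm (b k x) / lk" using gb gk lk by (simp add: lk_def field_simps)
   then show "1 <= (2 * norm (b k x) / lk) powr p" using p by (simp add: ge_one_powr_ge_zero)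
  qed simp
  also have "... = 2 powr Q * 2 powr p * (lk powr Q / lk powr p) * norm (b k x) powr p" using lk by (simp add: powr_mult powr_divide)
  also have "lk powr Q / lk powr p = L powr (Q - p) * (2 powr (Q - p)) ^ k"
  proof -
   have "lk powr Q / lk powr p = lk powr (Q - p)" by (simp add: powr_diff)
   also have "... = L powr (Q - p) * (2 ^ k) powr (Q - p)" using L by (simp add: lk_def powr_mult)
   finally show ?thesis by (simp only: two_pow_powr)
  qed
  finally have "norm (g x) powr Q <= c k * norm (b k x) powr p" by (simp add: c_def powr_add mult_ac)
  then have "enn (norm (g x) powr Q) <= enn (c k) * enn (norm (b k x) powr p)" using c0 by (simp add: ennreal_mult'[symmetric] ennreal_leI)
  also have "... = (\<Sum>j\<in>{k}. enn (c j) * (enn (norm (b j x) powr p) * indicator S x))" using True by simp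
  also have "... <= (\<Sum>j. enn (c j) * (enn (norm (b j x) powr p) * indicator S x))" by (rule sum_le_suminf) auto
  finally show ?thesis using True by (simp add: add_increasing)
 next
  case False
  then show ?thesis using Q by (cases "x \<in> S") (auto intro!: add_increasing2 ennreal_leI powr_mono2 simp: not_less)
 qed
 \<comment> \<open>The weights of the levels grow like 2^((Q-p) k) and the energies of
   \<open>b k\<close> fall like 2^(-si k); the condition Q - p < si is exactly summability.\<close>
 have r: "0 <= 2 powr (Q - p - si)" "2 powr (Q - p - si) < (1::real)" using si by (auto simp: powr_less_one)
 have "en Q S g <= (NN x. enn (L powr Q) * indicator S x + (\<Sum>k. enn (c k) * (enn (norm (b k x) powr p) * indicator S x)))"
  unfolding en_def by (intro nn_integral_mono pt)
 also have "... = enn (L powr Q) * emeasure lborel S + (\<Sum>k. enn (c k) * en p S (b k))"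
  unfolding en_def by (subst nn_integral_add) (auto simp: nn_integral_cmult_indicator nn_integral_suminf nn_integral_cmult)
 also have "(\<Sum>k. enn (c k) * en p S (b k)) <= (\<Sum>k. enn (C * (L powr (Q - p) * 2 powr (Q + p)) * (2 powr (Q - p - si)) ^ k))"
 proof (rule suminf_le)
  fix k
  have "enn (c k) * en p S (b k) <= enn (c k) * enn (C * (2 powr (- si)) ^ k)" using bk by (intro mult_left_mono) auto
  also have "... = enn (c k * (C * (2 powr (- si)) ^ k))" using c0 C by (simp add: ennreal_mult)
  also have "c k * (C * (2 powr (- si)) ^ k) = C * (L powr (Q - p) * 2 powr (Q + p)) * (2 powr (Q - p - si)) ^ k"
  proof -
   have "(2 powr (Q - p - si)) ^ k = (2 powr (Q - p)) ^ k * (2 powr (- si)) ^ k" by (simp add: power_mult_distrib[symmetric] powr_add[symmetric])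
   then show ?thesis by (simp add: c_def mult_ac)
  qed
  finally show "enn (c k) * en p S (b k) <= enn (C * (L powr (Q - p) * 2 powr (Q + p)) * (2 powr (Q - p - si)) ^ k)" .
 qed auto
 also have "... = enn (C * (L powr (Q - p) * 2 powr (Q + p)) * (1 / (1 - 2 powr (Q - p - si))))"
 proof (rule suminf_ennreal_eq)
  show "(%k. C * (L powr (Q - p) * 2 powr (Q + p)) * (2 powr (Q - p - si)) ^ k) sums (C * (L powr (Q - p) * 2 powr (Q + p)) * (1 / (1 - 2 powr (Q - p - si))))"
   using r by (intro sums_mult geometric_sums) auto
 qed (use C in auto)
 finally show ?thesis by (simp add: add_left_mono mult.assoc)
qed

text \<open>If A exceeded the bound, then V < A/2, and A^(1-te) > 2 C would give C A^te < A/2,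
  against the hypothesis.\<close>

lemma absorb_sublinear:
 fixes A V C te :: real
 assumes "0 <= A" "A <= V + C * A powr te" "0 <= V" "0 < C" "0 <= te" "te < 1"
 shows "A <= 2 * V + (2 * C) powr (1 / (1 - te))"
proof (rule ccontr)
 assume n: "\<not> ?thesis"
 have A: "A > 0" "A > 2 * V" "A > (2 * C) powr (1 / (1 - te))"
  using n assms(3) powr_ge_zero[of "2 * C" "1 / (1 - te)"] powr_gt_zero[of "2 * C" "1 / (1 - te)"] assms(4) by linarith+
 have "2 * C = ((2 * C) powr (1 / (1 - te))) powr (1 - te)" using assms by (simp add: powr_powr)
 also have "... < A powr (1 - te)" using A assms by (intro powr_less_mono2) auto
 finally have "2 * C * A powr te < A powr (1 - te) * A powr te" using A by (intro mult_strict_right_mono) auto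
 also have "... = A" using A by (simp add: powr_add[symmetric])
 finally show False using A assms by linarith
qed

lemma c1c_translation_le:
 fixes psi :: "'a::euclidean_space => real"
 assumes c: "c1c 1 psi psi'" and p: "p > 1"
 shows "en p UNIV (%x. psi (x + h) - psi x) <= enn (norm h powr p) * en p UNIV psi'"
proof -
 have "en p UNIV (%x. psi (x + h) - psi x) = en p (ball 0 (1 + norm h)) (%x. psi (x + h) - psi x)" unfolding en_def
 proof (intro nn_integral_cong)
  fix x
  show "enn (norm (psi (x + h) - psi x) powr p) * indicator UNIV x = enn (norm (psi (x + h) - psi x) powr p) * indicator (ball 0 (1 + norm h)) x"
  proof (cases "x \<in> ball 0 (1 + norm h)")
   case False
   then have "1 + norm h <= norm x" by simp
   moreover have "0 <= norm h" "norm x - norm h <= norm (x + h)" using norm_triangle_ineq2[of x "- h"] by auto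
   ultimately have "1 <= norm x" "1 <= norm (x + h)" by linarith+
   then show ?thesis using c1c_outside[OF c] by simp
  qed simp
 qed
 also have "... <= enn (norm h powr p) * en p (ball 0 (1 + 2 * norm h)) psi'" using p by (intro sob_diff_le[OF c1_sob[OF c1c_c1[OF c]]]) auto
 also have "... <= enn (norm h powr p) * en p UNIV psi'" by (intro mult_left_mono en_mono_set) auto
 finally show ?thesis .
qed

text \<open>A shift by a vector of length 2 moves the unit ball off itself, so inside the ball the
  difference psi(x + 2 e) - psi(x) is just -psi(x).\<close>

lemma poincare_c1c:
 fixes psi :: "'a::euclidean_space => real"
 assumes c: "c1c 1 psi psi'" and p: "p > 1"
 shows "en p UNIV psi <= enn (2 powr p) * en p UNIV psi'"
proof -
 obtain e :: 'a where e: "norm e = 1" using vector_choose_size[of 1] by auto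
 have "en p UNIV psi <= en p UNIV (%x. psi (x + 2 *R e) - psi x)" unfolding en_def
 proof (intro nn_integral_mono)
  fix x
  show "enn (norm (psi x) powr p) * indicator UNIV x <= enn (norm (psi (x + 2 *R e) - psi x) powr p) * indicator UNIV x"
  proof (cases "norm x < 1")
   case True
   then have "1 <= norm (x + 2 *R e)" using norm_triangle_ineq2[of "2 *R e" "- x"] e by (simp add: add.commute)
   then show ?thesis using c1c_outside[OF c] by simp
  next
   case False then show ?thesis using c1c_outside[OF c] by simp
  qed
 qed
 also have "... <= enn (norm (2 *R e) powr p) * en p UNIV psi'" by (rule c1c_translation_le[OF c p])
 finally show ?thesis using e by simp
qed

lemma en_le_sum_exponents:
 fixes f :: "'a::euclidean_space => 'b::euclidean_space"
 assumes [measurable]: "meas f" and q: "0 < q" "q <= p" and z: "!!x. 1 <= norm x ==> f x = 0"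
 shows "en q UNIV f <= emeasure lborel (ball (0::'a) 1) + en p UNIV f"
proof -
 have "en q UNIV f <= (NN x. indicator (ball 0 1) x + enn (norm (f x) powr p) * indicator UNIV x)" unfolding en_def
 proof (intro nn_integral_mono)
  fix x
  show "enn (norm (f x) powr q) * indicator UNIV x <= indicator (ball 0 1) x + enn (norm (f x) powr p) * indicator UNIV x"
  proof (cases "norm x < 1")
   case True
   have "norm (f x) powr q <= 1 + norm (f x) powr p"
   proof (cases "norm (f x) <= 1")
   case True
   then have "norm (f x) powr q <= 1 powr q" using q by (intro powr_mono2) auto
   then show ?thesis by (simp add: add_increasing2)
   next
   case False
   then have "norm (f x) powr q <= norm (f x) powr p" using q by (intro powr_mono) auto
   then show ?thesis by simp
   qed
   then have "enn (norm (f x) powr q) <= 1 + enn (norm (f x) powr p)" by (metis ennreal_leI ennreal_plus ennreal_1 zero_le_one powr_ge_zero)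
   then show ?thesis using True by simp
  next
   case False then show ?thesis using z[of x] by simp
  qed
 qed
 also have "... = emeasure lborel (ball (0::'a) 1) + en p UNIV f" unfolding en_def by (subst nn_integral_add) auto
 finally show ?thesis .
qed

text \<open>The exponent N/(N-1) is the one dual to the L^N source. If it is at most p, Poincare is
  enough. Otherwise psi is compared on each level with its mean at a suitable scale; the scale
  involves the unknown energy A itself, and the result A <= V + C A^(p/N) is sublinear because p < Q
  <= 2 <= N.\<close>

lemma sobolev_c1c:
 assumes p: "p > 1" and N: "DIM('a::euclidean_space) >= 2"
 shows "EX C>=0. ALL (psi::'a => real) psi'. c1c 1 psi psi' --> en p UNIV psi' <= 1 -->
  en (real DIM('a) / (real DIM('a) - 1)) UNIV psi <= enn C"
proof -
 define n where "n = real DIM('a)"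
 define Q where "Q = n / (n - 1)"
 define V where "V = measure lborel (ball (0::'a) 1)"
 have n: "n >= 2" using N by (simp add: n_def)
 have Q: "Q > 1" "Q <= 2" using n by (auto simp: Q_def field_simps)
 have V: "V > 0" "emeasure lborel (ball (0::'a) 1) = enn V" by (simp_all add: V_def content_ball_pos emeasure_ball_eq)
 show ?thesis
 proof (cases "Q <= p")
  case True
  have "en Q UNIV psi <= enn (V + 2 powr p)" if c: "c1c 1 psi psi'" and e: "en p UNIV psi' <= 1" for psi :: "'a => real" and psi'
  proof -
   have "en Q UNIV psi <= enn V + en p UNIV psi" using en_le_sum_exponents[OF c1_borel(1)[OF c1c_c1[OF c]] _ True] Q c1c_outside[OF c] V by auto
   also have "en p UNIV psi <= enn (2 powr p) * en p UNIV psi'" by (rule poincare_c1c[OF c p])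
   also have "... <= enn (2 powr p) * 1" using e by (intro mult_left_mono) auto
   finally show ?thesis using V by (simp add: add_left_mono)
  qed
  then show ?thesis using V by (intro exI[of _ "V + 2 powr p"]) (auto simp: Q_def n_def)
 next
  case False
  then have pQ: "p < Q" by simp
  \<comment> \<open>The radii chosen below shrink like 2^(-Qk/n), so the energy of the averaging
    error, of order t^p, falls like 2^(-si k).\<close>
  define si where "si = Q * p / n"
  have si: "Q - p < si"
  proof -
   have "n - p < p * (n - 1)" using p n mult_strict_right_mono[of 1 p n] by (simp add: algebra_simps)
   then have "(n - p) / (n - 1) < p" using n by (simp add: field_simps)
   moreover have "si = p / (n - 1)" using n by (simp add: Q_def si_def)
   then have "Q - si = (n - p) / (n - 1)" by (simp add: Q_def diff_divide_distrib)
   ultimately show ?thesis by simp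
  qed
  have pn: "0 < p / n" "p / n < 1" using p n pQ Q by auto
  define K where "K = 2 powr (Q + p) / (1 - 2 powr (Q - p - si))"
  have K: "K > 0" using si by (auto simp: K_def powr_less_one)
  define C where "C = (2 powr Q / V) powr (p / n) * K"
  have C: "C > 0" using K V by (simp add: C_def)
  have "en Q UNIV psi <= enn (2 * V + (2 * C) powr (1 / (1 - p / n)))" if c: "c1c 1 psi psi'" and e: "en p UNIV psi' <= 1" for psi :: "'a => real" and psi'
  proof -
   note c1_borel[OF c1c_c1[OF c], measurable]
   define A where "A = enn2real (en Q UNIV psi)"
   have A: "en Q UNIV psi = enn A" "0 <= A" using c1c_en_finite(1)[OF c, of Q UNIV] Q by (auto simp: A_def)
   show ?thesis
   proof (cases "A = 0")
   case True then show ?thesis using A by simp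
   next
   case False
   then have Apos: "A > 0" using A by simp
   \<comment> \<open>Solves V t^N = A 2^Q 2^(-Qk): then \<open>bavg_bound\<close> keeps the mean of
     psi at scale \<open>t k\<close> below 2^k / 2, half of the level.\<close>
   define t where "t k = (A * 2 powr Q / V) powr (1 / n) * (2 powr (- Q / n)) ^ k" for k :: nat
   have t: "t k > 0" for k using Apos V by (simp add: t_def)
   have tn: "V * t k ^ DIM('a) = A * 2 powr Q * (2 powr (- Q)) ^ k" for k
   proof -
   have "t k ^ DIM('a) = t k powr n" using t[of k] by (simp add: powr_realpow n_def)
   also have "... = (A * 2 powr Q / V) * (2 powr (- Q)) ^ k" using n Apos V by (simp add: t_def powr_mult powr_powr powr_realpow[symmetric] mult.commute)
   finally show ?thesis using V by simp
   qed
   define b where "b k x = psi x - bavg (t k) psi x" for k x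
   have [measurable]: "meas (b k)" for k
   proof -
   have [measurable]: "meas (bavg (t k) psi)" by (rule bavg_measurable[OF t]) simp
   show ?thesis unfolding b_def[abs_def] by measurable
   qed
   have "en Q UNIV psi = en Q (ball 0 1) psi" unfolding en_def using c1c_outside[OF c] by (intro nn_integral_cong) (auto simp: indicator_def)
   also have "... <= enn (1 powr Q) * emeasure lborel (ball (0::'a) 1) + enn ((A * 2 powr Q / V) powr (p / n) * (1 powr (Q - p) * 2 powr (Q + p) / (1 - 2 powr (Q - p - si))))"
   proof (rule en_by_levels[where b=b])
   fix k x assume lev: "1 * 2 ^ k < norm (psi x)" "norm (psi x) <= 1 * 2 ^ Suc k"
   have "enn (norm (bavg (t k) psi x) powr Q) <= enn (1 / measure lborel (ball (0::'a) (t k))) * en Q (ball x (t k)) psi"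
   by (rule bavg_bound[OF t _ Q(1)]) simp
   also have "... <= enn (1 / measure lborel (ball (0::'a) (t k))) * en Q UNIV psi" by (intro mult_left_mono en_mono_set) auto
   also have "... = enn (A / (V * t k ^ DIM('a)))"
   unfolding A measure_ball_eq[OF t] V_def[symmetric] using A(2) by (simp add: ennreal_mult'[symmetric] mult.commute)
   also have "A / (V * t k ^ DIM('a)) = (2 ^ k / 2) powr Q"
   proof -
   have "(2 powr (- Q)) ^ k = 1 / (2 powr Q) ^ k" by (simp add: powr_minus power_inverse inverse_eq_divide power_one_over)
   then show ?thesis unfolding tn using Apos by (simp add: powr_divide two_pow_powr field_simps)
   qed
   finally have "norm (bavg (t k) psi x) powr Q <= (2 ^ k / 2) powr Q" by simp
   then have "norm (bavg (t k) psi x) <= 2 ^ k / 2"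
   using Q powr_less_mono2[of Q "2^k/2" "norm (bavg (t k) psi x)"] by (meson not_le zero_le_power zero_le_numeral divide_nonneg_nonneg less_trans zero_less_one)
   then show "norm (psi x) <= 2 * norm (b k x)" using lev norm_triangle_ineq2[of "psi x" "bavg (t k) psi x"] by (simp add: b_def)
   next
   fix k
   have "en p (ball 0 1) (b k) <= en p UNIV (b k)" by (rule en_mono_set) simp
   also have "... <= enn (t k powr p)" unfolding b_def
   proof (rule bavg_diff_le[OF t _ _ p])
   fix z :: 'a assume z: "norm z < t k"
   have "en p UNIV (%x. psi (x + z) - psi x) <= enn (norm z powr p) * en p UNIV psi'" by (rule c1c_translation_le[OF c p])
   also have "... <= enn (t k powr p) * 1" using z p e by (intro mult_mono ennreal_leI powr_mono2) auto
   finally show "en p UNIV (%x. psi (x + z) - psi x) <= enn (t k powr p)" by simp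
   qed auto
   also have "t k powr p = (A * 2 powr Q / V) powr (p / n) * (2 powr (- si)) ^ k"
   using Apos V by (simp add: t_def powr_mult powr_powr powr_realpow[symmetric] si_def mult_ac)
   finally show "en p (ball 0 1) (b k) <= enn ((A * 2 powr Q / V) powr (p / n) * (2 powr (- si)) ^ k)" .
   qed (use p Q si in auto)
   also have "... = enn (V + C * A powr (p / n))"
   proof -
   have "(A * 2 powr Q / V) powr (p / n) * (1 powr (Q - p) * 2 powr (Q + p) / (1 - 2 powr (Q - p - si))) = C * A powr (p / n)"
   using Apos V by (simp add: C_def K_def powr_mult powr_divide mult_ac)
   then show ?thesis using V C by simp
   qed
   finally have "A <= V + C * A powr (p / n)" unfolding A using V C by (subst (asm) ennreal_le_iff) auto
   then have "A <= 2 * V + (2 * C) powr (1 / (1 - p / n))" using A V C pn by (intro absorb_sublinear) auto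
   then show ?thesis unfolding A by (rule ennreal_leI)
   qed
  qed
  then show ?thesis using V by (intro exI[of _ "2 * V + (2 * C) powr (1 / (1 - p / n))"]) (auto simp: Q_def n_def)
 qed
qed

lemma product_le_powr_sum:
 fixes x y q r :: real
 assumes "0 <= x" "0 <= y" "q > 1" "r > 1" "1/q + 1/r = 1"
 shows "x * y <= x powr q + y powr r"
proof -
 have "x * y <= x powr q / q + y powr r / r" using assms by (intro Youngs_inequality) auto
 also have "... <= x powr q / 1 + y powr r / 1" using assms by (intro add_mono divide_left_mono) auto
 finally show ?thesis by simp
qed

text \<open>With f / e and psi / K both factors have size of order 1, where Young's inequality for
  the dual exponents N and N/(N-1) loses nothing but a constant; homogeneity restores e K.\<close>

lemma source_pairing:
 assumes p: "p > 1" and N: "DIM('a::euclidean_space) >= 2"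
 shows "EX C>=0. ALL (f::'a => real) psi psi' e K. meas f --> c1c 1 psi psi' --> 0 < e --> 0 < K -->
  en (real DIM('a)) (ball 0 1) f <= enn (e powr real DIM('a)) --> en p UNIV psi' <= enn (K powr p) -->
  abs (LBINT x. f x * psi x) <= C * e * K"
proof -
 define n where "n = real DIM('a)"
 define Q where "Q = n / (n - 1)"
 have n: "n >= 2" using N by (simp add: n_def)
 have Q: "Q > 1" "1/n + 1/Q = 1" using n by (auto simp: Q_def field_simps)
 obtain C where C: "C >= 0" "!!(psi::'a => real) psi'. c1c 1 psi psi' ==> en p UNIV psi' <= 1 ==> en Q UNIV psi <= enn C"
  using sobolev_c1c[OF p N] unfolding Q_def n_def by auto
 have "abs (LBINT x. f x * psi x) <= (1 + C) * e * K"
  if [measurable]: "meas f" and c: "c1c 1 psi psi'" and e: "0 < e" and K: "0 < K"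
   and f: "en n (ball 0 1) f <= enn (e powr n)" and g: "en p UNIV psi' <= enn (K powr p)" for f psi :: "'a => real" and psi' e K
 proof -
  note c1_borel[OF c1c_c1[OF c], measurable]
  have c': "c1c 1 (%x. (1/K) * psi x) (%x. (1/K) *R psi' x)" by (rule c1c_cmult[OF c])
  have "en p UNIV (%x. (1/K) *R psi' x) = enn (abs (1/K) powr p) * en p UNIV psi'" by (rule en_scaleR) auto
  also have "... <= enn (abs (1/K) powr p) * enn (K powr p)" using g by (intro mult_left_mono) auto
  also have "... = 1" using K by (simp add: ennreal_mult'[symmetric] powr_mult[symmetric])
  finally have 1: "en Q UNIV (%x. (1/K) * psi x) <= enn C" by (rule C(2)[OF c'])
  have "en n (ball 0 1) (%x. (1/e) *R f x) = enn (abs (1/e) powr n) * en n (ball 0 1) f" by (rule en_scaleR) auto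
  also have "... <= enn (abs (1/e) powr n) * enn (e powr n)" using f by (intro mult_left_mono) auto
  also have "... = 1" using e by (simp add: ennreal_mult'[symmetric] powr_mult[symmetric])
  finally have 2: "en n (ball 0 1) (%x. (1/e) * f x) <= 1" by simp
  have "(NN x. enn (abs (((1/e) * f x) \<bullet> ((1/K) * psi x)))) <= enn 1 * en n (ball 0 1) (%x. (1/e) * f x) + enn 1 * en Q (ball 0 1) (%x. (1/K) * psi x)"
  proof (rule pairing_le)
   show "(1/K) * psi x = 0" if "x \<notin> ball 0 1" for x using that c1c_outside[OF c] by simp
   show "x * y <= 1 * x powr n + 1 * y powr Q" if "0 <= x" "0 <= y" for x y :: real using product_le_powr_sum[of x y n Q] that Q n by simp
  qed auto
  also have "... <= 1 + enn C" using 2 order_trans[OF en_mono_set[of "ball 0 1" UNIV Q "%x. (1/K) * psi x"] 1] by (simp add: add_mono)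
  finally have b: "(NN x. enn (abs (((1/e) * f x) * ((1/K) * psi x)))) <= enn (1 + C)" using C by simp
  have i: "integrable lborel (%x. ((1/e) * f x) * ((1/K) * psi x))" by (rule integrableI_bounded) (use b in \<open>auto intro: le_less_trans\<close>)
  have "enn (norm (LBINT x. ((1/e) * f x) * ((1/K) * psi x))) <= enn (1 + C)"
   by (rule order_trans[OF integral_norm_bound_ennreal[OF i]]) (use b in \<open>simp only: real_norm_def\<close>)
  then have "abs (LBINT x. ((1/e) * f x) * ((1/K) * psi x)) <= 1 + C" using C by (subst (asm) ennreal_le_iff) auto
  also have "(LBINT x. ((1/e) * f x) * ((1/K) * psi x)) = (LBINT x. (1/(e*K)) * (f x * psi x))" by (intro Bochner_Integration.integral_cong) auto
  also have "... = (1/(e*K)) * (LBINT x. f x * psi x)" by simp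
  finally show ?thesis using e K by (simp add: abs_mult field_simps)
 qed
 then show ?thesis using C(1) unfolding n_def by (intro exI[of _ "1 + C"]) auto
qed

section \<open>Existence of the p-harmonic replacement\<close>

lemma plap_continuous:
 assumes p: "p > 1" shows "continuous_on UNIV (plap p :: 'a::euclidean_space => 'a)"
proof (intro continuous_at_imp_continuous_on ballI)
 fix z :: 'a
 show "isCont (plap p) z"
 proof (cases "z = 0")
  case False
  then have "isCont (%z. norm z powr (p - 2) *R z) z" by (intro continuous_intros) auto
  then show ?thesis by (simp add: plap_def[abs_def])
 next
  case True
  have "((%z::'a. norm z powr (p - 1)) \<longlongrightarrow> norm (0::'a) powr (p - 1)) (at 0)"
   using p by (intro tendsto_powr2 tendsto_norm tendsto_ident_at tendsto_const) auto
  then have "((%z::'a. norm (plap p z)) \<longlongrightarrow> 0) (at 0)" using p by (simp add: norm_plap)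
  then have "(plap p \<longlongrightarrow> (0::'a)) (at 0)" by (rule tendsto_norm_zero_cancel)
  then show ?thesis using True by (simp add: isCont_def plap_def)
 qed
qed

text \<open>Tangent inequalities at a + b for the points a/(1-s) and b/s, weighted by 1-s and s. In
  contrast to the factor 2^p of \<open>norm_add_powr_le\<close>, the factor of |a|^p here tends to 1
  as s -> 0.\<close>

lemma norm_add_powr_convex:
 fixes a b :: "'a::real_inner"
 assumes p: "p > 1" and s: "0 < s" "s < 1"
 shows "norm (a + b) powr p <= (1 - s) powr (1 - p) * norm a powr p + s powr (1 - p) * norm b powr p"
proof -
 let ?n = "norm (a + b) powr p" and ?H = "plap p (a + b)"
 have *: "c * (norm z / c) powr p = c powr (1 - p) * norm z powr p" if "0 < c" for c and z :: 'a using that by (simp add: powr_divide powr_diff)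
 have "(1 - s) * (?n + p * (?H \<bullet> ((1 / (1 - s)) *R a - (a + b)))) + s * (?n + p * (?H \<bullet> ((1 / s) *R b - (a + b))))
  <= (1 - s) * norm ((1 / (1 - s)) *R a) powr p + s * norm ((1 / s) *R b) powr p" using s by (intro add_mono mult_left_mono plap_convex[OF p]) auto
 moreover have "(1 - s) * (n + p * (A / (1 - s) - (A + B))) + s * (n + p * (B / s - (A + B))) = n" for n A B using s by (simp add: field_simps)
 ultimately show ?thesis using s by (simp add: * inner_diff_right inner_add_right)
qed

text \<open>The infimum over test fields must remain a lower bound for a field that is only a limit
  of test fields, and with no loss of constant. First k tends to infinity, then s in
  \<open>norm_add_powr_convex\<close> to 0.\<close>

lemma le_en_limit:
 fixes X :: "'a::euclidean_space => 'b::euclidean_space"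
 assumes [measurable]: "meas X" "!!k. meas (Y k)" "S \<in> sets borel"
  and p: "p > 1" and fin: "en p S X < oo" and lim: "Lp_tendsto p S Y X"
  and le: "!!k. enn m <= en p S (Y k)"
 shows "enn m <= en p S X"
proof -
 obtain e where e: "en p S X = enn e" "0 <= e" using fin by (cases "en p S X") auto
 have "m <= (1 - s) powr (1 - p) * e" if s: "0 < s" "s < 1" for s
 proof -
  have "enn m <= enn ((1 - s) powr (1 - p)) * en p S X + enn (s powr (1 - p)) * en p S (%x. Y k x - X x)" for k
   by (rule order_trans[OF le[of k] en_le_combination]) (use norm_add_powr_convex[OF p s, of "X x" "Y k x - X x" for x] in auto)
  moreover have "(%k. enn ((1 - s) powr (1 - p)) * en p S X + enn (s powr (1 - p)) * en p S (%x. Y k x - X x))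
   ---> enn ((1 - s) powr (1 - p)) * en p S X + enn (s powr (1 - p)) * 0" by (intro tendsto_add tendsto_const ennreal_tendsto_cmult lim) auto
  ultimately have "enn m <= enn ((1 - s) powr (1 - p)) * en p S X + enn (s powr (1 - p)) * 0" by (intro LIMSEQ_le_const) auto
  then show ?thesis using e by (simp add: ennreal_mult[symmetric])
 qed
 then have "eventually (%s. m <= (1 - s) powr (1 - p) * e) (at_right 0)" by (intro eventually_at_rightI[of 0 1]) auto
 moreover have "((%s. (1 - s) powr (1 - p) * e) \<longlongrightarrow> (1 - 0) powr (1 - p) * e) (at_right 0)" by (intro tendsto_intros) auto
 ultimately have "m <= (1 - 0) powr (1 - p) * e" by (intro tendsto_lowerbound) auto
 then show ?thesis using e by (simp add: ennreal_leI)
qed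

lemma c1c_en_ball:
 assumes "c1c 1 psi psi'" shows "en p (ball 0 1) psi = en p UNIV psi" "en p (ball 0 1) psi' = en p UNIV psi'"
 unfolding en_def using c1c_outside[OF assms] by (auto intro!: nn_integral_cong simp: indicator_def)

lemma en_plap:
 assumes p: "p > 1" shows "en (p / (p - 1)) S (%x. plap p (D x)) = en p S D"
 unfolding en_def using p by (intro nn_integral_cong) (simp add: norm_plap powr_powr)

text \<open>Uniform convexity makes a minimizing sequence of test gradients Cauchy, hence strongly
  convergent, and \<open>poincare_c1c\<close> carries this over to the test functions. That the
  correction \<open>Phi\<close> is a limit of gradients of compactly supported functions encodes the
  boundary values.\<close>

lemma plap_minimizer:
 fixes D :: "'a::euclidean_space => 'a"
 assumes D[measurable]: "meas D" and p: "p > 1" and fin: "en p (ball 0 1) D < oo"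
 shows "EX phi Phi psi psi'. meas phi & meas Phi & (ALL k. c1c 1 (psi k) (psi' k))
  & Lp_tendsto p (ball 0 1) psi phi & Lp_tendsto p (ball 0 1) psi' Phi
  & en p (ball 0 1) (%x. D x + Phi x) <= en p (ball 0 1) D
  & (ALL ze ze'. c1c 1 ze ze' --> (LBINT x. plap p (D x + Phi x) \<bullet> ze' x) = 0)"
proof -
 let ?B = "ball (0::'a) 1"
 have p0: "p > 0" using p by simp
 have Bfin: "emeasure lborel ?B < oo" by (rule emeasure_lborel_ball_finite)
 define J where "J X = (LBINT x. norm (D x + X x) powr p * indicator ?B x)" for X :: "'a => 'a"
 have enJ: "en p ?B (%x. D x + X x) = enn (J X)" "integrable lborel (%x. norm (D x + X x) powr p * indicator ?B x)"
  if [measurable]: "meas X" and X: "en p ?B X < oo" for X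
 proof -
  have f: "en p ?B (%x. D x + X x) < oo" by (rule le_less_trans[OF en_add]) (use X fin p in \<open>auto simp: ennreal_mult_less_top\<close>)
  then show i: "integrable lborel (%x. norm (D x + X x) powr p * indicator ?B x)"
   by (intro integrableI_nonneg) (auto simp: en_def ennreal_mult' ennreal_indicator)
  show "en p ?B (%x. D x + X x) = enn (J X)"
   unfolding en_def J_def by (subst nn_integral_eq_integral[OF i, symmetric]) (auto simp: ennreal_mult' ennreal_indicator)
 qed
 have J0: "J X >= 0" for X unfolding J_def by (rule integral_nonneg_AE) auto
 have cfin: "en p ?B ze' < oo" if "c1c 1 ze ze'" for ze ze' using c1c_en_finite(2)[OF that p0] .
 have cm: "meas ze'" "meas ze" if "c1c 1 ze ze'" for ze ze' using c1_borel[OF c1c_c1[OF that]] by auto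
 define JS where "JS = {J ze' | ze ze'. c1c 1 ze ze'}"
 define m where "m = Inf JS"
 have JS: "JS ~= {}" "bdd_below JS" using c1c_zero[of 1, where 'a='a] J0 by (auto simp: JS_def bdd_below_def)
 have mle: "m <= J ze'" if "c1c 1 ze ze'" for ze ze' unfolding m_def using that JS(2) by (intro cInf_lower) (auto simp: JS_def)
 have m0: "0 <= m" unfolding m_def using JS(1) J0 by (intro cInf_greatest) (auto simp: JS_def)
 have "EX psi psi'. c1c 1 psi psi' & J psi' < m + 1 / real (Suc k)" for k
 proof -
  have "Inf JS < m + 1 / real (Suc k)" by (simp add: m_def)
  from cInf_lessD[OF JS(1) this] show ?thesis by (auto simp: JS_def)
 qed
 then obtain psi psi' where ps: "ALL k. c1c 1 (psi k) (psi' k) & J (psi' k) < m + 1 / real (Suc k)" by metis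
 have c: "c1c 1 (psi k) (psi' k)" and Jk: "J (psi' k) < m + 1 / real (Suc k)" for k using ps by auto
 note cm[OF c, measurable]
 have Jk1: "J (psi' k) <= m + 1" for k
 proof -
  have "1 / real (Suc k) <= 1" by simp
  then show ?thesis using Jk[of k] by linarith
 qed
 have cauchy: "EX n0. ALL i>=n0. ALL j>=n0. en p ?B (%x. psi' i x - psi' j x) <= enn e" if e: "e > 0" for e
 proof -
  \<comment> \<open>Both energies are at most m + 1, so the d-term is at most e/2. The midpoint is a
    competitor and has energy at least m, so the convexity defect is at most e/(2 C) beyond n0, and
    the C-term is at most e/2 too.\<close>
  define d where "d = e / (4 * (m + 1))"
  have d: "d > 0" using e m0 by (simp add: d_def)
  obtain C where C: "C > 0" and ucv: "!!(a::'a) b. norm (a - b) powr p <= d * (norm a powr p + norm b powr p)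
   + C * (norm a powr p + norm b powr p - 2 * norm ((1/2) *R (a + b)) powr p)" using uniform_convexity_powr[OF p d, where 'a='a] by metis
  obtain n0 where n0: "1 / real (Suc n0) < e / (4 * C)" using nat_approx_posE[of "e / (4 * C)"] e C by auto
  have "en p ?B (%x. psi' i x - psi' j x) <= enn e" if ij: "i >= n0" "j >= n0" for i j
  proof -
   have cij: "c1c 1 (%x. (1/2) * (psi i x + psi j x)) (%x. (1/2) *R (psi' i x + psi' j x))" by (intro c1c_cmult c1c_add c)
   define M where "M x = (1/2) *R (psi' i x + psi' j x)" for x
   have [measurable]: "meas M" unfolding M_def by measurable
   have Mf: "en p ?B M < oo" using cfin[OF cij] by (simp add: M_def[abs_def])
   note ii = enJ(2)[OF _ cfin[OF c[of i]]] enJ(2)[OF _ cfin[OF c[of j]]] enJ(2)[OF _ Mf]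
   let ?N = "%x. (d + C) * (norm (D x + psi' i x) powr p * indicator ?B x) + (d + C) * (norm (D x + psi' j x) powr p * indicator ?B x)
   - 2 * C * (norm (D x + M x) powr p * indicator ?B x)"
   have N: "norm (psi' i x - psi' j x) powr p * indicator ?B x <= ?N x" for x
   proof -
   have "(D x + psi' i x) + (D x + psi' j x) = (D x + D x) + (psi' i x + psi' j x)" by simp
   then have "(1/2) *R ((D x + psi' i x) + (D x + psi' j x)) = D x + M x" by (simp only: M_def scaleR_add_right[of _ "D x + D x"] scaleR_half_double)
   then show ?thesis using ucv[of "D x + psi' i x" "D x + psi' j x"] by (auto simp: indicator_def algebra_simps)
   qed
   have N0: "0 <= ?N x" for x by (rule order_trans[OF _ N]) simp
   have "en p ?B (%x. psi' i x - psi' j x) <= (NN x. enn (?N x))"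
   unfolding en_def by (intro nn_integral_mono) (metis N ennreal_indicator ennreal_leI ennreal_mult'' indicator_pos_le)
   also have "... = enn (LBINT x. ?N x)" by (rule nn_integral_eq_integral[OF _ AE_I2[OF N0]]) (use ii in auto)
   also have "(LBINT x. ?N x) = (d + C) * J (psi' i) + (d + C) * J (psi' j) - 2 * C * J M" unfolding J_def using ii by simp
   also have "... = d * (J (psi' i) + J (psi' j)) + C * (J (psi' i) + J (psi' j) - 2 * J M)" by (simp add: algebra_simps)
   also have "enn ... <= enn e"
   proof (rule ennreal_leI)
   have "1 / real (Suc i) <= 1 / real (Suc n0)" "1 / real (Suc j) <= 1 / real (Suc n0)" using ij by (auto intro!: divide_left_mono)
   then have "J (psi' i) + J (psi' j) - 2 * J M <= 2 * (e / (4 * C))" using Jk[of i] Jk[of j] mle[OF cij] n0 by (simp add: M_def[abs_def])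
   then have "C * (J (psi' i) + J (psi' j) - 2 * J M) <= C * (2 * (e / (4 * C)))" using C by (intro mult_left_mono) auto
   also have "... = e / 2" using C by simp
   finally have 1: "C * (J (psi' i) + J (psi' j) - 2 * J M) <= e / 2" .
   have "d * (J (psi' i) + J (psi' j)) <= d * (2 * (m + 1))" using Jk1[of i] Jk1[of j] d by (intro mult_left_mono) auto
   also have "... = e / 2"
   proof -
   have "e / (4 * M) * (2 * M) = e / 2" if "M > 0" for M :: real using that by (simp add: field_simps)
   from this[of "m + 1"] show ?thesis using m0 unfolding d_def by linarith
   qed
   finally show "d * (J (psi' i) + J (psi' j)) + C * (J (psi' i) + J (psi' j) - 2 * J M) <= e" using 1 by simp
   qed
   finally show ?thesis .
  qed
  then show ?thesis by blast
 qed
 have cauchy2: "EX n0. ALL i>=n0. ALL j>=n0. en p ?B (%x. psi i x - psi j x) <= enn e" if e: "e > 0" for e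
 proof -
  have "e / 2 powr p > 0" using e by simp
  from cauchy[OF this] obtain n0 where n0: "!!i j. i >= n0 ==> j >= n0 ==> en p ?B (%x. psi' i x - psi' j x) <= enn (e / 2 powr p)" by blast
  have "en p ?B (%x. psi i x - psi j x) <= enn e" if ij: "i >= n0" "j >= n0" for i j
  proof -
   have cd: "c1c 1 (%x. psi i x - psi j x) (%x. psi' i x - psi' j x)" by (rule c1c_diff[OF c c])
   have "en p ?B (%x. psi i x - psi j x) <= enn (2 powr p) * en p ?B (%x. psi' i x - psi' j x)" unfolding c1c_en_ball[OF cd] by (rule poincare_c1c[OF cd p])
   also have "... <= enn (2 powr p) * enn (e / 2 powr p)" by (intro mult_left_mono n0 ij) simp
   also have "... = enn e" by (simp add: ennreal_mult'[symmetric])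
   finally show ?thesis .
  qed
  then show ?thesis by blast
 qed
 have "EX Phi. meas Phi & Lp_tendsto p ?B psi' Phi" by (rule en_complete[where F=psi' and S="?B" and p=p]) (use p0 cauchy in auto)
 then obtain Phi where [measurable]: "meas Phi" and lim: "Lp_tendsto p ?B psi' Phi" by blast
 have "EX phi. meas phi & Lp_tendsto p ?B psi phi" by (rule en_complete[where F=psi and S="?B" and p=p]) (use p0 cauchy2 in auto)
 then obtain phi where phi: "meas phi" "Lp_tendsto p ?B psi phi" by blast
 have "EX r. strict_mono r & (AE x in lborel. x \<in> ?B --> (%n. psi' (r n) x) ---> Phi x)"
  by (rule en_AE_subseq[where F=psi' and S="?B" and p=p, OF _ _ _ p0 lim]) auto
 then obtain r where r: "strict_mono r" "AE x in lborel. x \<in> ?B --> (%n. psi' (r n) x) ---> Phi x" by blast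
 have JPhi: "en p ?B (%x. D x + Phi x) <= enn (m + e)" if e: "e > 0" for e
 proof -
  obtain n0 where n0: "1 / real (Suc n0) < e" using nat_approx_posE[of e] e by auto
  show ?thesis
  proof (rule en_fatou[where F="%n x. D x + psi' (r (n + n0)) x"])
   show "AE x in lborel. x \<in> ?B --> (%n. D x + psi' (r (n + n0)) x) ---> D x + Phi x"
   using r(2) by eventually_elim (intro impI tendsto_add tendsto_const LIMSEQ_ignore_initial_segment[where f="%n. psi' (r n) _"], simp)
   fix n
   have "r (n + n0) >= n0" using seq_suble[OF r(1), of "n + n0"] by linarith
   then have "1 / real (Suc (r (n + n0))) <= 1 / real (Suc n0)" by (intro divide_left_mono) auto
   then have "J (psi' (r (n + n0))) <= m + e" using Jk[of "r (n + n0)"] n0 by linarith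
   then show "en p ?B (%x. D x + psi' (r (n + n0)) x) <= enn (m + e)" by (subst enJ(1)[OF _ cfin[OF c]]) (auto intro: ennreal_leI)
  qed (use p0 in auto)
 qed
 have "J (%x. 0) >= m" using mle[OF c1c_zero[of 1]] by simp
 have enD: "en p ?B D = enn (J (%x. 0))" using enJ(1)[of "%x. 0"] by (simp add: en_def)
 have min: "en p ?B (%x. D x + Phi x) <= en p ?B D"
 proof (rule ennreal_le_epsilon)
  fix e :: real assume "0 < e"
  from JPhi[OF this] have "en p ?B (%x. D x + Phi x) <= enn (m + e)" .
  also have "... <= enn (J (%x. 0) + e)" using \<open>J (%x. 0) >= m\<close> by (intro ennreal_leI) simp
  also have "... = en p ?B D + enn e" using \<open>0 < e\<close> J0 by (simp add: enD)
  finally show "en p ?B (%x. D x + Phi x) <= en p ?B D + enn e" .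
 qed
 have finW: "en p ?B (%x. D x + Phi x) < oo" using min fin by (rule le_less_trans)
 have finPhi: "en p ?B Phi < oo" using le_less_trans[OF en_diff[of "%x. D x + Phi x" D ?B p]] finW fin p by (simp add: ennreal_mult_less_top)
 have JPhim: "J Phi <= m"
 proof (rule field_le_epsilon)
  fix e :: real assume "e > 0"
  then show "J Phi <= m + e" using JPhi[of e] m0 by (simp add: enJ(1)[OF _ finPhi] del: ennreal_plus)
 qed
 \<comment> \<open>One sign only; applied to -ze it gives the equation in
   \<open>EL0\<close>.\<close>
 have EL: "0 <= (LBINT x. plap p (D x + Phi x) \<bullet> ze' x)" if ze: "c1c 1 ze ze'" for ze ze'
 proof -
  note cm[OF ze, measurable]
  obtain B where B: "B > 0" "!!x. norm (ze' x) <= B" using c1c_bounded_ex[OF ze] by auto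
  have z: "ze' x = 0" if "x \<notin> ?B" for x using c1c_outside[OF ze, of x] that by auto
  let ?X = "%t x. D x + (Phi x + t *R ze' x)"
  have pos: "0 <= (LBINT x. plap p (?X t x) \<bullet> ze' x)" if t: "t > 0" for t
  proof -
   have ft: "en p ?B (%x. Phi x + t *R ze' x) < oo"
   by (rule le_less_trans[OF en_add]) (use finPhi cfin[OF c1c_cmult[OF ze]] p in \<open>auto simp: ennreal_mult_less_top\<close>)
   note ia = enJ[OF _ finPhi] and ib = enJ[OF _ ft]
   have "enn m <= en p ?B (?X t)"
   proof (rule le_en_limit[OF _ _ _ p, where Y="%k x. D x + (psi' k x + t *R ze' x)"])
   have ck: "c1c 1 (%x. psi k x + t * ze x) (%x. psi' k x + t *R ze' x)" for k by (intro c1c_add c c1c_cmult ze)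
   show "enn m <= en p ?B (%x. D x + (psi' k x + t *R ze' x))" for k by (subst enJ(1)[OF _ cfin[OF ck]]) (auto intro: ennreal_leI mle[OF ck])
   show "(%k. en p ?B (%x. D x + (psi' k x + t *R ze' x) - ?X t x)) ---> 0" using lim by simp
   qed (use ib in auto)
   then have "m <= J (%x. Phi x + t *R ze' x)" using J0 by (simp add: ib(1))
   also have i1: "integrable lborel (%x. plap p (?X t x) \<bullet> ze' x)"
   by (rule pairing_integrable[where S="?B" and p=p]) (use z p ib cfin[OF ze] in \<open>auto simp: en_plap\<close>)
   then have "J (%x. Phi x + t *R ze' x) <= (LBINT x. norm (D x + Phi x) powr p * indicator ?B x + p * t * (plap p (?X t x) \<bullet> ze' x))" unfolding J_def
   proof (intro integral_mono)
   fix x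
   \<comment> \<open>The tangent is taken at the perturbed field and not at the minimizer:
     minimality then gives the sign for each t > 0 without differentiating the energy, and dominated
     convergence lets t tend to 0.\<close>
   have "norm (?X t x) powr p + p * (plap p (?X t x) \<bullet> ((D x + Phi x) - ?X t x)) <= norm (D x + Phi x) powr p" by (rule plap_convex[OF p])
   then have "norm (?X t x) powr p <= norm (D x + Phi x) powr p + p * t * (plap p (?X t x) \<bullet> ze' x)" by (simp add: algebra_simps)
   then show "norm (?X t x) powr p * indicator ?B x <= norm (D x + Phi x) powr p * indicator ?B x + p * t * (plap p (?X t x) \<bullet> ze' x)"
   using z[of x] by (auto simp: indicator_def)
   qed (use ia ib in auto)
   also have "... = J Phi + p * t * (LBINT x. plap p (?X t x) \<bullet> ze' x)" unfolding J_def using ia i1 by simp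
   finally have "0 <= p * t * (LBINT x. plap p (?X t x) \<bullet> ze' x)" using JPhim by linarith
   then show ?thesis using p t by (metis mult_pos_pos mult_le_cancel_left_pos mult_zero_right less_trans zero_less_one)
  qed
  have "(%k. LBINT x. plap p (?X (1 / real (Suc k)) x) \<bullet> ze' x) ---> (LBINT x. plap p (D x + Phi x) \<bullet> ze' x)"
  proof (rule integral_dominated_convergence[where w="%x. B * (indicator ?B x + 2 powr p * (norm (D x + Phi x) powr p * indicator ?B x + B powr p * indicator ?B x))"])
   show "integrable lborel (%x. B * (indicator ?B x + 2 powr p * (norm (D x + Phi x) powr p * indicator ?B x + B powr p * indicator ?B x)))"
   using enJ(2)[OF _ finPhi] Bfin by (auto simp: integrable_indicator_iff)
   have "(%k. 1 / real (Suc k)) ---> 0" using LIMSEQ_inverse_real_of_nat by (simp add: inverse_eq_divide)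
   then have "(%k. ?X (1 / real (Suc k)) x) ---> D x + (Phi x + 0 *R ze' x)" for x by (intro tendsto_intros)
   then have "(%k. plap p (?X (1 / real (Suc k)) x)) ---> plap p (D x + Phi x)" for x using continuous_on_tendsto_compose[OF plap_continuous[OF p]] by fastforce
   then show "AE x in lborel. (%k. plap p (?X (1 / real (Suc k)) x) \<bullet> ze' x) ---> plap p (D x + Phi x) \<bullet> ze' x"
   by (intro AE_I2 tendsto_inner tendsto_const)
   fix k
   let ?t = "1 / real (Suc k)"
   have "norm (plap p (?X ?t x) \<bullet> ze' x) <= B * (1 + 2 powr p * (norm (D x + Phi x) powr p + B powr p))" for x
   proof -
   have "norm (?t *R ze' x) <= 1 * B" unfolding norm_scaleR by (rule mult_mono) (use B in auto)
   then have 1: "norm (?t *R ze' x) powr p <= B powr p" using p by (intro powr_mono2) auto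
   have "norm (plap p (?X ?t x) \<bullet> ze' x) <= norm (?X ?t x) powr (p - 1) * B"
   using B(2)[of x] order_trans[OF Cauchy_Schwarz_ineq2[of "plap p (?X ?t x)" "ze' x"]] p by (simp add: norm_plap mult_left_mono)
   also have "... <= (1 + norm (?X ?t x) powr p) * B" using p B by (intro mult_right_mono powr_minus_one_le) auto
   also have "norm (?X ?t x) powr p <= 2 powr p * (norm (D x + Phi x) powr p + norm (?t *R ze' x) powr p)"
   using norm_add_powr_le(1)[of p "D x + Phi x" "?t *R ze' x"] p by (simp add: add.assoc)
   finally show ?thesis using 1 B by (smt (verit) mult.commute mult_left_mono powr_ge_zero)
   qed
   then show "AE x in lborel. norm (plap p (?X ?t x) \<bullet> ze' x) <= B * (indicator ?B x + 2 powr p * (norm (D x + Phi x) powr p * indicator ?B x + B powr p * indicator ?B x))"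
   using z B by (intro AE_I2) (auto simp: indicator_def)
  qed auto
  from LIMSEQ_le_const[OF this, of 0] pos show ?thesis by auto
 qed
 have EL0: "(LBINT x. plap p (D x + Phi x) \<bullet> ze' x) = 0" if ze: "c1c 1 ze ze'" for ze ze'
 proof -
  have "0 <= (LBINT x. plap p (D x + Phi x) \<bullet> ((-1) *R ze' x))" by (rule EL[OF c1c_cmult[OF ze]])
  then show ?thesis using EL[OF ze] by simp
 qed
 show ?thesis by (rule exI[of _ phi], rule exI[of _ Phi], rule exI[of _ psi], rule exI[of _ psi']) (use phi c lim min EL0 in auto)
qed

section \<open>Cutoffs and truncated powers\<close>

lemma positive_part_square_deriv:
 "((%t::real. (max 0 t)\<^sup>2) has_real_derivative 2 * max 0 t) (at t)"
proof -
 consider "t > 0" | "t < 0" | "t = 0" by linarith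
 then show ?thesis
 proof cases
  case 1
  have "((%t::real. t\<^sup>2) has_real_derivative 2 * max 0 t) (at t)" using 1 by (auto intro!: derivative_eq_intros)
  then show ?thesis by (rule has_field_derivative_transform_within_open[where S="{0<..}"]) (use 1 in auto)
 next
  case 2
  have "((%t::real. 0) has_real_derivative 2 * max 0 t) (at t)" using 2 by simp
  then show ?thesis by (rule has_field_derivative_transform_within_open[where S="{..<0}"]) (use 2 in auto)
 next
  case 3
  have "((%h::real. (max 0 h)\<^sup>2 / h) \<longlongrightarrow> 0) (at 0)"
  proof (rule Lim_null_comparison)
   show "eventually (%h::real. norm ((max 0 h)\<^sup>2 / h) <= abs h) (at 0)" by (rule always_eventually) (auto simp: power2_eq_square max_def)
   have "((%h::real. abs h) \<longlongrightarrow> abs 0) (at 0)" by (intro tendsto_intros)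
   then show "((%h::real. abs h) \<longlongrightarrow> 0) (at 0)" by simp
  qed
  then show ?thesis using 3 by (simp add: DERIV_def)
 qed
qed

lemma cutoff_exists:
 assumes r: "0 < r" "r < R"
 shows "EX eta eta'. c1c R eta eta' & (ALL x::'a::euclidean_space. 0 <= eta x) & (ALL x. norm x <= r --> 1 <= eta x)"
proof -
 define s where "s = (r + R) / 2"
 have s: "r < s" "s < R" using r by (auto simp: s_def)
 define C where "C = 1 / (s\<^sup>2 - r\<^sup>2)\<^sup>2"
 have rs: "r\<^sup>2 < s\<^sup>2" using r s by (intro power_strict_mono) auto
 have C: "C > 0" using rs by (simp add: C_def)
 have q: "c1 (%x::'a. s\<^sup>2 - x \<bullet> x) (%x. (- 2) *R x)" by (auto simp: c1_def inner_commute intro!: derivative_eq_intros continuous_intros)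
 define eta where "eta x = C * (max 0 (s\<^sup>2 - x \<bullet> x))\<^sup>2" for x :: 'a
 define eta' where "eta' x = C *R ((2 * max 0 (s\<^sup>2 - x \<bullet> x)) *R ((- 2) *R x))" for x :: 'a
 have "c1 eta eta'" unfolding eta_def[abs_def] eta'_def[abs_def] by (intro c1_cmult c1_compose[OF positive_part_square_deriv _ q] continuous_intros)
 moreover have "eta x = 0 & eta' x = 0" if "s <= norm x" for x
 proof -
  have "s\<^sup>2 <= (norm x)\<^sup>2" using that s r by (intro power_mono) auto
  then show ?thesis by (simp add: eta_def eta'_def power2_norm_eq_inner)
 qed
 ultimately have "c1c R eta eta'" using s r by (auto simp: c1c_def intro!: exI[of _ s])
 moreover have "1 <= eta x" if "norm x <= r" for x
 proof -
  have "(norm x)\<^sup>2 <= r\<^sup>2" using that by (intro power_mono) auto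
  then have "s\<^sup>2 - r\<^sup>2 <= max 0 (s\<^sup>2 - x \<bullet> x)" by (simp add: power2_norm_eq_inner)
  then have "(s\<^sup>2 - r\<^sup>2)\<^sup>2 <= (max 0 (s\<^sup>2 - x \<bullet> x))\<^sup>2" using rs by (intro power_mono) auto
  then have "C * (s\<^sup>2 - r\<^sup>2)\<^sup>2 <= eta x" unfolding eta_def using C by (intro mult_left_mono) auto
  moreover have "C * (s\<^sup>2 - r\<^sup>2)\<^sup>2 = 1" using rs by (simp add: C_def)
  ultimately show ?thesis by simp
 qed
 moreover have "0 <= eta x" for x using C by (simp add: eta_def)
 ultimately show ?thesis by blast
qed

lemma c1c_translate:
 fixes psi :: "'a::euclidean_space => real"
 assumes c: "c1c r psi psi'" and h: "norm h + r <= R"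
 shows "c1c R (%x. psi (x + h)) (%x. psi' (x + h))"
proof -
 obtain s where s: "s > 0" "s < r" "!!x. s <= norm x ==> psi x = 0 & psi' x = 0" using c by (auto simp: c1c_def)
 have "psi (x + h) = 0 & psi' (x + h) = 0" if "s + norm h <= norm x" for x using that norm_triangle_ineq2[of x "- h"] by (intro s(3)) auto
 moreover have "s + norm h > 0" "s + norm h < R" using s h by (auto intro: add_pos_nonneg)
 ultimately show ?thesis using c1_translate[OF c1c_c1[OF c]] unfolding c1c_def by blast
qed

text \<open>Isabelle's \<open>0 powr 0 = 0\<close> would make the exponent \<open>0\<close> discontinuous.\<close>

definition pw :: "real => real => real" where "pw a t = (if a = 0 then 1 else t powr a)"

lemma pw_nonneg: "0 <= pw a t" by (simp add: pw_def)

lemma pw_mono: "0 <= a ==> 0 <= s ==> s <= t ==> pw a s <= pw a t"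
 by (auto simp: pw_def intro: powr_mono2)

lemma pw_powr: "0 <= t ==> 0 < p ==> pw (a / p) t powr p = pw a t"
 by (auto simp: pw_def powr_powr)

lemma mult_pw: "0 <= t ==> t * pw a t = t powr (a + 1)"
 by (cases "t = 0") (auto simp: pw_def powr_add)

lemma powr_mult_pw_le:
 assumes "0 <= x" "0 <= y" "0 <= a" "0 < b"
 shows "x powr b * pw a y <= x powr (b + a) + y powr (b + a)"
proof (cases "a = 0")
 case True then show ?thesis by (simp add: pw_def)
next
 case False
 define z where "z = max x y"
 have "x powr b * y powr a <= z powr b * z powr a" using assms by (intro mult_mono powr_mono2) (auto simp: z_def)
 also have "... = z powr (b + a)" by (simp add: powr_add)
 also have "... <= x powr (b + a) + y powr (b + a)" by (auto simp: z_def max_def)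
 finally show ?thesis using False by (simp add: pw_def)
qed

lemma pw_scale: "0 <= t ==> 0 < l ==> pw a t = pw a l * pw a (t / l)"
 by (auto simp: pw_def powr_divide)

text \<open>The weight |t|^a, frozen beyond m. The truncation makes its primitive Lipschitz, so that
  \<open>sob_chain\<close> applies; bounds uniform in m allow m to tend to infinity
  afterwards.\<close>

definition tpw :: "real => nat => real => real" where "tpw a m t = pw a (min (abs t) (real m))"

lemma tpw_continuous: "0 <= a ==> continuous_on UNIV (tpw a m)"
 unfolding tpw_def[abs_def] pw_def by (cases "a = 0") (auto intro!: continuous_intros continuous_on_powr')

lemma tpw_bounds: "0 <= tpw a m t" "0 <= a ==> tpw a m t <= pw a (real m)" "0 <= a ==> tpw a m t <= pw a (abs t)"
 "0 < p ==> tpw (a / p) m t powr p = tpw a m t" unfolding tpw_def by (auto intro!: pw_nonneg pw_mono pw_powr)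

text \<open>The upper bound is the mean value theorem with an even weight that grows with |t|. For
  the lower bound let l = s - t > 0: either s >= l/2 or t < -l/2, so the top or the bottom quarter
  of [t, s] consists of points of modulus at least l/4, where the weight is at least
  (l/4)^a.\<close>

lemma tpw_primitive:
 assumes a: "0 <= a"
 shows "EX g. (ALL t. (g has_real_derivative tpw a m t) (at t)) & g 0 = 0 & (ALL t. abs (g t) <= abs t * tpw a m t)
  & (ALL s t. abs s <= real m --> abs t <= real m --> (abs (s - t) / 4) powr (a + 1) <= abs (g s - g t))"
proof -
 have cont: "isCont (tpw a m) x" for x using tpw_continuous[OF a, of m] by (simp add: continuous_on_eq_continuous_at)
 obtain F where F: "!!t::real. (F has_vector_derivative tpw a m t) (at t)"
  using einterval_antiderivative[of "-oo" "oo" "tpw a m"] cont by auto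
 define g where "g t = F t - F 0" for t
 have g: "(g has_real_derivative tpw a m t) (at t)" for t
  using F[of t] unfolding g_def has_real_derivative_iff_has_vector_derivative by (auto intro!: derivative_eq_intros)
 have mvt: "EX xi. s < xi & xi < t & g t - g s = (t - s) * tpw a m xi" if "s < t" for s t using MVT2[OF that, of g "tpw a m"] g by blast
 have ev: "tpw a m s <= tpw a m t" if "abs s <= abs t" for s t using that a unfolding tpw_def by (intro pw_mono) auto
 have 1: "abs (g t) <= abs t * tpw a m t" for t
 proof -
  consider "t > 0" | "t < 0" | "t = 0" by linarith
  then show ?thesis
  proof cases
   case 1
   then obtain xi where "0 < xi" "xi < t" "g t - g 0 = (t - 0) * tpw a m xi" using mvt by blast
   then show ?thesis using ev[of xi t] tpw_bounds(1)[of a m xi] 1 by (simp add: g_def abs_mult mult_left_mono)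
  next
   case 2
   then obtain xi where "t < xi" "xi < 0" "g 0 - g t = (0 - t) * tpw a m xi" using mvt by blast
   then have "g t = t * tpw a m xi" by (simp add: g_def)
   then have "abs (g t) = abs t * tpw a m xi" using tpw_bounds(1)[of a m xi] by (simp add: abs_mult)
   then show ?thesis using ev[of xi t] \<open>t < xi\<close> \<open>xi < 0\<close> by (simp add: mult_left_mono)
  qed (simp add: g_def)
 qed
 have mono: "g s <= g t" if "s <= t" for s t
 proof (cases "s = t")
  case False
  then have "s < t" using that by simp
  from mvt[OF this] obtain xi where "g t - g s = (t - s) * tpw a m xi" by blast
  moreover have "0 <= (t - s) * tpw a m xi" using that tpw_bounds(1) by simp
  ultimately show ?thesis by simp
 qed simp
 have quarter: "(l / 4) powr (a + 1) <= g (s + l/4) - g s" if l: "l > 0" and q: "!!r. s < r ==> r < s + l/4 ==> l / 4 <= abs r & abs r <= real m" for s l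
 proof -
  have "s < s + l/4" using l by simp
  from mvt[OF this] obtain xi where x: "s < xi" "xi < s + l/4" "g (s + l/4) - g s = (l/4) * tpw a m xi" by auto
  have "pw a (l/4) <= tpw a m xi" unfolding tpw_def using q[OF x(1,2)] l a by (intro pw_mono) auto
  then have "(l/4) * pw a (l/4) <= g (s + l/4) - g s" unfolding x(3) using l by (intro mult_left_mono) auto
  moreover have "(l/4) * pw a (l/4) = (l/4) powr (a + 1)" using l by (intro mult_pw) simp
  ultimately show ?thesis by (simp only:)
 qed
 have *: "((s - t) / 4) powr (a + 1) <= g s - g t" if st: "t < s" "abs s <= real m" "abs t <= real m" for s t
 proof -
  define l where "l = s - t"
  have l: "l > 0" using st by (simp add: l_def)
  show ?thesis
  proof (cases "l / 2 <= s")
   case True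
   have "(l / 4) powr (a + 1) <= g ((s - l/4) + l/4) - g (s - l/4)" by (rule quarter[OF l]) (use True st l in auto)
   also have "... <= g s - g t"
   proof -
   have "t <= s - l/4" using st(1) by (simp add: l_def field_simps)
   from mono[OF this] show ?thesis by simp
   qed
   finally show ?thesis by (simp add: l_def)
  next
   case False
   have "(l / 4) powr (a + 1) <= g (t + l/4) - g t"
   proof (rule quarter[OF l])
   fix r assume "t < r" "r < t + l/4"
   then have "r <= - (l/4)" "t <= r" using False by (auto simp: l_def field_simps)
   then show "l / 4 <= abs r & abs r <= real m" using l st by linarith
   qed
   also have "... <= g s - g t"
   proof -
   have "t + l/4 <= s" using st(1) by (simp add: l_def field_simps)
   from mono[OF this] show ?thesis by simp
   qed
   finally show ?thesis by (simp add: l_def)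
  qed
 qed
 have 3: "(abs (s - t) / 4) powr (a + 1) <= abs (g s - g t)" if "abs s <= real m" "abs t <= real m" for s t
 proof -
  consider "t < s" | "s < t" | "s = t" by linarith
  then show ?thesis
  proof cases
   case 1 then show ?thesis using *[of t s] that by auto
  next
   case 2
   note st = this
   have "((t - s) / 4) powr (a + 1) <= g t - g s" using *[of s t] that st by auto
   then show ?thesis using st by (simp add: abs_minus_commute)
  qed simp
 qed
 show ?thesis using g 1 3 by (intro exI[of _ g]) (auto simp: g_def)
qed

text \<open>Replaces Minkowski's inequality for sums of dyadic pieces: q-th powers add up at the
  price of slowly growing geometric weights, with a constant independent of the number of
  pieces.\<close>

lemma telescoping_powr:
 assumes q: "q > 1" and b: "\<beta> > 0"
 shows "EX c>0. ALL (J::nat) (a::nat => 'b::real_inner). norm (\<Sum>j<J. a j) powr q <= c * (\<Sum>j<J. (2 powr \<beta>) ^ j * norm (a j) powr q)"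
proof -
 \<comment> \<open>Chosen so that mu^(1-q) = 2^beta: splitting off one summand by convexity, with
   weights 1 - mu and mu, costs exactly one factor 2^beta on the rest.\<close>
 define mu where "mu = (2 powr \<beta>) powr (- 1 / (q - 1))"
 have mu: "0 < mu" "mu < 1" "mu powr (1 - q) = 2 powr \<beta>"
 proof -
  show "0 < mu" by (simp add: mu_def)
  show "mu < 1" using q b by (simp add: mu_def powr_powr powr_less_one)
  have "- 1 / (q - 1) * (1 - q) = 1" using q by (simp add: field_simps)
  moreover have "mu powr (1 - q) = (2 powr \<beta>) powr (- 1 / (q - 1) * (1 - q))" unfolding mu_def by (rule powr_powr)
  ultimately show "mu powr (1 - q) = 2 powr \<beta>" by simp
 qed
 define c where "c = (1 - mu) powr (1 - q)"
 have two: "norm (x + y) powr q <= c * norm x powr q + (2 powr \<beta>) * norm y powr q" for x y :: 'b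
 proof -
  define X Y where "X = (1 / (1 - mu)) *R x" "Y = (1 / mu) *R y"
  have xy: "x = (1 - mu) *R X" "y = mu *R Y" using mu by (auto simp: X_Y_def)
  define Z where "Z = x + y"
  have "(1 - mu) * (norm Z powr q + q * (plap q Z \<bullet> (X - Z))) + mu * (norm Z powr q + q * (plap q Z \<bullet> (Y - Z)))
   <= (1 - mu) * norm X powr q + mu * norm Y powr q" using mu by (intro add_mono mult_left_mono plap_convex q) auto
  moreover have "(1 - mu) * (norm Z powr q + q * (plap q Z \<bullet> (X - Z))) + mu * (norm Z powr q + q * (plap q Z \<bullet> (Y - Z)))
   = norm Z powr q + q * (plap q Z \<bullet> ((1 - mu) *R X + mu *R Y - Z))" by (simp add: inner_diff_right inner_add_right algebra_simps)
  moreover have "(1 - mu) *R X + mu *R Y - Z = 0" using xy by (simp add: Z_def)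
  ultimately have "norm (x + y) powr q <= (1 - mu) * norm X powr q + mu * norm Y powr q" by (simp add: Z_def)
  also have "... = (1 - mu) * (norm x / (1 - mu)) powr q + mu * (norm y / mu) powr q" using mu by (simp add: X_Y_def)
  also have "... = c * norm x powr q + mu powr (1 - q) * norm y powr q"
  proof -
   have "(1 - mu) * (norm x / (1 - mu)) powr q = c * norm x powr q" using mu by (simp add: c_def powr_divide powr_diff)
   moreover have "mu * (norm y / mu) powr q = mu powr (1 - q) * norm y powr q" using mu(1) by (simp add: powr_divide powr_diff)
   ultimately show ?thesis by simp
  qed
  finally show ?thesis using mu by simp
 qed
 have c: "c > 0" using mu by (simp add: c_def)
 have "norm (\<Sum>j<J. a j) powr q <= c * (\<Sum>j<J. (2 powr \<beta>) ^ j * norm (a j) powr q)" for J and a :: "nat => 'b"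
 proof (induction J arbitrary: a)
  case 0 then show ?case by simp
 next
  case (Suc J)
  have "norm (\<Sum>j<Suc J. a j) powr q = norm (a 0 + (\<Sum>j<J. a (Suc j))) powr q" by (simp only: sum.lessThan_Suc_shift)
  also have "... <= c * norm (a 0) powr q + (2 powr \<beta>) * norm (\<Sum>j<J. a (Suc j)) powr q" by (rule two)
  also have "... <= c * norm (a 0) powr q + (2 powr \<beta>) * (c * (\<Sum>j<J. (2 powr \<beta>) ^ j * norm (a (Suc j)) powr q))"
   using Suc.IH[of "%j. a (Suc j)"] by simp
  also have "... = c * (\<Sum>j<Suc J. (2 powr \<beta>) ^ j * norm (a j) powr q)"
   unfolding sum.lessThan_Suc_shift by (simp add: distrib_left sum_distrib_left mult_ac)
  finally show ?case .
 qed
 then show ?thesis using c by blast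
qed

section \<open>Higher integrability of p-harmonic gradients\<close>

definition plap_harmonic :: "real => real => ('a::euclidean_space => 'a) => bool" where
 "plap_harmonic p R D \<longleftrightarrow> (ALL psi psi'. c1c R psi psi' --> (LBINT x. plap p (D x) \<bullet> psi' x) = 0)"

text \<open>p belongs to the equation, q is the integrability of the gradient reached so far. The
  iteration raises q and keeps p.\<close>

definition energy_bounded :: "real => real => real => ('a::euclidean_space => real) => ('a => 'a) => real => bool" where
 "energy_bounded p q R w D K \<longleftrightarrow> sob p (ball 0 R) w D & plap_harmonic p R D & en q (ball 0 R) D <= enn K"

lemma plap_pairing_zero_translate:
 fixes D :: "'a::euclidean_space => 'a"
 assumes h: "plap_harmonic p R D" and [measurable]: "meas D" and r: "norm k + r <= R" and psi: "c1c r psi psi'"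
 shows "(LBINT x. plap p (D (x + k)) \<bullet> psi' x) = 0"
proof -
 note c1_borel[OF c1c_c1[OF psi], measurable]
 have "c1c R (%x. psi (x + - k)) (%x. psi' (x + - k))" by (rule c1c_translate[OF psi]) (use r in simp)
 then have "0 = (LBINT x. plap p (D x) \<bullet> psi' (x + - k))" using h unfolding plap_harmonic_def by metis
 also have "... = (LBINT x. plap p (D (x + k)) \<bullet> psi' x)" by (subst integral_affine[where c=1 and t=k]) (auto simp: add.commute)
 finally show ?thesis ..
qed

text \<open>Testing the equation for the difference \<open>d\<close> of \<open>w\<close> with a truncated power of \<open>d\<close> times a cutoff.\<close>

lemma difference_energy:
 fixes w eta :: "'a::euclidean_space => real"
 assumes p: "p > 1" and q: "p <= q" and r: "0 < r" "r < R1" "norm h + R1 <= R" and h: "h ~= 0" "norm h <= 1"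
  and cut: "c1c R1 eta eta'" "!!x. 0 <= eta x" "!!x. norm x <= r ==> 1 <= eta x" and B: "!!x. norm (eta' x) <= B" "B >= 1"
  and cc: "Cc > 0" "!!l (a::'a) b. 0 < l ==> l <= 1 ==> norm (a - b) powr p <= Cc * l powr (min 1 (p/2)) *
   ((plap p a - plap p b) \<bullet> (a - b) / l + max (norm a) (norm b) powr p)"
  and s: "sob p (ball 0 R) w D" and eq: "plap_harmonic p R D"
  and K: "en q (ball 0 R) D <= enn K" "0 <= K"
 shows "(NN x. enn (tpw (q - p) m (w (x + h) - w x) * norm (D (x + h) - D x) powr p) * indicator (ball 0 r) x)
  <= enn (8 * Cc * B * K * norm h powr (q - p + min 1 (p/2)))"
proof -
 define a where "a = q - p"
 define l where "l = norm h"
 define k where "k = min 1 (p/2)"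
 have a: "0 <= a" using q by (simp add: a_def)
 have l: "0 < l" "l <= 1" using h by (auto simp: l_def)
 have q1: "q > 1" using p q by simp
 note sob_borel[OF s, measurable] c1_borel[OF c1c_c1[OF cut(1)], measurable]
 define d where "d x = w (x + h) - w x" for x
 define F where "F x = D (x + h)" for x
 have [measurable]: "meas d" "meas F" unfolding d_def F_def by measurable
 have [measurable]: "meas (tpw a m)" using tpw_continuous[OF a] by (rule borel_measurable_continuous_onI)
 have R1R: "R1 <= R" using r h norm_ge_zero[of h] by linarith
 have p0: "p > 0" using p by simp
 have sd: "sob p (ball 0 R1) d (%x. F x - D x)" unfolding d_def F_def by (rule sob_diff_translate[OF s r(3) p0])
 have subF: "{x. x - h \<in> ball 0 R1} \<subseteq> ball 0 R"
 proof
  fix x assume "x \<in> {x. x - h \<in> ball 0 R1}"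
  then show "x \<in> ball 0 R" using r(3) norm_triangle_sub[of x h] by simp
 qed
 have enF: "en s (ball 0 R1) F <= en s (ball 0 R) D" for s unfolding F_def by (subst en_translate) (simp, simp, rule en_mono_set[OF subF])
 have enD: "en s (ball 0 R1) D <= en s (ball 0 R) D" for s by (intro en_mono_set subset_ball R1R)
 \<comment> \<open>The difference divided by |h| has q-energy at most K, like D and its translate,
   which puts the three quantities on an equal footing.\<close>
 define y where "y x = d x / l" for x
 have [measurable]: "meas y" unfolding y_def by measurable
 have eny: "en q (ball 0 R1) y <= enn K"
 proof -
  have "en q (ball 0 R1) y = en q (ball 0 R1) (%x. (1/l) *R d x)" by (simp add: y_def[abs_def])
  also have "... = enn (abs (1/l) powr q) * en q (ball 0 R1) d" by (rule en_scaleR) auto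
  also have "... <= enn (abs (1/l) powr q) * (enn (norm h powr q) * en q (ball 0 R) D)"
   unfolding d_def by (intro mult_left_mono sob_diff_le[OF s p r(3) q1]) auto
  also have "... = (enn (abs (1/l) powr q) * enn (norm h powr q)) * en q (ball 0 R) D" by (simp add: mult.assoc)
  also have "enn (abs (1/l) powr q) * enn (norm h powr q) = 1" using l by (simp add: ennreal_mult'[symmetric] powr_mult[symmetric] l_def[symmetric])
  finally show ?thesis using K by simp
 qed
 let ?s = "%x. norm (F x) powr q + norm (D x) powr q + 2 * norm (y x) powr q"
 let ?E = "NN x. enn (?s x * indicator (ball 0 R1) x)"
 have en3: "?E <= enn (4 * K)"
 proof -
  have "?E = en q (ball 0 R1) F + en q (ball 0 R1) D + 2 * en q (ball 0 R1) y"
   unfolding en_def by (simp add: ennreal_mult' ennreal_indicator distrib_right mult.assoc nn_integral_cmult nn_integral_add)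
  also have "... <= enn K + enn K + 2 * enn K" by (intro add_mono mult_left_mono order_trans[OF enF K(1)] order_trans[OF enD K(1)] eny) auto
  also have "... = enn (K + K + 2 * K)" using K(2) by (simp only: ennreal_plus ennreal_mult) simp
  also have "K + K + 2 * K = 4 * K" by simp
  finally show ?thesis .
 qed
 obtain g where g: "!!t. (g has_real_derivative tpw a m t) (at t)" "!!t. abs (g t) <= abs t * tpw a m t" using tpw_primitive[OF a, of m] by auto
 have sg: "sob p (ball 0 R1) (%x. g (d x)) (%x. tpw a m (d x) *R (F x - D x))"
  by (rule sob_chain[OF sd _ _ p0 g(1) tpw_continuous[OF a], where L="pw a (real m)"])
   (use tpw_bounds[of a m] a emeasure_lborel_ball_finite[of "0::'a" R1] in auto)
 have [measurable]: "meas (%x. g (d x))" using sob_borel(1)[OF sg] .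
 define H where "H x = plap p (F x) - plap p (D x)" for x
 have [measurable]: "meas H" unfolding H_def by measurable
 have fD: "en p (ball 0 R) D < oo" by (rule sob_finite(2)[OF s])
 have enH: "en (p / (p - 1)) (ball 0 R1) H < oo"
 proof -
  have "en (p / (p - 1)) (ball 0 R1) H <= enn (2 powr (p / (p - 1))) * (en (p / (p - 1)) (ball 0 R1) (%x. plap p (F x)) + en (p / (p - 1)) (ball 0 R1) (%x. plap p (D x)))"
   unfolding H_def by (rule en_diff) (use p in auto)
  also have "... < oo" unfolding en_plap[OF p] using le_less_trans[OF enF fD] le_less_trans[OF enD fD] by (auto simp: ennreal_mult_less_top)
  finally show ?thesis .
 qed
 \<comment> \<open>The equation minus its translate: it has the difference H of the two fluxes and
   holds on the smaller ball, whose translate by h still lies inside the ball of radius R.\<close>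
 have eqH: "(LBINT x. H x \<bullet> psi' x) = 0" if psi: "c1c R1 psi psi'" for psi psi'
 proof -
  note c1_borel[OF c1c_c1[OF psi], measurable]
  have i: "integrable lborel (%x. plap p (X x) \<bullet> psi' x)" if [measurable]: "meas X" and "en p (ball 0 R1) X < oo" for X :: "'a => 'a"
   by (rule pairing_integrable[where S="ball 0 R1" and p=p]) (use that p c1c_outside[OF psi] c1c_en_finite(2)[OF psi p0] in \<open>auto simp: en_plap\<close>)
  have "(LBINT x. H x \<bullet> psi' x) = (LBINT x. plap p (F x) \<bullet> psi' x) - (LBINT x. plap p (D x) \<bullet> psi' x)" unfolding H_def inner_diff_left
   by (rule Bochner_Integration.integral_diff) (use i le_less_trans[OF enF fD] le_less_trans[OF enD fD] in auto)
  also have "(LBINT x. plap p (F x) \<bullet> psi' x) = 0" unfolding F_def by (rule plap_pairing_zero_translate[OF eq _ r(3) psi]) simp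
  also have "(LBINT x. plap p (D x) \<bullet> psi' x) = 0" using eq c1c_mono[OF psi R1R] by (auto simp: plap_harmonic_def)
  finally show ?thesis by simp
 qed
 have test: "(LBINT x. H x \<bullet> (eta x *R (tpw a m (d x) *R (F x - D x)) + g (d x) *R eta' x)) = 0" by (rule sob_test[OF sg cut(1) p _ enH eqH]) auto
 define P where "P x = eta x * tpw a m (d x) * (H x \<bullet> (F x - D x))" for x
 define Z where "Z x = g (d x) * (H x \<bullet> eta' x)" for x
 have [measurable]: "meas P" "meas Z" unfolding P_def Z_def by measurable
 have P0: "P x >= 0" for x unfolding P_def H_def using cut(2) tpw_bounds(1) plap_monotone_nonneg[OF p] by (intro mult_nonneg_nonneg) auto
 \<comment> \<open>The cutoff term. g(d) is of size |d|^(a+1) = l^(a+1) |y|^(a+1), and the exponents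
   p - 1 of the flux and a + 1 add up to q, so q-th powers suffice and a factor l^(a+1) is
   gained.\<close>
 have zl: "abs (Z x) <= l powr (a + 1) * B * ?s x" for x
 proof -
  have gd: "abs (g (d x)) <= l powr (a + 1) * norm (y x) powr (a + 1)"
  proof -
   have "abs (g (d x)) <= abs (d x) * pw a (abs (d x))" using g(2)[of "d x"] mult_left_mono[OF tpw_bounds(3)[OF a, of m "d x"], of "abs (d x)"] by simp
   also have "... = abs (d x) powr (a + 1)" by (rule mult_pw) simp
   also have "abs (d x) = l * norm (y x)" using l by (simp add: y_def)
   finally show ?thesis using l by (simp add: powr_mult)
  qed
  have HB: "abs (H x \<bullet> eta' x) <= (norm (F x) powr (p - 1) + norm (D x) powr (p - 1)) * B"
  proof -
   have "abs (H x \<bullet> eta' x) <= norm (H x) * norm (eta' x)" by (rule Cauchy_Schwarz_ineq2)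
   also have "... <= (norm (plap p (F x)) + norm (plap p (D x))) * B" unfolding H_def using B by (intro mult_mono norm_triangle_ineq4) auto
   finally show ?thesis by (simp add: norm_plap[OF p])
  qed
  have "abs (Z x) <= (l powr (a + 1) * norm (y x) powr (a + 1)) * ((norm (F x) powr (p - 1) + norm (D x) powr (p - 1)) * B)"
   unfolding Z_def abs_mult using gd HB by (intro mult_mono) auto
  also have "... = l powr (a + 1) * B * (norm (F x) powr (p - 1) * norm (y x) powr (a + 1) + norm (D x) powr (p - 1) * norm (y x) powr (a + 1))"
   by (simp add: algebra_simps)
  also have "... <= l powr (a + 1) * B * ((norm (F x) powr q + norm (y x) powr q) + (norm (D x) powr q + norm (y x) powr q))"
  proof (intro mult_left_mono add_mono)
   have e: "p - 1 + (a + 1) = q" by (simp add: a_def)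
   have *: "s powr (p - 1) * t powr (a + 1) <= s powr q + t powr q" if "0 <= s" "0 <= t" for s t :: real
   using powr_mult_pw_le[of s t "a + 1" "p - 1"] that a p unfolding e by (simp add: pw_def)
   show "norm (F x) powr (p - 1) * norm (y x) powr (a + 1) <= norm (F x) powr q + norm (y x) powr q"
   "norm (D x) powr (p - 1) * norm (y x) powr (a + 1) <= norm (D x) powr q + norm (y x) powr q" by (rule *; simp)+
  qed (use B in auto)
  finally show ?thesis by (simp add: algebra_simps)
 qed
 have Zsupp: "Z x = 0" if "x \<notin> ball 0 R1" for x using c1c_outside[OF cut(1), of x] that by (simp add: Z_def)
 have Psupp: "P x = 0" if "x \<notin> ball 0 R1" for x using c1c_outside[OF cut(1), of x] that by (simp add: P_def)
 have Zint: "(NN x. enn (abs (Z x))) <= enn (4 * B * K * l powr (a + 1))"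
 proof -
  have "(NN x. enn (abs (Z x))) <= (NN x. enn (l powr (a + 1) * B) * enn (?s x * indicator (ball 0 R1) x))"
   using zl Zsupp B by (intro nn_integral_mono) (auto simp: indicator_def ennreal_mult[symmetric] intro: ennreal_leI)
  also have "... = enn (l powr (a + 1) * B) * ?E" by (rule nn_integral_cmult) measurable
  also have "... <= enn (l powr (a + 1) * B) * enn (4 * K)" by (intro mult_left_mono en3) simp
  also have "... = enn (4 * B * K * l powr (a + 1))" using B K by (simp add: ennreal_mult[symmetric] mult_ac)
  finally show ?thesis .
 qed
 have Zi: "integrable lborel Z" by (rule integrableI_bounded) (use Zint in \<open>auto intro: le_less_trans\<close>)
 have PZi: "integrable lborel (%x. H x \<bullet> (eta x *R (tpw a m (d x) *R (F x - D x)) + g (d x) *R eta' x))"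
  by (rule pairing_integrable[where S="ball 0 R1" and p=p]) (use p enH c1c_outside[OF cut(1)] sob_mult_finite[OF sg cut(1) p0] in auto)
 have PZ: "H x \<bullet> (eta x *R (tpw a m (d x) *R (F x - D x)) + g (d x) *R eta' x) = P x + Z x" for x by (simp add: P_def Z_def inner_add_right)
 have "integrable lborel (%x. (P x + Z x) - Z x)" using PZi Zi unfolding PZ by (rule Bochner_Integration.integrable_diff)
 then have Pi: "integrable lborel P" by simp
 have "(LBINT x. P x) + (LBINT x. Z x) = 0" using test Pi Zi unfolding PZ by simp
 then have PeqZ: "(LBINT x. P x) = - (LBINT x. Z x)" by simp
 have Pint: "(NN x. enn (P x)) <= enn (4 * B * K * l powr (a + 1))"
 proof -
  have "(NN x. enn (P x)) = enn (LBINT x. P x)" by (rule nn_integral_eq_integral[OF Pi]) (simp add: P0)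
  also have "... <= enn (norm (LBINT x. Z x))" unfolding PeqZ by (rule ennreal_leI) simp
  also have "... <= (NN x. enn (norm (Z x)))" by (rule integral_norm_bound_ennreal[OF Zi])
  finally show ?thesis using Zint by simp
 qed
 define C1 where "C1 = Cc * l powr k"
 have C1: "C1 >= 0" using cc by (simp add: C1_def)
 \<comment> \<open>Coercivity with the parameter l = |h|. Its loss 1/l meets the factor l^(a+1) of
   the tested energy, its second term carries l^a from the weight; both contributions end up at
   l^(a+k).\<close>
 have pt: "tpw a m (d x) * norm (F x - D x) powr p <= C1 / l * P x + C1 * l powr a * ?s x"
  if x: "x \<in> ball 0 r" for x
 proof -
  define E where "E = H x \<bullet> (F x - D x)"
  have E0: "0 <= E" unfolding E_def H_def by (rule plap_monotone_nonneg[OF p])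
  have t0: "0 <= tpw a m (d x)" by (rule tpw_bounds(1))
  have "tpw a m (d x) * norm (F x - D x) powr p <= tpw a m (d x) * (C1 * (E / l + max (norm (F x)) (norm (D x)) powr p))"
   using cc(2)[OF l, of "F x" "D x"] t0 by (intro mult_left_mono) (auto simp: C1_def E_def H_def k_def)
  also have "... = C1 / l * (tpw a m (d x) * E) + C1 * (tpw a m (d x) * max (norm (F x)) (norm (D x)) powr p)" by (simp add: algebra_simps)
  also have "... <= C1 / l * P x + C1 * (l powr a * ?s x)"
  proof (intro add_mono mult_left_mono)
   have "1 * (tpw a m (d x) * E) <= eta x * (tpw a m (d x) * E)" using cut(3)[of x] x t0 E0 by (intro mult_right_mono) auto
   then show "tpw a m (d x) * E <= P x" by (simp add: P_def E_def mult.assoc)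
   have pwl: "pw a l <= l powr a" using l by (auto simp: pw_def)
   have "tpw a m (d x) <= pw a (abs (d x))" by (rule tpw_bounds(3)[OF a])
   also have "... = pw a l * pw a (norm (y x))" using l pw_scale[of "abs (d x)" l a] by (simp add: y_def)
   also have "... <= l powr a * pw a (norm (y x))" using pwl by (intro mult_right_mono pw_nonneg)
   finally have tp: "tpw a m (d x) <= l powr a * pw a (norm (y x))" .
   have *: "s powr p * pw a (norm (y x)) <= s powr q + norm (y x) powr q" if "0 <= s" for s
   using powr_mult_pw_le[of s "norm (y x)" a p] that a p0 by (simp add: a_def)
   have "tpw a m (d x) * max (norm (F x)) (norm (D x)) powr p <= (l powr a * pw a (norm (y x))) * (norm (F x) powr p + norm (D x) powr p)"
   using tp by (intro mult_mono) (auto simp: max_def pw_nonneg)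
   also have "... = l powr a * (norm (F x) powr p * pw a (norm (y x)) + norm (D x) powr p * pw a (norm (y x)))" by (simp add: algebra_simps)
   also have "... <= l powr a * ((norm (F x) powr q + norm (y x) powr q) + (norm (D x) powr q + norm (y x) powr q))" by (intro mult_left_mono add_mono *) auto
   finally show "tpw a m (d x) * max (norm (F x)) (norm (D x)) powr p <= l powr a * ?s x" by (simp add: algebra_simps)
  qed (use C1 l in auto)
  finally show ?thesis by (simp add: mult.assoc)
 qed
 have rR1: "ball 0 r \<subseteq> ball (0::'a) R1" using r by (intro subset_ball) simp
 have "(NN x. enn (tpw a m (d x) * norm (F x - D x) powr p) * indicator (ball 0 r) x)
  = (NN x. enn (tpw a m (d x) * norm (F x - D x) powr p * indicator (ball 0 r) x))" by (intro nn_integral_cong) (simp add: indicator_def)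
 also have "... <= enn (C1 / l) * (NN x. enn (P x)) + enn (C1 * l powr a) * ?E"
  using pt rR1 P0 C1 l by (intro nn_integral_le_lincomb) (auto simp: indicator_def)
 also have "... <= enn (C1 / l) * enn (4 * B * K * l powr (a + 1)) + enn (C1 * l powr a) * enn (4 * K)"
  by (intro add_mono mult_left_mono Pint en3) auto
 also have "... = enn (C1 / l * (4 * B * K * l powr (a + 1)) + C1 * l powr a * (4 * K))"
 proof -
  have "enn x * enn y + enn z * enn w = enn (x * y + z * w)" if "0 <= x" "0 <= y" "0 <= z" "0 <= w" for x y z w
   using that by (simp add: ennreal_mult)
  then show ?thesis using C1 l B K by simp
 qed
 also have "... <= enn (8 * Cc * B * K * l powr (a + k))"
 proof (rule ennreal_leI, goal_cases)
  case 1
  have "C1 / l * (4 * B * K * l powr (a + 1)) = 4 * B * K * (C1 * l powr a)" using l by (simp add: powr_add)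
  moreover have "C1 * l powr a * (4 * K) <= 4 * B * K * (C1 * l powr a)"
   using mult_right_mono[OF B(2), of "4 * K * (C1 * l powr a)"] K C1 by (simp add: mult_ac)
  ultimately have "C1 / l * (4 * B * K * l powr (a + 1)) + C1 * l powr a * (4 * K) <= 8 * B * K * (C1 * l powr a)" by simp
  also have "... = 8 * Cc * B * K * l powr (a + k)" by (simp add: C1_def powr_add mult_ac)
  finally show ?case .
 qed
 finally show ?thesis by (simp add: d_def F_def a_def l_def k_def)
qed

lemma en_le_cmult:
 fixes g :: "'a::euclidean_space => 'b::euclidean_space"
 assumes [measurable]: "meas g" "S \<in> sets borel" and c: "0 <= c"
  and le: "!!x. x \<in> S ==> norm (f x) powr q <= c * norm (g x) powr p"
 shows "en q S f <= enn c * en p S g"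
proof -
 have "en q S f <= (NN x. enn c * (enn (norm (g x) powr p) * indicator S x))"
  unfolding en_def by (intro nn_integral_mono) (use le c in \<open>auto simp: indicator_def ennreal_mult[symmetric] intro!: ennreal_leI\<close>)
 then show ?thesis unfolding en_def by (simp add: nn_integral_cmult)
qed

lemma plap_coercive_ex:
 assumes p: "p > 1"
 shows "EX C>0. ALL l (a::'a::real_inner) b. 0 < l --> l <= 1 --> norm (a - b) powr p <= C * l powr (min 1 (p/2)) *
   ((plap p a - plap p b) \<bullet> (a - b) / l + max (norm a) (norm b) powr p)"
proof (rule plap_coercive[OF p, where 'a='a])
 fix C assume "0 < C" and *: "!!l (a::'a) b. 0 < l ==> l <= 1 ==> norm (a - b) powr p <= C * l powr (min 1 (p/2)) *
   ((plap p a - plap p b) \<bullet> (a - b) / l + max (norm a) (norm b) powr p)"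
 show ?thesis by (intro exI[of _ C] conjI allI impI * \<open>0 < C\<close>)
qed

text \<open>Let X be the primitive of |t|^((q-p)/p). The energy of X(d) is the weighted energy of
  \<open>difference_energy\<close>, a shift by z costs |z|^p <= |h|^p, and the lower bound for X
  returns |d(x + z) - d(x)|^q since ((q-p)/p + 1) p = q. The powers of |h| add up to p + (q - p) + k
  = q + k.\<close>

lemma second_difference:
 fixes r0 R :: real
 assumes p: "p > 1" and q: "p <= q" and r0: "0 < r0" "r0 < R"
 defines "ta \<equiv> min 1 ((R - r0) / 3)"
 shows "EX C>=0. ALL (w::'a::euclidean_space => real) D K h z. energy_bounded p q R w D K --> 0 <= K --> h ~= 0 --> norm h <= ta --> norm z <= norm h -->
  en q (ball 0 r0) (%x. (w (x + z + h) - w (x + z)) - (w (x + h) - w x)) <= enn (C * K * norm h powr (q + min 1 (p/2)))"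
proof -
 have tau: "0 < ta" "ta <= 1" "r0 + 3 * ta <= R" using r0 by (auto simp: ta_def min_def field_simps)
 have "EX eta eta'. c1c (r0 + 2 * ta) eta eta' & (ALL x::'a. 0 <= eta x) & (ALL x. norm x <= r0 + ta --> 1 <= eta x)"
  by (rule cutoff_exists) (use tau r0 in auto)
 then obtain eta eta' where cut: "c1c (r0 + 2 * ta) eta eta'" "!!x::'a. 0 <= eta x" "!!x. norm x <= r0 + ta ==> 1 <= eta x" by blast
 obtain B0 where B0: "!!x. norm (eta' x) <= B0" using c1c_bounded_ex[OF cut(1)] by blast
 define B where "B = max 1 B0"
 have B: "!!x. norm (eta' x) <= B" "B >= 1" using B0 by (auto simp: B_def intro: max.coboundedI2)
 obtain Cc where cc: "Cc > 0" "!!l (a::'a) b. 0 < l ==> l <= 1 ==> norm (a - b) powr p <= Cc * l powr (min 1 (p/2)) *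
   ((plap p a - plap p b) \<bullet> (a - b) / l + max (norm a) (norm b) powr p)" using plap_coercive_ex[OF p, where 'a='a] by (elim exE conjE) (rule that, auto)
 define C where "C = 4 powr q * (8 * Cc * B)"
 have C: "C >= 0" using cc B by (simp add: C_def)
 have "en q (ball 0 r0) (%x. (w (x + z + h) - w (x + z)) - (w (x + h) - w x)) <= enn (C * K * norm h powr (q + min 1 (p/2)))"
  if eb: "energy_bounded p q R w D K" and K0: "0 <= K"
   and h: "h ~= 0" "norm h <= ta" and z: "norm z <= norm h" for w :: "'a => real" and D K h z
 proof -
  note s = eb[unfolded energy_bounded_def, THEN conjunct1]
  define k where "k = min 1 (p/2)"
  define a where "a = q - p"
  have a: "0 <= a" "0 <= a / p" "a / p + 1 = q / p" using p q by (auto simp: a_def field_simps)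
  define d where "d x = w (x + h) - w x" for x
  define E where "E x = D (x + h) - D x" for x
  note sob_borel[OF s, measurable]
  have [measurable]: "meas d" "meas E" unfolding d_def E_def by measurable
  have sd: "sob p (ball 0 (r0 + ta)) d E" unfolding d_def E_def by (rule sob_diff_translate[OF s]) (use h tau p in auto)
  \<comment> \<open>The lower bound for the primitive holds only where both arguments are below the
    truncation; elsewhere G is set to 0. For each x it is eventually the full difference, so Fatou's
    lemma removes m.\<close>
  define G where "G m x = (if abs (d (x + z)) <= real m & abs (d x) <= real m then d (x + z) - d x else 0)" for m x
  have [measurable]: "meas (G m)" for m unfolding G_def by measurable
  have bd: "en q (ball 0 r0) (G m) <= enn (C * K * norm h powr (q + k))" for m
  proof -
   have [measurable]: "meas (tpw (a/p) m)" using tpw_continuous[OF a(2)] by (rule borel_measurable_continuous_onI)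
   obtain X where X: "ALL t. (X has_real_derivative tpw (a/p) m t) (at t)"
   "ALL s t. abs s <= real m --> abs t <= real m --> (abs (s - t) / 4) powr (a/p + 1) <= abs (X s - X t)" using tpw_primitive[OF a(2), of m] by blast
   have sX: "sob p (ball 0 (r0 + ta)) (%x. X (d x)) (%x. tpw (a/p) m (d x) *R E x)"
   by (rule sob_chain[OF sd _ _ _ X(1)[rule_format] tpw_continuous[OF a(2)], where L="pw (a/p) (real m)"])
   (use tpw_bounds[of "a/p" m] a p emeasure_lborel_ball_finite[of "0::'a" "r0 + ta"] in auto)
   note sob_borel(1)[OF sX, measurable]
   have [measurable]: "meas (%x. X (d (x + z)) - X (d x))" using measurable_compose[OF _ sob_borel(1)[OF sX], of "%x. x + z" borel] by measurable
   have "en q (ball 0 r0) (G m) <= enn (4 powr q) * en p (ball 0 r0) (%x. X (d (x + z)) - X (d x))"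
   proof (rule en_le_cmult)
   fix x assume "x \<in> ball (0::'a) r0"
   show "norm (G m x) powr q <= 4 powr q * norm (X (d (x + z)) - X (d x)) powr p"
   proof (cases "abs (d (x + z)) <= real m & abs (d x) <= real m")
   case True
   then have "(abs (d (x + z) - d x) / 4) powr (q / p) <= abs (X (d (x + z)) - X (d x))" using X(2)[rule_format, of "d (x + z)" "d x"] a(3) by simp
   then have "((abs (d (x + z) - d x) / 4) powr (q / p)) powr p <= abs (X (d (x + z)) - X (d x)) powr p" using p by (intro powr_mono2) auto
   moreover have "((abs (d (x + z) - d x) / 4) powr (q / p)) powr p = (abs (d (x + z) - d x) / 4) powr q" using p by (simp add: powr_powr)
   ultimately have "(abs (d (x + z) - d x) / 4) powr q <= abs (X (d (x + z)) - X (d x)) powr p" by (simp only:)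
   moreover have "(abs (d (x + z) - d x) / 4) powr q = abs (d (x + z) - d x) powr q / 4 powr q" by (simp add: powr_divide)
   ultimately show ?thesis using True by (simp add: G_def pos_divide_le_eq mult.commute)
   qed (auto simp: G_def)
   qed auto
   also have "... <= enn (4 powr q) * (enn (norm z powr p) * en p (ball 0 (r0 + ta)) (%x. tpw (a/p) m (d x) *R E x))"
   by (intro mult_left_mono sob_diff_le[OF sX p _ p]) (use z h in auto)
   also have "en p (ball 0 (r0 + ta)) (%x. tpw (a/p) m (d x) *R E x) =
   (NN x. enn (tpw (q - p) m (w (x + h) - w x) * norm (D (x + h) - D x) powr p) * indicator (ball 0 (r0 + ta)) x)"
   unfolding en_def by (intro nn_integral_cong) (use p tpw_bounds(1)[of "a/p" m] in \<open>simp add: powr_mult tpw_bounds(4) a_def d_def E_def\<close>)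
   also have "... <= enn (8 * Cc * B * K * norm h powr (q - p + min 1 (p/2)))"
   by (rule difference_energy[OF p q _ _ _ h(1) _ cut B cc s]) (use tau r0 h eb K0 in \<open>auto simp: energy_bounded_def\<close>)
   also have "enn (4 powr q) * (enn (norm z powr p) * enn (8 * Cc * B * K * norm h powr (q - p + min 1 (p/2))))
   <= enn (4 powr q) * (enn (norm h powr p) * enn (8 * Cc * B * K * norm h powr (q - p + min 1 (p/2))))"
   using z p by (intro mult_left_mono mult_right_mono ennreal_leI powr_mono2) auto
   also have "... = enn (C * K * norm h powr (q + k))"
   proof -
   have "norm h powr (q + k) = norm h powr p * norm h powr (q - p + k)" by (simp add: powr_add[symmetric])
   then show ?thesis using cc B K0 by (simp add: C_def k_def ennreal_mult[symmetric] mult_ac)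
   qed
   finally show ?thesis by (simp add: mult_left_mono)
  qed
  have "en q (ball 0 r0) (%x. d (x + z) - d x) <= enn (C * K * norm h powr (q + k))"
  proof (rule en_fatou[OF _ _ _ _ bd])
   have "(%m. G m x) ---> d (x + z) - d x" for x
   proof (rule tendsto_eventually)
   obtain M where M: "max (abs (d (x + z))) (abs (d x)) <= real M" using real_arch_simple by blast
   show "eventually (%m. G m x = d (x + z) - d x) sequentially" using eventually_ge_at_top[of M] by eventually_elim (use M in \<open>auto simp: G_def\<close>)
   qed
   then show "AE x in lborel. x \<in> ball 0 r0 --> (%m. G m x) ---> d (x + z) - d x" by simp
  qed (use p q in auto)
  then show ?thesis by (simp add: d_def k_def)
 qed
 then show ?thesis using C by blast
qed

text \<open>The difference of quotients at steps T and T/2 is a second difference divided by T, with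
  q-energy of order T^k. Summing over T = t/2^j yields the rate; the limit of the quotients is
  identified a.e. along a subsequence by \<open>sob_diffquot\<close>, and Fatou's lemma transfers
  the bound to the exponent q.\<close>

lemma gradient_approximation:
 fixes r0 R :: real
 assumes p: "p > 1" and q: "p <= q" and r0: "0 < r0" "r0 < R"
 defines "ta \<equiv> min 1 ((R - r0) / 3)"
 shows "EX C>=0. ALL (w::'a::euclidean_space => real) D K e t. energy_bounded p q R w D K --> 0 <= K --> norm e = 1 --> 0 < t --> t <= ta -->
  en q (ball 0 r0) (%x. (w (x + t *R e) - w x) / t - D x \<bullet> e) <= enn (C * K * t powr min 1 (p/2))"
proof -
 define k where "k = min 1 (p/2)"
 have k: "k > 0" using p by (simp add: k_def)
 have tau: "0 < ta" "ta <= 1" "r0 + 3 * ta <= R" using r0 by (auto simp: ta_def min_def field_simps)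
 have q1: "q > 1" "q > 0" using p q by auto
 obtain C where C: "C >= 0" "ALL (w::'a => real) D K h z. energy_bounded p q R w D K --> 0 <= K --> h ~= 0 --> norm h <= ta --> norm z <= norm h -->
  en q (ball 0 r0) (%x. (w (x + z + h) - w (x + z)) - (w (x + h) - w x)) <= enn (C * K * norm h powr (q + k))"
  using second_difference[OF p q r0, where 'a='a, folded ta_def k_def] by (elim exE conjE) (rule that)
 obtain c where c: "c > 0" "ALL (J::nat) (a::nat => real). norm (\<Sum>j<J. a j) powr q <= c * (\<Sum>j<J. (2 powr (k/2)) ^ j * norm (a j) powr q)"
  using telescoping_powr[OF q1(1), of "k/2"] k by (auto simp del: real_norm_def)
 \<comment> \<open>Half of the decay rate k pays for the weights of \<open>telescoping_powr\<close>;
   the remaining factor 2^(-k/2) sums as a geometric series.\<close>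
 define y where "y = 2 powr (- k / 2)"
 have y: "0 < y" "y < 1" using k by (auto simp: y_def powr_less_one)
 define C' where "C' = c * C / (1 - y)"
 have C': "C' >= 0" using c C y by (simp add: C'_def)
 have "en q (ball 0 r0) (%x. (w (x + t *R e) - w x) / t - D x \<bullet> e) <= enn (C' * K * t powr k)"
  if eb: "energy_bounded p q R w D K" and K0: "0 <= K"
   and e: "norm e = 1" and t: "0 < t" "t <= ta" for w :: "'a => real" and D K e t
 proof -
  note s = eb[unfolded energy_bounded_def, THEN conjunct1]
  note sob_borel[OF s, measurable]
  define T where "T j = t / 2 ^ j" for j :: nat
  have T: "T j > 0" "T j <= t" "T j = 2 * T (Suc j)" for j using t by (auto simp: T_def field_simps)
  define Q where "Q j x = (w (x + T j *R e) - w x) / T j" for j x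
  have [measurable]: "meas (Q j)" for j unfolding Q_def by measurable
  define a where "a j x = Q j x - Q (Suc j) x" for j x
  have [measurable]: "meas (a j)" for j unfolding a_def by measurable
  have en_a: "en q (ball 0 r0) (a j) <= enn (C * K * t powr k * (y\<^sup>2) ^ j)" for j
  proof -
   define h where "h = T (Suc j) *R e"
   have nh: "norm h = T (Suc j)" using T(1)[of "Suc j"] e by (simp add: h_def)
   have h: "h ~= 0" "norm h <= ta" using nh T(1,2)[of "Suc j"] t by auto
   have "a j x = (1 / T j) *R ((w (x + h + h) - w (x + h)) - (w (x + h) - w x))" for x
   proof -
   have "T j *R e = h + h" unfolding h_def T(3)[of j] by (simp add: scaleR_2[symmetric])
   then have "Q j x = (w (x + h + h) - w x) / T j" by (simp add: Q_def add.assoc)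
   moreover have "Q (Suc j) x = 2 * (w (x + h) - w x) / T j" using T(1)[of "Suc j"] by (simp add: Q_def h_def T(3)[of j] field_simps)
   ultimately show ?thesis by (simp add: a_def diff_divide_distrib[symmetric])
   qed
   then have "en q (ball 0 r0) (a j) = enn (abs (1 / T j) powr q) * en q (ball 0 r0) (%x. (w (x + h + h) - w (x + h)) - (w (x + h) - w x))"
   by (subst en_scaleR[symmetric]) (auto intro!: en_cong)
   also have "... <= enn (abs (1 / T j) powr q) * enn (C * K * norm h powr (q + k))" by (intro mult_left_mono C(2)[rule_format, OF eb K0 h]) auto
   also have "... = enn ((1 / T j) powr q * (C * K * norm h powr (q + k)))" using T(1)[of j] by (subst ennreal_mult') auto
   also have "... <= enn ((1 / T j) powr q * (C * K * T j powr (q + k)))"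
   using T[of j] T(1)[of "Suc j"] C(1) K0 q1 k unfolding nh by (intro ennreal_leI mult_left_mono powr_mono2) auto
   also have "(1 / T j) powr q * (C * K * T j powr (q + k)) = C * K * T j powr k" using T(1)[of j] by (simp add: powr_add powr_divide)
   also have "T j powr k = t powr k * (y\<^sup>2) ^ j"
   proof -
   have "y\<^sup>2 = 2 powr (- k)" by (simp add: y_def power2_eq_square powr_add[symmetric])
   moreover have "(2 ^ j) powr k = (2 powr k) ^ j" by (rule two_pow_powr)
   ultimately show ?thesis using t by (simp add: T_def powr_divide powr_minus divide_simps power_mult_distrib[symmetric] flip: power_inverse)
   qed
   finally show ?thesis by (simp add: mult.assoc)
  qed
  have bd: "en q (ball 0 r0) (%x. Q 0 x - Q J x) <= enn (C' * K * t powr k)" for J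
  proof -
   have sum: "Q 0 x - Q J x = (\<Sum>j<J. a j x)" for x by (induction J) (auto simp: a_def)
   have "en q (ball 0 r0) (%x. Q 0 x - Q J x) <= (\<Sum>j<J. enn (c * (2 powr (k/2)) ^ j) * en q (ball 0 r0) (a j))"
   proof (rule en_le_sum)
   show "norm (Q 0 x - Q J x) powr q <= (\<Sum>j<J. c * (2 powr (k/2)) ^ j * norm (a j x) powr q)" for x
   using c(2)[rule_format, where J=J and a="%j. a j x"] unfolding sum by (simp add: sum_distrib_left mult.assoc)
   qed (use c(1) in auto)
   also have "... <= (\<Sum>j<J. enn (c * (2 powr (k/2)) ^ j) * enn (C * K * t powr k * (y\<^sup>2) ^ j))" by (intro sum_mono mult_left_mono en_a) auto
   also have "... = (\<Sum>j<J. enn (c * C * K * t powr k * y ^ j))"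
   proof (intro sum.cong refl)
   fix j
   have "2 powr (k/2) * y\<^sup>2 = y" by (simp add: y_def power2_eq_square powr_add[symmetric])
   then have "(2 powr (k/2)) ^ j * (y\<^sup>2) ^ j = y ^ j" by (simp add: power_mult_distrib[symmetric])
   then have "c * (2 powr (k/2)) ^ j * (C * K * t powr k * (y\<^sup>2) ^ j) = c * C * K * t powr k * y ^ j" by (simp add: mult_ac)
   then show "enn (c * (2 powr (k/2)) ^ j) * enn (C * K * t powr k * (y\<^sup>2) ^ j) = enn (c * C * K * t powr k * y ^ j)"
   using c C(1) K0 y by (subst ennreal_mult[symmetric]) auto
   qed
   also have "... = enn (\<Sum>j<J. c * C * K * t powr k * y ^ j)" using c C(1) K0 y by (intro sum_ennreal) auto
   also have "... <= enn (C' * K * t powr k)"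
   proof (rule ennreal_leI, goal_cases)
   case 1
   have "(\<Sum>j<J. y ^ j) <= (\<Sum>j. y ^ j)" using y by (intro sum_le_suminf) (auto intro: summable_geometric)
   also have "... = 1 / (1 - y)" using y by (intro suminf_geometric) auto
   finally have "c * C * K * t powr k * (\<Sum>j<J. y ^ j) <= c * C * K * t powr k * (1 / (1 - y))" using c C(1) K0 by (intro mult_left_mono) auto
   then show ?case by (simp add: sum_distrib_left C'_def mult_ac)
   qed
   finally show ?thesis .
  qed
  have lim: "(%j. en p (ball 0 r0) (%x. Q j x - D x \<bullet> e)) ---> 0" unfolding Q_def
  proof (rule sob_diffquot[OF s p r0(2) e T(1)])
   have "(%j. t * (1/2) ^ j) ---> t * 0" by (intro tendsto_mult tendsto_const LIMSEQ_power_zero) simp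
   then show "T ---> 0" unfolding T_def[abs_def] by (simp add: power_one_over)
   show "T j + r0 <= R" for j using T(2)[of j] t tau by linarith
  qed
  obtain f where f: "strict_mono f" "AE x in lborel. x \<in> ball 0 r0 --> (%n. Q (f n) x) ---> D x \<bullet> e"
   by (rule en_AE_subseq[OF _ _ _ _ lim]) (use p in auto)
  have "en q (ball 0 r0) (%x. Q 0 x - D x \<bullet> e) <= enn (C' * K * t powr k)" by (rule en_fatou[where F="%n x. Q 0 x - Q (f n) x"])
   (use q1 bd f(2) in \<open>auto elim!: eventually_mono intro!: tendsto_intros\<close>)
  then show ?thesis by (simp add: Q_def T_def)
 qed
 then show ?thesis using C' unfolding k_def by blast
qed

text \<open>At scale t the mean of the difference quotient differs from the directional derivative
  by energy of order t^k, while that mean is bounded pointwise by a multiple of t^(-N/q). With t_j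
  falling like 2^(-qj/N) the bound is half of the j-th level, and \<open>en_by_levels\<close>
  applies.\<close>

lemma directional_gain:
 fixes e :: "'a::euclidean_space"
 assumes p: "p > 1" and q: "p <= q" and r: "0 < r" "r < R" and K: "0 < K" and e: "norm e = 1"
 shows "EX K'>=0. ALL w D. energy_bounded p q R w D K -->
  en (q * (1 + min 1 (p/2) / (2 * real DIM('a)))) (ball 0 r) (%x. D x \<bullet> e) <= enn K'"
proof -
 define r0 where "r0 = (r + R) / 2"
 define ta where "ta = min 1 ((R - r0) / 3)"
 define k where "k = min 1 (p/2)"
 define n where "n = real DIM('a)"
 have n: "n > 0" by (simp add: n_def)
 have k: "k > 0" using p by (simp add: k_def)
 have r0: "0 < r0" "r0 < R" using r by (auto simp: r0_def)
 have tau: "0 < ta" "ta <= 1" "r0 + 3 * ta <= R" "r + ta <= r0" using r r0 by (auto simp: ta_def r0_def min_def field_simps)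
 have q1: "q > 1" "q > 0" using p q by auto
 obtain C1 where C1: "C1 >= 0" "ALL (w::'a => real) D K h z. energy_bounded p q R w D K --> 0 <= K --> h ~= 0 --> norm h <= ta --> norm z <= norm h -->
  en q (ball 0 r0) (%x. (w (x + z + h) - w (x + z)) - (w (x + h) - w x)) <= enn (C1 * K * norm h powr (q + k))"
  using second_difference[OF p q r0, where 'a='a, folded ta_def k_def] by (elim exE conjE) (rule that)
 obtain C2 where C2: "C2 >= 0" "ALL (w::'a => real) D K e t. energy_bounded p q R w D K --> 0 <= K --> norm e = 1 --> 0 < t --> t <= ta -->
  en q (ball 0 r0) (%x. (w (x + t *R e) - w x) / t - D x \<bullet> e) <= enn (C2 * K * t powr k)"
  using gradient_approximation[OF p q r0, where 'a='a, folded ta_def k_def] by (elim exE conjE) (rule that)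
 define V where "V = measure lborel (ball (0::'a) 1)"
 have V: "V > 0" unfolding V_def using content_ball_pos[of 1 "0::'a"] by simp
 \<comment> \<open>The rate at which t_j^k falls when t_j falls like 2^(-qj/n).\<close>
 define si where "si = k * q / n"
 \<comment> \<open>Twice the pointwise bound for the means at the largest scale \<open>ta\<close>,
   so that means at scale \<open>t j\<close> stay below half of L 2^j.\<close>
 define L where "L = 2 * (K / (V * ta ^ DIM('a))) powr (1 / q)"
 have L: "L > 0" using K V tau by (simp add: L_def)
 define C where "C = 2 powr q * (C1 + C2) * K * ta powr k"
 have C: "C >= 0" using C1 C2 K by (simp add: C_def)
 \<comment> \<open>Half of the admissible gain q k / n, which keeps the inequality Q - q < si
   strict.\<close>
 define Q where "Q = q * (1 + k / (2 * n))"
 have Q: "Q > 0" "Q - q < si" using q1 k n by (auto simp: Q_def si_def field_simps add_pos_pos)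
 define K' where "K' = L powr Q * measure lborel (ball (0::'a) r) + C * (L powr (Q - q) * 2 powr (Q + q) / (1 - 2 powr (Q - q - si)))"
 have K': "0 <= L powr Q * measure lborel (ball (0::'a) r)" "0 <= C * (L powr (Q - q) * 2 powr (Q + q) / (1 - 2 powr (Q - q - si)))"
  using C Q by (auto intro!: mult_nonneg_nonneg divide_nonneg_nonneg simp: powr_less_one less_imp_le)
 have bound: "en Q (ball 0 r) (%x. D x \<bullet> e) <= enn K'"
  if eb: "energy_bounded p q R w D K" for w :: "'a => real" and D
 proof -
  have s: "sob p (ball 0 R) w D" and KD: "en q (ball 0 R) D <= enn K" using eb by (auto simp: energy_bounded_def)
  note sob_borel[OF s, measurable]
  define t where "t j = ta * (2 powr (- (q / n))) ^ j" for j :: nat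
  have t: "t j > 0" "t j <= ta" for j
  proof -
   have "2 powr (- (q / n)) < 1" using q1 n by (simp add: powr_less_one)
   then have "(2 powr (- (q / n))) ^ j <= 1" by (intro power_le_one) auto
   then show "t j > 0" "t j <= ta" using tau by (auto simp: t_def)
  qed
  define G where "G j x = (w (x + t j *R e) - w x) / t j" for j x
  have [measurable]: "meas (G j)" for j unfolding G_def by measurable
  have [measurable]: "meas (bavg (t j) (G j))" for j using t by (intro bavg_measurable) auto
  define b where "b j x = D x \<bullet> e - bavg (t j) (G j) x" for j x
  have [measurable]: "meas (b j)" for j unfolding b_def by measurable
  have osc: "en q (ball 0 r) (%x. G j x - bavg (t j) (G j) x) <= enn (C1 * K * t j powr k)" for j
  proof (rule bavg_diff_le[OF t(1) _ _ q1(1)])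
   fix z :: 'a assume z: "norm z < t j"
   define h where "h = t j *R e"
   have h: "h ~= 0" "norm h <= ta" "norm h = t j" using t[of j] e by (auto simp: h_def)
   have "en q (ball 0 r) (%x. G j (x + z) - G j x) =
   en q (ball 0 r) (%x. (1 / t j) *R ((w (x + z + h) - w (x + z)) - (w (x + h) - w x)))"
   by (rule en_cong) (simp add: G_def h_def diff_divide_distrib[symmetric])
   also have "... = enn (abs (1 / t j) powr q) * en q (ball 0 r) (%x. (w (x + z + h) - w (x + z)) - (w (x + h) - w x))" by (rule en_scaleR) auto
   also have "... <= enn (abs (1 / t j) powr q) * en q (ball 0 r0) (%x. (w (x + z + h) - w (x + z)) - (w (x + h) - w x))"
   using tau by (intro mult_left_mono en_mono_set subset_ball) auto
   also have "... <= enn (abs (1 / t j) powr q) * enn (C1 * K * norm h powr (q + k))"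
   by (intro mult_left_mono C1(2)[rule_format, OF eb]) (use K h z in auto)
   also have "... = enn (abs (1 / t j) powr q * (C1 * K * norm h powr (q + k)))" by (subst ennreal_mult') auto
   also have "abs (1 / t j) powr q * (C1 * K * norm h powr (q + k)) = C1 * K * t j powr k" using t(1)[of j] unfolding h(3) by (simp add: powr_add powr_divide)
   finally show "en q (ball 0 r) (%x. G j (x + z) - G j x) <= enn (C1 * K * t j powr k)" .
  qed auto
  have enb: "en q (ball 0 r) (b j) <= enn (C * (2 powr (- si)) ^ j)" for j
  proof -
   have "en q (ball 0 r) (b j) = en q (ball 0 r) (%x. (G j x - bavg (t j) (G j) x) - (G j x - D x \<bullet> e))" by (rule en_cong) (simp add: b_def)
   also have "... <= enn (2 powr q) * (en q (ball 0 r) (%x. G j x - bavg (t j) (G j) x) + en q (ball 0 r) (%x. G j x - D x \<bullet> e))"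
   by (rule en_diff) (use q1 in auto)
   also have "en q (ball 0 r) (%x. G j x - D x \<bullet> e) <= en q (ball 0 r0) (%x. G j x - D x \<bullet> e)" using tau by (intro en_mono_set subset_ball) auto
   also have "... <= enn (C2 * K * t j powr k)" unfolding G_def by (intro C2(2)[rule_format, OF eb]) (use K e t in auto)
   also note osc[of j]
   also have "enn (2 powr q) * (enn (C1 * K * t j powr k) + enn (C2 * K * t j powr k)) = enn (2 powr q * (C1 + C2) * K * t j powr k)"
   using C1(1) C2(1) K by (simp add: ennreal_plus[symmetric] ennreal_mult[symmetric] algebra_simps del: ennreal_plus)
   also have "2 powr q * (C1 + C2) * K * t j powr k = C * (2 powr (- si)) ^ j"
   proof -
   have "((2 powr (- (q / n))) ^ j) powr k = (2 powr (- si)) ^ j" by (simp add: powr_realpow[symmetric] powr_powr si_def mult_ac)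
   then show ?thesis using tau by (simp add: t_def C_def powr_mult)
   qed
   finally show ?thesis by (simp add: mult_left_mono add_mono)
  qed
  have avg: "abs (bavg (t j) (G j) x) <= (L / 2) * 2 ^ j" if x: "x \<in> ball 0 r" for j x
  proof -
   have "ball x (t j) \<subseteq> ball 0 r0"
   proof
   fix y assume "y \<in> ball x (t j)"
   then have "dist x y < t j" by simp
   then show "y \<in> ball 0 r0" using x t(2)[of j] tau(4) dist_triangle[of 0 y x] by simp
   qed
   then have "en q (ball x (t j)) (G j) <= en q (ball 0 r0) (G j)" by (rule en_mono_set)
   also have "... = en q (ball 0 r0) (%x. (1 / t j) *R (w (x + t j *R e) - w x))" by (rule en_cong) (simp add: G_def)
   also have "... = enn (abs (1 / t j) powr q) * en q (ball 0 r0) (%x. w (x + t j *R e) - w x)" by (rule en_scaleR) auto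
   also have "... <= enn (abs (1 / t j) powr q) * (enn (norm (t j *R e) powr q) * en q (ball 0 R) D)"
   by (intro mult_left_mono sob_diff_le[OF s p _ q1(1)]) (use t(2)[of j] t(1)[of j] tau e in auto)
   also have "... = (enn (abs (1 / t j) powr q) * enn (norm (t j *R e) powr q)) * en q (ball 0 R) D" by (simp add: mult.assoc)
   also have "enn (abs (1 / t j) powr q) * enn (norm (t j *R e) powr q) = 1"
   using t(1)[of j] e by (simp add: ennreal_mult'[symmetric] powr_mult[symmetric])
   finally have GK: "en q (ball x (t j)) (G j) <= enn K" using KD by (simp add: order_trans)
   have "enn (norm (bavg (t j) (G j) x) powr q) <= enn (1 / measure lborel (ball (0::'a) (t j))) * en q (ball x (t j)) (G j)"
   by (rule bavg_bound[OF t(1) _ q1(1)]) auto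
   also have "... <= enn (1 / measure lborel (ball (0::'a) (t j))) * enn K" by (intro mult_left_mono GK) auto
   also have "... = enn (K / (t j ^ DIM('a) * V))" using K measure_ball_eq[OF t(1)[of j], of "0::'a"] by (simp add: ennreal_mult''[symmetric] V_def)
   finally have "norm (bavg (t j) (G j) x) powr q <= K / (t j ^ DIM('a) * V)" using K V t(1)[of j] by simp
   then have "(norm (bavg (t j) (G j) x) powr q) powr (1 / q) <= (K / (t j ^ DIM('a) * V)) powr (1 / q)" using q1 by (intro powr_mono2) auto
   then have "abs (bavg (t j) (G j) x) <= (K / (t j ^ DIM('a) * V)) powr (1 / q)" using q1 by (simp add: powr_powr)
   also have "K / (t j ^ DIM('a) * V) = (K / (V * ta ^ DIM('a))) * (2 ^ j) powr q"
   proof -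
   have "((2 powr (- (q / n))) ^ j) ^ DIM('a) = 2 powr (- (q * j))" using n by (simp add: powr_realpow[symmetric] powr_powr n_def)
   moreover have "(2 ^ j) powr q = 2 powr (q * j)" by (simp add: powr_realpow[symmetric] powr_powr mult.commute)
   ultimately show ?thesis by (simp add: t_def power_mult_distrib powr_minus divide_simps)
   qed
   also have "((K / (V * ta ^ DIM('a))) * (2 ^ j) powr q) powr (1 / q) = (L / 2) * 2 ^ j" using K V tau q1 by (subst powr_mult) (simp_all add: powr_powr L_def)
   finally show ?thesis .
  qed
  have "en Q (ball 0 r) (%x. D x \<bullet> e) <= enn (L powr Q) * emeasure lborel (ball (0::'a) r) + enn (C * (L powr (Q - q) * 2 powr (Q + q) / (1 - 2 powr (Q - q - si))))"
  proof (rule en_by_levels[OF _ _ _ q1(2) Q(1) L C Q(2) _ enb])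
   fix j x assume x: "x \<in> ball 0 r" and "L * 2 ^ j < norm (D x \<bullet> e)" "norm (D x \<bullet> e) <= L * 2 ^ Suc j"
   then show "norm (D x \<bullet> e) <= 2 * norm (b j x)" using avg[OF x, of j] norm_triangle_ineq2[of "D x \<bullet> e" "bavg (t j) (G j) x"] by (simp add: b_def)
  qed auto
  also have "... = enn K'" using K' by (simp add: emeasure_ball_eq ennreal_mult[symmetric] K'_def)
  finally show ?thesis .
 qed
 have "0 <= K'" using K' by (simp add: K'_def)
 then show ?thesis by (intro exI[of _ K'] conjI allI impI bound[unfolded Q_def k_def n_def])
qed

lemma gradient_gain:
 assumes p: "p > 1" and q: "p <= q" and r: "0 < r" "r < R" and K: "0 < K"
 shows "EX K'>0. ALL w (D::'a::euclidean_space => 'a). energy_bounded p q R w D K -->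
  en (q * (1 + min 1 (p/2) / (2 * real DIM('a)))) (ball 0 r) D <= enn K'"
proof -
 define Q where "Q = q * (1 + min 1 (p/2) / (2 * real DIM('a)))"
 have Q: "Q > 0" unfolding Q_def using p q by (intro mult_pos_pos add_pos_nonneg) auto
 have "ALL e:Basis::'a set. EX K'>=0. ALL w D. energy_bounded p q R w D K -->
  en Q (ball 0 r) (%x. D x \<bullet> e) <= enn K'" unfolding Q_def by (intro ballI directional_gain p q r K norm_Basis)
 from bchoice[OF this] obtain k where k: "ALL e:Basis::'a set. 0 <= k e & (ALL w D. energy_bounded p q R w D K -->
  en Q (ball 0 r) (%x. D x \<bullet> e) <= enn (k e))" by (elim exE) (rule that)
 define n where "n = real DIM('a)"
 define K' where "K' = n powr Q * (\<Sum>e\<in>Basis. k e) + 1"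
 have bound: "en Q (ball 0 r) D <= enn K'" if eb: "energy_bounded p q R w D K" for w and D :: "'a => 'a"
 proof -
  have [measurable]: "meas D" using eb sob_borel(2) unfolding energy_bounded_def by blast
  have "en Q (ball 0 r) D <= (\<Sum>e\<in>Basis. enn (n powr Q) * en Q (ball 0 r) (%x. D x \<bullet> e))"
  proof (rule en_le_sum)
   show "norm (D x) powr Q <= (\<Sum>e\<in>Basis. n powr Q * norm (D x \<bullet> e) powr Q)" for x
   proof -
   define m where "m = Max ((%e. abs (D x \<bullet> e)) ` Basis)"
   have "m \<in> (%e. abs (D x \<bullet> e)) ` Basis" unfolding m_def by (rule Max_in) auto
   then obtain e where e: "e \<in> Basis" "m = abs (D x \<bullet> e)" by auto
   have "norm (D x) <= (\<Sum>e\<in>Basis. abs (D x \<bullet> e))" by (rule norm_le_l1)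
   also have "... <= (\<Sum>e\<in>(Basis::'a set). m)" unfolding m_def by (intro sum_mono Max_ge) auto
   finally have "norm (D x) <= n * m" by (simp add: n_def)
   then have "norm (D x) powr Q <= (n * m) powr Q" using Q by (intro powr_mono2) auto
   also have "... = n powr Q * norm (D x \<bullet> e) powr Q" using e by (simp add: powr_mult n_def)
   also have "... <= (\<Sum>e\<in>Basis. n powr Q * norm (D x \<bullet> e) powr Q)" by (rule member_le_sum[OF e(1)]) auto
   finally show ?thesis .
   qed
  qed auto
  also have "... <= (\<Sum>e\<in>Basis. enn (n powr Q) * enn (k e))" by (intro sum_mono mult_left_mono) (use k eb in auto)
  also have "... = enn (\<Sum>e\<in>Basis. n powr Q * k e)" using k by (subst sum_ennreal[symmetric]) (auto simp: ennreal_mult)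
  also have "... <= enn K'" by (intro ennreal_leI) (simp add: K'_def sum_distrib_left)
  finally show ?thesis .
 qed
 have "K' > 0" using k by (auto simp: K'_def intro!: add_nonneg_pos mult_nonneg_nonneg sum_nonneg)
 then show ?thesis by (intro exI[of _ K'] conjI allI impI bound[unfolded Q_def])
qed

text \<open>The gain factor l > 1 does not depend on the exponent already reached, so its powers
  exceed any prescribed \<open>q0\<close> after finitely many rounds.\<close>

lemma gradient_higher_integrability:
 assumes p: "p > 1" and r: "0 < r" "r < R"
 shows "EX q>=q0. EX K>0. q >= p & (ALL w (D::'a::euclidean_space => 'a). energy_bounded p p R w D 1 -->
  en q (ball 0 r) D <= enn K)"
proof -
 define l where "l = 1 + min 1 (p/2) / (2 * real DIM('a))"
 have l: "l > 1" using p by (simp add: l_def)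
 have step: "EX K>0. ALL w (D::'a => 'a). energy_bounded p p R w D 1 -->
  en (p * l ^ j) (ball 0 r) D <= enn K" if "0 < r" "r < R" for r j using that
 proof (induction j arbitrary: r)
  case 0
  have "en p (ball 0 r) D <= enn 1" if "energy_bounded p p R w D 1" for w and D :: "'a => 'a"
   using that unfolding energy_bounded_def by (elim conjE) (erule order_trans[rotated], rule en_mono_set, use 0 in auto)
  then show ?case by (intro exI[of _ 1]) auto
 next
  case (Suc j)
  \<comment> \<open>The induction runs over all radii at once: the bound at stage j is taken on an
    intermediate ball and spent on the ball of radius r.\<close>
  define r' where "r' = (r + R) / 2"
  have r': "0 < r'" "r' < R" "r < r'" using Suc by (auto simp: r'_def)
  obtain K1 where K1: "K1 > 0" "ALL w (D::'a => 'a). energy_bounded p p R w D 1 -->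
   en (p * l ^ j) (ball 0 r') D <= enn K1" using Suc.IH[OF r'(1,2)] by blast
  have pq: "p <= p * l ^ j" using p l by simp
  obtain K2 where K2: "K2 > 0" "ALL w (D::'a => 'a). energy_bounded p (p * l ^ j) r' w D K1 -->
   en (p * l ^ j * l) (ball 0 r) D <= enn K2" using gradient_gain[OF p pq Suc.prems(1) r'(3) K1(1), where 'a='a] unfolding l_def by blast
  have "en (p * l ^ Suc j) (ball 0 r) D <= enn K2" if eb: "energy_bounded p p R w D 1" for w and D :: "'a => 'a"
  proof -
   have "sob p (ball 0 r') w D" by (rule sob_mono[where T="ball 0 R"]) (use r' eb in \<open>auto simp: energy_bounded_def\<close>)
   moreover have "plap_harmonic p r' D" using eb c1c_mono r'(2) unfolding energy_bounded_def plap_harmonic_def by (meson less_imp_le)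
   ultimately have "energy_bounded p (p * l ^ j) r' w D K1" using K1(2)[rule_format, OF eb] by (simp add: energy_bounded_def)
   then show ?thesis using K2(2) by (auto simp: mult_ac)
  qed
  then show ?case using K2(1) by blast
 qed
 obtain j where "max 1 (q0 / p) < l ^ j" using real_arch_pow[OF l] by blast
 then have "q0 <= p * l ^ j" "p <= p * l ^ j" using p by (auto simp: field_simps)
 then show ?thesis using step[OF r, of j] by blast
qed

section \<open>Comparison and energy decay for nearly constant coefficients\<close>

definition weak_eq :: "real => ('a::euclidean_space => 'a) => ('a => real) => ('a => real) => bool" where
 "weak_eq p D b f \<longleftrightarrow> (ALL psi psi'. c1c 1 psi psi' --> (LBINT x. b x * (plap p (D x) \<bullet> psi' x)) = (LBINT x. f x * psi x))"

text \<open>Unit ball, unit energy, and one parameter for the deviation of the coefficient and the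
  L^N norm of the source: the normalization that reproduces itself under
  \<open>nearly_harmonic_rescale\<close>.\<close>

definition nearly_harmonic :: "real => real => ('a::euclidean_space => real) => ('a => 'a) => ('a => real) => ('a => real) => bool" where
 "nearly_harmonic p ep v D b f \<longleftrightarrow> meas D & meas b & meas f &
  (ALL r<1. sob p (ball 0 r) v D) & en p (ball 0 1) D <= 1 & (ALL x:ball 0 1. abs (b x - 1) <= ep) &
  en (real DIM('a)) (ball 0 1) f <= enn (ep powr real DIM('a)) & weak_eq p D b f"

lemma plap_scaleR: "0 < m ==> plap p (m *R z) = m powr (p - 1) *R plap p z"
 by (cases "z = 0") (simp_all add: plap_def powr_mult powr_diff power2_eq_square)

text \<open>The original equation is tested with psi((x - t)/c). The chain rule supplies a factor
  1/c on the left only, and the flux of m D is m^(p-1) times that of D; hence the factor k c m^(p-1)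
  on the source.\<close>

lemma weak_eq_rescale:
 fixes D :: "'a::euclidean_space => 'a"
 assumes e: "weak_eq p D b f" and [measurable]: "meas D" "meas b" "meas f"
  and c: "c > 0" "norm t + c <= 1" and m: "m > 0"
 shows "weak_eq p (%x. m *R D (t + c *R x)) (%x. k * b (t + c *R x)) (%x. (k * c * m powr (p - 1)) * f (t + c *R x))" unfolding weak_eq_def
proof (intro allI impI)
 fix psi :: "'a => real" and psi' assume psi: "c1c 1 psi psi'"
 note c1_borel[OF c1c_c1[OF psi], measurable]
 define ze where "ze x = psi ((- (1/c)) *R t + (1/c) *R x)" for x
 define ze' where "ze' x = (1/c) *R psi' ((- (1/c)) *R t + (1/c) *R x)" for x
 have [measurable]: "meas ze" "meas ze'" unfolding ze_def ze'_def by measurable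
 obtain s where s: "s > 0" "s < 1" "!!x. s <= norm x ==> psi x = 0 & psi' x = 0" using psi by (auto simp: c1c_def)
 have "ze x = 0 & ze' x = 0" if x: "norm t + c * s <= norm x" for x
 proof -
  have "norm x <= norm (x - t) + norm t" using norm_triangle_ineq[of "x - t" t] by simp
  then have "s <= norm (x - t) / c" using x c by (simp add: field_simps)
  also have "... = norm ((- (1/c)) *R t + (1/c) *R x)" using c norm_scaleR[of "1/c" "x - t"] by (simp add: scaleR_diff_right)
  finally show ?thesis using s(3) by (simp add: ze_def ze'_def)
 qed
 moreover have "norm t + c * s > 0" using s c by (intro add_nonneg_pos mult_pos_pos) auto
 moreover have "norm t + c * s < 1" using c mult_strict_left_mono[OF s(2) c(1)] by linarith
 ultimately have "c1c 1 ze ze'" unfolding c1c_def using c1_affine[OF c1c_c1[OF psi], of "(- (1/c)) *R t" "1/c"] by (auto simp: ze_def[abs_def] ze'_def[abs_def])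
 then have "(LBINT x. b x * (plap p (D x) \<bullet> ze' x)) = (LBINT x. f x * ze x)" using e unfolding weak_eq_def by blast
 moreover have "ze (t + c *R x) = psi x" "ze' (t + c *R x) = (1/c) *R psi' x" for x using c by (simp_all add: ze_def ze'_def scaleR_add_right)
 moreover have "(LBINT x. b x * (plap p (D x) \<bullet> ze' x)) = abs c ^ DIM('a) *R (LBINT x. b (t + c *R x) * (plap p (D (t + c *R x)) \<bullet> ze' (t + c *R x)))"
  using c by (intro integral_affine) auto
 moreover have "(LBINT x. f x * ze x) = abs c ^ DIM('a) *R (LBINT x. f (t + c *R x) * ze (t + c *R x))" using c by (intro integral_affine) auto
 ultimately have "c ^ DIM('a) * (LBINT x. b (t + c *R x) * (plap p (D (t + c *R x)) \<bullet> psi' x) / c) = c ^ DIM('a) * (LBINT x. f (t + c *R x) * psi x)"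
  using c by simp
 then have *: "(LBINT x. b (t + c *R x) * (plap p (D (t + c *R x)) \<bullet> psi' x) / c) = (LBINT x. f (t + c *R x) * psi x)"
  by (rule mult_left_cancel[THEN iffD1, rotated]) (use c in simp)
 have "(LBINT x. k * b (t + c *R x) * (plap p (m *R D (t + c *R x)) \<bullet> psi' x))
  = (LBINT x. (k * c * m powr (p - 1)) * (b (t + c *R x) * (plap p (D (t + c *R x)) \<bullet> psi' x) / c))"
  using c by (intro Bochner_Integration.integral_cong refl) (simp add: plap_scaleR[OF m])
 also have "... = (k * c * m powr (p - 1)) * (LBINT x. f (t + c *R x) * psi x)" by (simp only: integral_mult_right_zero *)
 also have "... = (LBINT x. (k * c * m powr (p - 1)) * f (t + c *R x) * psi x)" by (simp add: mult.assoc)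
 finally show "(LBINT x. k * b (t + c *R x) * (plap p (m *R D (t + c *R x)) \<bullet> psi' x))
  = (LBINT x. (k * c * m powr (p - 1)) * f (t + c *R x) * psi x)" .
qed

text \<open>The flux pairing equals that of (1 - b) times the flux plus the source pairing, and each
  is of order ep for test gradients of energy at most K^p.\<close>

lemma nearly_harmonic_pairing:
 fixes K :: real
 assumes p: "p > 1" and N: "DIM('a::euclidean_space) >= 2" and K: "K > 0"
 shows "EX M>=0. ALL ep v (D::'a => 'a) b f psi psi'. 0 < ep --> nearly_harmonic p ep v D b f --> c1c 1 psi psi' -->
  en p UNIV psi' <= enn (K powr p) --> abs (LBINT x. plap p (D x) \<bullet> psi' x) <= M * ep"
proof -
 obtain C1 where C1: "C1 >= 0" "ALL (f::'a => real) psi psi' e K. meas f --> c1c 1 psi psi' --> 0 < e --> 0 < K -->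
  en (real DIM('a)) (ball 0 1) f <= enn (e powr real DIM('a)) --> en p UNIV psi' <= enn (K powr p) -->
  abs (LBINT x. f x * psi x) <= C1 * e * K" using source_pairing[OF p N] by blast
 obtain C2 where C2: "C2 > 0" "ALL x y::real. 0 <= x --> 0 <= y --> x * y <= 1 * x powr (p / (p - 1)) + C2 * y powr p" using young_eps[OF p, of 1] by auto
 define M where "M = C1 * K + (1 + C2 * K powr p)"
 have "abs (LBINT x. plap p (D x) \<bullet> psi' x) <= M * ep"
  if e: "0 < ep" and nh: "nearly_harmonic p ep v D b f" and psi: "c1c 1 psi psi'" and pK: "en p UNIV psi' <= enn (K powr p)"
  for ep v b f psi psi' and D :: "'a => 'a"
 proof -
  have [measurable]: "meas D" "meas b" "meas f" 
   and eD: "en p (ball 0 1) D <= 1" and b: "!!x. x \<in> ball 0 1 ==> abs (b x - 1) <= ep"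
   and ef: "en (real DIM('a)) (ball 0 1) f <= enn (ep powr real DIM('a))" and eq: "weak_eq p D b f" using nh by (auto simp: nearly_harmonic_def)
  note c1_borel[OF c1c_c1[OF psi], measurable]
  have z: "psi' x = 0" if "x \<notin> ball 0 1" for x using c1c_outside[OF psi, of x] that by simp
  define G where "G x = plap p (D x) \<bullet> psi' x" for x
  have [measurable]: "meas G" unfolding G_def by measurable
  have GN: "(NN x. enn (abs (G x))) <= enn (1 + C2 * K powr p)"
  proof -
   have "(NN x. enn (abs (G x))) <= enn 1 * en (p / (p - 1)) (ball 0 1) (%x. plap p (D x)) + enn C2 * en p (ball 0 1) psi'"
   unfolding G_def by (rule pairing_le) (use z C2 in auto)
   also have "... <= enn 1 * 1 + enn C2 * enn (K powr p)"
   unfolding en_plap[OF p] by (intro add_mono mult_left_mono eD order_trans[OF en_mono_set pK]) auto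
   also have "... = enn (1 + C2 * K powr p)" using C2 by (simp add: ennreal_mult)
   finally show ?thesis .
  qed
  have Gi: "integrable lborel G" by (rule integrableI_bounded) (use GN in \<open>auto intro: le_less_trans\<close>)
  have bd: "abs ((1 - b x) * G x) <= ep * abs (G x)" for x
  proof (cases "x \<in> ball 0 1")
   case True then show ?thesis using b[OF True] by (auto simp: abs_mult abs_minus_commute intro: mult_right_mono)
  qed (simp add: G_def z)
  have bi: "integrable lborel (%x. (1 - b x) * G x)"
   by (rule Bochner_Integration.integrable_bound[OF integrable_mult_right[OF Gi, of ep]]) (use bd e in \<open>auto simp: abs_mult\<close>)
  have "(LBINT x. G x) = (LBINT x. (1 - b x) * G x) + (LBINT x. G x - (1 - b x) * G x)" using Gi bi by simp
  also have "(LBINT x. G x - (1 - b x) * G x) = (LBINT x. b x * (plap p (D x) \<bullet> psi' x))"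
   by (intro Bochner_Integration.integral_cong) (auto simp: G_def algebra_simps)
  also have "... = (LBINT x. f x * psi x)" using eq psi unfolding weak_eq_def by blast
  finally have split: "(LBINT x. G x) = (LBINT x. (1 - b x) * G x) + (LBINT x. f x * psi x)" .
  have "abs (LBINT x. f x * psi x) <= C1 * ep * K" using C1(2) psi e K ef pK by auto
  moreover have "abs (LBINT x. (1 - b x) * G x) <= ep * (1 + C2 * K powr p)"
  proof -
   have "abs (LBINT x. (1 - b x) * G x) <= (LBINT x. ep * abs (G x))" using integral_abs_bound[of lborel "%x. (1 - b x) * G x"] bi Gi bd
   by (intro order_trans[OF integral_abs_bound] integral_mono) auto
   also have "... = ep * (LBINT x. abs (G x))" by simp
   also have "(LBINT x. abs (G x)) <= 1 + C2 * K powr p"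
   proof -
   have "enn (LBINT x. abs (G x)) = (NN x. enn (abs (G x)))" using Gi by (intro nn_integral_eq_integral[symmetric]) auto
   then show ?thesis using GN C2 K by (metis ennreal_le_iff add_nonneg_nonneg zero_le_one mult_nonneg_nonneg less_imp_le powr_ge_zero)
   qed
   finally show ?thesis using e by simp
  qed
  ultimately have "abs (LBINT x. G x) <= ep * (1 + C2 * K powr p) + C1 * ep * K" unfolding split by linarith
  then show ?thesis by (simp add: G_def M_def algebra_simps)
 qed
 note bound = this
 have "M >= 0" using C1 C2 K by (simp add: M_def)
 then show ?thesis by (intro exI[of _ M] conjI allI impI bound)
qed

lemma plap_coercive_absorb_ex:
 assumes p: "p > 1" and d: "d > 0"
 shows "EX C>0. ALL (a::'a::real_inner) b. norm (a - b) powr p <= d * norm b powr p + C * ((plap p a - plap p b) \<bullet> (a - b))"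
proof (rule plap_coercive_absorb[OF p d, where 'a='a])
 fix C assume "0 < C" and *: "!!(a::'a) b. norm (a - b) powr p <= d * norm b powr p + C * ((plap p a - plap p b) \<bullet> (a - b))"
 then show ?thesis by (intro exI[of _ C] conjI allI impI *)
qed

text \<open>W - D is a limit of test gradients, so it may be inserted in both equations. The pairing
  of the difference of the fluxes with W - D is then at most M ep, and
  \<open>plap_coercive_absorb\<close> converts this into closeness, the energy of D being at most
  1.\<close>

lemma harmonic_comparison:
 assumes p: "p > 1" and N: "DIM('a::euclidean_space) >= 2" and d: "dl > 0"
 shows "EX ep>0. ALL v (D::'a => 'a) b f. nearly_harmonic p ep v D b f -->
  (EX w W. (ALL r<1. sob p (ball 0 r) w W) & plap_harmonic p 1 W & en p (ball 0 1) W <= 1 & en p (ball 0 1) (%x. W x - D x) <= enn dl)"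
proof -
 \<comment> \<open>K^p bounds the energy of late approximants: the correction has energy at most 2 *
   2^p as a difference of two fields of energy at most 1, and the approximation error is below
   1.\<close>
 define K where "K = (2 powr p * (2 powr p * 2 + 1)) powr (1 / p)"
 have K: "K > 0" "K powr p = 2 powr p * (2 powr p * 2 + 1)" 
 proof -
  have "2 powr p * 2 + 1 > (0::real)" by (intro add_pos_pos) auto
  then show "K > 0" "K powr p = 2 powr p * (2 powr p * 2 + 1)" using p by (auto simp: K_def powr_powr)
 qed
 obtain C where C: "C > 0" "ALL (a::'a) b. norm (a - b) powr p <= dl / 2 * norm b powr p + C * ((plap p a - plap p b) \<bullet> (a - b))"
  using plap_coercive_absorb_ex[OF p, of "dl / 2", where 'a='a] d by auto
 obtain M where M: "M >= 0" "ALL ep v (D::'a => 'a) b f psi psi'. 0 < ep --> nearly_harmonic p ep v D b f --> c1c 1 psi psi' -->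
  en p UNIV psi' <= enn (K powr p) --> abs (LBINT x. plap p (D x) \<bullet> psi' x) <= M * ep"
  using nearly_harmonic_pairing[OF p N K(1)] by (elim exE conjE) (rule that)
 define ep where "ep = dl / (2 * C * (M + 1))"
 have e: "ep > 0" "C * (M * ep) <= dl / 2" 
 proof -
  show "ep > 0" using C(1) M(1) d by (simp add: ep_def)
  have "C * (M * ep) = dl / 2 * (M / (M + 1))" using C(1) by (simp add: ep_def)
  also have "... <= dl / 2 * 1" using M(1) d by (intro mult_left_mono) auto
  finally show "C * (M * ep) <= dl / 2" by simp
 qed
 have "EX w W. (ALL r<1. sob p (ball 0 r) w W) & plap_harmonic p 1 W & en p (ball 0 1) W <= 1 & en p (ball 0 1) (%x. W x - D x) <= enn dl"
  if nh: "nearly_harmonic p ep v D b f" for v b f and D :: "'a => 'a"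
 proof -
  let ?B = "ball (0::'a) 1"
  have D[measurable]: "meas D" and sv: "!!r. r < 1 ==> sob p (ball 0 r) v D" and eD: "en p ?B D <= 1" using nh by (auto simp: nearly_harmonic_def)
  have fD: "en p ?B D < oo" using eD by (rule le_less_trans) simp
  obtain phi Phi psi psi' where [measurable]: "meas phi" "meas Phi" and ck: "ALL k. c1c 1 (psi k) (psi' k)"
   and l: "Lp_tendsto p ?B psi phi" "Lp_tendsto p ?B psi' Phi"
   and le: "en p ?B (%x. D x + Phi x) <= en p ?B D" and el: "ALL ze ze'. c1c 1 ze ze' --> (LBINT x. plap p (D x + Phi x) \<bullet> ze' x) = 0"
   using plap_minimizer[OF D p fD] by blast
  have c: "c1c 1 (psi k) (psi' k)" for k using ck by blast
  have [measurable]: "meas (psi' k)" for k by (rule c1_borel(2)[OF c1c_c1[OF c]])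
  define W where "W x = D x + Phi x" for x
  have [measurable]: "meas W" unfolding W_def by measurable
  have eW: "en p ?B W <= 1" unfolding W_def using le eD by (rule order_trans)
  have sW: "sob p (ball 0 r) (%x. v x + phi x) W" if r: "r < 1" for r unfolding W_def
  proof (rule sob_add[OF sv[OF r]])
   show "sob p (ball 0 r) phi Phi"
   proof (rule sob_limit[where U=psi and E=psi'])
   show "sob p (ball 0 r) (psi k) (psi' k)" for k by (rule c1_sob[OF c1c_c1[OF c]]) (use p in simp)
   have sub: "ball 0 r \<subseteq> ?B" using r by (intro subset_ball) simp
   show "Lp_tendsto p (ball 0 r) psi phi" by (rule en_tendsto_squeeze[OF _ l(1), of _ 1]) (simp add: en_mono_set[OF sub])
   show "Lp_tendsto p (ball 0 r) psi' Phi" by (rule en_tendsto_squeeze[OF _ l(2), of _ 1]) (simp add: en_mono_set[OF sub])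
   qed (use p in auto)
  qed (use p in auto)
  have enPhi: "en p ?B Phi <= enn (2 powr p * 2)"
  proof -
   have "en p ?B Phi = en p ?B (%x. W x - D x)" by (simp add: W_def)
   also have "... <= enn (2 powr p) * (en p ?B W + en p ?B D)" by (rule en_diff) (use p in auto)
   also have "... <= enn (2 powr p) * (1 + 1)" by (intro mult_left_mono add_mono eW eD) auto
   finally show ?thesis by (simp add: ennreal_mult)
  qed
  \<comment> \<open>The limit of the test gradients is determined only inside the ball; cut off, it
    is a limit on the whole space, where the pairings are integrated.\<close>
  define X where "X x = (if x \<in> ?B then Phi x else 0)" for x
  have [measurable]: "meas X" unfolding X_def by measurable
  have X0: "X x = 0" if "x \<notin> ?B" for x using that by (simp add: X_def)
  have psi0: "psi' k x = 0" if "x \<notin> ?B" for k x using c1c_outside[OF c, of x] that by simp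
  have lX: "Lp_tendsto p ?B psi' X" by (rule Lim_transform_eventually[OF l(2)]) (auto intro!: always_eventually en_cong simp: X_def)
  have enX: "en p ?B X < oo"
  proof -
   have "en p ?B X = en p ?B Phi" by (rule en_cong) (simp add: X_def)
   then show ?thesis using le_less_trans[OF enPhi] by simp
  qed
  have lim: "(%k. LBINT x. plap p (Y x) \<bullet> psi' k x) ---> (LBINT x. plap p (Y x) \<bullet> X x)"
   if [measurable]: "meas Y" and "en p ?B Y <= 1" for Y :: "'a => 'a" by (rule pairing_tendsto[where S="?B" and p=p])
   (use that p X0 psi0 enX lX c1c_en_finite(2)[OF c] in \<open>auto simp: en_plap intro: le_less_trans\<close>)
  have iW: "(LBINT x. plap p (W x) \<bullet> X x) = 0"
  proof (rule LIMSEQ_unique[OF lim[OF _ eW]])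
   have "(LBINT x. plap p (W x) \<bullet> psi' k x) = 0" for k using el c[of k] unfolding W_def by blast
   then show "(%k. LBINT x. plap p (W x) \<bullet> psi' k x) ---> 0" by simp
  qed simp
  have iD: "abs (LBINT x. plap p (D x) \<bullet> X x) <= M * ep"
  proof (rule LIMSEQ_le_const2)
   show "(%k. abs (LBINT x. plap p (D x) \<bullet> psi' k x)) ---> abs (LBINT x. plap p (D x) \<bullet> X x)" by (intro tendsto_rabs lim D eD)
   have "eventually (%k. en p ?B (%x. psi' k x - Phi x) < 1) sequentially" using l(2) by (rule order_tendstoD) simp
   then obtain k0 where k0: "!!k. k >= k0 ==> en p ?B (%x. psi' k x - Phi x) < 1" by (auto simp: eventually_sequentially)
   show "EX k0. ALL k>=k0. abs (LBINT x. plap p (D x) \<bullet> psi' k x) <= M * ep"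
   proof (intro exI[of _ k0] allI impI M(2)[rule_format, OF e(1) nh c])
   fix k assume "k0 <= k"
   have "en p UNIV (psi' k) = en p ?B (psi' k)" unfolding en_def using p psi0[of _ k] by (intro nn_integral_cong) (auto simp: indicator_def)
   also have "... = en p ?B (%x. Phi x + (psi' k x - Phi x))" by simp
   also have "... <= enn (2 powr p) * (en p ?B Phi + en p ?B (%x. psi' k x - Phi x))" by (rule en_add) (use p in auto)
   also have "... <= enn (2 powr p) * (enn (2 powr p * 2) + 1)" by (intro mult_left_mono add_mono enPhi less_imp_le[OF k0] \<open>k0 <= k\<close>) auto
   also have "... = enn (K powr p)" unfolding K(2) by (simp add: ennreal_mult)
   finally show "en p UNIV (psi' k) <= enn (K powr p)" .
   qed
  qed
  define P where "P x = (plap p (W x) - plap p (D x)) \<bullet> X x" for x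
  have P0: "P x >= 0" for x using plap_monotone_nonneg[OF p, of "W x" "D x"] by (simp add: P_def X_def W_def)
  have ii: "integrable lborel (%x. plap p (Y x) \<bullet> X x)" if [measurable]: "meas Y" and "en p ?B Y <= 1" for Y :: "'a => 'a"
   by (rule pairing_integrable[where S="?B" and p=p]) (use that p X0 enX in \<open>auto simp: en_plap intro: le_less_trans\<close>)
  have Pi: "integrable lborel P" unfolding P_def inner_diff_left using ii[OF _ eW] ii[OF _ eD] by auto
  have "(LBINT x. P x) <= M * ep" unfolding P_def inner_diff_left using ii[OF _ eW] ii[OF _ eD] iW iD by simp
  then have nP: "(NN x. enn (P x)) <= enn (M * ep)" using nn_integral_eq_integral[OF Pi] P0 by (simp add: ennreal_leI)
  have "norm (W x - D x) powr p <= dl/2 * norm (D x) powr p + C * P x" if "x \<in> ?B" for x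
   using C(2)[rule_format, of "W x" "D x"] that by (simp add: P_def X_def W_def)
  then have "en p ?B (%x. W x - D x) <= enn (dl/2) * en p ?B D + enn C * (NN x. enn (P x))"
   unfolding en_real using C(1) d P0 Pi by (intro nn_integral_le_lincomb) (auto simp: indicator_def)
  also have "... <= enn (dl/2) * 1 + enn C * enn (M * ep)" by (intro add_mono mult_left_mono eD nP) auto
  also have "... = enn (dl/2 + C * (M * ep))" using C M e d by (simp add: ennreal_mult)
  also have "... <= enn dl" using e by (intro ennreal_leI) linarith
  finally have "en p ?B (%x. W x - D x) <= enn dl" .
  moreover have "plap_harmonic p 1 W" using el by (simp add: plap_harmonic_def W_def)
  ultimately show ?thesis using sW eW by blast
 qed
 note main = this
 show ?thesis by (intro exI[of _ ep] conjI allI impI e main)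
qed

text \<open>Hoelder's inequality on a small ball, obtained by cutting at the height L = t^(-N/q),
  for which both parts are of the same order t^(N(1 - p/q)).\<close>

lemma en_ball_le_interpolate:
 fixes W :: "'a::euclidean_space => 'b::euclidean_space"
 assumes [measurable]: "meas W" and p: "0 < p" "p <= q" and t: "0 < t" "t <= r" and K: "en q (ball 0 r) W <= enn K" "0 <= K"
 shows "en p (ball 0 t) W <= enn ((measure lborel (ball (0::'a) 1) + K) * t powr (real DIM('a) * (1 - p / q)))"
proof -
 define N where "N = real DIM('a)"
 define L where "L = t powr (- N / q)"
 have L: "L > 0" "L powr p * t powr N = t powr (N * (1 - p / q))" "L powr (p - q) = t powr (N * (1 - p / q))"
 proof -
  show "L > 0" using t by (simp add: L_def)
  show "L powr p * t powr N = t powr (N * (1 - p / q))" using t p unfolding L_def powr_powr powr_add[symmetric] by (simp add: field_simps)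
  have "- N / q * (p - q) = N * (1 - p / q)" using p by (simp add: field_simps)
  then show "L powr (p - q) = t powr (N * (1 - p / q))" unfolding L_def powr_powr by (simp only:)
 qed
 have "norm (W x) powr p <= L powr p + L powr (p - q) * norm (W x) powr q" for x
 proof (cases "norm (W x) <= L")
  case True
  then have "norm (W x) powr p <= L powr p" using p by (intro powr_mono2) auto
  then show ?thesis by (simp add: add_increasing2)
 next
  case False
  then have n: "norm (W x) > 0" "L <= norm (W x)" using L by auto
  have "norm (W x) powr p = norm (W x) powr (p - q) * norm (W x) powr q" using n by (simp add: powr_add[symmetric])
  also have "... <= L powr (p - q) * norm (W x) powr q" using n L p by (intro mult_right_mono powr_mono2') auto
  finally show ?thesis using add_increasing[of "L powr p"] by simp
 qed
 moreover have "ball 0 t \<subseteq> ball (0::'a) r" using t by (intro subset_ball) simp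
 ultimately have "en p (ball 0 t) W <= enn (L powr p) * (\<integral>\<^sup>+x. enn (indicator (ball 0 t) x) \<partial>(lborel :: 'a measure)) + enn (L powr (p - q)) * en q (ball 0 r) W"
  unfolding en_real by (intro nn_integral_le_lincomb) (auto simp: indicator_def add_increasing2)
 also have "... = enn (L powr p) * emeasure lborel (ball (0::'a) t) + enn (L powr (p - q)) * en q (ball 0 r) W" by (simp add: ennreal_indicator)
 also have "... <= enn (L powr p) * enn (t powr N * measure lborel (ball (0::'a) 1)) + enn (L powr (p - q)) * enn K"
  using t K measure_ball_eq[OF t(1), of "0::'a"] by (intro add_mono mult_left_mono) (auto simp: emeasure_ball_eq[of _ t] N_def powr_realpow)
 also have "... = enn (L powr p * (t powr N * measure lborel (ball (0::'a) 1)) + L powr (p - q) * K)" using K by (simp add: ennreal_mult)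
 also have "L powr p * (t powr N * measure lborel (ball (0::'a) 1)) + L powr (p - q) * K = (measure lborel (ball (0::'a) 1) + K) * t powr (N * (1 - p / q))"
  unfolding L(3) mult.assoc[symmetric] L(2) by (simp add: algebra_simps)
 finally show ?thesis by (simp add: N_def)
qed

text \<open>The replacement W decays with the exponent N(1 - p/q), larger than the required N - s by
  at least s/2, where s = p(1 - alpha). The surplus te^(s/2) beats the constants once te is small;
  the distance \<open>dl\<close> between the fields is chosen after te.\<close>

lemma energy_decay_step:
 assumes p: "p > 1" and N: "DIM('a::euclidean_space) >= 2" and a: "0 < \<alpha>" "\<alpha> < 1"
 shows "EX te ep. 0 < te & te < 1 & 0 < ep & (ALL v (D::'a => 'a) b f. nearly_harmonic p ep v D b f -->
  en p (ball 0 te) D <= enn (te powr (real DIM('a) - p * (1 - \<alpha>))))"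
proof -
 define n where "n = real DIM('a)"
 have n: "n > 0" by (simp add: n_def)
 \<comment> \<open>The lower bound on q gives N p / q <= s/2. The radius is 9/10 because W is a
   Sobolev gradient only on balls smaller than the unit ball.\<close>
 have "EX q>=2 * n / (1 - \<alpha>). EX K>0. q >= p & (ALL w (D::'a => 'a). energy_bounded p p (9/10) w D 1 -->
  en q (ball 0 (1/2)) D <= enn K)" by (rule gradient_higher_integrability[OF p]) auto
 then obtain q K where q: "q >= 2 * n / (1 - \<alpha>)" and K: "K > 0" "q >= p" "ALL w (D::'a => 'a). energy_bounded p p (9/10) w D 1 -->
  en q (ball 0 (1/2)) D <= enn K" by (elim exE conjE) (rule that; assumption)
 define M where "M = measure lborel (ball (0::'a) 1) + K"
 have M: "M > 0" using K by (simp add: M_def add_nonneg_pos)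
 define s where "s = p * (1 - \<alpha>)"
 have s: "s > 0" using p a by (simp add: s_def)
 \<comment> \<open>Makes 2^p M te^(s/2) <= 1/2, so that W uses up half of the allowed
   energy.\<close>
 define te where "te = min (1/2) ((1 / (2 * (2 powr p * M))) powr (2 / s))"
 have th: "0 < te" "te <= 1/2" "te < 1" using M by (auto simp: te_def)
 have thM: "2 powr p * M * te powr (s / 2) <= 1/2"
 proof -
  have "te powr (s/2) <= ((1 / (2 * (2 powr p * M))) powr (2 / s)) powr (s/2)" using s th by (intro powr_mono2) (auto simp: te_def)
  also have "... = 1 / (2 * (2 powr p * M))" using s M by (simp add: powr_powr)
  finally show ?thesis using M by (simp add: field_simps)
 qed
 \<comment> \<open>The other half of the allowed energy te^(n-s), divided by the factor 2^p of
   \<open>en_diff\<close>.\<close>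
 define dl where "dl = te powr (n - s) / (2 * 2 powr p)"
 have d: "dl > 0" using th by (simp add: dl_def)
 obtain ep where e: "ep > 0" "ALL v (D::'a => 'a) b f. nearly_harmonic p ep v D b f -->
  (EX w W. (ALL r<1. sob p (ball 0 r) w W) & plap_harmonic p 1 W & en p (ball 0 1) W <= 1 & en p (ball 0 1) (%x. W x - D x) <= enn dl)"
  using harmonic_comparison[OF p N d] by (elim exE conjE) (rule that)
 have "en p (ball 0 te) D <= enn (te powr (n - s))" if nh: "nearly_harmonic p ep v D b f" for v b f and D :: "'a => 'a"
 proof -
  have [measurable]: "meas D" using nh by (simp add: nearly_harmonic_def)
  obtain w W where W: "ALL r<1. sob p (ball 0 r) w W" "plap_harmonic p 1 W" "en p (ball 0 1) W <= 1" "en p (ball 0 1) (%x. W x - D x) <= enn dl"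
   using e(2)[rule_format, OF nh] by (elim exE conjE) (rule that)
  have [measurable]: "meas W" using sob_borel(2)[OF W(1)[rule_format, of 0]] by simp
  have "plap_harmonic p (9/10) W" using W(2) c1c_mono[of "9/10" _ _ 1] by (auto simp: plap_harmonic_def)
  moreover have "en p (ball 0 (9/10)) W <= enn 1" unfolding ennreal_1 by (rule order_trans[OF en_mono_set[OF subset_ball] W(3)]) simp
  ultimately have "en q (ball 0 (1/2)) W <= enn K" by (intro K(3)[rule_format, of w W]) (use W(1) in \<open>auto simp: energy_bounded_def\<close>)
  then have "en p (ball 0 te) W <= enn (M * te powr (n * (1 - p / q)))"
   unfolding M_def n_def by (intro en_ball_le_interpolate[where r="1/2"]) (use p K th in auto)
  moreover have "te powr (n * (1 - p / q)) <= te powr (n - s) * te powr (s / 2)"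
  proof -
   have "q * (1 - \<alpha>) >= 2 * n" using q a by (simp add: field_simps)
   then have "p * (2 * n) <= p * (q * (1 - \<alpha>))" using p by simp
   then have "n * p / q <= s / 2" using K(2) p by (simp add: s_def field_simps)
   then have "n - s / 2 <= n * (1 - p / q)" by (simp add: algebra_simps)
   then have "te powr (n * (1 - p / q)) <= te powr (n - s / 2)" using th by (intro powr_mono') auto
   also have "n - s / 2 = (n - s) + s / 2" by simp
   finally show ?thesis by (simp only: powr_add)
  qed
  then have W2: "enn (M * te powr (n * (1 - p / q))) <= enn (M * (te powr (n - s) * te powr (s / 2)))"
   using M by (intro ennreal_leI mult_left_mono) auto
  ultimately have W1: "en p (ball 0 te) W <= enn (M * (te powr (n - s) * te powr (s / 2)))" using order_trans by blast
  have "en p (ball 0 te) D = en p (ball 0 te) (%x. W x - (W x - D x))" by simp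
  also have "... <= enn (2 powr p) * (en p (ball 0 te) W + en p (ball 0 te) (%x. W x - D x))" by (rule en_diff) (use p in auto)
  also have "... <= enn (2 powr p) * (enn (M * (te powr (n - s) * te powr (s / 2))) + enn dl)"
   using th by (intro mult_left_mono add_mono W1 order_trans[OF en_mono_set W(4)]) auto
  also have "... = enn (2 powr p * (M * (te powr (n - s) * te powr (s / 2)) + dl))" using M d by (simp add: ennreal_mult)
  also have "... <= enn (te powr (n - s))"
  proof (rule ennreal_leI, goal_cases)
   case 1
   have "2 powr p * (M * (te powr (n - s) * te powr (s / 2)) + dl) = te powr (n - s) * (2 powr p * M * te powr (s / 2)) + te powr (n - s) / 2"
   by (simp add: dl_def algebra_simps)
   also have "... <= te powr (n - s) * (1/2) + te powr (n - s) / 2" by (intro add_mono mult_left_mono thM) auto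
   finally show ?case by simp
  qed
  finally show ?thesis .
 qed
 note main = this[unfolded n_def s_def]
 show ?thesis by (rule exI[of _ te], rule exI[of _ ep]) (intro conjI allI impI th(1) th(3) e(1) main)
qed

text \<open>The decay hypothesis says exactly that te^(-alpha) v(te x) has energy at most 1 again.
  The source gains te m^(p-1) with m = te^(1-alpha) <= 1, and the factor te cancels the growth of
  the L^N norm under dilation. The oscillation bound of the coefficient is inherited.\<close>

lemma nearly_harmonic_rescale:
 fixes D :: "'a::euclidean_space => 'a"
 assumes p: "p > 1" and a: "0 < \<alpha>" "\<alpha> < 1" and th: "0 < te" "te < 1" and e: "0 < ep"
  and nh: "nearly_harmonic p ep v D b f" and en: "en p (ball 0 te) D <= enn (te powr (real DIM('a) - p * (1 - \<alpha>)))"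
 shows "nearly_harmonic p ep (%x. te powr (- \<alpha>) * v (0 + te *R x)) (%x. (te powr (- \<alpha>) * te) *R D (0 + te *R x))
  (%x. 1 * b (0 + te *R x)) (%x. (1 * te * (te powr (- \<alpha>) * te) powr (p - 1)) * f (0 + te *R x))"
proof -
 define n where "n = real DIM('a)"
 define m where "m = te powr (- \<alpha>) * te"
 have [measurable]: "meas D" "meas b" "meas f"
  and sv: "!!r. r < 1 ==> sob p (ball 0 r) v D" and b: "!!x. x \<in> ball 0 1 ==> abs (b x - 1) <= ep"
  and ef: "en n (ball 0 1) f <= enn (ep powr n)" and eq: "weak_eq p D b f" using nh by (auto simp: nearly_harmonic_def n_def)
 have m: "m > 0" "m = te powr (1 - \<alpha>)" using th by (auto simp: m_def powr_diff powr_minus divide_simps)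
 have m1: "m <= 1" unfolding m(2) using th a by (intro powr_le1) auto
 have thn: "te ^ DIM('a) = te powr n" using th by (simp add: n_def powr_realpow)
 have 1: "en p (ball 0 1) (%x. m *R D (0 + te *R x)) <= 1"
 proof -
  have "enn (te powr n) * en p (ball 0 1) (%x. m *R D (0 + te *R x))
   = enn (abs m powr p) * (enn (te ^ DIM('a)) * en p (ball 0 1) (%x. D (0 + te *R x)))" by (subst en_scaleR) (auto simp: thn mult_ac)
  also have "... = enn (abs m powr p) * en p (ball 0 te) D" using en_affine[of D te p 0 1] th by simp
  also have "... <= enn (abs m powr p) * enn (te powr (n - p * (1 - \<alpha>)))" using en by (intro mult_left_mono) (auto simp: n_def)
  also have "... = enn (te powr n)" using m th by (simp add: ennreal_mult[symmetric] powr_powr powr_add[symmetric] mult.commute)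
  finally have "enn (te powr n) * en p (ball 0 1) (%x. m *R D (0 + te *R x)) <= enn (te powr n) * 1" by simp
  then show ?thesis using th by (subst (asm) ennreal_mult_le_mult_iff) auto
 qed
 have 2: "en n (ball 0 1) (%x. (1 * te * m powr (p - 1)) * f (0 + te *R x)) <= enn (ep powr n)"
 proof -
  define k where "k = 1 * te * m powr (p - 1)"
  have k: "0 <= k" "k <= te" using th m(1) m1 p mult_left_mono[of "m powr (p - 1)" 1 te] by (auto simp: k_def powr_le1)
  have "en n (ball 0 1) (%x. k * f (0 + te *R x)) = enn (abs k powr n) * en n (ball 0 1) (%x. f (0 + te *R x))" by (subst en_scaleR[symmetric]) auto
  also have "... <= enn (te powr n) * en n (ball 0 1) (%x. f (0 + te *R x))" using k by (intro mult_right_mono ennreal_leI powr_mono2) (auto simp: n_def)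
  also have "... = en n (ball 0 te) f" using en_affine[of f te n 0 1] th by (simp add: thn)
  also have "... <= enn (ep powr n)" using th by (intro order_trans[OF en_mono_set ef]) auto
  finally show ?thesis by (simp add: k_def)
 qed
 have 3: "sob p (ball 0 r) (%x. te powr (- \<alpha>) * v (0 + te *R x)) (%x. m *R D (0 + te *R x))" if "r < 1" for r
 proof -
  have "te * r < 1"
  proof (cases "r <= 0")
   case True then have "te * r <= 0" using th by (simp add: mult_nonneg_nonpos)
   then show ?thesis by simp
  next
   case False then have "te * r < 1 * 1" using th that by (intro mult_strict_mono) auto
   then show ?thesis by simp
  qed
  then show ?thesis unfolding m_def by (intro sob_affine sv th)
 qed
 have 4: "abs (1 * b (0 + te *R x) - 1) <= ep" if "x \<in> ball 0 1" for x
 proof -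
  have "te * norm x < 1 * 1" using that th by (intro mult_strict_mono') auto
  then show ?thesis using b[of "te *R x"] th by simp
 qed
 have 5: "weak_eq p (%x. m *R D (0 + te *R x)) (%x. 1 * b (0 + te *R x)) (%x. (1 * te * m powr (p - 1)) * f (0 + te *R x))"
  by (rule weak_eq_rescale[OF eq]) (use th m in auto)
 show ?thesis unfolding nearly_harmonic_def m_def[symmetric] n_def[symmetric] using 1 2 3 4 5 by simp
qed

text \<open>Induction on k applies the estimate for te^k to the rescaled function, which is again
  nearly harmonic with the same ep. A general radius is compared with the next larger power of
  te.\<close>

lemma energy_decay:
 assumes p: "p > 1" and N: "DIM('a::euclidean_space) >= 2" and a: "0 < \<alpha>" "\<alpha> < 1"
 shows "EX C ep. 0 < C & 0 < ep & (ALL v (D::'a => 'a) b f rho. nearly_harmonic p ep v D b f --> 0 < rho --> rho <= 1 -->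
  en p (ball 0 rho) D <= enn (C * rho powr (real DIM('a) - p * (1 - \<alpha>))))"
proof -
 define n where "n = real DIM('a)"
 define s where "s = n - p * (1 - \<alpha>)"
 obtain te ep where th: "0 < te" "te < 1" and e: "0 < ep" and step: "ALL v (D::'a => 'a) b f. nearly_harmonic p ep v D b f -->
  en p (ball 0 te) D <= enn (te powr s)" using energy_decay_step[OF p N a, folded n_def, folded s_def] by (elim exE conjE) (rule that; assumption)
 have iter: "en p (ball 0 (te ^ k)) D <= enn ((te ^ k) powr s)" if "nearly_harmonic p ep v D b f" for k v b f and D :: "'a => 'a" using that
 proof (induction k arbitrary: v D b f)
  case 0 then show ?case by (simp add: nearly_harmonic_def)
 next
  case (Suc k)
  define m where "m = te powr (- \<alpha>) * te"
  have m: "m > 0" "m = te powr (1 - \<alpha>)" using th by (auto simp: m_def powr_diff powr_minus divide_simps)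
  have [measurable]: "meas D" using Suc.prems by (simp add: nearly_harmonic_def)
  have thn: "te ^ DIM('a) = te powr n" using th by (simp add: n_def powr_realpow)
  have "en p (ball 0 (te ^ k)) (%x. m *R D (0 + te *R x)) <= enn ((te ^ k) powr s)" unfolding m_def
   by (rule Suc.IH[OF nearly_harmonic_rescale[OF p a th e Suc.prems]]) (use step Suc.prems in \<open>auto simp: s_def n_def\<close>)
  then have *: "enn (m powr p) * en p (ball 0 (te ^ k)) (%x. D (0 + te *R x)) <= enn ((te ^ k) powr s)" using m(1) by (subst (asm) en_scaleR) auto
  have "enn (m powr p) * en p (ball 0 (te ^ Suc k)) D = enn (te powr n) * (enn (m powr p) * en p (ball 0 (te ^ k)) (%x. D (0 + te *R x)))"
   using en_affine[of D te p 0 "te ^ k"] th by (simp add: thn mult_ac)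
  also have "... <= enn (te powr n) * enn ((te ^ k) powr s)" by (intro mult_left_mono *) simp
  also have "... = enn (m powr p * (te ^ Suc k) powr s)"
  proof -
   have "m powr p * (te ^ Suc k) powr s = (te powr ((1 - \<alpha>) * p) * te powr s) * (te ^ k) powr s" using th m by (simp add: powr_powr powr_mult)
   also have "te powr ((1 - \<alpha>) * p) * te powr s = te powr n" unfolding powr_add[symmetric] by (simp add: s_def mult.commute)
   finally show ?thesis by (simp add: ennreal_mult)
  qed
  also have "... = enn (m powr p) * enn ((te ^ Suc k) powr s)" by (simp add: ennreal_mult)
  finally show ?case using m(1) by (subst (asm) ennreal_mult_le_mult_iff) auto
 qed
 \<comment> \<open>The absolute value covers both signs of the exponent N - p(1 - alpha); for a
   negative one y^s >= 1 already.\<close>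
 define C where "C = te powr (- abs s)"
 have "en p (ball 0 rho) D <= enn (C * rho powr s)" if nh: "nearly_harmonic p ep v D b f" and r: "0 < rho" "rho <= 1" for v b f rho and D :: "'a => 'a"
 proof -
  have "EX k. te ^ Suc k < rho & rho <= te ^ k"
  proof -
   obtain j where j: "te ^ j < rho" using real_arch_pow_inv[OF r(1) th(2)] by blast
   define k where "k = (LEAST j. te ^ j < rho)"
   have k: "te ^ k < rho" unfolding k_def by (rule LeastI[where P="%j. te ^ j < rho", OF j])
   then have "k ~= 0" using r by (intro notI) simp
   then obtain i where i: "k = Suc i" using not0_implies_Suc by blast
   then have "\<not> te ^ i < rho" using not_less_Least[of i "%j. te ^ j < rho"] by (simp add: k_def[symmetric])
   then show ?thesis using k i by auto
  qed
  then obtain k where k: "te ^ Suc k < rho" "rho <= te ^ k" by blast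
  define y where "y = rho / te ^ k"
  have y: "te <= y" "y <= 1" "0 < y" using k th r by (auto simp: y_def field_simps)
  have "en p (ball 0 rho) D <= en p (ball 0 (te ^ k)) D" using k by (intro en_mono_set subset_ball)
  also have "... <= enn ((te ^ k) powr s)" by (rule iter[OF nh])
  also have "... <= enn (C * rho powr s)"
  proof (rule ennreal_leI)
   have "1 <= C * y powr s"
   proof -
   have "te powr abs s <= y powr s"
   proof (cases "s >= 0")
   case True then show ?thesis using y th by (simp add: powr_mono2)
   next
   case False
   have "te powr abs s <= 1" using th by (intro powr_le1) auto
   also have "1 <= y powr s" using False y powr_mono2'[of s y 1] by simp
   finally show ?thesis .
   qed
   then have "C * te powr abs s <= C * y powr s" by (intro mult_left_mono) (auto simp: C_def)
   moreover have "C * te powr abs s = 1" using th by (simp add: C_def powr_add[symmetric])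
   ultimately show ?thesis by simp
   qed
   then have "1 * (te ^ k) powr s <= (C * y powr s) * (te ^ k) powr s" by (intro mult_right_mono) auto
   also have "... = C * (y * te ^ k) powr s" using th y by (simp add: powr_mult)
   also have "y * te ^ k = rho" using th by (simp add: y_def)
   finally show "(te ^ k) powr s <= C * rho powr s" by simp
  qed
  finally show ?thesis .
 qed
 note main = this[unfolded s_def n_def]
 have "C > 0" using th by (simp add: C_def)
 show ?thesis by (rule exI[of _ C], rule exI[of _ ep]) (intro conjI allI impI \<open>C > 0\<close> e main)
qed

section \<open>The Caccioppoli inequality\<close>

lemma sob_cong_AE:
 assumes s: "sob p S u D" and [measurable]: "meas u'" and ae: "AE x in lborel. x \<in> S --> u' x = u x"
 shows "sob p S u' D"
proof (rule sobE[OF s])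
 fix psi psi' assume c: "!!k. c1 (psi k) (psi' k)" "Lp_tendsto p S psi u" "Lp_tendsto p S psi' D"
 have "en p S (%x. psi k x - u' x) = en p S (%x. psi k x - u x)" for k by (rule en_cong_AE) (use ae in \<open>auto elim!: eventually_mono\<close>)
 moreover have "en p S u' = en p S u" by (rule en_cong_AE) (use ae in \<open>auto elim!: eventually_mono\<close>)
 ultimately show ?thesis using c sob_finite[OF s] sob_borel(2)[OF s] assms(2) unfolding sob_def by (metis (lifting) ext)
qed

text \<open>A power m >= p of an ordinary cutoff: its gradient carries the factor eta^(m-1), which
  is dominated by the power (p-1)/p of the cutoff eta^m itself. This is the form in which the
  gradient term can be absorbed.\<close>

lemma cutoff_power:
 assumes p: "p > 1" and r: "0 < r" "r < R"
 shows "EX ze ze' B. c1c R ze ze' & B >= 1 & (ALL x::'a::euclidean_space. 0 <= ze x & ze x <= B & norm (ze' x) <= B * ze x powr ((p - 1) / p)) & (ALL x. norm x <= r --> 1 <= ze x)"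
proof -
 obtain eta eta' where cut: "c1c R eta eta'" "!!x::'a. 0 <= eta x" "!!x. norm x <= r ==> 1 <= eta x" using cutoff_exists[OF r] by blast
 obtain B0 where B0: "B0 > 0" "!!x. norm (eta x) <= B0" "!!x. norm (eta' x) <= B0" using c1c_bounded_ex[OF cut(1)] by blast
 define m where "m = nat \<lceil>p\<rceil>"
 have m: "real m >= p" "m > 1" using p by (auto simp: m_def)
 define B where "B = max 1 B0"
 have B: "B >= 1" "!!x. eta x <= B" "!!x. norm (eta' x) <= B" using B0 by (auto simp: B_def abs_le_iff intro: max.coboundedI2)
 define C where "C = real m * B ^ m"
 have mB: "B ^ k <= C" if "k <= m" for k
 proof -
  have "B ^ k <= B ^ m" using B that by (intro power_increasing) auto
  also have "... <= C" using m B mult_right_mono[of 1 "real m" "B ^ m"] by (simp add: C_def)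
  finally show ?thesis .
 qed
 have "c1 (%x. eta x ^ m) (%x. (real m * eta x ^ (m - 1)) *R eta' x)"
  by (rule c1_compose[where g="%t. t ^ m" and g'="%t. real m * t ^ (m - 1)", OF _ _ c1c_c1[OF cut(1)]]) (auto intro!: continuous_intros derivative_eq_intros)
 then have "c1c R (%x. eta x ^ m) (%x. (real m * eta x ^ (m - 1)) *R eta' x)" using cut(1) m by (auto simp: c1c_def)
 moreover have "C >= 1" using mB[of 0] by simp
 moreover have "0 <= eta x ^ m" "eta x ^ m <= C" for x using cut(2) power_mono[OF B(2) cut(2), of x m] mB[of m] by auto
 moreover have "norm ((real m * eta x ^ (m - 1)) *R eta' x) <= C * (eta x ^ m) powr ((p - 1) / p)" for x
 proof (cases "eta x = 0")
  case False
  then have e: "eta x > 0" using cut(2)[of x] by simp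
  define a where "a = (p - 1) / p"
  have ma: "real m * a <= real (m - 1)" "0 <= a" using m p by (auto simp: a_def field_simps of_nat_diff)
  have "real (m - 1) - real m * a <= real (m - 1)" using ma by simp
  have "eta x ^ (m - 1) = eta x powr (real m * a) * eta x powr (real (m - 1) - real m * a)" using e m by (simp add: powr_add[symmetric] powr_realpow[symmetric])
  also have "eta x powr (real (m - 1) - real m * a) <= B powr (real (m - 1) - real m * a)" using e B ma by (intro powr_mono2) auto
  also have "... <= B powr real (m - 1)" using B ma m by (intro powr_mono) auto
  also have "... = B ^ (m - 1)" using B(1) by (intro powr_realpow) simp
  also have "eta x powr (real m * a) = (eta x ^ m) powr a" using e by (simp add: powr_realpow[symmetric] powr_powr)
  finally have *: "eta x ^ (m - 1) <= (eta x ^ m) powr a * B ^ (m - 1)" by (simp add: mult_left_mono)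
  have "norm ((real m * eta x ^ (m - 1)) *R eta' x) = real m * eta x ^ (m - 1) * norm (eta' x)" using e by simp
  also have "... <= real m * ((eta x ^ m) powr a * B ^ (m - 1)) * B" using * B e by (intro mult_mono) auto
  also have "... = C * (eta x ^ m) powr a" using m by (simp add: C_def power_eq_if[of B m])
  finally show ?thesis by (simp add: a_def)
 qed (use m in \<open>simp add: power_0_left\<close>)
 moreover have "1 <= eta x ^ m" if "norm x <= r" for x using cut(3)[OF that] by simp
 ultimately show ?thesis by (intro exI[of _ "%x. eta x ^ m"] exI[of _ "%x. (real m * eta x ^ (m - 1)) *R eta' x"] exI[of _ C]) auto
qed

text \<open>The right side 2^N leaves room for adding the N-th powers of two normalized sources, as
  2 <= 2^N.\<close>

definition two_phase :: "real => real => ('a::euclidean_space => real) => ('a => 'a) => ('a => real) => ('a => real) => bool" where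
 "two_phase p \<mu> U D a g \<longleftrightarrow> sob p (ball 0 (3/4)) U D & (ALL x. abs (U x) <= 1) & meas a & meas g &
  (ALL x:ball 0 1. \<mu> <= a x & a x <= 1 / \<mu>) & en (real DIM('a)) (ball 0 1) g <= enn (2 powr real DIM('a)) & weak_eq p D a g"

text \<open>The test function is the cutoff times U, reached by C1 functions. With A the integral of
  ze |D|^p, the cutoff term takes mu A / 2 by Young's inequality and |U| <= 1, the source term takes
  mu A / 4 because it grows only like A^(1/p), and mu A / 4 remains on the left.\<close>

lemma caccioppoli:
 assumes p: "p > 1" and N: "DIM('a::euclidean_space) >= 2" and mu: "0 < \<mu>"
 shows "EX C>0. ALL U (D::'a => 'a) a g. two_phase p \<mu> U D a g -->
  en p (ball 0 (1/2)) D <= enn C"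
proof -
 let ?B = "ball (0::'a) (3/4)"
 obtain ze ze' B where z: "c1c (3/4) ze ze'" "B >= 1" and zB: "ALL x::'a. 0 <= ze x & ze x <= B & norm (ze' x) <= B * ze x powr ((p - 1) / p)" and z1: "ALL x. norm x <= 1/2 --> 1 <= ze x"
  using cutoff_power[OF p, of "1/2" "3/4", where 'a='a] by auto
 obtain C1 where C1: "C1 >= 0" "ALL (f::'a => real) psi psi' e K. meas f --> c1c 1 psi psi' --> 0 < e --> 0 < K -->
  en (real DIM('a)) (ball 0 1) f <= enn (e powr real DIM('a)) --> en p UNIV psi' <= enn (K powr p) -->
  abs (LBINT x. f x * psi x) <= C1 * e * K" using source_pairing[OF p N] by blast
 obtain C2 where C2: "C2 > 0" "ALL x y::real. 0 <= x --> 0 <= y --> x * y <= (\<mu>\<^sup>2 / (2 * B)) * x powr (p / (p - 1)) + C2 * y powr p"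
  using young_eps[OF p, of "\<mu>\<^sup>2 / (2 * B)"] mu z(2) by auto
 define V where "V = measure lborel ?B"
 define M1 where "M1 = (B * B powr ((p - 1) / p)) powr p * V"
 define b1 where "b1 = 2 powr p * 2 powr p * B powr (p - 1)"
 define b2 where "b2 = 2 powr p * 2 powr p * M1 + 2 powr p"
 have b: "b1 > 0" "b2 > 0" "M1 >= 0" "V >= 0" using z(2) by (auto simp: b1_def b2_def M1_def V_def intro!: add_nonneg_pos)
 have p': "p / (p - 1) > 1" "p / (p - 1) / (p / (p - 1) - 1) = p" using p by (auto simp: field_simps)
 \<comment> \<open>The weight in Young's inequality for K against K^p = b1 A + b2; it limits the
   source term to mu A / 4 plus a constant.\<close>
 define d where "d = \<mu> / (8 * (C1 + 1) * b1)"
 have d: "d > 0" "2 * C1 * (d * b1) <= \<mu> / 4"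
 proof -
  show "d > 0" using mu C1(1) b by (simp add: d_def)
  have "2 * C1 * (d * b1) = \<mu> / 4 * (C1 / (C1 + 1))" using b C1(1) by (simp add: d_def divide_simps)
  also have "... <= \<mu> / 4 * 1" using mu C1(1) by (intro mult_left_mono) auto
  finally show "2 * C1 * (d * b1) <= \<mu> / 4" by simp
 qed
 obtain C3 where C3: "C3 > 0" "ALL x y::real. 0 <= x --> 0 <= y --> x * y <= d * x powr p + C3 * y powr (p / (p - 1))"
  using young_eps[OF p'(1) d(1)] unfolding p'(2) by auto
 define C where "C = 4 / \<mu> * (2 * C1 * (d * b2 + C3) + B * C2 / \<mu> * V) + 1"
 have C: "C > 0" unfolding C_def using C1(1) C2(1) C3(1) d(1) b mu z(2) by (intro add_nonneg_pos mult_nonneg_nonneg add_nonneg_nonneg) auto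
 have "en p (ball 0 (1/2)) D <= enn C"
  if tp: "two_phase p \<mu> U D a g" for U a g and D :: "'a => 'a"
 proof -
  have s: "sob p ?B U D" and U: "ALL x. abs (U x) <= 1" and [measurable]: "meas a" "meas g"
   and a: "ALL x:ball 0 1. \<mu> <= a x & a x <= 1 / \<mu>" and g: "en (real DIM('a)) (ball 0 1) g <= enn (2 powr real DIM('a))" and eq: "weak_eq p D a g"
   using tp unfolding two_phase_def by blast+
  have p0: "p > 0" using p by simp
  note sob_borel[OF s, measurable] c1_borel[OF c1c_c1[OF z(1)], measurable]
  have zout: "ze x = 0" "ze' x = 0" if "x \<notin> ?B" for x using c1c_outside[OF z(1), of x] that by auto
  have aB: "abs (a x) <= 1 / \<mu>" "\<mu> <= a x" if "x \<in> ?B" for x using a that mu by (force dest: bspec[of _ _ x])+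
  define P where "P x = ze x * norm (D x) powr p" for x
  have [measurable]: "meas P" unfolding P_def by measurable
  have P0: "P x >= 0" for x using zB by (simp add: P_def)
  have "(NN x. enn (norm (P x))) <= (NN x. enn B * (enn (norm (D x) powr p) * indicator ?B x))"
  proof (intro nn_integral_mono)
   fix x show "enn (norm (P x)) <= enn B * (enn (norm (D x) powr p) * indicator ?B x)"
   proof (cases "x \<in> ?B")
   case True
   have "enn (norm (P x)) <= enn (B * norm (D x) powr p)" using zB by (intro ennreal_leI) (auto simp: P_def intro!: mult_right_mono)
   then show ?thesis using True z(2) by (simp add: ennreal_mult)
   qed (simp add: P_def zout)
  qed
  also have "... = enn B * en p ?B D" unfolding en_def by (simp add: nn_integral_cmult)
  also have "... < oo" using sob_finite(2)[OF s] by (simp add: ennreal_mult_less_top)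
  finally have Pi: "integrable lborel P" by (intro integrableI_bounded) auto
  \<comment> \<open>Finite because D has finite energy on the ball of radius 3/4; this is what makes
    the absorption legitimate.\<close>
  define A where "A = (LBINT x. P x)"
  have A: "A >= 0" "(NN x. enn (P x)) = enn A" using P0 nn_integral_eq_integral[OF Pi] by (auto simp: A_def intro: Bochner_Integration.integral_nonneg)
  define X where "X x = ze x *R D x + U x *R ze' x" for x
  have [measurable]: "meas X" unfolding X_def by measurable
  have enX: "en p ?B X <= enn (2 powr p * (B powr (p - 1) * A + M1))"
  proof -
   have "en p ?B (%x. ze x *R D x) <= (NN x. enn (B powr (p - 1)) * enn (P x))" unfolding en_def
   proof (intro nn_integral_mono, goal_cases)
   case (1 x)
   have "ze x powr p = ze x powr (p - 1) * ze x" using zB by (cases "ze x = 0") (auto simp: powr_diff)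
   also have "... <= B powr (p - 1) * ze x" using zB p by (intro mult_right_mono powr_mono2) auto
   finally have "ze x powr p * norm (D x) powr p <= B powr (p - 1) * ze x * norm (D x) powr p" by (intro mult_right_mono) auto
   then have "enn (norm (ze x *R D x) powr p) <= enn (B powr (p - 1) * P x)" using zB by (intro ennreal_leI) (simp add: P_def powr_mult mult.assoc)
   then show ?case using P0[of x] by (auto simp: ennreal_mult indicator_def)
   qed
   also have "... = enn (B powr (p - 1) * A)" using A by (simp add: nn_integral_cmult ennreal_mult)
   finally have 1: "en p ?B (%x. ze x *R D x) <= enn (B powr (p - 1) * A)" .
   have "en p ?B (%x. U x *R ze' x) <= (NN x. enn ((B * B powr ((p - 1) / p)) powr p) * indicator ?B x)" unfolding en_def
   proof (intro nn_integral_mono mult_right_mono ennreal_leI powr_mono2)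
   fix x
   have "norm (U x *R ze' x) <= 1 * (B * ze x powr ((p - 1) / p))" unfolding norm_scaleR using U zB by (intro mult_mono) auto
   also have "... <= 1 * (B * B powr ((p - 1) / p))" using zB z(2) p by (intro mult_left_mono powr_mono2) auto
   finally show "norm (U x *R ze' x) <= B * B powr ((p - 1) / p)" by simp
   qed (use p0 in auto)
   also have "... = enn M1" by (simp add: nn_integral_cmult_indicator emeasure_ball_eq M1_def V_def ennreal_mult)
   finally have 2: "en p ?B (%x. U x *R ze' x) <= enn M1" .
   have "en p ?B X <= enn (2 powr p) * (en p ?B (%x. ze x *R D x) + en p ?B (%x. U x *R ze' x))" unfolding X_def by (rule en_add) (use p0 in auto)
   also have "... <= enn (2 powr p) * (enn (B powr (p - 1) * A) + enn M1)" by (intro mult_left_mono add_mono 1 2) auto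
   also have "... = enn (2 powr p * (B powr (p - 1) * A + M1))" using A(1) b by (simp add: ennreal_mult)
   finally show ?thesis .
  qed
  obtain psi psi' where psi: "ALL k. c1c (3/4) (psi k) (psi' k)" and l: "Lp_tendsto p ?B psi' X" using sob_mult_approx[OF s z(1) p0] unfolding X_def by blast
  have c: "c1c (3/4) (psi k) (psi' k)" for k using psi by blast
  have [measurable]: "meas (psi' k)" for k by (rule c1_borel(2)[OF c1c_c1[OF c]])
  have psi0: "psi' k x = 0" if "x \<notin> ?B" for k x using c1c_outside[OF c, of x] that by simp
  define H where "H x = a x *R plap p (D x)" for x
  have [measurable]: "meas H" unfolding H_def by measurable
  have enH: "en (p / (p - 1)) ?B H < oo"
  proof -
   have "en (p / (p - 1)) ?B H <= en (p / (p - 1)) ?B (%x. (1 / \<mu>) *R plap p (D x))" unfolding H_def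
   proof (rule en_mono)
   fix x assume "x \<in> ?B"
   then show "norm (a x *R plap p (D x)) <= norm ((1 / \<mu>) *R plap p (D x))" unfolding norm_scaleR using aB(1)[of x] mu by (intro mult_right_mono) auto
   qed (use p in auto)
   also have "... = enn (abs (1 / \<mu>) powr (p / (p - 1))) * en p ?B D" by (subst en_scaleR) (auto simp: en_plap[OF p])
   also have "... < oo" using sob_finite(2)[OF s] by (simp add: ennreal_mult_less_top)
   finally show ?thesis .
  qed
  have fX: "en p ?B X < oo" using enX by (rule le_less_trans) simp
  have X0: "X x = 0" if "x \<notin> ?B" for x using zout[OF that] by (simp add: X_def)
  have lim: "(%k. LBINT x. H x \<bullet> psi' k x) ---> (LBINT x. H x \<bullet> X x)"
   by (rule pairing_tendsto[where S="?B" and p=p]) (use p X0 psi0 fX enH l c1c_en_finite(2)[OF c p0] in auto)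
  have Hi: "integrable lborel (%x. H x \<bullet> X x)" by (rule pairing_integrable[where S="?B" and p=p]) (use p X0 fX enH in auto)
  define K where "K = (b1 * A + b2) powr (1 / p)"
  have K: "K > 0" "K powr p = b1 * A + b2" 
  proof -
   have "b1 * A + b2 > 0" using b A(1) by (intro add_nonneg_pos) auto
   then show "K > 0" "K powr p = b1 * A + b2" using p by (auto simp: K_def powr_powr)
  qed
  have "(LBINT x. H x \<bullet> X x) <= 2 * C1 * K"
  proof (rule LIMSEQ_le_const2[OF lim])
   have "eventually (%k. en p ?B (%x. psi' k x - X x) < 1) sequentially" using l by (rule order_tendstoD) simp
   then obtain k0 where k0: "!!k. k >= k0 ==> en p ?B (%x. psi' k x - X x) < 1" by (auto simp: eventually_sequentially)
   have "(LBINT x. H x \<bullet> psi' k x) <= 2 * C1 * K" if "k0 <= k" for k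
   proof -
   have c': "c1c 1 (psi k) (psi' k)" using c1c_mono[OF c] by simp
   have "en p UNIV (psi' k) = en p ?B (psi' k)" unfolding en_def using p psi0[of _ k] by (intro nn_integral_cong) (auto simp: indicator_def)
   also have "... = en p ?B (%x. X x + (psi' k x - X x))" by simp
   also have "... <= enn (2 powr p) * (en p ?B X + en p ?B (%x. psi' k x - X x))" by (rule en_add) (use p0 in auto)
   also have "... <= enn (2 powr p) * (enn (2 powr p * (B powr (p - 1) * A + M1)) + enn 1)"
   using less_imp_le[OF k0[OF that]] by (intro mult_left_mono add_mono enX) auto
   also have "... = enn (2 powr p * (2 powr p * (B powr (p - 1) * A + M1) + 1))" using A(1) b by (simp add: ennreal_mult)
   also have "2 powr p * (2 powr p * (B powr (p - 1) * A + M1) + 1) = K powr p" unfolding K(2) by (simp add: b1_def b2_def algebra_simps)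
   finally have "en p UNIV (psi' k) <= enn (K powr p)" .
   then have "abs (LBINT x. g x * psi k x) <= C1 * 2 * K" using C1(2) c' K(1) g by auto
   moreover have "(LBINT x. H x \<bullet> psi' k x) = (LBINT x. g x * psi k x)" using eq c' unfolding weak_eq_def H_def by simp
   ultimately show ?thesis by simp
   qed
   then show "EX k0. ALL k>=k0. (LBINT x. H x \<bullet> psi' k x) <= 2 * C1 * K" by blast
  qed
  moreover have "(LBINT x. \<mu> / 2 * P x - (B * C2 / \<mu>) * indicator ?B x) <= (LBINT x. H x \<bullet> X x)"
  proof (rule integral_mono)
   show "integrable lborel (%x. \<mu> / 2 * P x - (B * C2 / \<mu>) * indicator ?B x)" using Pi by (auto simp: emeasure_ball_eq)
   show "integrable lborel (%x. H x \<bullet> X x)" by (rule Hi)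
   fix x
   show "\<mu> / 2 * P x - (B * C2 / \<mu>) * indicator ?B x <= H x \<bullet> X x"
   proof (cases "x \<in> ?B")
   case True
   define y where "y = norm (D x) powr (p - 1) * ze x powr ((p - 1) / p)"
   have y: "y <= (\<mu>\<^sup>2 / (2 * B)) * P x + C2"
   proof -
   have "y powr (p / (p - 1)) = P x" using p zB by (simp add: y_def P_def powr_mult powr_powr)
   moreover have "y >= 0" by (simp add: y_def)
   ultimately show ?thesis using C2(2)[rule_format, of y 1] by simp
   qed
   have "abs (a x * (U x * (plap p (D x) \<bullet> ze' x))) <= (1 / \<mu>) * (1 * (norm (plap p (D x)) * norm (ze' x)))"
   unfolding abs_mult using mu aB[OF True] U Cauchy_Schwarz_ineq2[of "plap p (D x)" "ze' x"] by (intro mult_mono) auto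
   also have "... <= (1 / \<mu>) * (1 * (norm (D x) powr (p - 1) * (B * ze x powr ((p - 1) / p))))"
   unfolding norm_plap[OF p] using zB mu by (intro mult_left_mono) auto
   also have "... = (B / \<mu>) * y" by (simp add: y_def)
   also have "... <= (B / \<mu>) * ((\<mu>\<^sup>2 / (2 * B)) * P x + C2)" using y z(2) mu by (intro mult_left_mono) auto
   also have "... = \<mu> / 2 * P x + B * C2 / \<mu>" using z(2) mu by (simp add: field_simps power2_eq_square)
   finally have "\<mu> * P x - (\<mu> / 2 * P x + B * C2 / \<mu>) <= a x * P x + a x * (U x * (plap p (D x) \<bullet> ze' x))"
   using mult_right_mono[OF aB(2)[OF True] P0[of x]] by linarith
   moreover have "H x \<bullet> X x = a x * P x + a x * (U x * (plap p (D x) \<bullet> ze' x))"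
   using plap_inner_self[OF p, of "D x"] by (simp add: H_def X_def P_def inner_add_right algebra_simps)
   ultimately show ?thesis using True by simp
   qed (simp add: P_def zout X0)
  qed
  moreover have "(LBINT x. \<mu> / 2 * P x - (B * C2 / \<mu>) * indicator ?B x) = \<mu> / 2 * A - (B * C2 / \<mu>) * V"
   using Pi by (subst Bochner_Integration.integral_diff) (auto simp: A_def V_def emeasure_ball_eq)
  moreover have "K <= d * (b1 * A + b2) + C3" using C3(2)[rule_format, of K 1] K by simp
  then have "2 * C1 * K <= 2 * C1 * (d * (b1 * A + b2) + C3)" using C1(1) by (intro mult_left_mono) auto
  moreover have "2 * C1 * (d * (b1 * A + b2) + C3) = (2 * C1 * (d * b1)) * A + 2 * C1 * (d * b2 + C3)" by (simp add: algebra_simps)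
  moreover have "(2 * C1 * (d * b1)) * A <= \<mu> / 4 * A" using d(2) A(1) by (rule mult_right_mono)
  ultimately have "\<mu> / 4 * A <= 2 * C1 * (d * b2 + C3) + (B * C2 / \<mu>) * V" by linarith
  then have "A <= C - 1" using mu by (simp add: C_def field_simps)
  then have AC: "A <= C" by simp
  have "en p (ball 0 (1/2)) D <= (NN x. enn (P x))" unfolding en_def
  proof (intro nn_integral_mono)
   fix x show "enn (norm (D x) powr p) * indicator (ball 0 (1/2)) x <= enn (P x)"
   proof (cases "x \<in> ball 0 (1/2)")
   case True
   then have "1 * norm (D x) powr p <= P x" unfolding P_def using z1 by (intro mult_right_mono) auto
   then show ?thesis using True by (simp add: ennreal_leI)
   qed simp
  qed
  also have "... <= enn C" unfolding A(2) using AC by (rule ennreal_leI)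
  finally show ?thesis .
 qed
 note main = this
 show ?thesis by (rule exI[of _ C]) (intro conjI allI impI, rule C, (rule main; assumption))
qed

section \<open>Removing the jump across the zero level\<close>

text \<open>The kink is smoothed by C1 functions whose slope passes from l to r on [0, 1/j]. They
  converge uniformly, with error |r - l| / j. The ramp begins at 0, so the slopes converge at every
  point, also at the kink, where the limit is l in accordance with the test
  \<open>u x > 0\<close>.\<close>

lemma sob_kink:
 fixes u :: "'a::euclidean_space => real" and l r :: real
 assumes s: "sob p S u D" and [measurable]: "S \<in> sets borel" and fin: "emeasure lborel S < oo" and p: "p > 0"
 shows "sob p S (%x. (if u x > 0 then r else l) * u x) (%x. (if u x > 0 then r else l) *R D x)"
proof -
 define j where "j k = real (Suc k)" for k
 have j: "j k > 0" for k by (simp add: j_def)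
 let ?h = "%k t. j k / 2 * (2 * max 0 t - 2 * max 0 (t - 1 / j k))"
 define g where "g k t = l * t + (r - l) * (j k / 2 * ((max 0 t)\<^sup>2 - (max 0 (t - 1 / j k))\<^sup>2))" for k t
 define g' where "g' k t = l + (r - l) * (?h k t)" for k t
 have dg: "(g k has_real_derivative g' k t) (at t)" for k t
 proof -
  have "((%t. (max 0 (t - 1 / j k))\<^sup>2) has_real_derivative 2 * max 0 (t - 1 / j k) * 1) (at t)"
   by (rule DERIV_chain2[OF positive_part_square_deriv]) (auto intro!: derivative_eq_intros)
  then have "((%t. (max 0 (t - 1 / j k))\<^sup>2) has_real_derivative 2 * max 0 (t - 1 / j k)) (at t)" by simp
  from DERIV_add[OF DERIV_cmult_Id DERIV_cmult[OF DERIV_cmult[OF DERIV_diff[OF positive_part_square_deriv this]]]]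
  show ?thesis unfolding g_def[abs_def] g'_def .
 qed
 have cg: "continuous_on UNIV (g' k)" for k unfolding g'_def by (intro continuous_intros)
 have hat: "0 <= ?h k t" "?h k t <= 1" for k t
 proof -
  have "1 / j k > 0" using j[of k] by simp
  then have "0 <= max 0 t - max 0 (t - 1 / j k)" "max 0 t - max 0 (t - 1 / j k) <= 1 / j k" by linarith+
  from this(1) mult_left_mono[OF this(2), of "j k"]
  show "0 <= ?h k t" "?h k t <= 1" using j[of k] by (auto simp: algebra_simps)
 qed
 have bg: "abs (g' k t) <= abs l + abs (r - l)" for k t
 proof -
  define y where "y = ?h k t"
  have "abs ((r - l) * y) <= abs (r - l) * 1" unfolding abs_mult using hat[of k t, folded y_def] by (intro mult_left_mono) auto
  then show ?thesis unfolding g'_def y_def[symmetric] by (intro order_trans[OF abs_triangle_ineq]) simp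
 qed
 define T' where "T' t = (if t > 0 then r else l)" for t :: real
 have diff: "abs (g k t - T' t * t) <= abs (r - l) / j k" for k t
 proof -
  define h where "h = j k / 2 * ((max 0 t)\<^sup>2 - (max 0 (t - 1 / j k))\<^sup>2) - max 0 t"
  have "abs h <= 1 / j k"
  proof -
   consider "t <= 0" | "0 < t" "t <= 1 / j k" | "1 / j k < t" by linarith
   then show ?thesis
   proof cases
   case 1
   moreover have "t - 1 / j k <= 0" using 1 order_trans[of t 0 "1 / j k"] j[of k] by simp
   ultimately show ?thesis using j[of k] by (simp add: h_def)
   next
   case 2
   then have "j k * t <= 1" using j[of k] by (simp add: field_simps)
   then have "(j k * t) * t <= 1 * t" using 2 by (intro mult_right_mono) auto
   then have "0 <= j k / 2 * t\<^sup>2" "j k / 2 * t\<^sup>2 <= t / 2" using j[of k] by (auto simp: power2_eq_square)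
   then show ?thesis using 2 by (simp add: h_def)
   next
   case 3
   then have t: "t > 0" using j[of k] less_trans[of 0 "1 / j k" t] by simp
   have "j k / 2 * (t\<^sup>2 - (t - 1 / j k)\<^sup>2) = t - 1 / (2 * j k)" using j[of k] by (simp add: power2_eq_square field_simps)
   moreover have "h = j k / 2 * (t\<^sup>2 - (t - 1 / j k)\<^sup>2) - t" using 3 t by (simp add: h_def)
   ultimately have "h = - (1 / (2 * j k))" by linarith
   then show ?thesis using j[of k] by (simp add: field_simps)
   qed
  qed
  moreover have "g k t - T' t * t = (r - l) * h" by (auto simp: g_def T'_def h_def max_def algebra_simps)
  ultimately show ?thesis using mult_left_mono[of "abs h" "1 / j k" "abs (r - l)"] by (simp add: abs_mult)
 qed
 have jl: "(%k. 1 / j k) ---> 0" unfolding j_def using LIMSEQ_inverse_real_of_nat by (simp add: inverse_eq_divide)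
 have ptw: "(%k. g' k t) ---> T' t" for t
 proof (rule tendsto_eventually)
  show "eventually (%k. g' k t = T' t) sequentially"
  proof (cases "t > 0")
   case True
   have "eventually (%k. 1 / j k < t) sequentially" using jl True by (rule order_tendstoD)
   then show ?thesis
   proof eventually_elim
   case (elim k)
   then show ?case using True j[of k] by (simp add: g'_def T'_def algebra_simps)
   qed
  next
   case False
   have "t - 1 / j k <= 0" for k using False order_trans[of t 0 "1 / j k"] j[of k] by simp
   then show ?thesis using False by (auto simp: g'_def T'_def)
  qed
 qed
 note sob_borel[OF s, measurable]
 have [measurable]: "meas T'" unfolding T'_def by measurable
 have [measurable]: "meas (g' k)" for k using cg by (rule borel_measurable_continuous_onI)
 have "sob p S (%x. T' (u x) * u x) (%x. T' (u x) *R D x)"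
 proof (rule sob_limit[where U="%k x. g k (u x)" and E="%k x. g' k (u x) *R D x"])
  show "sob p S (%x. g k (u x)) (%x. g' k (u x) *R D x)" for k by (rule sob_chain[OF s _ fin p dg cg bg]) simp
  show "(%k. en p S (%x. g k (u x) - T' (u x) * u x)) ---> 0"
  proof (rule en_tendsto_squeeze)
   have "(%k. (abs (r - l) * (1 / j k)) powr p) ---> (abs (r - l) * 0) powr p"
   using p j by (intro tendsto_powr' tendsto_mult tendsto_const jl) (auto simp: less_imp_le)
   then show "(%k. enn ((abs (r - l) / j k) powr p)) ---> 0" using p by (subst ennreal_0[symmetric]) (intro tendsto_ennrealI, simp)
   fix k
   have "en p S (%x. g k (u x) - T' (u x) * u x) <= (NN x. enn ((abs (r - l) / j k) powr p) * indicator S x)"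
   unfolding en_def using p diff by (intro nn_integral_mono mult_right_mono ennreal_leI powr_mono2) auto
   also have "... = enn (measure lborel S) * enn ((abs (r - l) / j k) powr p)"
   using fin by (subst nn_integral_cmult_indicator) (auto simp: emeasure_eq_ennreal_measure mult.commute less_top)
   finally show "en p S (%x. g k (u x) - T' (u x) * u x) <= enn (measure lborel S) * enn ((abs (r - l) / j k) powr p)" .
  qed
  have "(%k. en p S (%x. (g' k (u x) - T' (u x)) *R D x)) ---> 0"
  proof (rule en_scaleR_tendsto[OF _ _ _ p sob_finite(2)[OF s]])
   fix k x
   have "abs (T' (u x)) <= abs l + abs (r - l)" using abs_triangle_ineq[of l "r - l"] by (auto simp: T'_def)
   then show "abs (g' k (u x) - T' (u x)) <= 2 * (abs l + abs (r - l))"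
   using bg[of k "u x"] abs_triangle_ineq4[of "g' k (u x)" "T' (u x)"] unfolding distrib_left by linarith
  qed (auto intro!: LIM_zero ptw)
  then show "(%k. en p S (%x. g' k (u x) *R D x - T' (u x) *R D x)) ---> 0" by (simp add: scaleR_diff_left)
 qed (use p in auto)
 then show ?thesis unfolding T'_def .
qed

text \<open>The flux is homogeneous of degree p - 1, so multiplying D by k^(1/(p-1)) multiplies it
  by k, even if k varies with x. For k constant on each phase the new field is again a gradient by
  \<open>sob_kink\<close>.\<close>

lemma weak_eq_normalize:
 assumes e: "weak_eq p D a g" and p: "p > 1" and k: "!!x. k x > 0"
 shows "weak_eq p (%x. k x powr (1 / (p - 1)) *R D x) (%x. a x / k x) g"
proof -
 have "a x / k x * (plap p (k x powr (1 / (p - 1)) *R D x) \<bullet> y) = a x * (plap p (D x) \<bullet> y)" for x y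
 proof -
  have "k x powr (1 / (p - 1)) > 0" using k[of x] by simp
  then have "plap p (k x powr (1 / (p - 1)) *R D x) = k x *R plap p (D x)" using k[of x] p by (simp add: plap_scaleR powr_powr)
  then show ?thesis using k[of x] by simp
 qed
 then show ?thesis using e by (simp add: weak_eq_def)
qed

definition almost_phase :: "real => real => real => ('a::euclidean_space => real) => ('a => real) => real => real => bool" where
 "almost_phase \<mu> ep c U a kp km \<longleftrightarrow> \<mu> <= kp & kp <= 1 / \<mu> & \<mu> <= km & km <= 1 / \<mu> & (ALL x:ball 0 c. abs (a x - (if U x > 0 then kp else km)) <= ep)"

text \<open>After freezing, E is the gradient of the kinked function V and solves an equation with
  the coefficient a/k, close to 1. Dilation to the unit ball and a small multiple m make it
  \<open>nearly_harmonic\<close>; m may depend on c, whereas ep is fixed before c.\<close>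

lemma local_decay:
 assumes p: "p > 1" and N: "DIM('a::euclidean_space) >= 2" and mu: "0 < \<mu>" "\<mu> < 1" and al: "0 < \<alpha>" "\<alpha> < 1"
 shows "EX ep>0. ALL c. 0 < c --> c <= 1/2 --> (EX K>0. ALL U (D::'a => 'a) a g kp km s.
  two_phase p \<mu> U D a g -->
  almost_phase \<mu> ep c U a kp km --> 0 < s --> s <= c -->
  en p (ball 0 s) D <= enn (K * s powr (real DIM('a) - p * (1 - \<alpha>))))"
proof -
 define n where "n = real DIM('a)"
 define si where "si = n - p * (1 - \<alpha>)"
 obtain C0 where C0: "C0 > 0" "ALL U (D::'a => 'a) a g. two_phase p \<mu> U D a g -->
  en p (ball 0 (1/2)) D <= enn C0" using caccioppoli[OF p N mu(1)] by (elim exE conjE) (rule that; assumption)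
 obtain C ep where C: "C > 0" and e: "ep > 0" and dec: "ALL v (D::'a => 'a) b f rho. nearly_harmonic p ep v D b f --> 0 < rho --> rho <= 1 -->
  en p (ball 0 rho) D <= enn (C * rho powr si)" using energy_decay[OF p N al, folded n_def, folded si_def] by (elim exE conjE) (rule that; assumption)
 define e1 where "e1 = \<mu> powr (1 / (p - 1))"
 define e2 where "e2 = (1 / \<mu>) powr (1 / (p - 1))"
 have e12: "e1 > 0" "e2 > 0" using mu by (auto simp: e1_def e2_def)
 have main: "EX K>0. ALL U (D::'a => 'a) a g kp km s.
  two_phase p \<mu> U D a g -->
  almost_phase \<mu> (ep * \<mu>) c U a kp km --> 0 < s --> s <= c -->
  en p (ball 0 s) D <= enn (K * s powr si)" if c: "0 < c" "c <= 1/2" for c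
 proof -
  \<comment> \<open>The first entry brings the energy on the ball of radius c, known from
    Caccioppoli, down to 1; the second makes the source, of size at most 2 m^(p-1), at most
    ep.\<close>
  define m where "m = min ((c powr n / (e2 powr p * C0)) powr (1 / p)) ((ep / 2) powr (1 / (p - 1)))"
  have m: "m > 0" "m powr p * (e2 powr p * C0) <= c powr n" "m powr (p - 1) <= ep / 2"
  proof -
   show "m > 0" using c e12 C0(1) e by (simp add: m_def)
   have "m powr p <= ((c powr n / (e2 powr p * C0)) powr (1 / p)) powr p" using \<open>m > 0\<close> p by (intro powr_mono2) (auto simp: m_def)
   also have "... = c powr n / (e2 powr p * C0)" using c e12 C0(1) p by (simp add: powr_powr)
   finally show "m powr p * (e2 powr p * C0) <= c powr n" using e12 C0(1) by (simp add: field_simps)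
   have "m powr (p - 1) <= ((ep / 2) powr (1 / (p - 1))) powr (p - 1)" using \<open>m > 0\<close> p by (intro powr_mono2) (auto simp: m_def)
   also have "... = ep / 2" using e p by (simp add: powr_powr)
   finally show "m powr (p - 1) <= ep / 2" .
  qed
  have cn: "c ^ DIM('a) = c powr n" using c by (simp add: n_def powr_realpow)
  define K where "K = c powr n * (1 / (m * e1)) powr p * C * c powr (- si)"
  have K: "K > 0" using c m(1) e12 C by (simp add: K_def)
  have "en p (ball 0 s) D <= enn (K * s powr si)"
   if tp: "two_phase p \<mu> U D a g" and ap: "almost_phase \<mu> (ep * \<mu>) c U a kp km"
   and s: "0 < s" "s <= c" for U a g kp km s and D :: "'a => 'a"
  proof -
   have sD: "sob p (ball 0 (3/4)) U D" and [measurable]: "meas a" "meas g"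
   and g: "en n (ball 0 1) g <= enn (2 powr n)" and eq: "weak_eq p D a g" using tp unfolding two_phase_def n_def by blast+
   note sob_borel[OF sD, measurable]
   note k = ap[unfolded almost_phase_def]
   have C0D: "en p (ball 0 (1/2)) D <= enn C0" by (rule C0(2)[rule_format, OF tp])
   define k where "k x = (if U x > 0 then kp else km)" for x
   have [measurable]: "meas k" unfolding k_def by measurable
   have kb: "\<mu> <= k x" "k x <= 1 / \<mu>" "k x > 0" for x using k mu by (auto simp: k_def)
   define E where "E x = k x powr (1 / (p - 1)) *R D x" for x
   have [measurable]: "meas E" unfolding E_def by measurable
   have kE: "e1 <= k x powr (1 / (p - 1))" "k x powr (1 / (p - 1)) <= e2" for x using kb[of x] mu p unfolding e1_def e2_def by (auto intro: powr_mono2)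
   define V where "V x = k x powr (1 / (p - 1)) * U x" for x
   have sV: "sob p (ball 0 (3/4)) V E"
   proof -
   have "k x powr (1 / (p - 1)) = (if U x > 0 then kp powr (1 / (p - 1)) else km powr (1 / (p - 1)))" for x by (simp add: k_def)
   then show ?thesis unfolding V_def[abs_def] E_def[abs_def]
   using sob_kink[OF sD _ _, of "kp powr (1 / (p - 1))" "km powr (1 / (p - 1))"] emeasure_lborel_ball_finite[of "0::'a" "3/4"] p by simp
   qed
   have eqE: "weak_eq p E (%x. a x / k x) g" unfolding E_def by (rule weak_eq_normalize[OF eq p kb(3)])
   define G where "G x = m *R E (0 + c *R x)" for x
   have [measurable]: "meas G" unfolding G_def by measurable
   have mc: "m / c > 0" "m / c * c = m" using m(1) c by auto
   have "nearly_harmonic p ep (%x. m / c * V (0 + c *R x)) G (%x. 1 * (a (0 + c *R x) / k (0 + c *R x))) (%x. (1 * c * m powr (p - 1)) * g (0 + c *R x))"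
   unfolding nearly_harmonic_def
   proof (intro conjI allI impI ballI)
   show "meas G" by measurable
   show "meas (%x. 1 * (a (0 + c *R x) / k (0 + c *R x)))" by measurable
   show "meas (%x. (1 * c * m powr (p - 1)) * g (0 + c *R x))" by measurable
   show "sob p (ball 0 r) (%x. m / c * V (0 + c *R x)) G" if r: "r < 1" for r
   proof -
   have "c * r <= c * 1" using r c by (intro mult_left_mono) auto
   then have "c * r <= 3/4" using c by linarith
   then have "ball 0 (c * r) \<subseteq> ball (0::'a) (3/4)" by (rule subset_ball)
   then show ?thesis using sob_affine[OF sob_mono[OF sV], of 0 c r "m / c"] c unfolding mc(2) G_def[abs_def] by simp
   qed
   show "en p (ball 0 1) G <= 1"
   proof -
   have "enn (c powr n) * en p (ball 0 1) G = enn (m powr p) * (enn (c ^ DIM('a)) * en p (ball 0 1) (%x. E (0 + c *R x)))"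
   unfolding G_def using m(1) by (subst en_scaleR) (auto simp: cn mult_ac)
   also have "... = enn (m powr p) * en p (ball 0 c) E" using en_affine[of E c p 0 1] c by simp
   also have "en p (ball 0 c) E <= en p (ball 0 (1/2)) (%x. e2 *R D x)"
   proof (rule order_trans[OF en_mono_set en_mono])
   show "norm (E x) <= norm (e2 *R D x)" for x using kE(2)[of x] e12 by (simp add: E_def mult_right_mono)
   qed (use c p in auto)
   also have "... = enn (e2 powr p) * en p (ball 0 (1/2)) D" using e12 by (subst en_scaleR) auto
   also have "... <= enn (e2 powr p) * enn C0" by (intro mult_left_mono C0D) auto
   also have "enn (m powr p) * (enn (e2 powr p) * enn C0) = enn (m powr p * (e2 powr p * C0))" using C0(1) by (simp add: ennreal_mult)
   also have "... <= enn (c powr n) * 1" using m(2) by (simp add: ennreal_leI)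
   finally have "enn (c powr n) * en p (ball 0 1) G <= enn (c powr n) * 1" by (simp add: mult_left_mono)
   then show ?thesis using c by (subst (asm) ennreal_mult_le_mult_iff) auto
   qed
   show "abs (1 * (a (0 + c *R x) / k (0 + c *R x)) - 1) <= ep" if "x \<in> ball 0 1" for x
   proof -
   define y where "y = 0 + c *R x"
   have "y \<in> ball 0 c" using that c mult_strict_left_mono[of "norm x" 1 c] by (simp add: y_def)
   then have "abs (a y - k y) <= ep * \<mu>" using ap by (simp add: k_def almost_phase_def)
   also have "... <= ep * k y" using kb e by (intro mult_left_mono) auto
   finally have "abs (a y - k y) / k y <= ep" using kb(3)[of y] by (simp add: field_simps)
   moreover have "a y / k y - 1 = (a y - k y) / k y" using kb(3)[of y] by (simp add: field_simps)
   ultimately have "abs (1 * (a y / k y) - 1) <= ep" using kb(3)[of y] by (simp add: abs_divide)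
   then show ?thesis unfolding y_def .
   qed
   show "en (real DIM('a)) (ball 0 1) (%x. (1 * c * m powr (p - 1)) * g (0 + c *R x)) <= enn (ep powr real DIM('a))"
   proof -
   define q where "q = 1 * c * m powr (p - 1)"
   have q: "0 <= q" "q powr n = c powr n * (m powr (p - 1)) powr n" using c by (auto simp: q_def powr_mult)
   have "en n (ball 0 1) (%x. q * g (0 + c *R x)) = enn (q powr n) * en n (ball 0 1) (%x. g (0 + c *R x))"
   using en_scaleR[of "%x. g (0 + c *R x)" "ball 0 1" n q] q(1) by simp
   also have "... = enn ((m powr (p - 1)) powr n) * en n (ball 0 c) g" using en_affine[of g c n 0 1] c by (simp add: q(2) cn ennreal_mult mult_ac)
   also have "... <= enn ((m powr (p - 1)) powr n) * enn (2 powr n)" using c by (intro mult_left_mono order_trans[OF en_mono_set g] subset_ball) auto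
   also have "... = enn ((2 * m powr (p - 1)) powr n)" by (simp add: ennreal_mult[symmetric] powr_mult mult.commute)
   also have "... <= enn (ep powr n)" using m(3) by (intro ennreal_leI powr_mono2) (auto simp: n_def)
   finally show ?thesis by (simp add: q_def n_def)
   qed
   show "weak_eq p G (%x. 1 * (a (0 + c *R x) / k (0 + c *R x))) (%x. (1 * c * m powr (p - 1)) * g (0 + c *R x))"
   unfolding G_def by (rule weak_eq_rescale[OF eqE]) (use c m(1) in auto)
   qed
   then have dG: "en p (ball 0 (s / c)) G <= enn (C * (s / c) powr si)" by (rule dec[rule_format]) (use s c in auto)
   have "en p (ball 0 s) D = enn (c ^ DIM('a)) * en p (ball 0 (s / c)) (%x. D (0 + c *R x))" using en_affine[of D c p 0 "s / c"] c by simp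
   also have "... <= enn (c powr n) * en p (ball 0 (s / c)) (%x. (1 / (m * e1)) *R G x)" unfolding cn
   proof (intro mult_left_mono en_mono)
   fix x
   have "norm (D (0 + c *R x)) * (m * e1) <= norm (G x)"
   using mult_left_mono[OF kE(1)[of "0 + c *R x"], of "m * norm (D (0 + c *R x))"] m(1) by (simp add: G_def E_def mult_ac)
   then show "norm (D (0 + c *R x)) <= norm ((1 / (m * e1)) *R G x)" using m(1) e12 by (simp add: field_simps)
   qed (use p in auto)
   also have "... = enn (c powr n) * (enn ((1 / (m * e1)) powr p) * en p (ball 0 (s / c)) G)" using m(1) e12 by (subst en_scaleR) auto
   also have "... <= enn (c powr n) * (enn ((1 / (m * e1)) powr p) * enn (C * (s / c) powr si))" by (intro mult_left_mono dG) auto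
   also have "... = enn (c powr n * ((1 / (m * e1)) powr p * (C * (s / c) powr si)))" using C by (simp add: ennreal_mult)
   also have "c powr n * ((1 / (m * e1)) powr p * (C * (s / c) powr si)) = K * s powr si" using s c by (simp add: K_def powr_divide powr_minus divide_simps)
   finally show ?thesis .
  qed
  note bound = this
  show ?thesis by (rule exI[of _ K], intro conjI allI impI, rule K, (rule bound; assumption))
 qed
 show ?thesis by (rule exI[of _ "ep * \<mu>"]) (use main e mu in \<open>simp add: n_def si_def\<close>)
qed

section \<open>From energy decay to Hoelder continuity\<close>

lemma geometric_increments_converge:
 fixes a :: "nat => real"
 assumes k: "0 < k" "k < 1" and d: "!!j. abs (a (Suc j) - a j) <= A * k ^ j"
 shows "a ---> lim a" "abs (a j - lim a) <= A * k ^ j / (1 - k)"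
proof -
 have A: "A >= 0" using d[of 0] by simp
 have le: "abs (a (j + i) - a j) <= A * k ^ j / (1 - k)" for i j
 proof -
  have "abs (a (j + i) - a j) <= (\<Sum>l<i. A * k ^ (j + l))"
  proof (induction i)
   case (Suc i)
   have "abs (a (j + Suc i) - a j) <= abs (a (j + Suc i) - a (j + i)) + abs (a (j + i) - a j)" by simp
   also have "... <= A * k ^ (j + i) + (\<Sum>l<i. A * k ^ (j + l))" using d[of "j + i"] Suc.IH by simp
   finally show ?case by simp
  qed simp
  also have "... = A * k ^ j * (\<Sum>l<i. k ^ l)" by (simp add: sum_distrib_left power_add mult_ac)
  also have "(\<Sum>l<i. k ^ l) <= (\<Sum>l. k ^ l)" using k by (intro sum_le_suminf) (auto intro: summable_geometric)
  also have "(\<Sum>l. k ^ l) = 1 / (1 - k)" using k by (intro suminf_geometric) auto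
  finally show ?thesis using A k by (simp add: mult_left_mono)
 qed
 have "summable (%j. a (Suc j) - a j)"
  by (rule summable_comparison_test'[where g="%j. A * k ^ j"]) (use k d in \<open>auto intro!: summable_mult summable_geometric\<close>)
 then have "convergent (%j. a j - a 0)" by (simp add: summable_iff_convergent sum_lessThan_telescope)
 then obtain l where "(%j. a j - a 0) ---> l" by (auto simp: convergent_def)
 from tendsto_add[OF this tendsto_const[of "a 0"]] have "a ---> l + a 0" by simp
 then show l: "a ---> lim a" by (simp add: limI)
 have "(%i. abs (a (i + j) - a j)) ---> abs (lim a - a j)" by (intro tendsto_intros LIMSEQ_ignore_initial_segment l)
 then have "abs (lim a - a j) <= A * k ^ j / (1 - k)" by (rule LIMSEQ_le_const2) (use le[of j] in \<open>auto simp: add.commute\<close>)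
 then show "abs (a j - lim a) <= A * k ^ j / (1 - k)" by (simp add: abs_minus_commute)
qed

lemma bavg_diff_const:
 fixes u :: "'a::euclidean_space => real"
 assumes t: "t > 0" and [measurable]: "meas u" and u: "!!x. abs (u x) <= M"
 shows "bavg t (%y. u y - c) x = bavg t u x - c"
proof -
 note ball_kernel_props(1)[OF t, measurable]
 have k: "integrable lborel (ball_kernel t :: 'a => real)" "(LBINT z. ball_kernel t (z::'a)) = 1"
  using nn_integral_eq_integrable[of "ball_kernel t" "lborel :: 'a measure" 1] ball_kernel_props[OF t, where 'a='a] by auto
 have "integrable lborel (%z::'a. ball_kernel t z * u (x - z))" by (rule Bochner_Integration.integrable_bound[OF integrable_mult_right[OF k(1), of M]])
   (use u ball_kernel_props(2)[OF t, where 'a='a] order_trans[OF abs_ge_zero u] in \<open>auto simp: abs_mult mult.commute[of M] intro!: mult_left_mono\<close>)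
 then show ?thesis unfolding bavg_def moll_def using k by (simp add: right_diff_distrib)
qed

text \<open>Only pairs at distance at most d are compared; the bound |v| <= 1 handles distant pairs
  later.\<close>

definition locally_holder :: "real => real => real => real => ('a::euclidean_space => real) => bool" where
 "locally_holder \<alpha> K d r u \<longleftrightarrow> (EX v. (AE x in lborel. x \<in> ball 0 r --> v x = u x) & (ALL x. abs (v x) <= 1) &
  (ALL x:ball 0 r. ALL y:ball 0 r. dist x y <= d --> abs (v x - v y) <= K * dist x y powr \<alpha>))"

text \<open>Poincare makes the means over balls of radius rho_j differ by a multiple of H
  rho_j^alpha between consecutive scales and between neighbouring centres. The means therefore
  converge geometrically, and two points are compared at the scale of their distance.\<close>

lemma morrey_holder:
 assumes p: "p > 1" and al: "0 < \<alpha>" "\<alpha> < 1"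
 shows "EX C>0. ALL u (D::'a::euclidean_space => 'a) r R rho0 H. sob p (ball 0 R) u D --> (ALL x. abs (u x) <= 1) --> 0 < rho0 --> r + rho0 <= R --> 0 < H -->
  (ALL x:ball 0 r. ALL rho. 0 < rho --> rho <= rho0 --> en p (ball x rho) D <= enn (H powr p * rho powr (real DIM('a) - p * (1 - \<alpha>)))) -->
  locally_holder \<alpha> (C * H) (rho0 / 6) r u"
proof -
 define n where "n = real DIM('a)"
 define V where "V = measure lborel (ball (0::'a) 1)"
 have V: "V > 0" unfolding V_def using content_ball_pos[of 1 "0::'a"] by simp
 define k where "k = 2 powr (- \<alpha>)"
 have k: "0 < k" "k < 1" using al by (auto simp: k_def powr_less_one)
 define B where "B = (2 powr n / V) * (2 ^ DIM('a) * 2 powr p * 3 powr (n - p * (1 - \<alpha>)))"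
 have B: "B > 0" using V by (simp add: B_def)
 define C2 where "C2 = B powr (1 / p)"
 have C2: "C2 > 0" using B by (simp add: C2_def)
 define C where "C = 2 * C2 * (2 / (1 - k) + 1) * 4 powr \<alpha>"
 have C: "C > 0" using C2 k by (simp add: C_def add_pos_pos)
 have main: "locally_holder \<alpha> (C * H) (rho0 / 6) r u"
  if s: "sob p (ball 0 R) u D" and u1: "ALL x. abs (u x) <= 1" and r0: "0 < rho0" "r + rho0 <= R" and H: "0 < H"
   and m: "ALL x:ball 0 r. ALL rho. 0 < rho --> rho <= rho0 --> en p (ball x rho) D <= enn (H powr p * rho powr (real DIM('a) - p * (1 - \<alpha>)))"
  for u and D :: "'a => 'a" and r R rho0 H
 proof -
  note sob_borel[OF s, measurable]
  have p0: "p > 0" using p by simp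
  \<comment> \<open>One constant c serves all sub-balls of radius at least rho/2, which yields at
    once the comparison of scales (same centre) and of centres (half the radius).\<close>
  have approx: "EX c. ALL t y. rho / 2 <= t --> dist x y + t <= rho --> abs (bavg t u y - c) <= C2 * H * rho powr \<alpha>"
   if x: "x \<in> ball 0 r" and rho: "0 < rho" "3 * rho <= rho0" for x rho
  proof -
   have "ball x (1 * (3 * rho)) \<subseteq> ball 0 R"
   proof
   fix y assume "y \<in> ball x (1 * (3 * rho))"
   then have "dist x y < 3 * rho" by simp
   then show "y \<in> ball 0 R" using x rho r0 dist_triangle[of 0 y x] by simp
   qed
   from sob_affine[OF sob_mono[OF s this], of 1] have "sob p (ball 0 (3 * rho)) (%y. u (x + y)) (%y. D (x + y))" by simp
   from poincare[OF this p rho(1)] obtain c where c: "en p (ball 0 rho) (%y. u (x + y) - c) <= enn (2 ^ DIM('a) * (2 * rho) powr p) * en p (ball 0 (3 * rho)) (%y. D (x + y))" by blast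
   have E: "en p (ball x rho) (%y. u y - c) <= enn (2 ^ DIM('a) * (2 * rho) powr p * (H powr p * (3 * rho) powr (n - p * (1 - \<alpha>))))"
   proof -
   have "en p (ball x rho) (%y. u y - c) = en p (ball 0 rho) (%y. u (x + y) - c)" using en_affine[of "%y. u y - c" 1 p x rho] by simp
   also note c
   also have "en p (ball 0 (3 * rho)) (%y. D (x + y)) = en p (ball x (3 * rho)) D" using en_affine[of D 1 p x "3 * rho"] by simp
   also have "... <= enn (H powr p * (3 * rho) powr (n - p * (1 - \<alpha>)))" using m x rho by (simp add: n_def)
   finally show ?thesis by (simp add: ennreal_mult mult_left_mono)
   qed
   have "abs (bavg t u y - c) <= C2 * H * rho powr \<alpha>" if t: "rho / 2 <= t" "dist x y + t <= rho" for t y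
   proof -
   have t0: "t > 0" using t rho by linarith
   have sub: "ball y t \<subseteq> ball x rho"
   proof
   fix z assume "z \<in> ball y t"
   then show "z \<in> ball x rho" using t dist_triangle[of x z y] by simp
   qed
   have "enn (norm (bavg t (%y. u y - c) y) powr p) <= enn (1 / measure lborel (ball (0::'a) t)) * en p (ball y t) (%y. u y - c)"
   by (rule bavg_bound[OF t0 _ p]) simp
   also have "... <= enn (1 / ((rho / 2) ^ DIM('a) * V)) * enn (2 ^ DIM('a) * (2 * rho) powr p * (H powr p * (3 * rho) powr (n - p * (1 - \<alpha>))))"
   proof (intro mult_mono order_trans[OF en_mono_set[OF sub] E] ennreal_leI)
   have "(rho / 2) ^ DIM('a) <= t ^ DIM('a)" using t rho by (intro power_mono) auto
   then show "1 / measure lborel (ball (0::'a) t) <= 1 / ((rho / 2) ^ DIM('a) * V)"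
   using V rho t0 measure_ball_eq[OF t0, of "0::'a"] by (auto simp: V_def[symmetric] intro!: divide_left_mono mult_right_mono)
   qed auto
   also have "... = enn (B * (H powr p * rho powr (p * \<alpha>)))"
   proof -
   have "(2 * rho) powr p * (3 * rho) powr (n - p * (1 - \<alpha>)) / rho powr n = 2 powr p * 3 powr (n - p * (1 - \<alpha>)) * rho powr (p * \<alpha>)"
   proof -
   have e: "rho powr p * rho powr (n - p * (1 - \<alpha>)) / rho powr n = rho powr (p * \<alpha>)"
   using rho(1) by (simp add: powr_add[symmetric] powr_diff[symmetric] algebra_simps)
   show ?thesis unfolding e[symmetric] by (simp add: powr_mult)
   qed
   moreover have "(rho / 2) ^ DIM('a) = rho powr n / 2 powr n" using rho(1) by (simp add: n_def powr_realpow power_divide)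
   ultimately have "1 / ((rho / 2) ^ DIM('a) * V) * (2 ^ DIM('a) * (2 * rho) powr p * (H powr p * (3 * rho) powr (n - p * (1 - \<alpha>)))) = B * (H powr p * rho powr (p * \<alpha>))"
   using V rho(1) by (simp add: B_def divide_simps) (simp add: mult_ac)
   then show ?thesis using V rho(1) by (simp add: ennreal_mult[symmetric])
   qed
   finally have "norm (bavg t (%y. u y - c) y) powr p <= B * (H powr p * rho powr (p * \<alpha>))" using B by simp
   then have "(norm (bavg t (%y. u y - c) y) powr p) powr (1 / p) <= (B * (H powr p * rho powr (p * \<alpha>))) powr (1 / p)" using p by (intro powr_mono2) auto
   also have "... = C2 * H * rho powr \<alpha>" using H rho(1) B p by (simp add: powr_mult powr_powr C2_def)
   finally have "(norm (bavg t (%y. u y - c) y) powr p) powr (1 / p) <= C2 * H * rho powr \<alpha>" .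
   moreover have "bavg t (%y. u y - c) y = bavg t u y - c" by (rule bavg_diff_const[OF t0, where M=1]) (use u1 in auto)
   ultimately show ?thesis using p by (simp add: powr_powr)
   qed
   then show ?thesis by blast
  qed
  \<comment> \<open>Divided by 3 because Poincare on a ball uses the energy of the triple
    ball.\<close>
  define rho where "rho j = rho0 / 3 / 2 ^ j" for j :: nat
  have rho: "0 < rho j" "3 * rho j <= rho0" "rho (Suc j) = rho j / 2" for j using r0 by (auto simp: rho_def field_simps)
  define a where "a j x = bavg (rho j) u x" for j x
  have [measurable]: "meas (a j)" for j unfolding a_def using rho(1)[of j] by measurable
  define A where "A = 2 * C2 * H * (rho0 / 3) powr \<alpha>"
  have Arho: "2 * (C2 * H * rho j powr \<alpha>) = A * k ^ j" for j
  proof -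
   have "k ^ j = 1 / (2 ^ j) powr \<alpha>" unfolding two_pow_powr k_def by (simp add: powr_minus power_inverse divide_inverse)
   then have "rho j powr \<alpha> = (rho0 / 3) powr \<alpha> * k ^ j" using r0 unfolding rho_def by (subst powr_divide) auto
   then show ?thesis by (simp add: A_def)
  qed
  have close: "abs (a i y - a (Suc j) x) <= A * k ^ j" if x: "x \<in> ball 0 r" and "i = j & y = x \<or> i = Suc j & dist x y <= rho j / 2" for i j x y
  proof -
   obtain c where c: "ALL t y. rho j / 2 <= t --> dist x y + t <= rho j --> abs (bavg t u y - c) <= C2 * H * rho j powr \<alpha>" using approx[OF x rho(1,2)] by blast
   have "abs (a i y - c) <= C2 * H * rho j powr \<alpha>" "abs (a (Suc j) x - c) <= C2 * H * rho j powr \<alpha>"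
   unfolding a_def using that(2) rho[of j] by (intro c[rule_format]; auto)+
   then show ?thesis unfolding Arho[symmetric] by linarith
  qed
  define w where "w x = lim (%j. a j x)" for x
  have inc: "abs (a (Suc j) x - a j x) <= A * k ^ j" if "x \<in> ball 0 r" for x j using close[OF that, of j j x] by (simp add: abs_minus_commute)
  have w: "(%j. a j x) ---> w x" "abs (a j x - w x) <= A * k ^ j / (1 - k)" if "x \<in> ball 0 r" for x j
   unfolding w_def using geometric_increments_converge[OF k inc[OF that]] by auto
  \<comment> \<open>The clamp gives |v| <= 1 everywhere, also where the means need not converge. It
    does not increase differences and does not change u, which is bounded by 1.\<close>
  define v where "v x = max (- 1) (min 1 (w x))" for x
  have "AE x in lborel. x \<in> ball 0 r --> v x = u x"
  proof -
   have "Lp_tendsto p (ball 0 r) a u"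
   proof (rule en_tendsto_squeeze)
   have "rho ---> 0"
   proof -
   have "(%j. rho0 / 3 * (1/2) ^ j) ---> rho0 / 3 * 0" by (intro tendsto_mult tendsto_const LIMSEQ_power_zero) simp
   then show ?thesis unfolding rho_def[abs_def] by (simp add: power_one_over)
   qed
   then have "(%j. rho j powr p) ---> 0 powr p" using p rho by (intro tendsto_powr' tendsto_const) (auto simp: less_imp_le)
   then show "(%j. enn (rho j powr p)) ---> 0" using p by (subst ennreal_0[symmetric]) (intro tendsto_ennrealI, simp)
   fix j
   have "en p (ball 0 r) (%x. a j x - u x) = en p (ball 0 r) (%x. u x - bavg (rho j) u x)" unfolding a_def by (rule en_diff_commute)
   also have "... <= enn (rho j powr p) * en p (ball 0 R) D"
   proof (rule bavg_diff_le[OF rho(1) _ _ p])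
   fix z :: 'a assume z: "norm z < rho j"
   have "en p (ball 0 r) (%x. u (x + z) - u x) <= enn (norm z powr p) * en p (ball 0 R) D"
   by (rule sob_diff_le[OF s p _ p]) (use z rho[of j] r0 in linarith)
   also have "... <= enn (rho j powr p) * en p (ball 0 R) D" using z p by (intro mult_right_mono ennreal_leI powr_mono2) auto
   finally show "en p (ball 0 r) (%x. u (x + z) - u x) <= enn (rho j powr p) * en p (ball 0 R) D" .
   qed auto
   also have "... = enn (enn2real (en p (ball 0 R) D)) * enn (rho j powr p)" using sob_finite(2)[OF s] by (simp add: mult.commute)
   finally show "en p (ball 0 r) (%x. a j x - u x) <= enn (enn2real (en p (ball 0 R) D)) * enn (rho j powr p)" .
   qed
   then obtain f where f: "strict_mono f" "AE x in lborel. x \<in> ball 0 r --> (%j. a (f j) x) ---> u x" by (rule en_AE_subseq[rotated 4]) (use p0 in auto)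
   show ?thesis using f(2)
   proof eventually_elim
   case (elim x)
   show ?case
   proof
   assume x: "x \<in> ball 0 r"
   have "(%j. a (f j) x) ---> w x" using LIMSEQ_subseq_LIMSEQ[OF w(1)[OF x] f(1)] by (simp add: o_def)
   then have "w x = u x" using elim x LIMSEQ_unique by blast
   then show "v x = u x" using u1[rule_format, of x] by (simp add: v_def)
   qed
   qed
  qed
  moreover have "abs (v x - v y) <= C * H * dist x y powr \<alpha>" if x: "x \<in> ball 0 r" and y: "y \<in> ball 0 r" and d: "dist x y <= rho0 / 6" for x y
  proof (cases "x = y")
   case False
   then have d0: "dist x y > 0" by simp
   \<comment> \<open>The scale of the distance: at most rho_j / 2, so that the ball of radius rho_j
     / 2 around y lies in the ball of radius rho_j around x, and at least rho_j / 4, so that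
     rho_j^alpha is controlled by the distance.\<close>
   have "EX j. rho j / 4 < dist x y & dist x y <= rho j / 2"
   proof -
   define y0 where "y0 = dist x y / (rho0 / 6)"
   have y0: "0 < y0" "y0 <= 1" using d0 d r0 by (auto simp: y0_def field_simps)
   obtain j where j: "(1/2::real) ^ j < y0" using real_arch_pow_inv[OF y0(1), of "1/2"] by auto
   define i where "i = (LEAST j. (1/2::real) ^ j < y0)"
   have i: "(1/2) ^ i < y0" unfolding i_def by (rule LeastI[where P="%j. (1/2) ^ j < y0", OF j])
   then have "i ~= 0" using y0 by (intro notI) simp
   then obtain l where l: "i = Suc l" using not0_implies_Suc by blast
   then have "\<not> (1/2) ^ l < y0" using not_less_Least[of l "%j. (1/2) ^ j < y0"] by (simp add: i_def[symmetric])
   then have "rho l / 4 < dist x y & dist x y <= rho l / 2" using i l r0 by (simp add: y0_def rho_def field_simps power_one_over)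
   then show ?thesis by blast
   qed
   then obtain j where j: "rho j / 4 < dist x y" "dist x y <= rho j / 2" by blast
   have kj: "A * k ^ Suc j <= A * k ^ j" using k C2 H by (intro mult_left_mono power_decreasing) (auto simp: A_def)
   have "abs (w x - w y) <= abs (a (Suc j) x - w x) + abs (a (Suc j) y - a (Suc j) x) + abs (a (Suc j) y - w y)" by linarith
   also have "... <= A * k ^ j / (1 - k) + A * k ^ j + A * k ^ j / (1 - k)"
   using w(2)[OF x, of "Suc j"] w(2)[OF y, of "Suc j"] close[OF x, of "Suc j" j y] j k kj by (intro add_mono order_trans[OF w(2)] divide_right_mono x y) auto
   also have "... = (2 / (1 - k) + 1) * (A * k ^ j)" by (simp add: algebra_simps)
   also have "... = (2 / (1 - k) + 1) * (2 * (C2 * H * rho j powr \<alpha>))" unfolding Arho ..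
   also have "... <= (2 / (1 - k) + 1) * (2 * (C2 * H * (4 * dist x y) powr \<alpha>))"
   using j(1) rho(1)[of j] k C2 H al by (intro mult_left_mono powr_mono2) auto
   also have "... = C * H * dist x y powr \<alpha>" by (simp add: C_def powr_mult)
   finally have "abs (w x - w y) <= C * H * dist x y powr \<alpha>" .
   moreover have "abs (v x - v y) <= abs (w x - w y)" by (simp add: v_def max_def min_def)
   ultimately show ?thesis by linarith
  qed (use C H in simp)
  moreover have "abs (v x) <= 1" for x by (auto simp: v_def)
  ultimately show ?thesis unfolding locally_holder_def by blast
 qed
 show ?thesis by (rule exI[of _ C], intro conjI allI impI, rule C, (rule main; assumption))
qed

section \<open>The interior estimate and the theorem\<close>

text \<open>Of the moduli of continuity only one pair is recorded: oscillation at most ep at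
  distances below c, on the ball of radius (1 + r)/2. That pair decides the constant of
  \<open>interior_holder\<close>.\<close>

definition two_phase_in_ball :: "real => real => real => real => real => ('a::euclidean_space => real) => ('a => 'a) => ('a => real) =>
  ('a => real) => ('a => real) => ('a => real) => bool" where
 "two_phase_in_ball p \<mu> ep c r U D a g Ap Am \<longleftrightarrow> (ALL r<1. sob p (ball 0 r) U D) & (ALL x. abs (U x) <= 1) &
  meas a & meas g &
  (ALL x:ball 0 1. \<mu> <= Ap x & Ap x <= 1 / \<mu> & \<mu> <= Am x & Am x <= 1 / \<mu>) & (ALL x:ball 0 1. a x = (if U x > 0 then Ap x else Am x)) &
  en (real DIM('a)) (ball 0 1) g <= enn (2 powr real DIM('a)) & weak_eq p D a g & 0 < r & r < 1 &
  (ALL x:ball 0 ((1 + r) / 2). ALL y:ball 0 ((1 + r) / 2). dist x y < c --> abs (Ap x - Ap y) <= ep & abs (Am x - Am y) <= ep)"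

definition holder_representative :: "real => real => real => ('a::euclidean_space => real) => bool" where
 "holder_representative \<alpha> K r U \<longleftrightarrow> (EX v. (AE x in lborel. x \<in> ball 0 r --> v x = U x) & (ALL x. abs (v x) <= 1) &
  (ALL x:ball 0 r. ALL y:ball 0 r. abs (v x - v y) <= K * dist x y powr \<alpha>))"

text \<open>Each ball of radius R = (1 - r)/2 around a point of the ball of radius r is rescaled to
  the unit ball with U left unmultiplied, since |U| <= 1 already is the normalization. The
  coefficients are frozen at the centre, and scaling back turns the decay constant K into K R^(-p
  alpha).\<close>

lemma interior_holder:
 assumes p: "p > 1" and N: "DIM('a::euclidean_space) >= 2" and mu: "0 < \<mu>" "\<mu> < 1" and al: "0 < \<alpha>" "\<alpha> < 1"
 shows "EX ep>0. ALL c. 0 < c --> c <= 1/2 --> (EX C>0. ALL U (D::'a => 'a) a g Ap Am r.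
  two_phase_in_ball p \<mu> ep c r U D a g Ap Am --> holder_representative \<alpha> (C / (1 - r) powr \<alpha>) r U)"
proof -
 define n where "n = real DIM('a)"
 define si where "si = n - p * (1 - \<alpha>)"
 obtain ep where e: "ep > 0" and ld: "ALL c. 0 < c --> c <= 1/2 --> (EX K>0. ALL U (D::'a => 'a) a g kp km s.
  two_phase p \<mu> U D a g -->
  almost_phase \<mu> ep c U a kp km --> 0 < s --> s <= c -->
  en p (ball 0 s) D <= enn (K * s powr si))" using local_decay[OF p N mu al, folded n_def, folded si_def] by (elim exE conjE) (rule that; assumption)
 obtain C' where C': "C' > 0" and mh: "ALL u (D::'a::euclidean_space => 'a) r R rho0 H. sob p (ball 0 R) u D --> (ALL x. abs (u x) <= 1) --> 0 < rho0 --> r + rho0 <= R --> 0 < H -->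
  (ALL x:ball 0 r. ALL rho. 0 < rho --> rho <= rho0 --> en p (ball x rho) D <= enn (H powr p * rho powr si)) -->
  locally_holder \<alpha> (C' * H) (rho0 / 6) r u"
  using morrey_holder[OF p al, where 'a='a, folded n_def, folded si_def] by (elim exE conjE) (rule that; assumption)
 have main: "EX C>0. ALL U (D::'a => 'a) a g Ap Am r.
  two_phase_in_ball p \<mu> ep c r U D a g Ap Am --> holder_representative \<alpha> (C / (1 - r) powr \<alpha>) r U" if c: "0 < c" "c <= 1/2" for c
 proof -
  obtain K where K: "K > 0" and dec: "ALL U (D::'a => 'a) a g kp km s.
   two_phase p \<mu> U D a g -->
   almost_phase \<mu> ep c U a kp km --> 0 < s --> s <= c -->
   en p (ball 0 s) D <= enn (K * s powr si)" using ld[rule_format, OF c] by (elim exE conjE) (rule that; assumption)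
  define C where "C = 2 powr \<alpha> * (C' * K powr (1 / p) + 2 * (6 / c) powr \<alpha>)"
  have C: "C > 0" using C' K c by (auto simp: C_def intro!: mult_pos_pos add_pos_pos)
  have bound: "holder_representative \<alpha> (C / (1 - r) powr \<alpha>) r U"
   if h: "two_phase_in_ball p \<mu> ep c r U D a g Ap Am" for U a g Ap Am r and D :: "'a => 'a"
  proof -
   have s: "ALL r<1. sob p (ball 0 r) U D" and U: "ALL x. abs (U x) <= 1" and [measurable]: "meas a" "meas g"
   and A: "ALL x:ball 0 1. \<mu> <= Ap x & Ap x <= 1 / \<mu> & \<mu> <= Am x & Am x <= 1 / \<mu>" and a: "ALL x:ball 0 1. a x = (if U x > 0 then Ap x else Am x)"
   and g: "en n (ball 0 1) g <= enn (2 powr n)" and eq: "weak_eq p D a g" and r: "0 < r" "r < 1"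
   and osc: "ALL x:ball 0 ((1 + r) / 2). ALL y:ball 0 ((1 + r) / 2). dist x y < c --> abs (Ap x - Ap y) <= ep & abs (Am x - Am y) <= ep"
   using h unfolding two_phase_in_ball_def n_def by blast+
   \<comment> \<open>The radius for which every ball around a point of the ball of radius r stays in
     the ball of radius (1 + r)/2, where the oscillation is controlled.\<close>
   define R where "R = (1 - r) / 2"
   have R: "0 < R" "R < 1/2" "r + R = (1 + r) / 2" "r + R < 1" using r by (auto simp: R_def field_simps)
   have sR: "sob p (ball 0 (r + R)) U D" using s R by blast
   note sob_borel[OF sR, measurable]
   \<comment> \<open>Its p-th power is the constant of the energy decay in the original coordinates;
     R^(-alpha) is the origin of the power of 1 - r in the estimate.\<close>
   define H where "H = K powr (1 / p) * R powr (- \<alpha>)"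
   have H: "H > 0" "H powr p = K * R powr (- (p * \<alpha>))" using K R p by (auto simp: H_def powr_mult powr_powr mult.commute)
   have Rn: "R ^ DIM('a) = R powr n" using R by (simp add: n_def powr_realpow)
   have morrey: "en p (ball x0 rho) D <= enn (H powr p * rho powr si)" if x0: "x0 \<in> ball 0 r" and rho: "0 < rho" "rho <= R * c" for x0 rho
   proof -
   have inb: "x0 + R *R y \<in> ball 0 (r + R)" if "norm y < 1" for y
   proof -
   have "norm (x0 + R *R y) <= norm x0 + R * norm y" using norm_triangle_ineq[of x0 "R *R y"] R by simp
   also have "... < r + R * 1" using x0 that R by (intro add_strict_mono mult_strict_left_mono) auto
   finally show ?thesis by simp
   qed
   have inb1: "x0 + R *R y \<in> ball 0 1" if "norm y < 1" for y using inb[OF that] R by simp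
   have sub: "ball x0 (R * s) \<subseteq> ball 0 (r + R)" if "s <= 1" for s
   proof
   fix y assume "y \<in> ball x0 (R * s)"
   moreover have "R * s <= R" using that R by simp
   ultimately have "dist x0 y < R" by simp
   then show "y \<in> ball 0 (r + R)" using x0 dist_triangle[of 0 y x0] by simp
   qed
   define s where "s = rho / R"
   have s: "0 < s" "s <= c" "rho = R * s" using rho R by (auto simp: s_def field_simps)
   have "en p (ball 0 s) (%x. R *R D (x0 + R *R x)) <= enn (K * s powr si)"
   proof (rule dec[rule_format, where U="%x. 1 * U (x0 + R *R x)" and a="%x. 1 * a (x0 + R *R x)" and g="%x. (1 * R * R powr (p - 1)) * g (x0 + R *R x)" and kp="Ap x0" and km="Am x0"])
   show "two_phase p \<mu> (%x. 1 * U (x0 + R *R x)) (%x. R *R D (x0 + R *R x)) (%x. 1 * a (x0 + R *R x)) (%x. (1 * R * R powr (p - 1)) * g (x0 + R *R x))"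
   unfolding two_phase_def n_def[symmetric]
   proof (intro conjI allI ballI)
   show "sob p (ball 0 (3/4)) (%x. 1 * U (x0 + R *R x)) (%x. R *R D (x0 + R *R x))" using sob_affine[OF sob_mono[OF sR sub[of "3/4"]] R(1), of 1] by simp
   show "abs (1 * U (x0 + R *R x)) <= 1" for x using U by simp
   show "weak_eq p (%x. R *R D (x0 + R *R x)) (%x. 1 * a (x0 + R *R x)) (%x. (1 * R * R powr (p - 1)) * g (x0 + R *R x))"
   by (rule weak_eq_rescale[OF eq]) (use x0 R in auto)
   show "\<mu> <= 1 * a (x0 + R *R x)" "1 * a (x0 + R *R x) <= 1 / \<mu>" if "x \<in> ball 0 1" for x
   using a[rule_format, OF inb1[of x]] A[rule_format, OF inb1[of x]] that by simp_all
   show "en n (ball 0 1) (%x. (1 * R * R powr (p - 1)) * g (x0 + R *R x)) <= enn (2 powr n)"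
   proof -
   define q where "q = 1 * R * R powr (p - 1)"
   have q: "0 <= q" "q <= R" using R p by (auto simp: q_def mult_left_le powr_le1)
   have "en n (ball 0 1) (%x. q * g (x0 + R *R x)) = enn (q powr n) * en n (ball 0 1) (%x. g (x0 + R *R x))"
   using en_scaleR[of "%x. g (x0 + R *R x)" "ball 0 1" n q] q(1) by simp
   also have "... <= enn (R powr n) * en n (ball 0 1) (%x. g (x0 + R *R x))" using q by (intro mult_right_mono ennreal_leI powr_mono2) (auto simp: n_def)
   also have "... = en n (ball x0 (R * 1)) g" using en_affine[of g R n x0 1] R by (simp add: Rn)
   also have "... <= en n (ball 0 1) g" using sub[of 1] R by (intro en_mono_set) auto
   finally show ?thesis using g by (simp add: q_def)
   qed
   qed auto
   have x1: "x0 \<in> ball 0 1" "x0 \<in> ball 0 ((1 + r) / 2)" using x0 r by auto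
   have "abs (1 * a (x0 + R *R x) - (if 1 * U (x0 + R *R x) > 0 then Ap x0 else Am x0)) <= ep" if x: "x \<in> ball 0 c" for x
   proof -
   have nx: "norm x < 1" using x c by simp
   have "R * norm x < 1 * c" using x R c by (intro mult_strict_mono) auto
   then have "dist (x0 + R *R x) x0 < c" using R by (simp add: dist_norm)
   then have "abs (Ap (x0 + R *R x) - Ap x0) <= ep & abs (Am (x0 + R *R x) - Am x0) <= ep" using osc inb[OF nx] x1(2) R(3) by metis
   then show ?thesis using a[rule_format, OF inb1[OF nx]] by simp
   qed
   then show "almost_phase \<mu> ep c (%x. 1 * U (x0 + R *R x)) (%x. 1 * a (x0 + R *R x)) (Ap x0) (Am x0)" using A x1 unfolding almost_phase_def by blast
   qed (use s in auto)
   then have 1: "enn (R powr p) * en p (ball 0 s) (%x. D (x0 + R *R x)) <= enn (K * s powr si)" using R by (subst (asm) en_scaleR) auto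
   have "enn (R powr p) * en p (ball x0 rho) D = enn (R powr n) * (enn (R powr p) * en p (ball 0 s) (%x. D (x0 + R *R x)))"
   using en_affine[of D R p x0 s] R by (simp add: s(3) Rn mult_ac)
   also have "... <= enn (R powr n) * enn (K * s powr si)" by (intro mult_left_mono 1) simp
   also have "... = enn (R powr p * (H powr p * rho powr si))"
   proof -
   have "R powr p * (R powr (- (p * \<alpha>)) * R powr si) = R powr n" using R by (simp add: powr_add[symmetric] si_def algebra_simps)
   then have "R powr n * (K * s powr si) = R powr p * (H powr p * rho powr si)" unfolding H(2) s(3) using R s(1) by (simp add: powr_mult mult_ac)
   then show ?thesis using K by (simp add: ennreal_mult[symmetric])
   qed
   also have "... = enn (R powr p) * enn (H powr p * rho powr si)" by (rule ennreal_mult) auto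
   finally show ?thesis using R by (subst (asm) ennreal_mult_le_mult_iff) auto
   qed
   have Rc: "0 < R * c" "r + R * c <= r + R" using R c by (auto simp: mult_left_le)
   have "locally_holder \<alpha> (C' * H) ((R * c) / 6) r U" by (rule mh[rule_format, OF sR U[rule_format] Rc H(1)]) (rule morrey; assumption)
   then obtain v where v: "AE x in lborel. x \<in> ball 0 r --> v x = U x" "ALL x. abs (v x) <= 1"
   "ALL x:ball 0 r. ALL y:ball 0 r. dist x y <= (R * c) / 6 --> abs (v x - v y) <= C' * H * dist x y powr \<alpha>"
   unfolding locally_holder_def by (elim exE conjE) (rule that; assumption)
   have Ra: "R powr (- \<alpha>) = 2 powr \<alpha> / (1 - r) powr \<alpha>" using r by (simp add: R_def powr_minus powr_divide divide_simps)
   have "abs (v x - v y) <= C / (1 - r) powr \<alpha> * dist x y powr \<alpha>" if x: "x \<in> ball 0 r" "y \<in> ball 0 r" for x y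
   proof -
   have CC: "C / (1 - r) powr \<alpha> = C' * H + 2 * (6 / c) powr \<alpha> * R powr (- \<alpha>)" by (simp add: C_def H_def Ra algebra_simps add_divide_distrib)
   show ?thesis
   proof (cases "dist x y <= (R * c) / 6")
   case True
   then have "abs (v x - v y) <= C' * H * dist x y powr \<alpha>" using v(3) x by blast
   also have "... <= C / (1 - r) powr \<alpha> * dist x y powr \<alpha>" unfolding CC by (intro mult_right_mono) auto
   finally show ?thesis .
   next
   \<comment> \<open>Distant pairs: 6 dist / (c R) is at least 1 and hence so is its power alpha,
     while |v x - v y| <= 2. This contributes the second summand of C.\<close>
   case False
   then have "1 <= (6 / c) * (1 / R) * dist x y" using R c by (simp add: field_simps)
   then have "1 <= ((6 / c) * (1 / R) * dist x y) powr \<alpha>" using al by (simp add: ge_one_powr_ge_zero)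
   also have "... = (6 / c) powr \<alpha> * (1 / R) powr \<alpha> * dist x y powr \<alpha>" using R c by (simp only: powr_mult)
   also have "(1 / R) powr \<alpha> = R powr (- \<alpha>)" using R by (simp add: powr_divide powr_minus_divide)
   finally have "2 * 1 <= 2 * ((6 / c) powr \<alpha> * R powr (- \<alpha>) * dist x y powr \<alpha>)" by simp
   moreover have "abs (v x - v y) <= 2" using v(2)[rule_format, of x] v(2)[rule_format, of y] by linarith
   ultimately have "abs (v x - v y) <= 2 * (6 / c) powr \<alpha> * R powr (- \<alpha>) * dist x y powr \<alpha>" by simp
   also have "... <= C / (1 - r) powr \<alpha> * dist x y powr \<alpha>" unfolding CC using C' H by (intro mult_right_mono) auto
   finally show ?thesis .
   qed
   qed
   then show ?thesis using v(1,2) unfolding holder_representative_def by blast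
  qed
  show ?thesis by (rule exI[of _ C], intro conjI allI impI, rule C, (rule bound; assumption))
 qed
 show ?thesis by (rule exI[of _ "ep"], intro conjI allI impI, rule e, rule main; assumption)
qed

lemma holder_norm_le:
 assumes M: "0 <= M" "!!x. x \<in> D ==> abs (v x) <= M" and Q: "0 <= Q" "!!x y. x \<in> D ==> y \<in> D ==> abs (v x - v y) <= Q * dist x y powr \<alpha>"
 shows "holder_norm \<alpha> D v <= ereal (M + Q)"
proof -
 have "(SUP x\<in>D. ereal (abs (v x))) <= ereal M" using M by (intro SUP_least) auto
 moreover have "(SUP xy\<in>{(x, y). x \<in> D & y \<in> D & x ~= y}. ereal (abs (v (fst xy) - v (snd xy)) / dist (fst xy) (snd xy) powr \<alpha>)) <= ereal Q"
  using Q by (intro SUP_least) (auto simp: divide_le_eq)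
 ultimately show ?thesis unfolding holder_norm_def plus_ereal.simps(1)[symmetric] by (rule add_mono)
qed

text \<open>Uniform continuity on a compact ball. It guarantees that some admissible length exists
  for given coefficients; its value is read off from the modulus and not from the function.\<close>

lemma modulus_small:
 fixes A :: "'a::euclidean_space => real"
 assumes A: "continuous_on (ball 0 1) A" and R: "R < 1" and e: "0 < ep"
 shows "EX t>0. ALL s<=t. modulus A (ball 0 R) s <= ereal ep"
proof -
 have "cball 0 R \<subseteq> ball (0::'a) 1" using R by auto
 then have "uniformly_continuous_on (cball 0 R) A" using A by (intro compact_uniformly_continuous) (auto intro: continuous_on_subset)
 then obtain t where t: "t > 0" "ALL x:cball 0 R. ALL y:cball 0 R. dist y x < t --> dist (A y) (A x) < ep"
  using e unfolding uniformly_continuous_on_def by blast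
 have "modulus A (ball 0 R) s <= ereal ep" if "s <= t" for s unfolding modulus_def
 proof (rule SUP_least, clarify)
  fix x y :: 'a assume "x \<in> ball 0 R" "y \<in> ball 0 R" "dist x y < s"
  then show "ereal (abs (A (fst (x, y)) - A (snd (x, y)))) <= ereal ep" using t(2)[rule_format, of y x] that by (simp add: dist_real_def)
 qed
 then show ?thesis using t(1) by blast
qed

lemma modulus_leD: "modulus A E t <= ereal ep ==> x \<in> E ==> y \<in> E ==> dist x y < t ==> abs (A x - A y) <= ep"
 unfolding modulus_def by (auto simp: SUP_le_iff)

theorem theorem1p3:
  fixes p \<mu> :: real
  assumes N2: "CARD('n::finite) \<ge> 2"
    and p: "1 < p" and mu: "0 < \<mu>" "\<mu> < 1"
  shows "\<forall>\<alpha>. 0 < \<alpha> \<and> \<alpha> < 1 \<longrightarrow> (\<forall>\<omega> :: real \<Rightarrow> ereal. \<exists>C :: real.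
    \<forall>(Ap :: real^'n \<Rightarrow> real) Am fp fm u r.
      continuous_on (ball 0 1) Ap \<and> continuous_on (ball 0 1) Am \<and>
      (\<forall>x\<in>ball 0 1. \<mu> \<le> Ap x \<and> Ap x \<le> 1 / \<mu> \<and> \<mu> \<le> Am x \<and> Am x \<le> 1 / \<mu>) \<and>
      in_Lp (real CARD('n)) (ball 0 1) fp \<and> in_Lp (real CARD('n)) (ball 0 1) fm \<and>
      weak_solution p (ball 0 1) Ap Am fp fm u \<and> in_Linf (ball 0 1) u \<and>
      0 < r \<and> r < 1 \<and>
      (\<lambda>t. max (modulus Ap (ball 0 ((1 + r) / 2)) t) (modulus Am (ball 0 ((1 + r) / 2)) t)) = \<omega>
      \<longrightarrow>
      (\<exists>v. (AE x in lebesgue. x \<in> ball 0 1 \<longrightarrow> v x = u x) \<and>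
        holder_norm \<alpha> (ball 0 r) v
          \<le> ereal (C / (1 - r) powr \<alpha> *
               (Linf_norm (ball 0 1) u
                + Lp_norm (real CARD('n)) (ball 0 1) fp powr (1 / (p - 1))
                + Lp_norm (real CARD('n)) (ball 0 1) fm powr (1 / (p - 1))))))"
proof (intro allI impI, goal_cases)
 case al: (1 \<alpha> \<omega>)
 define n where "n = real CARD('n)"
 have n: "n >= 2" "n = real DIM(real^'n)" using N2 by (auto simp: n_def)
 have DIM: "DIM(real^'n) >= 2" using N2 by simp
 obtain ep where e: "ep > 0" and ih: "ALL c. 0 < c --> c <= 1/2 --> (EX C>0. ALL U (D::real^'n => real^'n) a g Ap Am r.
  two_phase_in_ball p \<mu> ep c r U D a g Ap Am --> holder_representative \<alpha> (C / (1 - r) powr \<alpha>) r U)"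
  using interior_holder[OF p DIM mu conjunct1[OF al] conjunct2[OF al]] by (elim exE conjE) (rule that; assumption)
 let ?S = "%u fp fm. Linf_norm (ball 0 1) u + Lp_norm n (ball 0 1) fp powr (1 / (p - 1)) + Lp_norm n (ball 0 1) fm powr (1 / (p - 1))"
 let ?hyp = "%(Ap :: real^'n => real) Am fp fm u r.
   continuous_on (ball 0 1) Ap & continuous_on (ball 0 1) Am &
   (ALL x:ball 0 1. \<mu> <= Ap x & Ap x <= 1 / \<mu> & \<mu> <= Am x & Am x <= 1 / \<mu>) &
   in_Lp n (ball 0 1) fp & in_Lp n (ball 0 1) fm &
   weak_solution p (ball 0 1) Ap Am fp fm u & in_Linf (ball 0 1) u &
   0 < r & r < 1 &
   (%t. max (modulus Ap (ball 0 ((1 + r) / 2)) t) (modulus Am (ball 0 ((1 + r) / 2)) t)) = \<omega>"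
 let ?concl = "%C u fp fm r. EX v. (AE x in lebesgue. x \<in> ball 0 1 --> v x = u x) & holder_norm \<alpha> (ball 0 r) v <= ereal (C / (1 - r) powr \<alpha> * ?S u fp fm)"
 have "EX C. ALL Ap Am fp fm u r. ?hyp Ap Am fp fm u r --> ?concl C u fp fm r"
 \<comment> \<open>The length c must depend on omega alone. If omega never drops to ep at any
   admissible c, it is not the modulus of continuous coefficients, and the hypotheses are
   contradictory.\<close>
 proof (cases "EX c. 0 < c & c <= 1/2 & \<omega> c <= ereal ep")
  case False
  have "\<not> ?hyp Ap Am fp fm u r" for Ap Am fp fm u r
  proof
   assume h: "?hyp Ap Am fp fm u r"
   have r: "(1 + r) / 2 < 1" using h by simp
   obtain t1 where t1: "t1 > 0" "ALL s<=t1. modulus Ap (ball 0 ((1 + r) / 2)) s <= ereal ep" using modulus_small[OF _ r e] h by blast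
   obtain t2 where t2: "t2 > 0" "ALL s<=t2. modulus Am (ball 0 ((1 + r) / 2)) s <= ereal ep" using modulus_small[OF _ r e] h by blast
   define c where "c = min (1/2) (min t1 t2)"
   have "\<omega> = (%t. max (modulus Ap (ball 0 ((1 + r) / 2)) t) (modulus Am (ball 0 ((1 + r) / 2)) t))" using h by simp
   then have "\<omega> c <= ereal ep" using t1(2) t2(2) by (simp add: c_def)
   then show False using False t1(1) t2(1) by (auto simp: c_def)
  qed
  then show ?thesis by blast
 next
  case True
  then obtain c where c: "0 < c" "c <= 1/2" and \<omega>c: "\<omega> c <= ereal ep" by blast
  obtain C where C: "C > 0" and est: "ALL U (D::real^'n => real^'n) a g Ap Am r.
   two_phase_in_ball p \<mu> ep c r U D a g Ap Am --> holder_representative \<alpha> (C / (1 - r) powr \<alpha>) r U"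
   using ih[rule_format, OF c] by (elim exE conjE) (rule that; assumption)
  have "?concl (1 + C) u fp fm r" if h: "?hyp Ap Am fp fm u r" for Ap Am fp fm u r
  proof -
   have cont: "continuous_on (ball 0 1) Ap" "continuous_on (ball 0 1) Am" and A: "ALL x:ball 0 1. \<mu> <= Ap x & Ap x <= 1 / \<mu> & \<mu> <= Am x & Am x <= 1 / \<mu>"
   and Lf: "in_Lp n (ball 0 1) fp" "in_Lp n (ball 0 1) fm" and ws: "weak_solution p (ball 0 1) Ap Am fp fm u" and ui: "in_Linf (ball 0 1) u"
   and r: "0 < r" "r < 1" and om: "\<omega> = (%t. max (modulus Ap (ball 0 ((1 + r) / 2)) t) (modulus Am (ball 0 ((1 + r) / 2)) t))" using h by auto
   have "1 - r > 0" "(1 - r) powr \<alpha> <= 1" using r al by (auto intro: powr_le1)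
   then have r1: "(1 - r) powr \<alpha> > 0" "(1 - r) powr \<alpha> <= 1" by auto
   \<comment> \<open>The bracket on the right-hand side. Dividing u by S bounds u by 1 and each
     source in L^N by 1, since the source scales with S^(p-1).\<close>
   define S where "S = ?S u fp fm"
   define L where "L = Linf_norm (ball 0 1) u"
   have L: "AE x in lborel. x \<in> ball 0 1 --> abs (u x) <= L" "0 <= L" unfolding L_def by (rule Linf_norm_AE[OF ui])+
   have LS: "L <= S" "Lp_norm n (ball 0 1) fp powr (1 / (p - 1)) <= S" "Lp_norm n (ball 0 1) fm powr (1 / (p - 1)) <= S" using L(2) by (auto simp: S_def L_def)
   show ?thesis
   proof (cases "S > 0")
   \<comment> \<open>S is nonnegative, so here it is 0; then u vanishes a.e. and the zero function
     is the representative.\<close>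
   case False
   then have "S = 0" "L = 0" using LS(1) L(2) by auto
   then have "AE x in lebesgue. x \<in> ball 0 1 --> 0 = u x" using AE_completion[OF L(1)] by (auto elim!: eventually_mono)
   moreover have "holder_norm \<alpha> (ball (0::real^'n) r) (%x. 0) <= ereal (0 + 0)" by (rule holder_norm_le) auto
   ultimately show ?thesis using \<open>S = 0\<close> by (intro exI[of _ "%x. 0"]) (simp add: S_def)
   next
   case S: True
   obtain u0 D a g where [measurable]: "meas u0" "meas D" "meas a" "meas g"
   and u0: "AE x in lborel. x \<in> ball 0 1 --> u0 x = u x" and a: "ALL x:ball 0 1. a x = (if u0 x > 0 then Ap x else Am x)"
   and g: "en n UNIV g <= enn (Lp_norm n (ball 0 1) fp powr n + Lp_norm n (ball 0 1) fm powr n)"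
   and s: "ALL r<1. sob p (ball 0 r) u0 D"
   and eq: "ALL psi psi'. c1c 1 psi psi' --> (LBINT x. a x * (plap p (D x) \<bullet> psi' x)) = (LBINT x. g x * psi x)"
   using weak_solution_borel[OF p cont Lf[unfolded n_def] ws, folded n_def] by (elim exE conjE) (rule that; assumption)
   \<comment> \<open>The clamp gives the bound at every point and changes u/S only on a null set of
     the ball. It preserves the sign, so U and u0 select the same phase everywhere.\<close>
   define U where "U x = max (- 1) (min 1 (1 / S * u0 x))" for x
   have [measurable]: "meas U" unfolding U_def by measurable
   have Uu: "AE x in lborel. x \<in> ball 0 1 --> U x = 1 / S * u0 x" using L(1) u0
   proof eventually_elim
   case (elim x)
   show ?case
   proof
   assume "x \<in> ball 0 1"
   then have "abs (u0 x) <= S" using elim LS(1) by auto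
   then have "abs (1 / S * u0 x) <= 1" using S by (simp add: abs_mult)
   then show "U x = 1 / S * u0 x" unfolding U_def by linarith
   qed
   qed
   have sU: "sob p (ball 0 t) U (%x. (1 / S) *R D x)" if t: "t < 1" for t
   by (rule sob_cong_AE[OF sob_cmult]) (use s t Uu in \<open>auto elim!: eventually_mono\<close>)
   have pos: "U x > 0 \<longleftrightarrow> u0 x > 0" for x
   proof -
   have "U x > 0 \<longleftrightarrow> 1 / S * u0 x > 0" unfolding U_def by linarith
   then show ?thesis using S by (simp add: zero_less_divide_iff)
   qed
   define G where "G x = (1 / S) powr (p - 1) * g x" for x
   have [measurable]: "meas G" unfolding G_def by measurable
   have "weak_eq p D a g" using eq by (simp add: weak_eq_def)
   from weak_eq_rescale[OF this, of 1 0 "1 / S" 1] have eqG: "weak_eq p (%x. (1 / S) *R D x) a G" using S by (simp add: G_def[abs_def])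
   have enG: "en n (ball 0 1) G <= enn (2 powr n)"
   proof -
   have F: "Lp_norm n (ball 0 1) f powr n <= (S powr (p - 1)) powr n" if "Lp_norm n (ball 0 1) f powr (1 / (p - 1)) <= S" for f :: "real^'n => real"
   proof (intro powr_mono2)
   have "(Lp_norm n (ball 0 1) f powr (1 / (p - 1))) powr (p - 1) <= S powr (p - 1)" using that p by (intro powr_mono2) auto
   then show "Lp_norm n (ball 0 1) f <= S powr (p - 1)" using p by (simp add: powr_powr Lp_norm_def)
   qed (use n in \<open>auto simp: Lp_norm_def\<close>)
   have SS: "((1 / S) powr (p - 1)) powr n * (S powr (p - 1)) powr n = 1" using S by (simp add: powr_mult[symmetric])
   have "en n (ball 0 1) G <= en n UNIV G" by (rule en_mono_set) simp
   also have "... = enn (((1 / S) powr (p - 1)) powr n) * en n UNIV g" using en_scaleR[of g UNIV n "(1 / S) powr (p - 1)"] by (simp add: G_def[abs_def])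
   also have "... <= enn (((1 / S) powr (p - 1)) powr n) * enn (2 * (S powr (p - 1)) powr n)"
   using F[OF LS(2)] F[OF LS(3)] by (intro mult_left_mono order_trans[OF g] ennreal_leI) auto
   also have "... = enn (2 * (((1 / S) powr (p - 1)) powr n * (S powr (p - 1)) powr n))" by (simp add: ennreal_mult[symmetric] mult_ac)
   \<comment> \<open>After scaling each phase contributes at most 1, and 2 <= 2^n.\<close>
   also have "... <= enn (2 powr n)" unfolding SS using n powr_mono[of 1 n 2] by (intro ennreal_leI) simp
   finally show ?thesis .
   qed
   have osc: "ALL x:ball 0 ((1 + r) / 2). ALL y:ball 0 ((1 + r) / 2). dist x y < c --> abs (Ap x - Ap y) <= ep & abs (Am x - Am y) <= ep"
   using \<omega>c unfolding om by (auto dest: modulus_leD)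
   have "ALL x. abs (U x) <= 1" by (auto simp: U_def)
   then have "two_phase_in_ball p \<mu> ep c r U (%x. (1 / S) *R D x) a G Ap Am"
   unfolding two_phase_in_ball_def n(2)[symmetric] using sU A a enG eqG r osc by (auto simp: pos)
   then have "holder_representative \<alpha> (C / (1 - r) powr \<alpha>) r U" using est by blast
   then obtain w where w: "AE x in lborel. x \<in> ball 0 r --> w x = U x" "ALL x. abs (w x) <= 1"
   "ALL x:ball 0 r. ALL y:ball 0 r. abs (w x - w y) <= C / (1 - r) powr \<alpha> * dist x y powr \<alpha>" unfolding holder_representative_def by blast
   \<comment> \<open>The Hoelder representative replaces u only inside the ball of radius r, where
     it was constructed; on the rest of the unit ball u itself is kept, which gives equality
     a.e.\<close>
   define v where "v x = (if x \<in> ball 0 r then S * w x else u x)" for x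
   have "AE x in lborel. x \<in> ball 0 1 --> v x = u x" using w(1) Uu u0 by eventually_elim (use S r in \<open>auto simp: v_def\<close>)
   then have "AE x in lebesgue. x \<in> ball 0 1 --> v x = u x" by (rule AE_completion)
   moreover have "holder_norm \<alpha> (ball 0 r) v <= ereal (S + S * (C / (1 - r) powr \<alpha>))"
   proof (rule holder_norm_le)
   show "abs (v x) <= S" if "x \<in> ball 0 r" for x using w(2) S that by (simp add: v_def abs_mult mult_left_le)
   show "abs (v x - v y) <= S * (C / (1 - r) powr \<alpha>) * dist x y powr \<alpha>" if "x \<in> ball 0 r" "y \<in> ball 0 r" for x y
   proof -
   have "abs (v x - v y) = S * abs (w x - w y)" using that S by (simp add: v_def right_diff_distrib[symmetric] abs_mult)
   also have "... <= S * (C / (1 - r) powr \<alpha> * dist x y powr \<alpha>)" using w(3) that S by (intro mult_left_mono) auto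
   finally show ?thesis by (simp only: mult.assoc)
   qed
   qed (use S C in auto)
   \<comment> \<open>The supremum norm contributes S, which is at most S / (1 - r)^alpha; hence the
     constant 1 + C.\<close>
   moreover have "S + S * (C / (1 - r) powr \<alpha>) <= (1 + C) / (1 - r) powr \<alpha> * S" using S r1 by (simp add: divide_simps algebra_simps)
   ultimately show ?thesis unfolding S_def[symmetric] by (meson ereal_less_eq(3) order_trans)
   qed
  qed
  then show ?thesis by blast
 qed
 then show ?case unfolding n_def .
qed

end
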